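(* Let $\lambda,\mu$ be the Lamé coefficients on $\Omega\subset\mathbb R^n$, $n\ge2$. The Lamé system $$\mathcal Lu=\nabla\cdot\left(\lambda(x)(\nabla\cdot u)I+\mu(x)(\nabla u+(\nabla u)^T)\right)=0$$ for an unknown function $u:\Omega\to\mathbb R^n$ can be written in an equivalent form as $\mathcal L'u=0$, where $$(\mathcal L'u)_\alpha=\partial_h\left(A^{hk}_{\alpha\beta}(r)(x)\,\partial_ku^\beta\right)+B^h_{\alpha\beta}(r)(x)\,\partial_hu^\beta,\qquad \alpha=1,\dots,n,$$ and where the auxiliary Lipschitz function $r$ gives rise to coefficients $B$ satisfying the estimate $|B|\lesssim|\nabla\lambda|+|\nabla\mu|$. Assume that $$\operatorname*{ess\,inf}_{x\in\Omega}\{\mu(x),\lambda(x)+2\mu(x)\}>0 .$$ The coefficients $A$ of the operator $\mathcal L'$ satisfy the integral $p$-ellipticity condition if and only if $$\left(1-\frac2p\right)^2<C(n,\lambda,\mu),$$ where $$C(2,\lambda,\mu)=1-\operatorname*{ess\,sup}_{x\in\Omega}\left(\frac{\lambda+\mu}{\lambda+3\mu}\right)^2\quad\text{for }n=2,$$ and for $n\ge3$ we have the following estimates for $C(n,\lambda,\mu)$ from above and below: $$C(n,\lambda,\mu)\le1-\operatorname*{ess\,sup}_{x\in\Omega}\left(\frac{\lambda+\mu}{\lambda+3\mu}\right)^2,$$ $$C(n,\lambda,\mu)\ge1-\operatorname*{ess\,sup}_{x\in\Omega}\left(1+\frac1{n-2}\right)^2\left(\frac{\lambda+\mu}{\mu(\lambda+2\mu)}\right)^2\left[\frac{\lambda+3\mu}2-\sqrt{\left(\frac{\lambda+\mu}2\right)^2+\frac{\mu(\lambda+2\mu)}{n-1}}\,\right]^2\ge1-\operatorname*{ess\,sup}_{x\in\Omega}\left(\frac{\lambda+\mu}{\max\{\mu,\lambda+2\mu\}}\right)^2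 .$$
   Context: $\Omega\subset\mathbb R^n$ is a bounded Lipschitz domain or an unbounded domain above a Lipschitz graph. The Lamé coefficients $\lambda,\mu$ are real-valued, bounded and locally Lipschitz in $\Omega$. Repeated indices are summed, and $h,k,\alpha,\beta$ run over $1,\dots,n$. The symbol $\lesssim$ means inequality up to a multiplicative constant. The auxiliary function $r\in\mathrm{Lip}_{loc}(\Omega)$ is real-valued, and the coefficients of $\mathcal L'$ are $$A^{hk}_{\alpha\beta}(r)(x)=\mu(x)\delta^{hk}\delta_{\alpha\beta}+(\lambda(x)+r(x))\delta^h_\alpha\delta^k_\beta+(\mu(x)-r(x))\delta^h_\beta\delta^k_\alpha,$$ $$B^h_{\alpha\beta}(r)(x)=\partial_kr(x)\left(\delta^h_\alpha\delta^k_\beta-\delta^h_\beta\delta^k_\alpha\right).$$ Integral $p$-ellipticity, for $p\in(1,\infty)$ and real coefficients $A=(A^{hk}_{\alpha\beta})$: there is $c>0$ such that for all $v\in W^{1,2}_0(\Omega;\mathbb R^n)$, $$\int_\Omega\left\langle A\left(\nabla v-\left(1-\tfrac2p\right)\tfrac{v}{|v|}\nabla|v|\right),\ \nabla v+\left(1-\tfrac2p\right)\tfrac{v}{|v|}\nabla|v|\right\rangle dx\ge c\int_\Omega|\nabla v|^2\,dx.$$ Here $\langle A\xi,\eta\rangle=A^{hk}_{\alpha\beta}\xi^\beta_k\eta^\alpha_h$, $(\nabla v)^\alpha_h=\partial_hv^\alpha$, and $\frac{v}{|v|}\nabla|v|$ has entries $\frac{v^\alpha}{|v|}\partial_h|v|$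 (taken to be $0$ where $v=0$). *)

theory Defs
  imports "HOL-Analysis.Analysis" "HOL-Probability.Essential_Supremum"
begin

section \<open>Domains\<close>

text \<open>The graph direction \<open>e\<close> is an arbitrary unit vector, that is, a rotation of coordinates is
  allowed; \<open>\<psi>\<close> is a function on the hyperplane orthogonal to \<open>e\<close>.\<close>

definition above_graph :: "'a::euclidean_space \<Rightarrow> ('a \<Rightarrow> real) \<Rightarrow> 'a set" where
  "above_graph e \<psi> = {x. \<psi> (x - (x \<bullet> e) *\<^sub>R e) < x \<bullet> e}"

definition lipschitz_graph_fun :: "'a::euclidean_space \<Rightarrow> ('a \<Rightarrow> real) \<Rightarrow> bool" where
  "lipschitz_graph_fun e \<psi> \<longleftrightarrow> norm e = 1 \<and> (\<exists>L. L-lipschitz_on {y. y \<bullet> e = 0} \<psi>)"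

definition lipschitz_graph_domain :: "'a::euclidean_space set \<Rightarrow> bool" where
  "lipschitz_graph_domain \<Omega> \<longleftrightarrow> (\<exists>e \<psi>. lipschitz_graph_fun e \<psi> \<and> \<Omega> = above_graph e \<psi>)"

definition bounded_lipschitz_domain :: "'a::euclidean_space set \<Rightarrow> bool" where
  "bounded_lipschitz_domain \<Omega> \<longleftrightarrow>
     open \<Omega> \<and> connected \<Omega> \<and> \<Omega> \<noteq> {} \<and> bounded \<Omega> \<and>
     (\<forall>z \<in> frontier \<Omega>. \<exists>\<rho>>0. \<exists>e \<psi>.
        lipschitz_graph_fun e \<psi> \<and> \<Omega> \<inter> ball z \<rho> = above_graph e \<psi> \<inter> ball z \<rho>)"

definition Lip_loc :: "'a::metric_space set \<Rightarrow> ('a \<Rightarrow> real) set" where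
  "Lip_loc \<Omega> = {f. local_lipschitz (UNIV :: real set) \<Omega> (\<lambda>_. f)}"


section \<open>Test functions, weak derivatives and Sobolev spaces\<close>

definition pd :: "'n::finite \<Rightarrow> (real^'n \<Rightarrow> real) \<Rightarrow> real^'n \<Rightarrow> real" where
  "pd i f = (\<lambda>x. frechet_derivative f (at x) (axis i 1))"

text \<open>Infinite differentiability: all iterated partial derivatives are (Frechet) differentiable.\<close>

definition smooth :: "(real^'n::finite \<Rightarrow> real) \<Rightarrow> bool" where
  "smooth f \<longleftrightarrow> (\<forall>is. \<forall>x. fold pd is f differentiable (at x))"

definition test_fun :: "(real^'n::finite) set \<Rightarrow> (real^'n \<Rightarrow> real) set" where
  "test_fun \<Omega> = {\<phi>. smooth \<phi> \<and> compact (closure {x. \<phi> x \<noteq> 0}) \<and> closure {x. \<phi> x \<noteq> 0} \<subseteq> \<Omega>}"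

definition L1_loc :: "(real^'n::finite) set \<Rightarrow> (real^'n \<Rightarrow> real) set" where
  "L1_loc \<Omega> = {f. \<forall>K. compact K \<and> K \<subseteq> \<Omega> \<longrightarrow> set_integrable lebesgue K f}"

definition L2 :: "(real^'n::finite) set \<Rightarrow> (real^'n \<Rightarrow> real) set" where
  "L2 S = {f. f \<in> borel_measurable (lebesgue_on S) \<and> set_integrable lebesgue S (\<lambda>x. (f x)\<^sup>2)}"

definition L2_loc :: "(real^'n::finite) set \<Rightarrow> (real^'n \<Rightarrow> real) set" where
  "L2_loc \<Omega> = {f. \<forall>K. compact K \<and> K \<subseteq> \<Omega> \<longrightarrow> f \<in> L2 K}"

definition has_wderiv ::
    "(real^'n::finite) set \<Rightarrow> 'n \<Rightarrow> (real^'n \<Rightarrow> real) \<Rightarrow> (real^'n \<Rightarrow> real) \<Rightarrow> bool" where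
  "has_wderiv \<Omega> i f g \<longleftrightarrow> f \<in> L1_loc \<Omega> \<and> g \<in> L1_loc \<Omega> \<and>
     (\<forall>\<phi> \<in> test_fun \<Omega>. (LINT x:\<Omega>|lebesgue. f x * pd i \<phi> x) = - (LINT x:\<Omega>|lebesgue. g x * \<phi> x))"

text \<open>The weak derivative is unique up to null sets in \<open>\<Omega>\<close>; \<open>wderiv\<close> picks a representative, and is
  only used below an integral over \<open>\<Omega>\<close> or an almost-everywhere quantifier.  For locally Lipschitz
  functions it is the almost everywhere defined classical partial derivative.\<close>

definition wderiv :: "(real^'n::finite) set \<Rightarrow> 'n \<Rightarrow> (real^'n \<Rightarrow> real) \<Rightarrow> real^'n \<Rightarrow> real" where
  "wderiv \<Omega> i f = (SOME g. has_wderiv \<Omega> i f g)"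

definition wgrad :: "(real^'n::finite) set \<Rightarrow> (real^'n \<Rightarrow> real) \<Rightarrow> real^'n \<Rightarrow> real^'n" where
  "wgrad \<Omega> f x = (\<chi> i. wderiv \<Omega> i f x)"

text \<open>The entry of the matrix in row \<open>\<alpha>\<close> and column \<open>h\<close> is the \<open>h\<close>-th derivative of the \<open>\<alpha>\<close>-th
  component.\<close>

definition wjac :: "(real^'n::finite) set \<Rightarrow> (real^'n \<Rightarrow> real^'n) \<Rightarrow> real^'n \<Rightarrow> real^'n^'n" where
  "wjac \<Omega> v x = (\<chi> \<alpha> h. wderiv \<Omega> h (\<lambda>y. v y $ \<alpha>) x)"

definition W12 :: "(real^'n::finite) set \<Rightarrow> (real^'n \<Rightarrow> real) set" where
  "W12 \<Omega> = {f \<in> L2 \<Omega>. \<forall>i. \<exists>g \<in> L2 \<Omega>. has_wderiv \<Omega> i f g}"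

text \<open>Closure of the test functions in the norm of \<open>W12\<close>.\<close>

definition W12_0 :: "(real^'n::finite) set \<Rightarrow> (real^'n \<Rightarrow> real) set" where
  "W12_0 \<Omega> = {f \<in> W12 \<Omega>. \<exists>\<phi> :: nat \<Rightarrow> real^'n \<Rightarrow> real. (\<forall>m. \<phi> m \<in> test_fun \<Omega>) \<and>
     (\<lambda>m. LINT x:\<Omega>|lebesgue. (f x - \<phi> m x)\<^sup>2) \<longlonglongrightarrow> 0 \<and>
     (\<forall>i. (\<lambda>m. LINT x:\<Omega>|lebesgue. (wderiv \<Omega> i f x - pd i (\<phi> m) x)\<^sup>2) \<longlonglongrightarrow> 0)}"

definition W12_loc :: "(real^'n::finite) set \<Rightarrow> (real^'n \<Rightarrow> real) set" where
  "W12_loc \<Omega> = {f \<in> L2_loc \<Omega>. \<forall>i. \<exists>g \<in> L2_loc \<Omega>. has_wderiv \<Omega> i f g}"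

definition W12_0_vec :: "(real^'n::finite) set \<Rightarrow> (real^'n \<Rightarrow> real^'n) set" where
  "W12_0_vec \<Omega> = {v. \<forall>\<alpha>. (\<lambda>x. v x $ \<alpha>) \<in> W12_0 \<Omega>}"

definition W12_loc_vec :: "(real^'n::finite) set \<Rightarrow> (real^'n \<Rightarrow> real^'n) set" where
  "W12_loc_vec \<Omega> = {v. \<forall>\<alpha>. (\<lambda>x. v x $ \<alpha>) \<in> W12_loc \<Omega>}"


section \<open>The Lame operator and its rewriting\<close>

definition kron :: "'n \<Rightarrow> 'n \<Rightarrow> real" where
  "kron i j = (if i = j then 1 else 0)"

text \<open>Argument order of coefficient arrays: \<open>A x h k \<alpha> \<beta>\<close> and \<open>B x h \<alpha> \<beta>\<close>.\<close>

definition lame_A :: "(real^'n::finite \<Rightarrow> real) \<Rightarrow> (real^'n \<Rightarrow> real) \<Rightarrow> (real^'n \<Rightarrow> real) \<Rightarrow>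
    real^'n \<Rightarrow> 'n \<Rightarrow> 'n \<Rightarrow> 'n \<Rightarrow> 'n \<Rightarrow> real" where
  "lame_A lam mu r x h k \<alpha> \<beta> =
     mu x * kron h k * kron \<alpha> \<beta> + (lam x + r x) * kron h \<alpha> * kron k \<beta>
     + (mu x - r x) * kron h \<beta> * kron k \<alpha>"

definition lame_B :: "(real^'n::finite) set \<Rightarrow> (real^'n \<Rightarrow> real) \<Rightarrow>
    real^'n \<Rightarrow> 'n \<Rightarrow> 'n \<Rightarrow> 'n \<Rightarrow> real" where
  "lame_B \<Omega> r x h \<alpha> \<beta> =
     (\<Sum>k\<in>UNIV. wderiv \<Omega> k r x * (kron h \<alpha> * kron k \<beta> - kron h \<beta> * kron k \<alpha>))"

definition coeff_norm :: "('n::finite \<Rightarrow> 'n \<Rightarrow> 'n \<Rightarrow> real) \<Rightarrow> real" where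
  "coeff_norm b = sqrt (\<Sum>h\<in>UNIV. \<Sum>\<alpha>\<in>UNIV. \<Sum>\<beta>\<in>UNIV. (b h \<alpha> \<beta>)\<^sup>2)"

text \<open>The stress \<open>\<lambda> (div u) I + \<mu> (\<nabla>u + (\<nabla>u)\<^sup>T)\<close>.\<close>

definition lame_stress :: "(real^'n::finite) set \<Rightarrow> (real^'n \<Rightarrow> real) \<Rightarrow> (real^'n \<Rightarrow> real) \<Rightarrow>
    (real^'n \<Rightarrow> real^'n) \<Rightarrow> real^'n \<Rightarrow> real^'n^'n" where
  "lame_stress \<Omega> lam mu u x =
     (lam x * trace (wjac \<Omega> u x)) *\<^sub>R mat 1 + mu x *\<^sub>R (wjac \<Omega> u x + transpose (wjac \<Omega> u x))"

text \<open>For \<open>u \<in> W12_loc_vec \<Omega>\<close> both operators are understood in the sense of distributions: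
  \<open>lame_op \<Omega> lam mu u \<alpha> \<phi>\<close> and \<open>system_op \<Omega> A B u \<alpha> \<phi>\<close> are the values of the \<open>\<alpha>\<close>-th component at
  the scalar test function \<open>\<phi>\<close>, with the divergence moved onto \<open>\<phi>\<close>.\<close>

definition lame_op :: "(real^'n::finite) set \<Rightarrow> (real^'n \<Rightarrow> real) \<Rightarrow> (real^'n \<Rightarrow> real) \<Rightarrow>
    (real^'n \<Rightarrow> real^'n) \<Rightarrow> 'n \<Rightarrow> (real^'n \<Rightarrow> real) \<Rightarrow> real" where
  "lame_op \<Omega> lam mu u \<alpha> \<phi> =
     - (LINT x:\<Omega>|lebesgue. \<Sum>h\<in>UNIV. lame_stress \<Omega> lam mu u x $ \<alpha> $ h * pd h \<phi> x)"

definition system_op :: "(real^'n::finite) set \<Rightarrow>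
    (real^'n \<Rightarrow> 'n \<Rightarrow> 'n \<Rightarrow> 'n \<Rightarrow> 'n \<Rightarrow> real) \<Rightarrow> (real^'n \<Rightarrow> 'n \<Rightarrow> 'n \<Rightarrow> 'n \<Rightarrow> real) \<Rightarrow>
    (real^'n \<Rightarrow> real^'n) \<Rightarrow> 'n \<Rightarrow> (real^'n \<Rightarrow> real) \<Rightarrow> real" where
  "system_op \<Omega> A B u \<alpha> \<phi> =
     - (LINT x:\<Omega>|lebesgue. \<Sum>h\<in>UNIV. \<Sum>k\<in>UNIV. \<Sum>\<beta>\<in>UNIV.
          A x h k \<alpha> \<beta> * wjac \<Omega> u x $ \<beta> $ k * pd h \<phi> x)
     + (LINT x:\<Omega>|lebesgue. \<Sum>h\<in>UNIV. \<Sum>\<beta>\<in>UNIV. B x h \<alpha> \<beta> * wjac \<Omega> u x $ \<beta> $ h * \<phi> x)"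

definition vanishes_weakly ::
    "(real^'n::finite) set \<Rightarrow> ('n \<Rightarrow> (real^'n \<Rightarrow> real) \<Rightarrow> real) \<Rightarrow> bool" where
  "vanishes_weakly \<Omega> T \<longleftrightarrow> (\<forall>\<alpha>. \<forall>\<phi> \<in> test_fun \<Omega>. T \<alpha> \<phi> = 0)"


section \<open>Integral p-ellipticity\<close>

definition A_form :: "('n::finite \<Rightarrow> 'n \<Rightarrow> 'n \<Rightarrow> 'n \<Rightarrow> real) \<Rightarrow> real^'n^'n \<Rightarrow> real^'n^'n \<Rightarrow> real" where
  "A_form a \<xi> \<eta> =
     (\<Sum>h\<in>UNIV. \<Sum>k\<in>UNIV. \<Sum>\<alpha>\<in>UNIV. \<Sum>\<beta>\<in>UNIV. a h k \<alpha> \<beta> * \<xi> $ \<beta> $ k * \<eta> $ \<alpha> $ h)"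

text \<open>The matrix \<open>(v/|v|) \<nabla>|v|\<close>; it is \<open>0\<close> where \<open>v = 0\<close>.\<close>

definition radial_jac :: "(real^'n::finite) set \<Rightarrow> (real^'n \<Rightarrow> real^'n) \<Rightarrow> real^'n \<Rightarrow> real^'n^'n" where
  "radial_jac \<Omega> v x =
     (if v x = 0 then 0
      else (\<chi> \<alpha> h. v x $ \<alpha> / norm (v x) * wderiv \<Omega> h (\<lambda>y. norm (v y)) x))"

text \<open>The norm on \<^typ>\<open>real^'n^'n\<close> is the Euclidean (Frobenius) norm.\<close>

definition integral_p_elliptic :: "(real^'n::finite) set \<Rightarrow> real \<Rightarrow>
    (real^'n \<Rightarrow> 'n \<Rightarrow> 'n \<Rightarrow> 'n \<Rightarrow> 'n \<Rightarrow> real) \<Rightarrow> bool" where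
  "integral_p_elliptic \<Omega> p A \<longleftrightarrow>
     (\<exists>c>0. \<forall>v \<in> W12_0_vec \<Omega>.
        (LINT x:\<Omega>|lebesgue. A_form (A x)
            (wjac \<Omega> v x - (1 - 2 / p) *\<^sub>R radial_jac \<Omega> v x)
            (wjac \<Omega> v x + (1 - 2 / p) *\<^sub>R radial_jac \<Omega> v x))
        \<ge> c * (LINT x:\<Omega>|lebesgue. (norm (wjac \<Omega> v x))\<^sup>2))"

definition essinf :: "'a measure \<Rightarrow> ('a \<Rightarrow> ereal) \<Rightarrow> ereal" where
  "essinf M f = - esssup M (\<lambda>x. - f x)"

end

theory Submission
  imports Defs
begin

text \<open>
  Write \<open>a = \<mu>\<close>, \<open>b = \<lambda> + 2\<mu>\<close> and \<open>\<rho> = r - \<mu>\<close>.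

  \<^bold>\<open>The equivalent form.\<close>  The terms of \<open>A(r)\<close> that contain \<open>r\<close> contribute
  \<open>\<partial>\<^sub>\<alpha>(r div u) - \<partial>\<^sub>h(r \<partial>\<^sub>\<alpha>u\<^sup>h)\<close>.  Second derivatives of \<open>u\<close> cancel in it, and the first order terms that
  remain are those removed by \<open>B(r)\<close>; so the operator does not depend on \<open>r\<close>
  (\<open>wderiv_cross_symmetric\<close>, \<open>lame_op_eq_system_op\<close>).  If \<open>r\<close> is a smooth function of \<open>(\<lambda>, \<mu>)\<close>, the chain
  rule bounds \<open>|\<nabla>r|\<close>, hence \<open>|B|\<close>, by \<open>|\<nabla>\<lambda>| + |\<nabla>\<mu>|\<close>: the values of \<open>(\<lambda>, \<mu>)\<close> lie in a compact set.

  \<^bold>\<open>One real parameter.\<close>  Where \<open>v \<noteq> 0\<close> put \<open>\<omega> = v/|v|\<close>, \<open>\<xi> = \<nabla>v\<close> and \<open>g = \<nabla>|v| = \<xi>\<^sup>T\<omega>\<close>.  On the matrix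
  \<open>\<omega> \<otimes> g\<close>, which has rank one, \<open>r\<close> drops out of the form, and the integrand of the ellipticity condition
  becomes \<open>\<langle>A\<xi>, \<xi>\<rangle> - s (a|g|\<^sup>2 + (b - a)(\<omega> \<bullet> g)\<^sup>2)\<close> with \<open>s = (1 - 2/p)\<^sup>2\<close> (\<open>integral_p_elliptic_iff\<close>).  The
  subtracted form is nonnegative and bounded by a multiple of \<open>|\<xi>|\<^sup>2\<close>, so the admissible \<open>s \<ge> 0\<close> form an
  interval that is open to the right; \<open>C\<close> is its supremum (\<open>elliptic_at_mono\<close>, \<open>elliptic_at_open\<close>).

  \<^bold>\<open>Bound from below.\<close>  For a suitable \<open>r\<close> the integrand is coercive pointwise.  At \<open>s = 1 - (\<rho>/a)\<^sup>2\<close> it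
  splits, after a decomposition of \<open>\<xi>\<close> into blocks along \<open>\<omega>\<close>, into a part controlled by Cauchy-Schwarz
  and two quadratic forms in two quantities each.  One of these is always a perfect square; the other one is, when \<open>\<rho>\<close>
  solves a quadratic equation (\<open>critical_form_ge\<close>).  Its root \<open>crit_rho\<close> defines \<open>r\<close>; the value
  \<open>(\<rho>/a)\<^sup>2\<close> is the expression with the square root in the theorem, and for \<open>n = 2\<close> it is
  \<open>((\<lambda> + \<mu>)/(\<lambda> + 3\<mu>))\<^sup>2\<close>.

  \<^bold>\<open>Bound from above.\<close>  Near a point \<open>x\<^sub>0\<close> test with \<open>v = N e + sin(\<tau> \<kappa> \<bullet> x) \<eta>\<close>, cut off, where \<open>N\<close> and
  then \<open>\<tau>\<close> are large.  Then \<open>\<omega>\<close> stays close to \<open>e\<close> while \<open>\<nabla>v\<close> is close to a multiple of \<open>\<eta> \<otimes> \<kappa>\<close>, where the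
  form is again independent of \<open>r\<close>.  The directions in \<open>critical_direction\<close> make it negative as soon
  as \<open>s > 1 - ((\<lambda> + \<mu>)/(\<lambda> + 3\<mu>))\<^sup>2\<close> at \<open>x\<^sub>0\<close> (\<open>not_elliptic_at_supercritical\<close>).  The coefficients are continuous,
  so essential suprema are suprema.

  \<^bold>\<open>Weak derivatives.\<close>  Mollifications of a locally Lipschitz function have locally bounded gradients, and
  suitable convex combinations of their tails have gradients that converge almost everywhere
  (\<open>tail_weights_AE_convergent\<close>, \<open>Lip_loc_smooth_approximation\<close>).  Dominated convergence carries the chain
  rule and the symmetry of second derivatives over to the limit.  The derivative of \<open>|v|\<close> is obtained from
  \<open>sqrt(\<epsilon>\<^sup>2 + |v|\<^sup>2)\<close> in two limits (\<open>has_wderiv_norm\<close>).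
\<close>

section \<open>Smooth functions and test functions\<close>

text \<open>Differentiability to a finite order, by recursion on the order, so that closure properties of
  \<open>smooth\<close> can be proved by induction.\<close>

primrec diffn :: "nat \<Rightarrow> (real^'n::finite \<Rightarrow> real) \<Rightarrow> bool" where
  "diffn 0 f = (\<forall>x. f differentiable (at x))"
| "diffn (Suc k) f = ((\<forall>x. f differentiable (at x)) \<and> (\<forall>i. diffn k (pd i f)))"

lemma diffn_iff_fold:
  "diffn k f \<longleftrightarrow> (\<forall>is. length is \<le> k \<longrightarrow> (\<forall>x. fold pd is f differentiable (at x)))"
proof (induction k arbitrary: f)
  case 0
  then show ?case by auto
next
  case (Suc k)
  show ?case
  proof
    assume L: "diffn (Suc k) f"
    show "\<forall>is. length is \<le> Suc k \<longrightarrow> (\<forall>x. fold pd is f differentiable (at x))"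
    proof (intro allI impI)
      fix "is" :: "'a list" and x assume "length is \<le> Suc k"
      then show "fold pd is f differentiable (at x)"
        using L Suc.IH by (cases "is") auto
    qed
  next
    assume R: "\<forall>is. length is \<le> Suc k \<longrightarrow> (\<forall>x. fold pd is f differentiable (at x))"
    have "\<forall>x. f differentiable (at x)" using R[rule_format, of "[]"] by simp
    moreover have "diffn k (pd i f)" for i
      unfolding Suc.IH using R[rule_format, of "i # is" for "is"] by auto
    ultimately show "diffn (Suc k) f" by simp
  qed
qed

lemma smooth_iff_diffn: "smooth f \<longleftrightarrow> (\<forall>k. diffn k f)"
  unfolding smooth_def diffn_iff_fold by auto

lemma diffn_differentiable: "diffn k f \<Longrightarrow> f differentiable (at x)"
  by (cases k) auto

lemma diffn_SucD: "diffn (Suc k) f \<Longrightarrow> diffn k f"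
  by (induction k arbitrary: f) auto

lemma pd_eqI: "(f has_derivative D) (at x) \<Longrightarrow> pd i f x = D (axis i 1)"
  unfolding pd_def by (metis frechet_derivative_at)

lemma differentiable_has_frechet:
  "f differentiable (at x) \<Longrightarrow> (f has_derivative frechet_derivative f (at x)) (at x)"
  using frechet_derivative_works by blast

lemma pd_const: "pd i (\<lambda>x. c) = (\<lambda>x. 0)"
  by (rule ext, subst pd_eqI[OF has_derivative_const]) simp

lemma pd_add:
  assumes "f differentiable (at x)" "g differentiable (at x)"
  shows "pd i (\<lambda>x. f x + g x) x = pd i f x + pd i g x"
  using pd_eqI[OF has_derivative_add[OF assms[THEN differentiable_has_frechet]], of i]
  unfolding pd_def .

lemma pd_mult:
  assumes "f differentiable (at x)" "g differentiable (at x)"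
  shows "pd i (\<lambda>x. f x * g x) x = f x * pd i g x + pd i f x * g x"
  using pd_eqI[OF has_derivative_mult[OF assms[THEN differentiable_has_frechet]], of i]
  unfolding pd_def .

lemma pd_compose:
  assumes "p differentiable (at x)" "(g has_real_derivative d) (at (p x))"
  shows "pd i (\<lambda>x. g (p x)) x = d * pd i p x"
proof -
  have "((\<lambda>x. g (p x)) has_derivative (\<lambda>y. d * frechet_derivative p (at x) y)) (at x)"
    using has_derivative_compose[OF differentiable_has_frechet[OF assms(1)] assms(2)[unfolded has_field_derivative_def]]
    by simp
  from pd_eqI[OF this] show ?thesis unfolding pd_def .
qed

lemma differentiable_compose_real:
  assumes "p differentiable (at x)" "(g has_real_derivative d) (at (p x))"
  shows "(\<lambda>x. g (p x)) differentiable (at x)"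
  using has_derivative_compose[OF differentiable_has_frechet[OF assms(1)] assms(2)[unfolded has_field_derivative_def]]
  unfolding differentiable_def by blast

lemma pd_inner: "pd i (\<lambda>x. k \<bullet> x) = (\<lambda>x. k $ i)"
  by (rule ext, subst pd_eqI[OF has_derivative_inner_right[OF has_derivative_ident]])
    (simp add: inner_axis)

lemma diffn_const: "diffn k (\<lambda>x. c)"
proof (induction k arbitrary: c)
  case (Suc k)
  then show ?case by (simp add: pd_const)
qed simp

lemma diffn_add: "diffn k f \<Longrightarrow> diffn k g \<Longrightarrow> diffn k (\<lambda>x. f x + g x)"
proof (induction k arbitrary: f g)
  case (Suc k)
  then have "pd i (\<lambda>x. f x + g x) = (\<lambda>x. pd i f x + pd i g x)" for i
    by (intro ext pd_add) auto
  with Suc show ?case by auto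
qed auto

lemma diffn_mult: "diffn k f \<Longrightarrow> diffn k g \<Longrightarrow> diffn k (\<lambda>x. f x * g x)"
proof (induction k arbitrary: f g)
  case (Suc k)
  then have "pd i (\<lambda>x. f x * g x) = (\<lambda>x. f x * pd i g x + pd i f x * g x)" for i
    by (intro ext pd_mult) auto
  with Suc show ?case
    by (auto intro!: diffn_add Suc.IH intro: diffn_SucD simp del: diffn.simps simp add: diffn.simps(2)[of k "\<lambda>x. f x * g x"])
       (auto intro: diffn_SucD)
qed auto

text \<open>Closure of the outer functions under differentiation replaces a formula for higher
  derivatives of a composition.\<close>

lemma diffn_compose:
  assumes F: "\<And>g. g \<in> F \<Longrightarrow> \<exists>g'\<in>F. \<forall>t::real. (g has_real_derivative g' t) (at t)"
    and g: "g \<in> F" and p: "diffn k p"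
  shows "diffn k (\<lambda>x. g (p x))"
  using g p
proof (induction k arbitrary: g p)
  case 0
  obtain g' where g': "\<And>t::real. (g has_real_derivative g' t) (at t)"
    using F[OF 0(1)] by blast
  show ?case
    unfolding diffn.simps
    by (intro allI differentiable_compose_real[OF _ g']) (use 0 in simp)
next
  case (Suc k)
  obtain g' where g': "g' \<in> F" "\<forall>t::real. (g has_real_derivative g' t) (at t)"
    using F[OF Suc.prems(1)] by blast
  have pdiff: "\<forall>x. p differentiable (at x)" using Suc.prems by simp
  have "pd i (\<lambda>x. g (p x)) = (\<lambda>x. g' (p x) * pd i p x)" for i
    by (rule ext) (rule pd_compose[OF pdiff[rule_format] g'(2)[rule_format]])
  moreover have "diffn k (\<lambda>x. g' (p x) * pd i p x)" for i
    using Suc.prems g'(1) by (intro diffn_mult Suc.IH[OF g'(1)] diffn_SucD[OF Suc.prems(2)]) simp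
  moreover have "(\<lambda>x. g (p x)) differentiable (at x)" for x
    by (rule differentiable_compose_real[OF pdiff[rule_format] g'(2)[rule_format]])
  ultimately show ?case by simp
qed

lemma smooth_const [simp]: "smooth (\<lambda>x. c)"
  by (simp add: smooth_iff_diffn diffn_const)

lemma smooth_add: "smooth f \<Longrightarrow> smooth g \<Longrightarrow> smooth (\<lambda>x. f x + g x)"
  by (simp add: smooth_iff_diffn diffn_add)

lemma smooth_mult: "smooth f \<Longrightarrow> smooth g \<Longrightarrow> smooth (\<lambda>x. f x * g x)"
  by (simp add: smooth_iff_diffn diffn_mult)

lemma smooth_minus: "smooth f \<Longrightarrow> smooth (\<lambda>x. - f x)"
  using smooth_mult[OF smooth_const[of "-1"], of f] by simp

lemma smooth_diff: "smooth f \<Longrightarrow> smooth g \<Longrightarrow> smooth (\<lambda>x. f x - g x)"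
  using smooth_add[of f "\<lambda>x. - g x"] smooth_minus[of g] by simp

lemma smooth_inner: "smooth (\<lambda>x. k \<bullet> x)"
  unfolding smooth_iff_diffn
proof
  fix n show "diffn n (\<lambda>x. k \<bullet> x)"
    by (cases n) (auto simp: pd_inner diffn_const)
qed

lemma smooth_component: "smooth (\<lambda>x. x $ i)"
  using smooth_inner[of "axis i 1"] by (simp add: inner_axis')

lemma smooth_sum: "(\<And>j. j \<in> J \<Longrightarrow> smooth (f j)) \<Longrightarrow> smooth (\<lambda>x. \<Sum>j\<in>J. f j x)"
  by (induction J rule: infinite_finite_induct) (auto intro: smooth_add)

lemma smooth_prod: "(\<And>j. j \<in> J \<Longrightarrow> smooth (f j)) \<Longrightarrow> smooth (\<lambda>x. \<Prod>j\<in>J. f j x)"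
  by (induction J rule: infinite_finite_induct) (auto intro: smooth_mult)

lemma smooth_pd: "smooth f \<Longrightarrow> smooth (pd i f)"
  unfolding smooth_iff_diffn using diffn.simps(2) by blast

lemma smooth_differentiable: "smooth f \<Longrightarrow> f differentiable (at x)"
  unfolding smooth_iff_diffn using diffn_differentiable by blast

lemma smooth_has_derivative:
  "smooth f \<Longrightarrow> (f has_derivative frechet_derivative f (at x)) (at x)"
  by (intro differentiable_has_frechet smooth_differentiable)

lemma smooth_continuous: "smooth f \<Longrightarrow> continuous_on S f"
  using differentiable_imp_continuous_within smooth_differentiable
  by (metis continuous_at_imp_continuous_on)

lemma smooth_compose:
  assumes "\<And>g. g \<in> F \<Longrightarrow> \<exists>g'\<in>F. \<forall>t::real. (g has_real_derivative g' t) (at t)"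
    and "g \<in> F" and "smooth p"
  shows "smooth (\<lambda>x. g (p x))"
  using assms diffn_compose[of F g] unfolding smooth_iff_diffn by blast

lemma smooth_sin:
  assumes "smooth p" shows "smooth (\<lambda>x. sin (p x))"
proof (rule smooth_compose[OF _ _ assms, of "{sin, cos, \<lambda>t. - sin t, \<lambda>t. - cos t}"])
  fix g :: "real \<Rightarrow> real" assume "g \<in> {sin, cos, \<lambda>t. - sin t, \<lambda>t. - cos t}"
  then show "\<exists>g'\<in>{sin, cos, \<lambda>t. - sin t, \<lambda>t. - cos t}. \<forall>t. (g has_real_derivative g' t) (at t)"
    by (auto intro!: derivative_eq_intros)
qed simp

text \<open>The derivatives of \<open>exp (- 1 / t)\<close>, extended by \<open>0\<close> to \<open>t \<le> 0\<close>, are this function times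
  polynomials in \<open>1 / t\<close>.\<close>

definition flat :: "real poly \<Rightarrow> real \<Rightarrow> real" where
  "flat q t = (if t > 0 then poly q (1 / t) * exp (- (1 / t)) else 0)"

lemma poly_times_exp_neg_tendsto_0: "((\<lambda>x. poly q x * exp (- x)) \<longlongrightarrow> (0::real)) at_top"
proof (induction q)
  case (pCons a q)
  have "((\<lambda>x. poly q x * x * exp (- x)) \<longlongrightarrow> (0::real)) at_top" for q :: "real poly"
  proof -
    have "((\<lambda>x. \<Sum>i\<le>degree q. coeff q i * (x ^ Suc i / exp x)) \<longlongrightarrow> (\<Sum>i\<le>degree q. coeff q i * 0)) at_top"
      by (intro tendsto_intros tendsto_power_div_exp_0)
    also have "(\<lambda>x. \<Sum>i\<le>degree q. coeff q i * (x ^ Suc i / exp x)) = (\<lambda>x. poly q x * x * exp (- x))"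
      unfolding poly_altdef sum_distrib_right
      by (intro ext sum.cong refl) (simp add: exp_minus field_simps)
    finally show ?thesis by simp
  qed
  moreover have "((\<lambda>x. a * exp (- x)) \<longlongrightarrow> a * 0) at_top"
    by (intro tendsto_intros) (rule filterlim_compose[OF exp_at_bot filterlim_uminus_at_bot_at_top])
  ultimately have "((\<lambda>x. a * exp (- x) + poly q x * x * exp (- x)) \<longlongrightarrow> a * 0 + 0) at_top"
    by (intro tendsto_add)
  then show ?case by (simp add: algebra_simps)
qed simp

lemma flat_deriv: "(flat q has_real_derivative flat ([:0, 0, 1:] * (q - pderiv q)) t) (at t)"
proof -
  consider "t > 0" | "t < 0" | "t = 0" by linarith
  then show ?thesis
  proof cases
    case 1
    have "((\<lambda>t. poly q (1 / t) * exp (- (1 / t))) has_real_derivative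
       flat ([:0, 0, 1:] * (q - pderiv q)) t) (at t)"
      using 1 by (auto intro!: derivative_eq_intros DERIV_chain'[OF _ poly_DERIV]
          simp: flat_def field_simps power2_eq_square)
    then show ?thesis
      by (rule DERIV_cong_ev[OF refl _ refl, THEN iffD1, rotated])
         (use 1 in \<open>auto simp: flat_def eventually_at_topological intro!: exI[of _ "{0<..}"] eventually_nhds[THEN iffD2]\<close>)
  next
    case 2
    have "((\<lambda>t. 0) has_real_derivative flat ([:0, 0, 1:] * (q - pderiv q)) t) (at t)"
      using 2 by (auto simp: flat_def)
    then show ?thesis
      by (rule DERIV_cong_ev[OF refl _ refl, THEN iffD1, rotated])
         (use 2 in \<open>auto simp: flat_def intro!: exI[of _ "{..<0}"] eventually_nhds[THEN iffD2]\<close>)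
  next
    case 3
    have "((\<lambda>h. flat q h / h) \<longlongrightarrow> 0) (at_right 0)"
    proof (rule Lim_transform_eventually)
      show "((\<lambda>h. poly ([:0, 1:] * q) (inverse h) * exp (- inverse h)) \<longlongrightarrow> 0) (at_right 0)"
        by (rule filterlim_compose[OF poly_times_exp_neg_tendsto_0 filterlim_inverse_at_top_right])
      show "\<forall>\<^sub>F h in at_right 0. poly ([:0, 1:] * q) (inverse h) * exp (- inverse h) = flat q h / h"
        using eventually_at_right_less[of 0]
        by eventually_elim (auto simp: flat_def field_simps)
    qed
    moreover have "((\<lambda>h. flat q h / h) \<longlongrightarrow> 0) (at_left 0)"
      by (rule Lim_transform_eventually[OF tendsto_const])
         (auto simp: eventually_at_filter flat_def)
    ultimately have "((\<lambda>h. flat q h / h) \<longlongrightarrow> 0) (at 0)"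
      by (simp add: filterlim_at_split)
    then show ?thesis unfolding DERIV_def using 3 by (simp add: flat_def)
  qed
qed

text \<open>The value at \<open>real m * t\<close> tends to \<open>1\<close> for \<open>t > 0\<close>, which makes products of dilates of this function
  converge to indicator functions of boxes.\<close>

definition flat1 :: "real \<Rightarrow> real" where "flat1 = flat 1"

lemma flat1_eq: "flat1 t = (if t > 0 then exp (- (1 / t)) else 0)"
  by (simp add: flat1_def flat_def)

lemma flat1_pos_iff [simp]: "0 < flat1 t \<longleftrightarrow> 0 < t" and flat1_nonneg [simp]: "0 \<le> flat1 t"
  and flat1_le_1 [simp]: "flat1 t \<le> 1" and flat1_eq_0_iff [simp]: "flat1 t = 0 \<longleftrightarrow> t \<le> 0"
  by (auto simp: flat1_eq)

lemma smooth_flat1: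
  assumes "smooth p" shows "smooth (\<lambda>x. flat1 (p x))"
proof (rule smooth_compose[OF _ _ assms, of "range flat"])
  show "\<And>g. g \<in> range flat \<Longrightarrow> \<exists>g'\<in>range flat. \<forall>t. (g has_real_derivative g' t) (at t)"
    using flat_deriv by blast
qed (simp add: flat1_def)

lemma line_deriv:
  assumes "g differentiable (at (y + s *\<^sub>R axis i 1))"
  shows "((\<lambda>s. g (y + s *\<^sub>R axis i 1)) has_real_derivative pd i g (y + s *\<^sub>R axis i 1)) (at s)"
proof -
  have "((\<lambda>s. g (y + s *\<^sub>R axis i 1)) has_derivative
     (\<lambda>h. frechet_derivative g (at (y + s *\<^sub>R axis i 1)) (h *\<^sub>R axis i 1))) (at s)"
    by (rule has_derivative_compose[of "\<lambda>s. y + s *\<^sub>R axis i 1"])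
       (auto intro!: derivative_eq_intros differentiable_has_frechet assms)
  moreover have "linear (frechet_derivative g (at (y + s *\<^sub>R axis i 1)))"
    using assms by (rule linear_frechet_derivative)
  ultimately show ?thesis
    by (simp add: has_field_derivative_def pd_def linear_scale mult.commute[of _ "frechet_derivative _ _ _"])
qed

lemma inverse_Suc_tendsto_0: "(\<lambda>m. 1 / real (Suc m)) \<longlonglongrightarrow> 0"
  using LIMSEQ_inverse_real_of_nat unfolding inverse_eq_divide .

text \<open>Two applications of the mean value theorem express the mixed second difference, which is
  symmetric in \<open>i\<close> and \<open>j\<close>, by either mixed derivative at a nearby point.\<close>

lemma pd_commute:
  fixes f :: "real^'n::finite \<Rightarrow> real"
  assumes f: "smooth f"
  shows "pd i (pd j f) x = pd j (pd i f) x"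
proof -
  define \<Delta> where "\<Delta> i j t = f (x + t *\<^sub>R axis i 1 + t *\<^sub>R axis j 1) - f (x + t *\<^sub>R axis i 1)
      - f (x + t *\<^sub>R axis j 1) + f x" for i j :: 'n and t :: real
  note line = line_deriv[OF smooth_differentiable]
  have key: "\<exists>\<xi> \<eta>. 0 < \<xi> \<and> \<xi> < t \<and> 0 < \<eta> \<and> \<eta> < t \<and>
      \<Delta> i j t = t\<^sup>2 * pd j (pd i f) (x + \<xi> *\<^sub>R axis i 1 + \<eta> *\<^sub>R axis j 1)"
    if t: "t > 0" for i j t
  proof -
    define \<phi> where "\<phi> s = f ((x + t *\<^sub>R axis j 1) + s *\<^sub>R axis i 1) - f (x + s *\<^sub>R axis i 1)" for s
    have d1: "(\<phi> has_real_derivative pd i f ((x + t *\<^sub>R axis j 1) + s *\<^sub>R axis i 1) - pd i f (x + s *\<^sub>R axis i 1)) (at s)" for s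
      unfolding \<phi>_def by (intro derivative_intros line f)
    then obtain \<xi> where \<xi>: "0 < \<xi>" "\<xi> < t"
      "\<phi> t - \<phi> 0 = (t - 0) * (pd i f ((x + t *\<^sub>R axis j 1) + \<xi> *\<^sub>R axis i 1) - pd i f (x + \<xi> *\<^sub>R axis i 1))"
      using MVT2[OF t d1] by blast
    define \<psi> where "\<psi> s = pd i f ((x + \<xi> *\<^sub>R axis i 1) + s *\<^sub>R axis j 1)" for s
    have d2: "(\<psi> has_real_derivative pd j (pd i f) ((x + \<xi> *\<^sub>R axis i 1) + s *\<^sub>R axis j 1)) (at s)" for s
      unfolding \<psi>_def by (intro line smooth_pd f)
    then obtain \<eta> where \<eta>: "0 < \<eta>" "\<eta> < t"
      "\<psi> t - \<psi> 0 = (t - 0) * pd j (pd i f) ((x + \<xi> *\<^sub>R axis i 1) + \<eta> *\<^sub>R axis j 1)"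
      using MVT2[OF t d2] by blast
    have "\<Delta> i j t = \<phi> t - \<phi> 0"
      unfolding \<Delta>_def \<phi>_def by (simp add: algebra_simps)
    also have "\<dots> = t * (\<psi> t - \<psi> 0)"
      using \<xi>(3) unfolding \<psi>_def by (simp add: algebra_simps)
    finally show ?thesis using \<xi> \<eta> by (auto simp: power2_eq_square)
  qed
  have lim: "(\<lambda>m. \<Delta> i j (1 / Suc m) * (Suc m)\<^sup>2) \<longlonglongrightarrow> pd j (pd i f) x" for i j
  proof -
    have "\<forall>m. \<exists>\<xi> \<eta>. 0 < \<xi> \<and> \<xi> < 1 / real (Suc m) \<and> 0 < \<eta> \<and> \<eta> < 1 / real (Suc m) \<and>
      \<Delta> i j (1 / Suc m) * (Suc m)\<^sup>2 = pd j (pd i f) (x + \<xi> *\<^sub>R axis i 1 + \<eta> *\<^sub>R axis j 1)"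
    proof
      fix m
      show "\<exists>\<xi> \<eta>. 0 < \<xi> \<and> \<xi> < 1 / real (Suc m) \<and> 0 < \<eta> \<and> \<eta> < 1 / real (Suc m) \<and>
      \<Delta> i j (1 / Suc m) * (Suc m)\<^sup>2 = pd j (pd i f) (x + \<xi> *\<^sub>R axis i 1 + \<eta> *\<^sub>R axis j 1)"
      proof -
        have "0 < 1 / real (Suc m)" by simp
        from key[OF this, of i j] obtain \<xi> \<eta> where *: "0 < \<xi>" "\<xi> < 1 / real (Suc m)" "0 < \<eta>"
          "\<eta> < 1 / real (Suc m)"
          "\<Delta> i j (1 / real (Suc m)) = (1 / real (Suc m))\<^sup>2 * pd j (pd i f) (x + \<xi> *\<^sub>R axis i 1 + \<eta> *\<^sub>R axis j 1)"
          by blast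
        have "(1 / real (Suc m))\<^sup>2 * (real (Suc m))\<^sup>2 = 1" by (simp add: power_divide)
        with *(5) have "\<Delta> i j (1 / Suc m) * (Suc m)\<^sup>2 = pd j (pd i f) (x + \<xi> *\<^sub>R axis i 1 + \<eta> *\<^sub>R axis j 1)"
          by (simp only: of_nat_power mult.assoc mult.commute[of "pd j (pd i f) y" for y])
             (simp only: mult.assoc[symmetric] mult_1_left)
        with *(1-4) show ?thesis by blast
      qed
    qed
    then obtain \<xi> \<eta> where *: "\<And>m. 0 < \<xi> m \<and> \<xi> m < 1 / real (Suc m) \<and> 0 < \<eta> m \<and> \<eta> m < 1 / real (Suc m) \<and>
      \<Delta> i j (1 / Suc m) * (Suc m)\<^sup>2 = pd j (pd i f) (x + \<xi> m *\<^sub>R axis i 1 + \<eta> m *\<^sub>R axis j 1)"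
      by metis
    note z = inverse_Suc_tendsto_0
    have "\<xi> \<longlonglongrightarrow> 0" "\<eta> \<longlonglongrightarrow> 0"
      using * by (auto intro!: tendsto_sandwich[OF _ _ tendsto_const z] always_eventually less_imp_le)
    then have "(\<lambda>m. x + \<xi> m *\<^sub>R axis i 1 + \<eta> m *\<^sub>R axis j 1) \<longlonglongrightarrow> x + 0 *\<^sub>R axis i 1 + 0 *\<^sub>R axis j 1"
      by (intro tendsto_intros)
    moreover have "isCont (pd j (pd i f)) x"
      using smooth_continuous[of "pd j (pd i f)" UNIV] f
      by (simp add: smooth_pd continuous_on_eq_continuous_at)
    ultimately have "(\<lambda>m. pd j (pd i f) (x + \<xi> m *\<^sub>R axis i 1 + \<eta> m *\<^sub>R axis j 1)) \<longlonglongrightarrow> pd j (pd i f) x"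
      by (intro isCont_tendsto_compose[of x "pd j (pd i f)"]) simp_all
    then show ?thesis using * by simp
  qed
  have "\<Delta> i j = \<Delta> j i" unfolding \<Delta>_def by (auto simp: algebra_simps)
  then show ?thesis using LIMSEQ_unique[OF lim[of i j]] lim[of j i] by simp
qed

lemma pd_eq_0_outside:
  assumes "closed K" "\<And>x. x \<notin> K \<Longrightarrow> f x = 0" "x \<notin> K"
  shows "pd i f x = 0"
proof -
  have "(f has_derivative (\<lambda>h. 0)) (at x)"
    by (rule has_derivative_transform_within_open[of "\<lambda>_. 0" _ _ _ "- K"])
       (use assms in auto)
  from pd_eqI[OF this] show ?thesis by simp
qed

lemma test_funI:
  assumes "smooth \<phi>" "compact K" "K \<subseteq> \<Omega>" "\<And>x. x \<notin> K \<Longrightarrow> \<phi> x = 0"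
  shows "\<phi> \<in> test_fun \<Omega>"
proof -
  have "closure {x. \<phi> x \<noteq> 0} \<subseteq> K"
    using assms by (intro closure_minimal) (auto intro: compact_imp_closed)
  moreover then have "compact (closure {x. \<phi> x \<noteq> 0})"
    using assms(2) by (meson closed_closure compact_imp_bounded bounded_subset compact_eq_bounded_closed)
  ultimately show ?thesis using assms unfolding test_fun_def by auto
qed

lemma test_funE:
  assumes "\<phi> \<in> test_fun \<Omega>"
  obtains K where "compact K" "K \<subseteq> \<Omega>" "\<And>x. x \<notin> K \<Longrightarrow> \<phi> x = 0" "\<And>i x. x \<notin> K \<Longrightarrow> pd i \<phi> x = 0"
proof
  let ?K = "closure {x. \<phi> x \<noteq> 0}"
  show "compact ?K" "?K \<subseteq> \<Omega>" using assms unfolding test_fun_def by auto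
  show *: "\<phi> x = 0" if "x \<notin> ?K" for x using that closure_subset[of "{x. \<phi> x \<noteq> 0}"] by blast
  show "pd i \<phi> x = 0" if "x \<notin> ?K" for i x
    by (rule pd_eq_0_outside[OF _ * that]) simp
qed

lemma test_fun_smooth: "\<phi> \<in> test_fun \<Omega> \<Longrightarrow> smooth \<phi>"
  unfolding test_fun_def by simp

lemma test_fun_pd: 
  assumes "\<phi> \<in> test_fun \<Omega>" shows "pd i \<phi> \<in> test_fun \<Omega>"
proof -
  obtain K where K: "compact K" "K \<subseteq> \<Omega>" "\<And>i x. x \<notin> K \<Longrightarrow> pd i \<phi> x = 0"
    using test_funE[OF assms] by metis
  show ?thesis
    by (rule test_funI[OF smooth_pd[OF test_fun_smooth[OF assms]] K(1,2) K(3)])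
qed

lemma test_fun_mult: 
  assumes f: "smooth f" and \<phi>: "\<phi> \<in> test_fun \<Omega>" shows "(\<lambda>x. f x * \<phi> x) \<in> test_fun \<Omega>"
proof -
  obtain K where K: "compact K" "K \<subseteq> \<Omega>" "\<And>x. x \<notin> K \<Longrightarrow> \<phi> x = 0"
    using test_funE[OF \<phi>] by metis
  show ?thesis
    by (rule test_funI[OF smooth_mult[OF f test_fun_smooth[OF \<phi>]] K(1,2)]) (simp add: K(3))
qed

lemma power_less_iff_less: "0 \<le> u \<Longrightarrow> 0 \<le> t \<Longrightarrow> u\<^sup>2 < t\<^sup>2 \<longleftrightarrow> u < (t::real)"
  by (meson not_less power_mono power_strict_mono pos2)

lemma ball_bump:
  fixes z :: "real^'n::finite"
  assumes "\<delta> > 0"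
  obtains \<zeta> where "smooth \<zeta>" "\<And>x. 0 \<le> \<zeta> x" "\<And>x. \<zeta> x \<le> 1" "\<And>x. 0 < \<zeta> x \<longleftrightarrow> x \<in> ball z \<delta>"
    "\<And>x. x \<notin> cball z \<delta> \<Longrightarrow> \<zeta> x = 0"
proof
  let ?\<zeta> = "\<lambda>x. flat1 (\<delta>\<^sup>2 - (\<Sum>i\<in>UNIV. (x $ i - z $ i) * (x $ i - z $ i)))"
  have eq: "?\<zeta> x = flat1 (\<delta>\<^sup>2 - (dist z x)\<^sup>2)" for x
  proof -
    have "(dist z x)\<^sup>2 = (x - z) \<bullet> (x - z)"
      by (metis dist_commute dist_norm power2_norm_eq_inner)
    then show ?thesis by (simp only: inner_vec_def vector_minus_component inner_real_def)
  qed
  show "smooth ?\<zeta>"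
    by (intro smooth_flat1 smooth_diff smooth_sum smooth_mult smooth_component smooth_const)
  show "0 < ?\<zeta> x \<longleftrightarrow> x \<in> ball z \<delta>" for x
    using assms power_less_iff_less[of "dist z x" \<delta>] unfolding eq by simp
  show "?\<zeta> x = 0" if "x \<notin> cball z \<delta>" for x
    using assms that power_mono[of \<delta> "dist z x" 2] unfolding eq by simp
qed simp_all

lemma box_bumps:
  fixes a b :: "real^'n::finite"
  obtains \<phi> where "\<And>m::nat. smooth (\<phi> m)" "\<And>m x. 0 \<le> \<phi> m x" "\<And>m x. \<phi> m x \<le> 1"
    "\<And>m x. x \<notin> box a b \<Longrightarrow> \<phi> m x = 0" "\<And>x. (\<lambda>m. \<phi> m x) \<longlonglongrightarrow> indicator (box a b) x"
proof
  let ?\<phi> = "\<lambda>m x. \<Prod>i\<in>UNIV. flat1 (real m * (x $ i - a $ i)) * flat1 (real m * (b $ i - x $ i))"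
  show "smooth (?\<phi> m)" for m
    by (intro smooth_prod smooth_mult smooth_flat1 smooth_diff smooth_component smooth_const)
  show "0 \<le> ?\<phi> m x" for m x by (intro prod_nonneg) auto
  show "?\<phi> m x \<le> 1" for m x by (intro prod_le_1) (auto intro: mult_le_one)
  show zero: "?\<phi> m x = 0" if "x \<notin> box a b" for m x
  proof -
    from that obtain i where "x $ i - a $ i \<le> 0 \<or> b $ i - x $ i \<le> 0"
      by (auto simp: mem_box_cart not_less)
    then have "real m * (x $ i - a $ i) \<le> 0 \<or> real m * (b $ i - x $ i) \<le> 0"
      by (auto intro: mult_nonneg_nonpos)
    then show ?thesis by (auto simp: prod_zero_iff)
  qed
  show "(\<lambda>m. ?\<phi> m x) \<longlonglongrightarrow> indicator (box a b) x" for x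
  proof (cases "x \<in> box a b")
    case True
    have one: "(\<lambda>m. flat1 (real m * t)) \<longlonglongrightarrow> 1" if "t > 0" for t
    proof (rule Lim_transform_eventually)
      have "(\<lambda>m. exp (- (1 / t * (1 / real m)))) \<longlonglongrightarrow> exp (- (1 / t * 0))"
        by (intro tendsto_intros lim_1_over_n)
      then show "(\<lambda>m. exp (- (1 / (real m * t)))) \<longlonglongrightarrow> 1" by (simp add: mult.commute)
      show "\<forall>\<^sub>F m in sequentially. exp (- (1 / (real m * t))) = flat1 (real m * t)"
        using eventually_gt_at_top[of 0] by eventually_elim (use that in \<open>simp add: flat1_eq\<close>)
    qed
    have "(\<lambda>m. ?\<phi> m x) \<longlonglongrightarrow> (\<Prod>i\<in>(UNIV::'n set). 1 * 1)"
      using True by (intro tendsto_prod tendsto_mult one) (auto simp: mem_box_cart)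
    then show ?thesis using True by simp
  next
    case False
    show ?thesis by (simp only: zero[OF False] indicator_simps(2)[OF False] tendsto_const)
  qed
qed

section \<open>Weak derivatives\<close>

lemma diff_quotient_tendsto_pd:
  assumes "w differentiable (at x)"
  shows "(\<lambda>m. (w (x + (1 / real (Suc m)) *\<^sub>R axis i 1) - w x) / (1 / real (Suc m))) \<longlonglongrightarrow> pd i w x"
proof -
  have "((\<lambda>s. w (x + s *\<^sub>R axis i 1)) has_real_derivative pd i w x) (at 0)"
    using line_deriv[of w x 0 i] assms by simp
  then have "((\<lambda>h. (w (x + h *\<^sub>R axis i 1) - w x) / h) \<longlongrightarrow> pd i w x) (at 0)"
    unfolding DERIV_def by simp
  then show ?thesis
    by (rule filterlim_compose) (use inverse_Suc_tendsto_0 in \<open>simp add: filterlim_at\<close>)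
qed

lemma integral_translate:
  fixes w :: "'a::euclidean_space \<Rightarrow> real"
  assumes "w \<in> borel_measurable borel"
  shows "(LINT x|lborel. w (x + c)) = (LINT x|lborel. w x)"
proof -
  have "(LINT x|lborel. w x) = (LINT x|distr lborel borel ((+) c). w x)"
    by (simp add: lborel_distr_plus)
  also have "\<dots> = (LINT x|lborel. w (c + x))"
    using assms by (intro integral_distr) auto
  finally show ?thesis by (simp add: add.commute)
qed

lemma integrable_translate:
  fixes w :: "'a::euclidean_space \<Rightarrow> real"
  assumes "integrable lborel w"
  shows "integrable lborel (\<lambda>x. w (x + c))"
proof -
  have "integrable (distr lborel borel ((+) c)) w"
    using assms by (simp add: lborel_distr_plus)
  then have "integrable lborel (\<lambda>x. w (c + x))"
    by (rule integrable_distr[rotated]) simp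
  then show ?thesis by (simp add: add.commute)
qed

text \<open>The difference quotients of \<open>w\<close> have integral \<open>0\<close> because Lebesgue measure is translation
  invariant; they converge boundedly to the partial derivative.\<close>

lemma integral_pd_eq_0:
  fixes w :: "real^'n::finite \<Rightarrow> real"
  assumes diff: "\<And>x. w differentiable (at x)" and K: "compact K" "\<And>x. x \<notin> K \<Longrightarrow> w x = 0"
    and B: "\<And>x. \<bar>pd i w x\<bar> \<le> B"
  shows "integral\<^sup>L lborel (pd i w) = 0"
proof -
  let ?t = "\<lambda>m::nat. 1 / real (Suc m)"
  define q where "q m x = (w (x + ?t m *\<^sub>R axis i 1) - w x) / ?t m" for m x
  obtain R where R: "K \<subseteq> cball 0 R"
    using compact_imp_bounded[OF K(1)] by (fastforce simp: bounded_iff subset_iff)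
  have wc: "continuous_on UNIV w"
    using diff by (simp add: continuous_on_eq_continuous_at differentiable_imp_continuous_within)
  then have wm[measurable]: "w \<in> borel_measurable borel"
    by (rule borel_measurable_continuous_onI)
  have qm[measurable]: "q m \<in> borel_measurable borel" for m
    unfolding q_def by measurable
  have wint: "integrable lborel w"
  proof -
    have "integrable lborel (\<lambda>x. indicator (cball 0 R) x *\<^sub>R w x)"
      using wc by (intro borel_integrable_compact) (auto intro: continuous_on_subset)
    moreover have "(\<lambda>x. indicator (cball 0 R) x *\<^sub>R w x) = w"
    proof
      fix x show "indicator (cball 0 R) x *\<^sub>R w x = w x"
        using K(2)[of x] subsetD[OF R, of x] by (cases "x \<in> cball 0 R") auto
    qed
    ultimately show ?thesis by simp
  qed
  have qB: "norm (q m x) \<le> B * indicator (cball 0 (R + 1)) x" for m x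
  proof (cases "x \<in> cball 0 (R + 1)")
    case True
    have t: "0 < ?t m" by simp
    obtain z where "w (x + ?t m *\<^sub>R axis i 1) - w (x + 0 *\<^sub>R axis i 1) = (?t m - 0) * pd i w (x + z *\<^sub>R axis i 1)"
      using MVT2[OF t line_deriv[OF diff]] by blast
    then have "q m x = pd i w (x + z *\<^sub>R axis i 1)" unfolding q_def by simp
    then show ?thesis using True B by simp
  next
    case False
    have "x \<notin> cball 0 R" using False by auto
    moreover have "x + ?t m *\<^sub>R axis i 1 \<notin> cball 0 R"
    proof
      assume "x + ?t m *\<^sub>R axis i 1 \<in> cball 0 R"
      moreover have "norm x \<le> norm (x + ?t m *\<^sub>R axis i 1) + norm (?t m *\<^sub>R axis i (1::real) :: real^'n)"
        by (metis add_diff_cancel_right' norm_triangle_ineq4)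
      moreover have "norm (?t m *\<^sub>R axis i (1::real) :: real^'n) \<le> 1" by simp
      moreover have "norm x > R + 1" using False by simp
      ultimately show False unfolding mem_cball_0 by linarith
    qed
    ultimately have "w x = 0" "w (x + ?t m *\<^sub>R axis i 1) = 0"
      using K(2) R by blast+
    then show ?thesis unfolding q_def using False by simp
  qed
  have "(\<lambda>m. integral\<^sup>L lborel (q m)) \<longlonglongrightarrow> integral\<^sup>L lborel (pd i w)"
  proof (rule integral_dominated_convergence[where w = "\<lambda>x. B * indicator (cball 0 (R + 1)) x"])
    have lim: "(\<lambda>m. q m x) \<longlonglongrightarrow> pd i w x" for x
      unfolding q_def by (rule diff_quotient_tendsto_pd[OF diff])
    show "AE x in lborel. (\<lambda>m. q m x) \<longlonglongrightarrow> pd i w x" by (rule AE_I2[OF lim])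
    show "pd i w \<in> borel_measurable lborel"
      by (rule borel_measurable_LIMSEQ_real[OF lim]) (simp add: qm)
    show "integrable lborel (\<lambda>x. B * indicator (cball 0 (R + 1)) x)"
      by (intro integrable_mult_right integrable_real_indicator emeasure_bounded_finite) simp_all
  qed (use qB in auto)
  moreover have "(\<lambda>m. integral\<^sup>L lborel (q m)) = (\<lambda>m. 0)"
  proof
    fix m
    have "integral\<^sup>L lborel (q m)
        = ((LINT x|lborel. w (x + ?t m *\<^sub>R axis i 1)) - integral\<^sup>L lborel w) / ?t m"
      unfolding q_def
      by (subst integral_divide_zero) (subst Bochner_Integration.integral_diff[OF integrable_translate[OF wint] wint], rule refl)
    also have "\<dots> = 0" by (subst integral_translate[OF wm]) simp
    finally show "integral\<^sup>L lborel (q m) = 0" .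
  qed
  ultimately show ?thesis by (simp add: LIMSEQ_const_iff)
qed

lemma set_integrable_mult_bounded:
  fixes g h :: "real^'n::finite \<Rightarrow> real"
  assumes g: "set_integrable lebesgue K g" and KS: "K \<subseteq> S"
    and h: "(\<lambda>x. indicator K x * h x) \<in> borel_measurable lebesgue" "\<And>x. x \<in> K \<Longrightarrow> \<bar>h x\<bar> \<le> B"
    and 0: "\<And>x. x \<in> S - K \<Longrightarrow> g x * h x = 0"
  shows "set_integrable lebesgue S (\<lambda>x. g x * h x)"
proof -
  have eq: "indicator S x *\<^sub>R (g x * h x) = (indicator K x * g x) * (indicator K x * h x)" for x
    using KS 0 by (auto simp: indicator_def)
  have gi: "integrable lebesgue (\<lambda>x. indicator K x * g x)"
    using g by (simp add: set_integrable_def)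
  show ?thesis
    unfolding set_integrable_def eq
  proof (rule Bochner_Integration.integrable_bound)
    show "integrable lebesgue (\<lambda>x. B * (indicator K x * g x))"
      using gi by simp
    show "(\<lambda>x. (indicator K x * g x) * (indicator K x * h x)) \<in> borel_measurable lebesgue"
      by (rule borel_measurable_times[OF borel_measurable_integrable[OF gi] h(1)])
    show "AE x in lebesgue. norm (indicator K x * g x * (indicator K x * h x)) \<le> norm (B * (indicator K x * g x))"
    proof (intro AE_I2)
      fix x :: "real^'n"
      have "\<bar>g x * h x\<bar> \<le> \<bar>B * g x\<bar>" if "x \<in> K"
        using mult_left_mono[OF order_trans[OF h(2)[OF that] abs_ge_self], of "\<bar>g x\<bar>"]
        by (simp add: abs_mult mult.commute)
      then show "norm (indicator K x * g x * (indicator K x * h x)) \<le> norm (B * (indicator K x * g x))"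
        by (cases "x \<in> K") auto
    qed
  qed
qed

lemma indicator_continuous_lebesgue_measurable:
  fixes h :: "real^'n::finite \<Rightarrow> real"
  assumes "K \<in> sets borel" "continuous_on K h"
  shows "(\<lambda>x. indicator K x * h x) \<in> borel_measurable lebesgue"
  using borel_measurable_continuous_on_indicator[OF assms(1) assms(2)]
  by (auto intro!: measurable_completion)

lemma set_integrable_mult_continuous:
  fixes g h :: "real^'n::finite \<Rightarrow> real"
  assumes g: "set_integrable lebesgue K g" and K: "compact K" "K \<subseteq> S"
    and h: "continuous_on K h" and 0: "\<And>x. x \<in> S - K \<Longrightarrow> g x * h x = 0"
  shows "set_integrable lebesgue S (\<lambda>x. g x * h x)"
proof -
  obtain B where "\<And>x. x \<in> K \<Longrightarrow> \<bar>h x\<bar> \<le> B"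
    using compact_imp_bounded[OF compact_continuous_image[OF h K(1)]] by (auto simp: bounded_iff)
  then show ?thesis
    using indicator_continuous_lebesgue_measurable[OF borel_compact[OF K(1)] h] 0
    by (intro set_integrable_mult_bounded[OF g K(2)]) auto
qed

lemma set_integrable_continuous_compact:
  fixes h :: "real^'n::finite \<Rightarrow> real"
  assumes K: "compact K" "K \<subseteq> S"
    and h: "continuous_on K h" and 0: "\<And>x. x \<in> S - K \<Longrightarrow> h x = 0"
  shows "set_integrable lebesgue S h"
proof -
  have "set_integrable lebesgue K (\<lambda>x. 1::real)"
    using lmeasurable_compact[OF K(1)]
    by (auto simp: set_integrable_def fmeasurable_def top_unique less_top intro!: integrable_real_indicator)
  from set_integrable_mult_continuous[OF this K h] 0 show ?thesis by simp
qed

lemma continuous_L1_loc: "continuous_on \<Omega> f \<Longrightarrow> f \<in> L1_loc \<Omega>"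
  unfolding L1_loc_def using continuous_on_subset by (blast intro: set_integrable_continuous_compact[OF _ order_refl])

lemma LINT_eq_lborel:
  fixes f :: "real^'n::finite \<Rightarrow> real"
  assumes "\<And>x. x \<notin> S \<Longrightarrow> f x = 0" "f \<in> borel_measurable borel"
  shows "(LINT x:S|lebesgue. f x) = integral\<^sup>L lborel f"
proof -
  have "(\<lambda>x. indicator S x *\<^sub>R f x) = f"
    by (rule ext) (use assms(1) in \<open>auto simp: indicator_def\<close>)
  then show ?thesis unfolding set_lebesgue_integral_def using assms(2) by (simp add: integral_completion)
qed

text \<open>The function \<open>h\<close> need only be differentiable near the support of \<open>\<phi>\<close>; this covers compositions
  with functions that are defined on an open set of values.\<close>

lemma integration_by_parts_test_fun:
  fixes h :: "real^'n::finite \<Rightarrow> real"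
  assumes \<phi>: "\<phi> \<in> test_fun \<Omega>" and K: "compact K" "K \<subseteq> V" "\<And>x. x \<notin> K \<Longrightarrow> \<phi> x = 0"
    and V: "open V" "V \<subseteq> \<Omega>" "\<And>x. x \<in> V \<Longrightarrow> h differentiable (at x)" "continuous_on V (pd i h)"
  shows "(LINT x:\<Omega>|lebesgue. h x * pd i \<phi> x) = - (LINT x:\<Omega>|lebesgue. pd i h x * \<phi> x)"
proof -
  have \<phi>s: "smooth \<phi>" using \<phi> by (rule test_fun_smooth)
  have pd0: "pd i \<phi> x = 0" if "x \<notin> K" for x
    by (rule pd_eq_0_outside[OF compact_imp_closed[OF K(1)] K(3) that])
  define w where "w x = h x * \<phi> x" for x
  have wder: "w differentiable (at x) \<and> pd i w x = h x * pd i \<phi> x + pd i h x * \<phi> x" for x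
  proof (cases "x \<in> K")
    case True
    then have "h differentiable (at x)" using K V by auto
    then show ?thesis
      unfolding w_def using smooth_differentiable[OF \<phi>s] by (auto intro: pd_mult)
  next
    case False
    have "(w has_derivative (\<lambda>h. 0)) (at x)"
      by (rule has_derivative_transform_within_open[of "\<lambda>_. 0" _ _ _ "- K"])
         (use False K compact_imp_closed in \<open>auto simp: w_def\<close>)
    moreover from pd_eqI[OF this] have "pd i w x = 0" by simp
    ultimately show ?thesis using False K(3) pd0 by (auto simp: differentiable_def)
  qed
  have hc: "continuous_on V h"
    using V(1,3) by (simp add: continuous_on_eq_continuous_at differentiable_imp_continuous_within)
  have c1: "continuous_on K (\<lambda>x. h x * pd i \<phi> x)" and c2: "continuous_on K (\<lambda>x. pd i h x * \<phi> x)"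
    by (intro continuous_on_mult continuous_on_subset[OF hc K(2)] continuous_on_subset[OF V(4) K(2)]
        smooth_continuous[OF smooth_pd[OF \<phi>s]] smooth_continuous[OF \<phi>s])+
  have i1: "set_integrable lebesgue \<Omega> (\<lambda>x. h x * pd i \<phi> x)"
    using K V pd0 by (intro set_integrable_continuous_compact[OF K(1) _ c1]) auto
  have i2: "set_integrable lebesgue \<Omega> (\<lambda>x. pd i h x * \<phi> x)"
    using K V by (intro set_integrable_continuous_compact[OF K(1) _ c2]) auto
  have cw: "continuous_on K (pd i w)" 
    using continuous_on_add[OF c1 c2] wder by (simp cong: continuous_on_cong)
  obtain B where B: "\<And>x. x \<in> K \<Longrightarrow> \<bar>pd i w x\<bar> \<le> B"
    using compact_imp_bounded[OF compact_continuous_image[OF cw K(1)]] by (auto simp: bounded_iff)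
  have w0: "pd i w x = 0" if "x \<notin> K" for x
    using wder[of x] pd0[OF that] K(3)[OF that] by simp
  have "integral\<^sup>L lborel (pd i w) = 0"
  proof (rule integral_pd_eq_0[OF _ K(1)])
    show "\<And>x. w differentiable (at x)" using wder by blast
    show "w x = 0" if "x \<notin> K" for x using that K(3) by (simp add: w_def)
    show "\<bar>pd i w x\<bar> \<le> max B 0" for x using B[of x] w0[of x] by (cases "x \<in> K") auto
  qed
  moreover have "pd i w \<in> borel_measurable borel"
  proof -
    have "(\<lambda>x. indicator K x *\<^sub>R pd i w x) \<in> borel_measurable borel"
      by (intro borel_measurable_continuous_on_indicator cw) (use K(1) in \<open>simp add: borel_compact\<close>)
    moreover have "(\<lambda>x. indicator K x *\<^sub>R pd i w x) = pd i w"
      by (rule ext) (use w0 in \<open>auto simp: indicator_def\<close>)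
    ultimately show ?thesis by simp
  qed
  ultimately have "(LINT x:\<Omega>|lebesgue. pd i w x) = 0"
    using w0 K V by (subst LINT_eq_lborel) auto
  then have "(LINT x:\<Omega>|lebesgue. h x * pd i \<phi> x + pd i h x * \<phi> x) = 0"
    using wder by simp
  then show ?thesis using set_integral_add(2)[OF i1 i2] by simp
qed

lemma has_wderiv_smooth:
  assumes "open \<Omega>" "smooth f"
  shows "has_wderiv \<Omega> i f (pd i f)"
  unfolding has_wderiv_def
proof (intro conjI ballI)
  fix \<phi> assume \<phi>: "\<phi> \<in> test_fun \<Omega>"
  obtain K where K: "compact K" "K \<subseteq> \<Omega>" "\<And>x. x \<notin> K \<Longrightarrow> \<phi> x = 0" using test_funE[OF \<phi>] by metis
  show "(LINT x:\<Omega>|lebesgue. f x * pd i \<phi> x) = - (LINT x:\<Omega>|lebesgue. pd i f x * \<phi> x)"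
    using assms by (intro integration_by_parts_test_fun[OF \<phi> K]) (auto intro: smooth_differentiable smooth_continuous smooth_pd)
qed (auto intro!: continuous_L1_loc smooth_continuous smooth_pd assms)

subsection \<open>Uniqueness\<close>

text \<open>Boxes form an intersection stable generator of the Borel sets, so all integrals over Borel sets
  vanish.\<close>

lemma AE_eq_0_if_box_integrals_0:
  fixes G :: "'a::euclidean_space \<Rightarrow> real"
  assumes G: "integrable lborel G" and supp: "\<And>x. x \<notin> box c d \<Longrightarrow> G x = 0"
    and box: "\<And>a b. (LINT x:box a b|lborel. G x) = 0"
  shows "AE x in lborel. G x = 0"
proof -
  have sI: "set_integrable lborel A G" if "A \<in> sets borel" for A
    using G that unfolding set_integrable_def by (intro integrable_mult_indicator) auto
  have all: "(LINT x:UNIV|lborel. G x) = 0"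
  proof -
    have "(LINT x:UNIV|lborel. G x) = (LINT x:box c d|lborel. G x)"
      unfolding set_lebesgue_integral_def using supp by (intro Bochner_Integration.integral_cong) (auto simp: indicator_def)
    then show ?thesis using box by simp
  qed
  let ?E = "range (\<lambda>(a, b). box a b :: 'a set)"
  have "(LINT x:A|lborel. G x) = 0" if A: "A \<in> sigma_sets UNIV ?E" for A
  proof (rule sigma_sets_induct_disjoint[OF _ _ A])
    show "Int_stable ?E" by (auto simp: Int_stable_def box_Int_box)
    show "?E \<subseteq> Pow UNIV" by simp
  next
    fix A assume "A \<in> ?E" then show "(LINT x:A|lborel. G x) = 0" using box by auto
  next
    show "(LINT x:{}|lborel. G x) = 0" by (simp add: set_lebesgue_integral_def)
  next
    fix A assume A: "A \<in> sigma_sets UNIV ?E" "(LINT x:A|lborel. G x) = 0"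
    then have Ab: "A \<in> sets borel" unfolding borel_eq_box by simp
    have "(LINT x:A \<union> (UNIV - A)|lborel. G x) = (LINT x:A|lborel. G x) + (LINT x:UNIV - A|lborel. G x)"
      using Ab by (intro set_integral_Un sI) auto
    then show "(LINT x:UNIV - A|lborel. G x) = 0" using A all by simp
  next
    fix A :: "nat \<Rightarrow> 'a set" assume A: "disjoint_family A" "range A \<subseteq> sigma_sets UNIV ?E"
      "\<And>i. (LINT x:A i|lborel. G x) = 0"
    then have Ab: "A i \<in> sets borel" for i unfolding borel_eq_box by auto
    then show "(LINT x:\<Union>(range A)|lborel. G x) = 0"
      using A by (subst lebesgue_integral_countable_add) (auto simp: disjoint_family_on_def intro!: sI)
  qed
  then have "(LINT x:A|lborel. G x) = (LINT x:A|lborel. 0)" if "A \<in> sets lborel" for A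
    using that unfolding sets_lborel borel_eq_box by simp
  from density_unique_real[OF G _ this] show ?thesis by simp
qed

text \<open>The fundamental lemma of the calculus of variations: test functions approximate the
  indicator functions of boxes.\<close>

lemma L1_loc_AE_eq_0:
  fixes g :: "real^'n::finite \<Rightarrow> real"
  assumes \<Omega>: "open \<Omega>" and g: "g \<in> L1_loc \<Omega>"
    and 0: "\<And>\<phi>. \<phi> \<in> test_fun \<Omega> \<Longrightarrow> (LINT x:\<Omega>|lebesgue. g x * \<phi> x) = 0"
  shows "AE x in lebesgue. x \<in> \<Omega> \<longrightarrow> g x = 0"
proof -
  have cbox: "AE x in lebesgue. x \<in> box c d \<longrightarrow> g x = 0" if cd: "cbox c d \<subseteq> \<Omega>" for c d :: "real^'n"
  proof -
    have gi: "set_integrable lebesgue (cbox c d) g"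
      using g cd compact_cbox unfolding L1_loc_def by blast
    have box0: "(LINT x:box a b|lebesgue. g x) = 0" if ab: "cbox a b \<subseteq> cbox c d" for a b
    proof -
      obtain \<phi> where \<phi>: "\<And>m::nat. smooth (\<phi> m)" "\<And>m x. 0 \<le> \<phi> m x" "\<And>m x. \<phi> m x \<le> 1"
        "\<And>m x. x \<notin> box a b \<Longrightarrow> \<phi> m x = 0" "\<And>x. (\<lambda>m. \<phi> m x) \<longlonglongrightarrow> indicator (box a b) x"
        using box_bumps[of a b] by blast
      have \<phi>t: "\<phi> m \<in> test_fun \<Omega>" for m
        by (rule test_funI[OF \<phi>(1) compact_cbox order_trans[OF ab cd]]) (use \<phi>(4) box_subset_cbox in blast)
      have eq: "indicator \<Omega> x *\<^sub>R (g x * \<phi> m x) = indicator (cbox c d) x * g x * \<phi> m x" for m x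
        using \<phi>(4)[of x m] ab cd box_subset_cbox[of a b] by (auto simp: indicator_def)
      have eq2: "indicator (box a b) x *\<^sub>R g x = indicator (cbox c d) x * g x * indicator (box a b) x" for x
        using ab cd box_subset_cbox[of a b] by (auto simp: indicator_def)
      have m: "(\<lambda>x. indicator (cbox c d) x * g x) \<in> borel_measurable lebesgue"
        using gi by (simp add: set_integrable_def borel_measurable_integrable)
      have "(\<lambda>m. LINT x|lebesgue. indicator (cbox c d) x * g x * \<phi> m x) \<longlonglongrightarrow>
          (LINT x|lebesgue. indicator (cbox c d) x * g x * indicator (box a b) x)"
      proof (rule integral_dominated_convergence[where w = "\<lambda>x. norm (indicator (cbox c d) x *\<^sub>R g x)"])
        show "(\<lambda>x. indicator (cbox c d) x * g x * \<phi> i x) \<in> borel_measurable lebesgue" for i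
          using \<phi>(1) by (intro borel_measurable_times m measurable_completion)
            (auto intro!: borel_measurable_continuous_onI smooth_continuous)
        show "AE x in lebesgue. (\<lambda>i. indicator (cbox c d) x * g x * \<phi> i x) \<longlonglongrightarrow> indicator (cbox c d) x * g x * indicator (box a b) x"
          by (intro AE_I2 tendsto_intros \<phi>(5))
        show "AE x in lebesgue. norm (indicator (cbox c d) x * g x * \<phi> i x) \<le> norm (indicator (cbox c d) x *\<^sub>R g x)" for i
          using \<phi>(2,3) by (intro AE_I2) (auto simp: abs_mult mult_left_le)
        show "(\<lambda>x. indicator (cbox c d) x * g x * indicator (box a b) x) \<in> borel_measurable lebesgue"
          by (rule borel_measurable_times[OF m]) (rule measurable_completion, simp)
      qed (use gi in \<open>simp add: set_integrable_def\<close>)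
      moreover have "(LINT x|lebesgue. indicator (cbox c d) x * g x * \<phi> m x) = 0" for m
        using 0[OF \<phi>t[of m]] unfolding set_lebesgue_integral_def eq by simp
      ultimately have "(LINT x|lebesgue. indicator (cbox c d) x * g x * indicator (box a b) x) = 0"
        by (simp add: LIMSEQ_const_iff)
      then show ?thesis unfolding set_lebesgue_integral_def eq2 .
    qed
    \<comment> \<open>A Borel representative of \<open>g\<close> on the box, since the generator argument is about Borel sets.\<close>
    let ?G = "\<lambda>x. indicator (box c d) x * g x"
    have Gi: "integrable lebesgue ?G"
      using set_integrable_subset[OF gi, of "box c d"] box_subset_cbox[of c d] by (simp add: set_integrable_def)
    then obtain G where G: "G \<in> borel_measurable lborel" "AE x in lborel. ?G x = G x"
      using completion_ex_borel_measurable_real[of ?G lborel] by (auto dest: borel_measurable_integrable)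
    define H where "H x = indicator (box c d) x * G x" for x
    have Hm: "H \<in> borel_measurable lborel" unfolding H_def using G by measurable
    have HAE: "AE x in lebesgue. ?G x = H x"
      using AE_completion[OF G(2)] by eventually_elim (auto simp: H_def indicator_def)
    have Hi': "integrable lebesgue H"
      using Gi HAE Hm by (subst integrable_cong_AE[of _ _ ?G]) (auto intro: measurable_completion simp: borel_measurable_integrable)
    then have Hi: "integrable lborel H" using Hm by (simp add: integrable_completion)
    have "AE x in lborel. H x = 0"
    proof (rule AE_eq_0_if_box_integrals_0[OF Hi])
      show "x \<notin> box c d \<Longrightarrow> H x = 0" for x by (simp add: H_def)
      fix a b :: "real^'n"
      obtain a' b' where ab': "box a b \<inter> box c d = box a' b'" using box_Int_box[of a b c d] by blast
      have sub: "cbox a'' b'' \<subseteq> cbox c d" if "box a b \<inter> box c d = box a'' b''" "box a'' b'' \<noteq> {}" for a'' b''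
      proof -
        have "box a'' b'' \<subseteq> cbox c d" using that(1) box_subset_cbox[of c d] by blast
        then have "closure (box a'' b'') \<subseteq> cbox c d" by (rule closure_minimal[OF _ closed_cbox])
        then show ?thesis using closure_box[OF that(2)] by simp
      qed
      have "(LINT x:box a b|lborel. H x) = (LINT x|lebesgue. indicator (box a b) x *\<^sub>R H x)"
        unfolding set_lebesgue_integral_def using Hm by (subst integral_completion) auto
      also have "\<dots> = (LINT x|lebesgue. indicator (box a' b') x *\<^sub>R g x)"
      proof (rule integral_cong_AE)
        have "AE x in lebesgue. indicator (box a b) x *\<^sub>R ?G x = indicator (box a b) x *\<^sub>R H x"
          using HAE by eventually_elim simp
        moreover have e: "indicator (box a b) x *\<^sub>R ?G x = indicator (box a' b') x *\<^sub>R g x" for x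
          unfolding ab'[symmetric] by (simp add: indicator_inter_arith)
        ultimately show "AE x in lebesgue. indicator (box a b) x *\<^sub>R H x = indicator (box a' b') x *\<^sub>R g x"
          unfolding e by (auto elim!: eventually_mono)
        show "(\<lambda>x. indicator (box a b) x *\<^sub>R H x) \<in> borel_measurable lebesgue"
          by (intro measurable_completion borel_measurable_scaleR Hm) simp
        have "(\<lambda>x. indicator (box a b) x *\<^sub>R ?G x) \<in> borel_measurable lebesgue"
          by (rule borel_measurable_scaleR[OF _ borel_measurable_integrable[OF Gi]]) (rule measurable_completion, simp)
        then show "(\<lambda>x. indicator (box a' b') x *\<^sub>R g x) \<in> borel_measurable lebesgue"
          unfolding e .
      qed
      also have "\<dots> = 0"
      proof (cases "box a' b' = {}")
        case False
        then show ?thesis using box0[OF sub[OF ab' False]] by (simp add: set_lebesgue_integral_def)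
      qed simp
      finally show "(LINT x:box a b|lborel. H x) = 0" .
    qed
    from AE_completion[OF this] HAE show ?thesis
      by eventually_elim (auto simp: indicator_def split: if_splits)
  qed
  \<comment> \<open>By Lindelof, countably many boxes with closure in \<open>\<Omega>\<close> cover \<open>\<Omega>\<close>.\<close>
  define \<F> where "\<F> = {box a b | a b. cbox a b \<subseteq> \<Omega>}"
  have Fop: "open F" if "F \<in> \<F>" for F using that unfolding \<F>_def by auto
  obtain \<D> where D: "\<D> \<subseteq> \<F>" "countable \<D>" "\<Union>\<D> = \<Union>\<F>"
    using Lindelof[of \<F>] Fop by blast
  have cover: "\<Omega> \<subseteq> \<Union>\<F>"
  proof
    fix x assume "x \<in> \<Omega>"
    then obtain a b where "cbox a b \<subseteq> \<Omega>" "x \<in> box a b"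
      using open_contains_cbox[OF \<Omega>] by metis
    then show "x \<in> \<Union>\<F>" unfolding \<F>_def by blast
  qed
  have "AE x in lebesgue. \<forall>X\<in>\<D>. x \<in> X \<longrightarrow> g x = 0"
    unfolding AE_ball_countable[OF D(2)]
  proof
    fix X assume "X \<in> \<D>"
    then obtain a b where "X = box a b" "cbox a b \<subseteq> \<Omega>" using D(1) unfolding \<F>_def by blast
    then show "AE x in lebesgue. x \<in> X \<longrightarrow> g x = 0" using cbox by simp
  qed
  then show ?thesis
  proof eventually_elim
    case (elim x)
    show ?case
    proof
      assume "x \<in> \<Omega>"
      with cover D(3) obtain X where "X \<in> \<D>" "x \<in> X" by blast
      with elim show "g x = 0" by blast
    qed
  qed
qed

lemma has_wderiv_unique:
  assumes "open \<Omega>" "has_wderiv \<Omega> i f g" "has_wderiv \<Omega> i f g'"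
  shows "AE x in lebesgue. x \<in> \<Omega> \<longrightarrow> g x = g' x"
proof -
  have g: "g \<in> L1_loc \<Omega>" "g' \<in> L1_loc \<Omega>" using assms unfolding has_wderiv_def by auto
  have "AE x in lebesgue. x \<in> \<Omega> \<longrightarrow> g x - g' x = 0"
  proof (rule L1_loc_AE_eq_0[OF assms(1)])
    show "(\<lambda>x. g x - g' x) \<in> L1_loc \<Omega>" using g unfolding L1_loc_def by auto
    fix \<phi> assume \<phi>: "\<phi> \<in> test_fun \<Omega>"
    obtain K where K: "compact K" "K \<subseteq> \<Omega>" "\<And>x. x \<notin> K \<Longrightarrow> \<phi> x = 0" using test_funE[OF \<phi>] by metis
    have I: "set_integrable lebesgue \<Omega> (\<lambda>x. u x * \<phi> x)" if "u \<in> L1_loc \<Omega>" for u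
      using that K \<phi> unfolding L1_loc_def
      by (intro set_integrable_mult_continuous[OF _ K(1,2)]) (auto intro: smooth_continuous test_fun_smooth)
    have "(LINT x:\<Omega>|lebesgue. g x * \<phi> x) = (LINT x:\<Omega>|lebesgue. g' x * \<phi> x)"
      using assms \<phi> unfolding has_wderiv_def by (metis neg_equal_iff_equal)
    then show "(LINT x:\<Omega>|lebesgue. (g x - g' x) * \<phi> x) = 0"
      using set_integral_diff(2)[OF I[OF g(1)] I[OF g(2)]] by (simp add: left_diff_distrib)
  qed
  then show ?thesis by simp
qed

lemma wderiv_has_wderiv: "has_wderiv \<Omega> i f g \<Longrightarrow> has_wderiv \<Omega> i f (wderiv \<Omega> i f)"
  unfolding wderiv_def by (rule someI[of "has_wderiv \<Omega> i f"])

lemma wderiv_AE_eq: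
  "open \<Omega> \<Longrightarrow> has_wderiv \<Omega> i f g \<Longrightarrow> AE x in lebesgue. x \<in> \<Omega> \<longrightarrow> wderiv \<Omega> i f x = g x"
  by (rule has_wderiv_unique[OF _ wderiv_has_wderiv])

section \<open>Convex combinations of tails\<close>

text \<open>Coefficients of the elements in the convex hull of the tail that starts at index \<open>m\<close>.\<close>

definition tail_weights :: "nat \<Rightarrow> (nat \<Rightarrow> real) set" where
  "tail_weights m = {c. (\<forall>k. 0 \<le> c k) \<and> (\<forall>k<m. c k = 0) \<and> finite {k. c k \<noteq> 0} \<and> sum c {k. c k \<noteq> 0} = 1}"

definition wsum :: "(nat \<Rightarrow> real) \<Rightarrow> (nat \<Rightarrow> 'b::real_vector) \<Rightarrow> 'b" where
  "wsum c u = (\<Sum>k | c k \<noteq> 0. c k *\<^sub>R u k)"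

lemma wsum_eq:
  assumes "finite A" "{k. c k \<noteq> 0} \<subseteq> A"
  shows "wsum c u = (\<Sum>k\<in>A. c k *\<^sub>R u k)"
  unfolding wsum_def using assms by (intro sum.mono_neutral_left) auto

lemma tail_weights_unit: "(\<lambda>k. if k = m then 1 else 0) \<in> tail_weights m"
proof -
  have "{k. (if k = m then 1 else 0) \<noteq> (0::real)} = {m}" by auto
  then show ?thesis unfolding tail_weights_def by auto
qed

lemma tail_weights_mono: "m \<le> l \<Longrightarrow> tail_weights l \<subseteq> tail_weights m"
  unfolding tail_weights_def by auto

lemma tail_weights_midpoint:
  assumes "c \<in> tail_weights m" "d \<in> tail_weights m"
  shows "(\<lambda>k. (c k + d k) / 2) \<in> tail_weights m"
    and "wsum (\<lambda>k. (c k + d k) / 2) u = (1 / 2) *\<^sub>R (wsum c u + wsum d u)"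
proof -
  let ?A = "{k. c k \<noteq> 0} \<union> {k. d k \<noteq> 0}"
  let ?e = "\<lambda>k. (c k + d k) / 2"
  have A: "finite ?A" using assms unfolding tail_weights_def by auto
  have e: "{k. ?e k \<noteq> 0} \<subseteq> ?A" by auto
  have ef: "finite {k. ?e k \<noteq> 0}" using finite_subset[OF e A] .
  have "sum ?e {k. ?e k \<noteq> 0} = sum ?e ?A"
    by (rule sum.mono_neutral_left[OF A e]) auto
  also have "\<dots> = (sum c ?A + sum d ?A) / 2" by (simp add: sum.distrib sum_divide_distrib add_divide_distrib)
  also have "sum c ?A = sum c {k. c k \<noteq> 0}" by (rule sum.mono_neutral_right[OF A]) auto
  also have "sum d ?A = sum d {k. d k \<noteq> 0}" by (rule sum.mono_neutral_right[OF A]) auto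
  finally have "sum ?e {k. ?e k \<noteq> 0} = 1" using assms unfolding tail_weights_def by simp
  then show "?e \<in> tail_weights m" using assms ef unfolding tail_weights_def by auto
  show "wsum ?e u = (1 / 2) *\<^sub>R (wsum c u + wsum d u)"
    unfolding wsum_eq[OF A e] wsum_eq[OF A Un_upper1] wsum_eq[OF A Un_upper2]
      sum.distrib[symmetric] scaleR_sum_right
    by (intro sum.cong refl) (simp add: scaleR_add_left[symmetric] add_divide_distrib)
qed

lemma norm_wsum_le:
  assumes c: "c \<in> tail_weights m" and "\<And>k. k \<ge> m \<Longrightarrow> norm (u k) \<le> B"
  shows "norm (wsum c u) \<le> B"
proof -
  have "norm (wsum c u) \<le> (\<Sum>k | c k \<noteq> 0. norm (c k *\<^sub>R u k))"
    unfolding wsum_def by (rule norm_sum)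
  also have "\<dots> \<le> (\<Sum>k | c k \<noteq> 0. c k * B)"
  proof (rule sum_mono)
    fix k assume "k \<in> {k. c k \<noteq> 0}"
    then have "k \<ge> m" "0 \<le> c k" using c unfolding tail_weights_def by (auto simp: not_less[symmetric])
    then show "norm (c k *\<^sub>R u k) \<le> c k * B" using assms(2) by (simp add: mult_left_mono)
  qed
  also have "\<dots> = B" using c unfolding tail_weights_def by (simp add: sum_distrib_right[symmetric])
  finally show ?thesis .
qed

lemma wsum_const: "c \<in> tail_weights m \<Longrightarrow> wsum c (\<lambda>k. b) = b"
  unfolding wsum_def tail_weights_def by (simp add: scaleR_sum_left[symmetric])

lemma wsum_diff: "wsum c (\<lambda>k. u k - v k) = wsum c u - wsum c v"
  unfolding wsum_def by (simp add: scaleR_diff_right sum_subtractf)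

text \<open>A form of the theorem of Mazur with convergence almost everywhere.  In the weighted \<open>L\<^sup>2\<close> space
  that makes the sequence bounded, choose in the convex hull of each tail an almost shortest
  element: the parallelogram law makes these elements a Cauchy sequence.\<close>

lemma tail_weights_AE_convergent:
  fixes u :: "nat \<Rightarrow> 'a \<Rightarrow> 'b::euclidean_space"
  assumes sf: "sigma_finite_measure M" and um [measurable]: "\<And>k. u k \<in> borel_measurable M"
    and bdd: "\<And>x. x \<in> space M \<Longrightarrow> bounded (range (\<lambda>k. u k x))"
  obtains c where "\<And>m. c m \<in> tail_weights m" "AE x in M. convergent (\<lambda>m. wsum (c m) (\<lambda>k. u k x))"
proof -
  interpret sigma_finite_measure M by (rule sf)
  obtain h :: "'a \<Rightarrow> real" where h [measurable]: "h \<in> borel_measurable M" and hpos: "\<And>x. 0 < h x"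
    and "\<And>x. h x \<le> 1" and hint: "integrable M h"
    by (rule obtain_positive_integrable_function) blast
  define b where "b x = (SUP k. norm (u k x))" for x
  have bb: "bdd_above (range (\<lambda>k. norm (u k x)))" if "x \<in> space M" for x
    using bdd[OF that] unfolding bounded_iff bdd_above_def by auto
  have bm [measurable]: "b \<in> borel_measurable M"
    unfolding b_def by (rule borel_measurable_cSUP) (use bb in auto)
  have ub: "norm (u k x) \<le> b x" if "x \<in> space M" for k x
    unfolding b_def by (rule cSUP_upper[OF _ bb[OF that]]) simp
  have b0: "0 \<le> b x" if "x \<in> space M" for x
    using ub[OF that, of 0] norm_ge_zero order_trans by blast
  \<comment> \<open>With this weight every convex combination is dominated by \<open>sqrt (h x)\<close>, where \<open>h\<close> is integrable.\<close>
  define g where "g x = sqrt (h x) / (1 + b x)" for x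
  have gm [measurable]: "g \<in> borel_measurable M" unfolding g_def by measurable
  have gpos: "0 < g x" if "x \<in> space M" for x
    using hpos[of x] b0[OF that] unfolding g_def by (auto intro!: divide_pos_pos)
  define V where "V c x = g x *\<^sub>R wsum c (\<lambda>k. u k x)" for c :: "nat \<Rightarrow> real" and x
  have Vm [measurable]: "V c \<in> borel_measurable M" for c
    unfolding V_def wsum_def by measurable
  have Vle: "norm (V c x) \<le> sqrt (h x)" if "c \<in> tail_weights m" "x \<in> space M" for c m x
  proof -
    have "norm (V c x) \<le> g x * b x"
      unfolding V_def using norm_wsum_le[OF that(1), of "\<lambda>k. u k x"] ub[OF that(2)] gpos[OF that(2)]
      by (simp add: mult_left_mono)
    also have "\<dots> \<le> sqrt (h x)"
      using b0[OF that(2)] hpos[of x] unfolding g_def by (simp add: field_simps mult_left_mono)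
    finally show ?thesis .
  qed
  have Vsq: "(norm (V c x))\<^sup>2 \<le> h x" if "c \<in> tail_weights m" "x \<in> space M" for c m x
    using power_mono[OF Vle[OF that] norm_ge_zero, of 2] hpos[of x] by simp
  have Vint: "integrable M (\<lambda>x. (norm (V c x))\<^sup>2)" if "c \<in> tail_weights m" for c m
    by (rule Bochner_Integration.integrable_bound[OF hint]) (use Vsq[OF that] in \<open>auto simp: order_trans[OF _ abs_ge_self]\<close>)
  define q where "q c = (LINT x|M. (norm (V c x))\<^sup>2)" for c
  have q0: "0 \<le> q c" for c unfolding q_def by (intro Bochner_Integration.integral_nonneg) auto
  have qle: "q c \<le> integral\<^sup>L M h" if "c \<in> tail_weights m" for c m
    unfolding q_def by (rule integral_mono[OF Vint[OF that] hint]) (use Vsq[OF that] in auto)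
  \<comment> \<open>The squared distance of the tail hulls to the origin increases with \<open>m\<close>, hence converges.\<close>
  define d where "d m = (INF c\<in>tail_weights m. q c)" for m
  have bel: "bdd_below (q ` A)" for A using q0 by (auto simp: bdd_below_def)
  have ne: "tail_weights m \<noteq> {}" for m using tail_weights_unit by blast
  have dle: "d m \<le> q c" if "c \<in> tail_weights m" for c m
    unfolding d_def by (rule cINF_lower[OF bel that])
  have dinc: "incseq d"
    unfolding incseq_def d_def by (intro allI impI cINF_superset_mono ne bel tail_weights_mono) auto
  have dbd: "d m \<le> integral\<^sup>L M h" for m
    using dle[OF tail_weights_unit] qle[OF tail_weights_unit] by (rule order_trans)
  obtain D where D: "d \<longlonglongrightarrow> D" "\<And>m. d m \<le> D"
    using incseq_convergent[OF dinc] dbd by blast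
  have "\<exists>c. c \<in> tail_weights m \<and> q c < d m + 1 / real (Suc m)" for m
  proof -
    have "d m < d m + 1 / real (Suc m)" by simp
    then show ?thesis using cINF_less_iff[OF ne bel, of m "d m + 1 / real (Suc m)"] unfolding d_def by blast
  qed
  then obtain c where c: "\<And>m. c m \<in> tail_weights m" and cq: "\<And>m. q (c m) < d m + 1 / real (Suc m)"
    by metis
  have diffq: "integrable M (\<lambda>x. (norm (V (c m) x - V (c l) x))\<^sup>2) \<and>
      (LINT x|M. (norm (V (c m) x - V (c l) x))\<^sup>2) \<le> 2 * (D - d m) + 4 * (1 / real (Suc m))"
    if "m \<le> l" for m l
  proof -
    let ?e = "\<lambda>k. (c m k + c l k) / 2"
    have cl: "c l \<in> tail_weights m" using c tail_weights_mono[OF that] by blast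
    note e = tail_weights_midpoint[OF c[of m] cl]
    have Ve: "V ?e x = (1 / 2) *\<^sub>R (V (c m) x + V (c l) x)" for x
      unfolding V_def e(2) by (simp add: scaleR_add_right mult.commute)
    have par: "(norm (V (c m) x - V (c l) x))\<^sup>2
        = 2 * (norm (V (c m) x))\<^sup>2 + 2 * (norm (V (c l) x))\<^sup>2 - 4 * (norm (V ?e x))\<^sup>2" for x
      unfolding Ve by (simp add: power_mult_distrib power2_norm_eq_inner inner_diff_left inner_diff_right
          inner_add_left inner_add_right inner_commute field_simps power2_eq_square[of "2::real"])
    note ints = Vint[OF c[of m]] Vint[OF cl] Vint[OF e(1)]
    have "integrable M (\<lambda>x. (norm (V (c m) x - V (c l) x))\<^sup>2)"
      unfolding par using ints by auto
    moreover have "(LINT x|M. (norm (V (c m) x - V (c l) x))\<^sup>2) = 2 * q (c m) + 2 * q (c l) - 4 * q ?e"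
      unfolding par q_def using ints by simp
    moreover have "2 * q (c m) + 2 * q (c l) - 4 * q ?e \<le> 2 * (D - d m) + 4 * (1 / real (Suc m))"
    proof -
      define a where "a = 1 / real (Suc m)"
      define b where "b = 1 / real (Suc l)"
      have "b \<le> a" unfolding a_def b_def using that by (simp add: frac_le)
      moreover have "q (c m) < d m + a" "q (c l) < d l + b" unfolding a_def b_def using cq by blast+
      ultimately show ?thesis
        unfolding a_def[symmetric] using dle[OF e(1)] D(2)[of l] by argo
    qed
    ultimately show ?thesis by simp
  qed
  \<comment> \<open>One more factor \<open>sqrt (h x)\<close> turns the Cauchy property from \<open>L\<^sup>2\<close> into \<open>L\<^sup>1\<close>, where a
    subsequence is Cauchy almost everywhere.\<close>
  define s where "s m x = sqrt (h x) *\<^sub>R V (c m) x" for m x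
  have sm [measurable]: "s m \<in> borel_measurable M" for m unfolding s_def by measurable
  have sint: "integrable M (s m)" for m
  proof (rule Bochner_Integration.integrable_bound[OF hint])
    show "AE x in M. norm (s m x) \<le> norm (h x)"
    proof (intro AE_I2)
      fix x assume "x \<in> space M"
      from mult_left_mono[OF Vle[OF c this], of "sqrt (h x)" m] hpos[of x]
      show "norm (s m x) \<le> norm (h x)" unfolding s_def by simp
    qed
  qed simp
  have cauchy: "\<exists>N. \<forall>i\<ge>N. \<forall>j\<ge>N. (LINT x|M. norm (s i x - s j x)) < e" if e: "e > 0" for e
  proof -
    define H where "H = integral\<^sup>L M h + 1"
    have H: "H > 0" unfolding H_def using hpos by (simp add: Bochner_Integration.integral_nonneg add_nonneg_pos less_imp_le)
    \<comment> \<open>The weight in Young's inequality below; the two resulting terms are at most \<open>e / 4\<close> and \<open>e / 2\<close>.\<close>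
    define t where "t = e / (2 * H)"
    have t: "t > 0" unfolding t_def using e H by simp
    have "(\<lambda>m. 2 * (D - d m) + 4 * (1 / real (Suc m))) \<longlonglongrightarrow> 2 * (D - D) + 4 * 0"
      by (intro tendsto_intros D(1) inverse_Suc_tendsto_0)
    then have "\<forall>\<^sub>F m in sequentially. 2 * (D - d m) + 4 * (1 / real (Suc m)) < t * e"
      using e t by (intro order_tendstoD) auto
    then obtain N where N: "\<And>m. m \<ge> N \<Longrightarrow> 2 * (D - d m) + 4 * (1 / real (Suc m)) < t * e"
      unfolding eventually_sequentially by blast
    have ml: "(LINT x|M. norm (s m x - s l x)) < e" if "N \<le> m" "m \<le> l" for m l
    proof -
      note dq = diffq[OF that(2)]
      have pw: "norm (s m x - s l x) \<le> t / 2 * h x + 1 / (2 * t) * (norm (V (c m) x - V (c l) x))\<^sup>2" for x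
      proof -
        let ?a = "sqrt (h x)" let ?b = "norm (V (c m) x - V (c l) x)"
        have "0 \<le> (t * ?a - ?b)\<^sup>2" by simp
        also have "\<dots> = t\<^sup>2 * h x + ?b\<^sup>2 - 2 * t * (?a * ?b)"
          using hpos[of x] by (simp add: power2_diff power_mult_distrib less_imp_le)
        finally have "2 * t * (?a * ?b) \<le> t\<^sup>2 * h x + ?b\<^sup>2" by simp
        then have "?a * ?b \<le> t / 2 * h x + 1 / (2 * t) * ?b\<^sup>2"
          using t by (simp add: field_simps power2_eq_square)
        moreover have "norm (s m x - s l x) = ?a * ?b"
          unfolding s_def scaleR_diff_right[symmetric] using hpos[of x] by simp
        ultimately show ?thesis by simp
      qed
      have "(LINT x|M. norm (s m x - s l x)) \<le> (LINT x|M. t / 2 * h x + 1 / (2 * t) * (norm (V (c m) x - V (c l) x))\<^sup>2)"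
        using dq hint sint pw by (intro integral_mono) (auto intro: integrable_norm)
      also have "\<dots> = t / 2 * integral\<^sup>L M h + 1 / (2 * t) * (LINT x|M. (norm (V (c m) x - V (c l) x))\<^sup>2)"
        using dq hint by simp
      also have "\<dots> < t / 2 * H + 1 / (2 * t) * (t * e)"
      proof (rule add_strict_mono)
        show "t / 2 * integral\<^sup>L M h < t / 2 * H" unfolding H_def using t by simp
        have "(LINT x|M. (norm (V (c m) x - V (c l) x))\<^sup>2) < t * e" using dq N[OF that(1)] by simp
        then show "1 / (2 * t) * (LINT x|M. (norm (V (c m) x - V (c l) x))\<^sup>2) < 1 / (2 * t) * (t * e)"
          using t by (intro mult_strict_left_mono) auto
      qed
      also have "\<dots> < e" unfolding t_def using e H by (simp add: field_simps)
      finally show ?thesis .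
    qed
    have "(LINT x|M. norm (s i x - s j x)) < e" if "N \<le> i" "N \<le> j" for i j
      using ml[of i j] ml[of j i] that by (cases "i \<le> j") (auto simp: norm_minus_commute)
    then show ?thesis by blast
  qed
  obtain r where r: "strict_mono r" "AE x in M. Cauchy (\<lambda>i. s (r i) x)"
    using cauchy_L1_AE_cauchy_subseq[OF sint cauchy] by blast
  show thesis
  proof (rule that[of "\<lambda>m. c (r m)"])
    show "c (r m) \<in> tail_weights m" for m
      using c[of "r m"] tail_weights_mono[OF seq_suble[OF r(1), of m]] by blast
    show "AE x in M. convergent (\<lambda>m. wsum (c (r m)) (\<lambda>k. u k x))"
      using r(2) AE_space
    proof eventually_elim
      case (elim x)
      let ?t = "sqrt (h x) * g x"
      have t: "?t > 0" using hpos[of x] gpos[OF elim(2)] by simp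
      obtain l where "(\<lambda>i. s (r i) x) \<longlonglongrightarrow> l"
        using elim(1) unfolding Cauchy_convergent_iff convergent_def by blast
      then have "(\<lambda>i. (1 / ?t) *\<^sub>R s (r i) x) \<longlonglongrightarrow> (1 / ?t) *\<^sub>R l"
        by (rule tendsto_scaleR[OF tendsto_const])
      then have "convergent (\<lambda>i. (1 / ?t) *\<^sub>R s (r i) x)" unfolding convergent_def by blast
      moreover have "(1 / ?t) *\<^sub>R s (r i) x = wsum (c (r i)) (\<lambda>k. u k x)" for i
        unfolding s_def V_def using hpos[of x] gpos[OF elim(2)] by simp
      ultimately show ?case by simp
    qed
  qed
qed

section \<open>Smooth approximation of locally Lipschitz functions\<close>

lemma frechet_eq_sum_pd:
  fixes f :: "real^'n::finite \<Rightarrow> real"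
  assumes "f differentiable (at x)"
  shows "frechet_derivative f (at x) h = (\<Sum>i\<in>UNIV. h $ i * pd i f x)"
proof -
  have lin: "linear (frechet_derivative f (at x))" using assms by (rule linear_frechet_derivative)
  have "frechet_derivative f (at x) h = frechet_derivative f (at x) (\<Sum>i\<in>UNIV. (h $ i) *\<^sub>R axis i 1)"
    using basis_expansion[of h] by (simp add: scalar_mult_eq_scaleR)
  also have "\<dots> = (\<Sum>i\<in>UNIV. h $ i * pd i f x)"
    by (simp add: linear_sum[OF lin] linear_scale[OF lin] pd_def)
  finally show ?thesis .
qed

text \<open>Differentiation under the integral sign falls on the kernel \<open>\<eta>\<close> only, so \<open>g\<close> may be merely
  continuous.\<close>

lemma convolution_has_derivative:
  fixes g \<eta> :: "real^'n::finite \<Rightarrow> real" and a b :: "real^'n"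
  assumes g: "continuous_on UNIV g" and \<eta>: "\<And>x. \<eta> differentiable (at x)"
    and c: "\<And>i. continuous_on UNIV (pd i \<eta>)"
  defines "J \<equiv> \<lambda>\<eta> x. integral (cbox a b) (\<lambda>y. g y * \<eta> (x - y))"
  shows "J \<eta> differentiable (at x)" "pd i (J \<eta>) x = J (pd i \<eta>) x"
proof -
  have \<eta>c: "continuous_on UNIV \<eta>"
    using \<eta> by (simp add: continuous_on_eq_continuous_at differentiable_imp_continuous_within)
  define D where "D x y = (\<Sum>i\<in>UNIV. (g y * pd i \<eta> (x - y)) *\<^sub>R blinfun_inner_right (axis i 1 :: real^'n))" for x y :: "real^'n"
  have Dapp: "blinfun_apply (D x y) h = g y * frechet_derivative \<eta> (at (x - y)) h" for x y h :: "real^'n"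
    unfolding D_def frechet_eq_sum_pd[OF \<eta>]
    by (simp add: blinfun.sum_left blinfun.scaleR_left inner_axis' sum_distrib_left mult_ac)
  have cg: "continuous_on S (\<lambda>p. g (snd p))" for S :: "((real^'n) \<times> (real^'n)) set"
    by (rule continuous_on_compose2[OF g]) (auto intro!: continuous_intros)
  have cp: "continuous_on S (\<lambda>p. pd i \<eta> (fst p - snd p))" for i and S :: "((real^'n) \<times> (real^'n)) set"
    by (rule continuous_on_compose2[OF c]) (auto intro!: continuous_intros)
  have Dc: "continuous_on (UNIV \<times> cbox a b) (\<lambda>(x, y). D x y)"
    unfolding D_def case_prod_beta by (intro continuous_intros cg cp)
  have Dcx: "continuous_on (cbox a b) (D x)"
  proof -
    have "continuous_on (cbox a b) (\<lambda>y. (x, y))"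
      by (rule continuous_on_Pair[OF continuous_on_const continuous_on_id])
    from continuous_on_compose2[OF Dc this] show ?thesis by auto
  qed
  have cc: "continuous_on S (\<lambda>y. g y * \<theta> (x - y))" if "continuous_on UNIV \<theta>" for \<theta> :: "real^'n \<Rightarrow> real" and S x
    by (intro continuous_on_mult continuous_on_subset[OF g] continuous_on_compose2[OF that] continuous_intros) auto
  have "(J \<eta> has_derivative blinfun_apply (integral (cbox a b) (D x))) (at x within UNIV)"
    unfolding J_def
  proof (rule leibniz_rule[OF _ _ Dc])
    show "((\<lambda>x. g y * \<eta> (x - y)) has_derivative blinfun_apply (D x y)) (at x within UNIV)" for x y
    proof -
      have "((\<lambda>x. \<eta> (x - y)) has_derivative (\<lambda>h. frechet_derivative \<eta> (at (x - y)) h)) (at x)"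
        by (rule has_derivative_compose[of "\<lambda>x. x - y", OF _ differentiable_has_frechet[OF \<eta>], unfolded o_def])
           (auto intro!: derivative_eq_intros)
      from has_derivative_mult_right[OF this, of "g y"]
      show ?thesis by (simp add: Dapp[abs_def])
    qed
    show "(\<lambda>y. g y * \<eta> (x - y)) integrable_on cbox a b" for x
      by (intro integrable_continuous cc \<eta>c)
  qed auto
  then have hd: "(J \<eta> has_derivative blinfun_apply (integral (cbox a b) (D x))) (at x)" by simp
  then show "J \<eta> differentiable (at x)" unfolding differentiable_def by blast
  have "pd i (J \<eta>) x = integral (cbox a b) (D x) (axis i 1)" by (rule pd_eqI[OF hd])
  also have "\<dots> = integral (cbox a b) (\<lambda>y. D x y (axis i 1))"
    by (rule blinfun_apply_integral[OF integrable_continuous[OF Dcx]])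
  also have "\<dots> = J (pd i \<eta>) x"
    unfolding J_def Dapp pd_def ..
  finally show "pd i (J \<eta>) x = J (pd i \<eta>) x" .
qed

lemma smooth_convolution:
  assumes g: "continuous_on UNIV g" and \<eta>: "smooth \<eta>"
  shows "smooth (\<lambda>x. integral (cbox a b) (\<lambda>y. g y * \<eta> (x - y)))"
  unfolding smooth_iff_diffn
proof
  fix k
  show "diffn k (\<lambda>x. integral (cbox a b) (\<lambda>y. g y * \<eta> (x - y)))"
    using \<eta>
  proof (induction k arbitrary: \<eta>)
    case 0
    have "(\<lambda>x. integral (cbox a b) (\<lambda>y. g y * \<eta> (x - y))) differentiable (at x)" for x
      by (rule convolution_has_derivative(1)[OF g smooth_differentiable[OF 0] smooth_continuous[OF smooth_pd[OF 0]]])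
    then show ?case by simp
  next
    case (Suc k)
    note C = convolution_has_derivative[OF g smooth_differentiable[OF Suc.prems] smooth_continuous[OF smooth_pd[OF Suc.prems]], where a = a and b = b]
    have "pd i (\<lambda>x. integral (cbox a b) (\<lambda>y. g y * \<eta> (x - y)))
        = (\<lambda>x. integral (cbox a b) (\<lambda>y. g y * pd i \<eta> (x - y)))" for i
      by (rule ext) (rule C(2))
    then show ?case
      unfolding diffn.simps using C(1) Suc.IH[OF smooth_pd[OF Suc.prems]] by simp
  qed
qed

text \<open>\<open>J x\<close> is an average of \<open>g\<close> over \<open>cball x \<delta>\<close>, and a difference quotient of \<open>J\<close> is the same average of
  difference quotients of \<open>g\<close>.\<close>

lemma mollify:
  fixes g :: "real^'n::finite \<Rightarrow> real"
  assumes g: "continuous_on UNIV g" and supp: "\<And>x. x \<notin> cball 0 R \<Longrightarrow> g x = 0" and \<delta>: "\<delta> > 0"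
  obtains J where "smooth J"
    "\<And>x e. (\<And>y. y \<in> cball x \<delta> \<Longrightarrow> \<bar>g y - g x\<bar> \<le> e) \<Longrightarrow> \<bar>J x - g x\<bar> \<le> e"
    "\<And>x i L. (\<And>y h. y \<in> cball x \<delta> \<Longrightarrow> \<bar>h\<bar> \<le> \<delta> \<Longrightarrow> \<bar>g (y + h *\<^sub>R axis i 1) - g y\<bar> \<le> L * \<bar>h\<bar>) \<Longrightarrow> \<bar>pd i J x\<bar> \<le> L"
proof -
  obtain \<zeta> :: "real^'n \<Rightarrow> real" where \<zeta>: "smooth \<zeta>" "\<And>x. 0 \<le> \<zeta> x" "\<And>x. \<zeta> x \<le> 1"
    "\<And>x. 0 < \<zeta> x \<longleftrightarrow> x \<in> ball 0 \<delta>" "\<And>x. x \<notin> cball 0 \<delta> \<Longrightarrow> \<zeta> x = 0"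
    using ball_bump[OF \<delta>, of 0] by metis
  have \<zeta>c: "continuous_on UNIV \<zeta>" by (rule smooth_continuous[OF \<zeta>(1)])
  obtain a b :: "real^'n" where ab: "cball 0 R \<subseteq> cbox a b"
    using bounded_subset_cbox_symmetric[OF bounded_cball[of 0 R]] by metis
  define \<kappa> where "\<kappa> x y = \<zeta> (x - y)" for x y
  have \<kappa>c: "continuous_on UNIV (\<kappa> x)" for x
    unfolding \<kappa>_def by (intro continuous_on_compose2[OF \<zeta>c] continuous_intros) auto
  have \<kappa>0: "\<kappa> x y = 0" if "y \<notin> cball x \<delta>" for x y
    unfolding \<kappa>_def using that by (intro \<zeta>(5)) (simp add: dist_norm norm_minus_commute)
  have cint: "integrable lborel (\<lambda>y. u y * \<kappa> x y)" if "continuous_on UNIV u" for u :: "real^'n \<Rightarrow> real" and x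
  proof -
    have "integrable lborel (\<lambda>y. indicator (cball x \<delta>) y *\<^sub>R (u y * \<kappa> x y))"
      using continuous_on_subset[OF continuous_on_mult[OF that \<kappa>c]] by (intro borel_integrable_compact) auto
    moreover have "indicator (cball x \<delta>) y *\<^sub>R (u y * \<kappa> x y) = u y * \<kappa> x y" for y
      using \<kappa>0[of y x] by (cases "y \<in> cball x \<delta>") auto
    ultimately show ?thesis by (simp only:)
  qed
  have \<kappa>int: "integrable lborel (\<kappa> x)" for x using cint[of "\<lambda>_. 1" x] by simp
  define Z where "Z = (LINT y|lborel. \<zeta> (- y))"
  have Zx: "(LINT y|lborel. \<kappa> x y) = Z" for x
  proof -
    have m: "(\<lambda>y. \<zeta> (- y)) \<in> borel_measurable borel"
      by (intro borel_measurable_continuous_onI continuous_on_compose2[OF \<zeta>c] continuous_intros) auto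
    show ?thesis using integral_translate[OF m, of "- x"] unfolding Z_def \<kappa>_def by simp
  qed
  have Zpos: "Z > 0"
  proof -
    have "Z \<ge> 0" unfolding Z_def by (intro Bochner_Integration.integral_nonneg \<zeta>(2))
    moreover have "Z \<noteq> 0"
    proof
      assume "Z = 0"
      then have "AE y in lborel. \<kappa> 0 y = 0"
        using integral_nonneg_eq_0_iff_AE[OF \<kappa>int[of 0]] \<zeta>(2) Zx[of 0] unfolding \<kappa>_def by auto
      then have "AE y in lborel. y \<notin> ball (0::real^'n) \<delta>"
      proof eventually_elim
        case (elim y)
        have "- y \<in> ball 0 \<delta> \<longleftrightarrow> y \<in> ball 0 \<delta>" by simp
        then show ?case using elim \<zeta>(4)[of "- y"] unfolding \<kappa>_def by auto
      qed
      then have "emeasure lborel (ball (0::real^'n) \<delta>) = 0"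
        by (subst (asm) AE_iff_measurable[of "ball 0 \<delta>"]) auto
      then show False using content_ball_pos[OF \<delta>, of "0::real^'n"] by (simp add: measure_def)
    qed
    ultimately show ?thesis by simp
  qed
  define I where "I x = (LINT y|lborel. g y * \<kappa> x y)" for x
  have Ieq: "I x = integral (cbox a b) (\<lambda>y. g y * \<zeta> (x - y))" for x
  proof -
    have "set_integrable lborel (cbox a b) (\<lambda>y. g y * \<kappa> x y)"
      using cint[OF g, of x] unfolding set_integrable_def by (intro integrable_mult_indicator) auto
    then have "(LINT y:cbox a b|lborel. g y * \<kappa> x y) = integral (cbox a b) (\<lambda>y. g y * \<kappa> x y)"
      by (rule set_borel_integral_eq_integral(2))
    moreover have "(LINT y:cbox a b|lborel. g y * \<kappa> x y) = I x"
      unfolding set_lebesgue_integral_def I_def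
    proof (rule Bochner_Integration.integral_cong[OF refl])
      fix y show "indicator (cbox a b) y *\<^sub>R (g y * \<kappa> x y) = g y * \<kappa> x y"
        using supp[of y] subsetD[OF ab, of y] by (cases "y \<in> cbox a b") auto
    qed
    ultimately show ?thesis unfolding \<kappa>_def by simp
  qed
  define J where "J x = (1 / Z) * I x" for x
  have bound: "\<bar>(1 / Z) * (LINT y|lborel. u y * \<kappa> x y)\<bar> \<le> e"
    if u: "continuous_on UNIV u" and e: "\<And>y. y \<in> cball x \<delta> \<Longrightarrow> \<bar>u y\<bar> \<le> e" for u x e
  proof -
    have "\<bar>LINT y|lborel. u y * \<kappa> x y\<bar> \<le> (LINT y|lborel. e * \<kappa> x y)"
    proof (rule integral_abs_bound_integral[OF cint[OF u]])
      show "integrable lborel (\<lambda>y. e * \<kappa> x y)" using \<kappa>int by simp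
      fix y show "\<bar>u y * \<kappa> x y\<bar> \<le> e * \<kappa> x y"
        using e[of y] \<kappa>0[of y x] \<zeta>(2)[of "x - y"] unfolding \<kappa>_def
        by (cases "y \<in> cball x \<delta>") (auto simp: abs_mult mult_right_mono)
    qed
    also have "\<dots> = e * Z" using Zx[of x] by simp
    finally show ?thesis using Zpos by (simp add: abs_mult field_simps)
  qed
  show thesis
  proof (rule that)
    show "smooth J"
      unfolding J_def Ieq by (intro smooth_mult smooth_const smooth_convolution g \<zeta>(1))
    fix x e
    assume e: "\<And>y. y \<in> cball x \<delta> \<Longrightarrow> \<bar>g y - g x\<bar> \<le> e"
    have cu: "continuous_on UNIV (\<lambda>y. g y - g x)" by (intro continuous_intros g)
    have "(LINT y|lborel. (g y - g x) * \<kappa> x y) = I x - g x * Z"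
      unfolding I_def left_diff_distrib using cint[OF g, of x] \<kappa>int[of x] Zx[of x] by simp
    then have eq: "(1 / Z) * (LINT y|lborel. (g y - g x) * \<kappa> x y) = J x - g x"
      using Zpos unfolding J_def by (simp add: field_simps)
    have "\<bar>(1 / Z) * (LINT y|lborel. (g y - g x) * \<kappa> x y)\<bar> \<le> e" by (rule bound[OF cu e])
    then show "\<bar>J x - g x\<bar> \<le> e" unfolding eq .
  next
    fix x i L
    assume L: "\<And>y h. y \<in> cball x \<delta> \<Longrightarrow> \<bar>h\<bar> \<le> \<delta> \<Longrightarrow> \<bar>g (y + h *\<^sub>R axis i 1) - g y\<bar> \<le> L * \<bar>h\<bar>"
    have sJ: "smooth J"
      unfolding J_def Ieq by (intro smooth_mult smooth_const smooth_convolution g \<zeta>(1))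
    have q: "\<bar>(J (x + h *\<^sub>R axis i 1) - J x) / h\<bar> \<le> L" if h: "0 < h" "h \<le> \<delta>" for h
    proof -
      let ?v = "h *\<^sub>R axis i 1 :: real^'n"
      have gv: "continuous_on UNIV (\<lambda>y. g (y + ?v))"
        by (intro continuous_on_compose2[OF g] continuous_intros) auto
      have cu: "continuous_on UNIV (\<lambda>y. g (y + ?v) - g y)" by (intro continuous_on_diff gv g)
      have m: "(\<lambda>y. g y * \<kappa> (x + ?v) y) \<in> borel_measurable borel"
        by (intro borel_measurable_continuous_onI continuous_on_mult g \<kappa>c)
      have "I (x + ?v) = (LINT y|lborel. g (y + ?v) * \<kappa> x y)"
        unfolding I_def integral_translate[OF m, of ?v, symmetric] by (simp add: \<kappa>_def)
      then have "(LINT y|lborel. (g (y + ?v) - g y) * \<kappa> x y) = I (x + ?v) - I x"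
        unfolding left_diff_distrib I_def using cint[OF gv, of x] cint[OF g, of x] by simp
      then have eq: "(1 / Z) * (LINT y|lborel. (g (y + ?v) - g y) * \<kappa> x y) = J (x + ?v) - J x"
        unfolding J_def by (simp add: right_diff_distrib)
      have "\<bar>(1 / Z) * (LINT y|lborel. (g (y + ?v) - g y) * \<kappa> x y)\<bar> \<le> L * \<bar>h\<bar>"
        by (rule bound[OF cu L]) (use h in auto)
      then have "\<bar>J (x + ?v) - J x\<bar> \<le> L * \<bar>h\<bar>" unfolding eq .
      then show ?thesis using h by (simp add: abs_divide divide_le_eq)
    qed
    have ev: "\<forall>\<^sub>F m in sequentially. 1 / real (Suc m) \<le> \<delta>"
      using order_tendstoD(2)[OF inverse_Suc_tendsto_0 \<delta>] by (rule eventually_mono) simp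
    have "\<forall>\<^sub>F m in sequentially.
        \<bar>(J (x + (1 / real (Suc m)) *\<^sub>R axis i 1) - J x) / (1 / real (Suc m))\<bar> \<le> L"
      using ev
    proof eventually_elim
      case (elim m)
      have "0 < 1 / real (Suc m)" by simp
      from q[OF this elim] show ?case .
    qed
    from tendsto_upperbound[OF tendsto_rabs[OF diff_quotient_tendsto_pd[OF smooth_differentiable[OF sJ]]] this]
    show "\<bar>pd i J x\<bar> \<le> L" by simp
  qed
qed

lemma Lip_loc_continuous_on: "f \<in> Lip_loc \<Omega> \<Longrightarrow> continuous_on \<Omega> f"
  unfolding Lip_loc_def using local_lipschitz_continuous_on[of UNIV \<Omega> "\<lambda>_. f" 0] by simp

lemma Lip_loc_compact:
  assumes "f \<in> Lip_loc \<Omega>" "compact K" "K \<subseteq> \<Omega>"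
  obtains L where "L-lipschitz_on K f"
proof -
  have "local_lipschitz {0::real} K (\<lambda>_. f)"
    using assms(1,3) unfolding Lip_loc_def by (auto intro: local_lipschitz_subset)
  from local_lipschitz_compact_implies_lipschitz[OF this assms(2), of thesis] that
  show thesis by simp
qed

lemma pd_wsum:
  assumes "\<And>k. F k differentiable (at x)"
  shows "pd i (\<lambda>x. wsum c (\<lambda>k. F k x)) x = wsum c (\<lambda>k. pd i (F k) x)"
proof -
  have "((\<lambda>x. wsum c (\<lambda>k. F k x)) has_derivative
      (\<lambda>h. wsum c (\<lambda>k. frechet_derivative (F k) (at x) h))) (at x)"
    unfolding wsum_def
    by (intro has_derivative_sum has_derivative_scaleR_right differentiable_has_frechet assms)
  from pd_eqI[OF this] show ?thesis by (simp add: pd_def)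
qed

text \<open>Mollification controls the gradients locally uniformly; passing to convex combinations of
  tails makes them converge almost everywhere.\<close>

lemma Lip_loc_smooth_approximation:
  fixes \<Omega> :: "(real^'n::finite) set"
  assumes \<Omega>: "open \<Omega>" and f: "f \<in> Lip_loc \<Omega>"
  obtains F G where "\<And>m::nat. smooth (F m)"
    "\<And>K. compact K \<Longrightarrow> K \<subseteq> \<Omega> \<Longrightarrow> uniform_limit K F f sequentially"
    "\<And>K. compact K \<Longrightarrow> K \<subseteq> \<Omega> \<Longrightarrow> \<exists>L. \<forall>\<^sub>F m in sequentially. \<forall>x\<in>K. \<forall>i. \<bar>pd i (F m) x\<bar> \<le> L"
    "AE x in lebesgue. x \<in> \<Omega> \<longrightarrow> (\<forall>i. (\<lambda>m. pd i (F m) x) \<longlonglongrightarrow> G i x)"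
proof -
  obtain C where C: "\<And>n. compact (C n)" "\<And>n. C n \<subseteq> \<Omega>" "\<And>n. C n \<subseteq> interior (C (Suc n))"
    "\<Union>(range C) = \<Omega>" "\<And>K. compact K \<Longrightarrow> K \<subseteq> \<Omega> \<Longrightarrow> \<exists>N. \<forall>n\<ge>N. K \<subseteq> C n"
    using open_Union_compact_subsets[OF \<Omega>] by metis
  have "\<exists>L. \<forall>n. (L n)-lipschitz_on (C n) f"
  proof (rule choice, rule allI)
    fix n show "\<exists>L. L-lipschitz_on (C n) f"
      using Lip_loc_compact[OF f C(1,2), of n] by blast
  qed
  then obtain L where L: "\<And>n. (L n)-lipschitz_on (C n) f" by blast
  have "\<exists>d>0. \<forall>x\<in>C n. cball x d \<subseteq> C (Suc n)" for n
    using compact_subset_open_imp_cball_epsilon_subset[OF C(1) open_interior C(3), of n] interior_subset[of "C (Suc n)"]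
    by (metis UN_subset_iff order_trans)
  then obtain d where d: "\<And>n. d n > 0" "\<And>n x. x \<in> C n \<Longrightarrow> cball x (d n) \<subseteq> C (Suc n)" by metis
  have Cmono: "C m \<subseteq> C n" if "m \<le> n" for m n
    using lift_Suc_mono_le[of C, OF _ that] C(3) interior_subset by blast
  have "\<exists>F. smooth F \<and> (\<forall>x\<in>C m. \<bar>F x - f x\<bar> \<le> 1 / real (Suc m)) \<and>
      (\<forall>j\<le>m. \<forall>x\<in>C j. \<forall>i. \<bar>pd i F x\<bar> \<le> L (Suc j))" for m
  proof -
    let ?K = "C (Suc m)"
    obtain R where R: "R > 0" "?K \<subseteq> ball 0 R"
      using compact_imp_bounded[OF C(1)[of "Suc m"]] bounded_subset_ballD[of ?K 0] by metis
    have fc: "continuous_on ?K f" using lipschitz_on_continuous_on[OF L] .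
    \<comment> \<open>Tietze: continue \<open>f\<close> from the compact set to a compactly supported function on the whole space.\<close>
    let ?f = "\<lambda>x. if x \<in> ?K then f x else 0"
    have cS: "continuous_on (?K \<union> - ball 0 R) ?f"
    proof (rule continuous_on_cases[OF compact_imp_closed[OF C(1)] _ fc])
      show "closed (- ball (0::real^'n) R)" by (simp add: closed_Compl)
      show "\<forall>x. x \<in> ?K \<and> \<not> x \<in> ?K \<or> x \<in> - ball 0 R \<and> x \<in> ?K \<longrightarrow> f x = 0" using R by auto
    qed simp
    obtain B where B: "\<And>x. x \<in> ?K \<Longrightarrow> \<bar>f x\<bar> \<le> B"
      using compact_imp_bounded[OF compact_continuous_image[OF fc C(1)]] by (auto simp: bounded_iff)
    have clS: "closedin (top_of_set UNIV) (?K \<union> - ball 0 R)"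
      using compact_imp_closed[OF C(1)] by (simp add: closed_Compl closed_Un)
    obtain g where g: "continuous_on UNIV g" "\<And>x. x \<in> ?K \<union> - ball 0 R \<Longrightarrow> g x = ?f x"
    proof (rule Tietze[OF cS clS, of "max B 0"])
      show "norm (?f x) \<le> max B 0" if "x \<in> ?K \<union> - ball 0 R" for x using B[of x] by auto
    qed auto
    have gf: "g x = f x" if "x \<in> ?K" for x using g(2)[of x] that by simp
    have g0: "g x = 0" if "x \<notin> cball 0 R" for x
    proof -
      have "x \<notin> ball 0 R" using that by simp
      moreover from this have "x \<notin> ?K" using R(2) by blast
      ultimately show ?thesis using g(2)[of x] by simp
    qed
    \<comment> \<open>The first bound makes \<open>J\<close> uniformly close to \<open>f\<close> on \<open>C m\<close>; the others keep points at distance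
      \<open>2 * \<delta>\<close> from \<open>C j\<close> inside \<open>C (Suc j)\<close>, where \<open>f\<close> has Lipschitz constant \<open>L (Suc j)\<close>.\<close>
    define \<delta> where "\<delta> = Min (insert (1 / (real (Suc m) * (L (Suc m) + 1))) ((\<lambda>j. d j / 2) ` {..m}))"
    have L0: "0 \<le> L n" for n using lipschitz_on_nonneg[OF L] .
    have \<delta>: "\<delta> > 0" unfolding \<delta>_def using d(1) L0[of "Suc m"]
      by (auto intro!: divide_pos_pos mult_pos_pos add_nonneg_pos)
    have \<delta>1: "\<delta> \<le> 1 / (real (Suc m) * (L (Suc m) + 1))" unfolding \<delta>_def by (rule Min_le) auto
    have \<delta>2: "\<delta> \<le> d j / 2" if "j \<le> m" for j unfolding \<delta>_def using that by (intro Min_le) auto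
    obtain J where J: "smooth J"
      "\<And>x e. (\<And>y. y \<in> cball x \<delta> \<Longrightarrow> \<bar>g y - g x\<bar> \<le> e) \<Longrightarrow> \<bar>J x - g x\<bar> \<le> e"
      "\<And>x i L. (\<And>y h. y \<in> cball x \<delta> \<Longrightarrow> \<bar>h\<bar> \<le> \<delta> \<Longrightarrow> \<bar>g (y + h *\<^sub>R axis i 1) - g y\<bar> \<le> L * \<bar>h\<bar>) \<Longrightarrow> \<bar>pd i J x\<bar> \<le> L"
      using mollify[OF g(1) g0 \<delta>] by blast
    have near: "cball x (2 * \<delta>) \<subseteq> C (Suc j)" if "j \<le> m" "x \<in> C j" for j x
    proof -
      have "2 * \<delta> \<le> d j" using \<delta>2[OF that(1)] by simp
      from order_trans[OF subset_cball[OF this] d(2)[OF that(2)]] show ?thesis .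
    qed
    have lip: "\<bar>g y - g z\<bar> \<le> L (Suc j) * dist y z" if "j \<le> m" "y \<in> C (Suc j)" "z \<in> C (Suc j)" for j y z
    proof -
      have "y \<in> ?K" "z \<in> ?K" using that Cmono[of "Suc j" "Suc m"] by auto
      then show ?thesis using lipschitz_onD[OF L that(2,3)] gf by (simp add: dist_real_def)
    qed
    have "\<bar>J x - f x\<bar> \<le> 1 / real (Suc m)" if x: "x \<in> C m" for x
    proof -
      have xK: "x \<in> ?K" using x Cmono[of m "Suc m"] by auto
      have "\<bar>J x - g x\<bar> \<le> 1 / real (Suc m)"
      proof (rule J(2))
        fix y assume y: "y \<in> cball x \<delta>"
        then have "y \<in> cball x (2 * \<delta>)" using \<delta> by simp
        then have "y \<in> ?K" using near[OF order_refl x] by blast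
        then have "\<bar>g y - g x\<bar> \<le> L (Suc m) * dist y x" using lip[of m y x] xK by simp
        also have "\<dots> \<le> (L (Suc m) + 1) * \<delta>"
          using y L0[of "Suc m"] \<delta> by (intro mult_mono) (auto simp: dist_commute)
        also have "\<dots> \<le> (L (Suc m) + 1) * (1 / (real (Suc m) * (L (Suc m) + 1)))"
          using \<delta>1 L0[of "Suc m"] by (intro mult_left_mono) auto
        also have "\<dots> = 1 / real (Suc m)" using L0[of "Suc m"] by (simp add: field_simps add_nonneg_eq_0_iff)
        finally show "\<bar>g y - g x\<bar> \<le> 1 / real (Suc m)" .
      qed
      then show ?thesis using gf[OF xK] by simp
    qed
    moreover have "\<bar>pd i J x\<bar> \<le> L (Suc j)" if j: "j \<le> m" "x \<in> C j" for i j x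
    proof (rule J(3))
      fix y h assume y: "y \<in> cball x \<delta>" and h: "\<bar>h\<bar> \<le> \<delta>"
      let ?v = "h *\<^sub>R axis i 1 :: real^'n"
      have nv: "norm ?v = \<bar>h\<bar>" by simp
      have "y \<in> cball x (2 * \<delta>)" using y \<delta> by simp
      moreover have "y + ?v \<in> cball x (2 * \<delta>)"
      proof -
        have "dist x (y + ?v) \<le> dist x y + dist y (y + ?v)" by (rule dist_triangle)
        also have "dist y (y + ?v) = \<bar>h\<bar>" using nv by (simp add: dist_norm)
        finally show ?thesis using y h by simp
      qed
      ultimately have "\<bar>g (y + ?v) - g y\<bar> \<le> L (Suc j) * dist (y + ?v) y"
        using near[OF j] by (intro lip[OF j(1)]) auto
      then show "\<bar>g (y + ?v) - g y\<bar> \<le> L (Suc j) * \<bar>h\<bar>" using nv by (simp add: dist_norm)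
    qed
    ultimately show ?thesis using J(1) by blast
  qed
  then obtain F where F: "\<And>m. smooth (F m)" "\<And>m x. x \<in> C m \<Longrightarrow> \<bar>F m x - f x\<bar> \<le> 1 / real (Suc m)"
      "\<And>m j x i. j \<le> m \<Longrightarrow> x \<in> C j \<Longrightarrow> \<bar>pd i (F m) x\<bar> \<le> L (Suc j)" by metis
  define u where "u m x = (if x \<in> \<Omega> then (\<chi> i. pd i (F m) x) else 0)" for m and x :: "real^'n"
  have um: "u m \<in> borel_measurable lborel" for m
  proof -
    have "(\<lambda>x. indicator \<Omega> x *\<^sub>R (\<chi> i. pd i (F m) x)) \<in> borel_measurable borel"
      using \<Omega> by (intro borel_measurable_continuous_on_indicator continuous_on_vec_lambda smooth_continuous smooth_pd F(1)) auto
    moreover have "(\<lambda>x. indicator \<Omega> x *\<^sub>R (\<chi> i. pd i (F m) x)) = u m"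
      by (auto simp: u_def fun_eq_iff)
    ultimately show ?thesis by simp
  qed
  have ub: "bounded (range (\<lambda>m. u m x))" for x
  proof (cases "x \<in> \<Omega>")
    case True
    then obtain j where j: "x \<in> C j" using C(4) by blast
    have "norm (u m x) \<le> (\<Sum>i\<in>(UNIV::'n set). L (Suc j)) + (\<Sum>m<j. norm (u m x))" for m
    proof (cases "m < j")
      case True
      then have "norm (u m x) \<le> (\<Sum>m<j. norm (u m x))" by (intro member_le_sum) auto
      moreover have "0 \<le> (\<Sum>i\<in>(UNIV::'n set). L (Suc j))"
        by (intro sum_nonneg) (use lipschitz_on_nonneg[OF L] in auto)
      ultimately show ?thesis by simp
    next
      case False
      have "norm (u m x) \<le> (\<Sum>i\<in>UNIV. \<bar>u m x $ i\<bar>)" by (rule norm_le_l1_cart)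
      also have "\<dots> \<le> (\<Sum>i\<in>(UNIV::'n set). L (Suc j))"
        using F(3)[of j m x] False j \<open>x \<in> \<Omega>\<close> by (intro sum_mono) (simp add: u_def)
      also have "\<dots> \<le> \<dots> + (\<Sum>m<j. norm (u m x))" by (simp add: sum_nonneg)
      finally show ?thesis .
    qed
    then show ?thesis unfolding bounded_iff by blast
  next
    case False
    then show ?thesis by (simp add: u_def)
  qed
  obtain c where c: "\<And>m. c m \<in> tail_weights m" "AE x in lborel. convergent (\<lambda>m. wsum (c m) (\<lambda>k. u k x))"
    using tail_weights_AE_convergent[OF sigma_finite_lborel um ub] by blast
  define U where "U m x = wsum (c m) (\<lambda>k. F k x)" for m x
  have pdU: "pd i (U m) x = wsum (c m) (\<lambda>k. pd i (F k) x)" for i m x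
    unfolding U_def by (intro pd_wsum smooth_differentiable F(1))
  show thesis
  proof (rule that[of U "\<lambda>i x. lim (\<lambda>m. pd i (U m) x)"])
    show "smooth (U m)" for m
      unfolding U_def wsum_def real_scaleR_def by (intro smooth_sum smooth_mult smooth_const F(1))
    fix K assume K: "compact K" "K \<subseteq> \<Omega>"
    then obtain N where N: "\<And>n. n \<ge> N \<Longrightarrow> K \<subseteq> C n" using C(5) by blast
    show "uniform_limit K U f sequentially"
    proof (rule uniform_limitI)
      fix e :: real assume "e > 0"
      then have "\<forall>\<^sub>F m in sequentially. 1 / real (Suc m) < e"
        using order_tendstoD(2)[OF inverse_Suc_tendsto_0] by blast
      then show "\<forall>\<^sub>F m in sequentially. \<forall>x\<in>K. dist (U m x) (f x) < e"
        using eventually_ge_at_top[of N]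
      proof eventually_elim
        case (elim m)
        show ?case
        proof
          fix x assume x: "x \<in> K"
          have "norm (wsum (c m) (\<lambda>k. F k x - f x)) \<le> 1 / real (Suc m)"
          proof (rule norm_wsum_le[OF c(1)])
            fix k assume k: "k \<ge> m"
            have "x \<in> C k" using N[of k] k elim(2) x by auto
            then have "\<bar>F k x - f x\<bar> \<le> 1 / real (Suc k)" by (rule F(2))
            also have "\<dots> \<le> 1 / real (Suc m)" using k by (simp add: frac_le)
            finally show "norm (F k x - f x) \<le> 1 / real (Suc m)" by simp
          qed
          moreover have "wsum (c m) (\<lambda>k. F k x - f x) = U m x - f x"
            unfolding U_def wsum_diff wsum_const[OF c(1)] ..
          ultimately show "dist (U m x) (f x) < e" using elim(1) by (simp add: dist_real_def)
        qed
      qed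
    qed
    show "\<exists>L. \<forall>\<^sub>F m in sequentially. \<forall>x\<in>K. \<forall>i. \<bar>pd i (U m) x\<bar> \<le> L"
    proof (intro exI eventually_sequentiallyI[of N] ballI allI)
      fix m x i assume m: "N \<le> m" and x: "x \<in> K"
      have "norm (wsum (c m) (\<lambda>k. pd i (F k) x)) \<le> L (Suc N)"
      proof (rule norm_wsum_le[OF c(1)])
        fix k assume "k \<ge> m"
        then show "norm (pd i (F k) x) \<le> L (Suc N)" using F(3)[of N k x i] N[of N] m x by auto
      qed
      then show "\<bar>pd i (U m) x\<bar> \<le> L (Suc N)" unfolding pdU by simp
    qed
  next
    have eq: "wsum (c m) (\<lambda>k. u k x) $ i = pd i (U m) x" if "x \<in> \<Omega>" for m x i
      unfolding pdU unfolding wsum_def using that by (simp add: u_def)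
    show "AE x in lebesgue. x \<in> \<Omega> \<longrightarrow> (\<forall>i. (\<lambda>m. pd i (U m) x) \<longlonglongrightarrow> lim (\<lambda>m. pd i (U m) x))"
      using AE_completion[OF c(2)]
    proof eventually_elim
      case (elim x)
      then obtain l where l: "(\<lambda>m. wsum (c m) (\<lambda>k. u k x)) \<longlonglongrightarrow> l" unfolding convergent_def by blast
      show ?case
      proof (intro impI allI)
        fix i assume x: "x \<in> \<Omega>"
        have "(\<lambda>m. pd i (U m) x) \<longlonglongrightarrow> l $ i" using tendsto_vec_nth[OF l, of i] unfolding eq[OF x] .
        then show "(\<lambda>m. pd i (U m) x) \<longlonglongrightarrow> lim (\<lambda>m. pd i (U m) x)" by (simp add: limI)
      qed
    qed
  qed
qed

section \<open>Weak derivatives of locally Lipschitz functions\<close>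

definition smooth_approx :: "(real^'n::finite) set \<Rightarrow> (real^'n \<Rightarrow> real) \<Rightarrow> (nat \<Rightarrow> real^'n \<Rightarrow> real) \<Rightarrow>
    ('n \<Rightarrow> real^'n \<Rightarrow> real) \<Rightarrow> bool" where
  "smooth_approx \<Omega> f F G \<longleftrightarrow> (\<forall>m. smooth (F m)) \<and>
     (\<forall>K. compact K \<and> K \<subseteq> \<Omega> \<longrightarrow> uniform_limit K F f sequentially \<and>
        (\<exists>L. \<forall>\<^sub>F m in sequentially. \<forall>x\<in>K. \<forall>i. \<bar>pd i (F m) x\<bar> \<le> L)) \<and>
     (AE x in lebesgue. x \<in> \<Omega> \<longrightarrow> (\<forall>i. (\<lambda>m. pd i (F m) x) \<longlonglongrightarrow> G i x))"

lemma smooth_approxD: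
  assumes "smooth_approx \<Omega> f F G"
  shows "smooth (F m)"
    "compact K \<Longrightarrow> K \<subseteq> \<Omega> \<Longrightarrow> uniform_limit K F f sequentially"
    "compact K \<Longrightarrow> K \<subseteq> \<Omega> \<Longrightarrow> \<exists>L. \<forall>\<^sub>F m in sequentially. \<forall>x\<in>K. \<forall>i. \<bar>pd i (F m) x\<bar> \<le> L"
    "AE x in lebesgue. x \<in> \<Omega> \<longrightarrow> (\<forall>i. (\<lambda>m. pd i (F m) x) \<longlonglongrightarrow> G i x)"
proof -
  note * = assms[unfolded smooth_approx_def]
  show "smooth (F m)" by (rule *[THEN conjunct1, rule_format])
  show "uniform_limit K F f sequentially" if "compact K" "K \<subseteq> \<Omega>"
    by (rule *[THEN conjunct2, THEN conjunct1, rule_format, OF conjI[OF that], THEN conjunct1])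
  show "\<exists>L. \<forall>\<^sub>F m in sequentially. \<forall>x\<in>K. \<forall>i. \<bar>pd i (F m) x\<bar> \<le> L" if "compact K" "K \<subseteq> \<Omega>"
    by (rule *[THEN conjunct2, THEN conjunct1, rule_format, OF conjI[OF that], THEN conjunct2])
  show "AE x in lebesgue. x \<in> \<Omega> \<longrightarrow> (\<forall>i. (\<lambda>m. pd i (F m) x) \<longlonglongrightarrow> G i x)"
    by (rule *[THEN conjunct2, THEN conjunct2])
qed

lemma Lip_loc_smooth_approx:
  fixes \<Omega> :: "(real^'a::finite) set"
  assumes "open \<Omega>" "f \<in> Lip_loc \<Omega>"
  obtains F G where "smooth_approx \<Omega> f F G"
proof (rule Lip_loc_smooth_approximation[OF assms])
  fix F and G :: "'a \<Rightarrow> real^'a \<Rightarrow> real"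
  assume FG: "\<And>m::nat. smooth (F m)"
    "\<And>K. compact K \<Longrightarrow> K \<subseteq> \<Omega> \<Longrightarrow> uniform_limit K F f sequentially"
    "\<And>K. compact K \<Longrightarrow> K \<subseteq> \<Omega> \<Longrightarrow> \<exists>L. \<forall>\<^sub>F m in sequentially. \<forall>x\<in>K. \<forall>i. \<bar>pd i (F m) x\<bar> \<le> L"
    "AE x in lebesgue. x \<in> \<Omega> \<longrightarrow> (\<forall>i. (\<lambda>m. pd i (F m) x) \<longlonglongrightarrow> G i x)"
  have "smooth_approx \<Omega> f F G"
    unfolding smooth_approx_def
  proof (intro conjI allI impI)
    show "smooth (F m)" for m by (rule FG(1))
    show "uniform_limit K F f sequentially" if "compact K \<and> K \<subseteq> \<Omega>" for K
      using FG(2) that by blast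
    show "\<exists>L. \<forall>\<^sub>F m in sequentially. \<forall>x\<in>K. \<forall>i. \<bar>pd i (F m) x\<bar> \<le> L" if "compact K \<and> K \<subseteq> \<Omega>" for K
      by (rule FG(3)) (use that in blast)+
    show "AE x in lebesgue. x \<in> \<Omega> \<longrightarrow> (\<forall>i. (\<lambda>m. pd i (F m) x) \<longlonglongrightarrow> G i x)" by (rule FG(4))
  qed
  then show thesis by (rule that)
qed

lemma continuous_on_compact_bound:
  fixes f :: "'a::metric_space \<Rightarrow> real"
  assumes "compact K" "continuous_on K f"
  obtains B where "\<And>x. x \<in> K \<Longrightarrow> \<bar>f x\<bar> \<le> B"
  using compact_imp_bounded[OF compact_continuous_image[OF assms(2,1)]] by (auto simp: bounded_iff)

text \<open>Limits of continuous functions against a fixed integrable weight: the form in which dominated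
  convergence is applied to gradients of approximations.\<close>

lemma compact_dominated_convergence:
  fixes a :: "real^'n::finite \<Rightarrow> real"
  assumes K: "compact K" and \<psi>: "set_integrable lebesgue K \<psi>"
    and c: "\<And>m. m \<ge> N \<Longrightarrow> continuous_on K (A m)"
    and B: "\<And>m x. m \<ge> N \<Longrightarrow> x \<in> K \<Longrightarrow> \<bar>A m x\<bar> \<le> B"
    and lim: "AE x in lebesgue. x \<in> K \<longrightarrow> (\<lambda>m. A m x) \<longlonglongrightarrow> a x"
  shows "set_integrable lebesgue K (\<lambda>x. \<psi> x * a x)"
    and "(\<lambda>m. LINT x:K|lebesgue. \<psi> x * A m x) \<longlonglongrightarrow> (LINT x:K|lebesgue. \<psi> x * a x)"
    and "(\<lambda>x. indicator K x * a x) \<in> borel_measurable lebesgue"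
    and "AE x in lebesgue. x \<in> K \<longrightarrow> \<bar>a x\<bar> \<le> B"
proof -
  let ?\<psi> = "\<lambda>x. indicator K x * \<psi> x"
  have pi: "integrable lebesgue ?\<psi>" using \<psi> by (simp add: set_integrable_def)
  have mA: "(\<lambda>x. indicator K x * A (m + N) x) \<in> borel_measurable lebesgue" for m
    by (rule indicator_continuous_lebesgue_measurable[OF borel_compact[OF K] c]) simp
  have limAE: "AE x in lebesgue. (\<lambda>m. indicator K x * A (m + N) x) \<longlonglongrightarrow> indicator K x * a x"
    using lim
  proof eventually_elim
    case (elim x)
    show ?case
    proof (cases "x \<in> K")
      case True
      then have "(\<lambda>m. A (m + N) x) \<longlonglongrightarrow> a x" using elim LIMSEQ_ignore_initial_segment by blast
      then show ?thesis using True by simp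
    qed simp
  qed
  show ma: "(\<lambda>x. indicator K x * a x) \<in> borel_measurable lebesgue"
  proof (rule borel_measurable_AE)
    show "(\<lambda>x. lim (\<lambda>m. indicator K x * A (m + N) x)) \<in> borel_measurable lebesgue"
      by (rule borel_measurable_lim_metric[OF mA])
    show "AE x in lebesgue. lim (\<lambda>m. indicator K x * A (m + N) x) = indicator K x * a x"
      using limAE by eventually_elim (rule limI)
  qed
  show "AE x in lebesgue. x \<in> K \<longrightarrow> \<bar>a x\<bar> \<le> B"
    using lim
  proof eventually_elim
    case (elim x)
    show ?case
    proof
      assume x: "x \<in> K"
      then have "(\<lambda>m. \<bar>A m x\<bar>) \<longlonglongrightarrow> \<bar>a x\<bar>" using elim by (intro tendsto_rabs) blast
      moreover have "\<forall>\<^sub>F m in sequentially. \<bar>A m x\<bar> \<le> B"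
        using B x by (intro eventually_sequentiallyI[of N]) blast
      ultimately show "\<bar>a x\<bar> \<le> B" by (rule tendsto_upperbound) simp
    qed
  qed
  have limAE': "AE x in lebesgue. (\<lambda>m. ?\<psi> x * (indicator K x * A (m + N) x)) \<longlonglongrightarrow> ?\<psi> x * (indicator K x * a x)"
    using limAE by eventually_elim (rule tendsto_mult[OF tendsto_const])
  have dom: "AE x in lebesgue. norm (?\<psi> x * (indicator K x * A (m + N) x)) \<le> \<bar>B\<bar> * \<bar>?\<psi> x\<bar>" for m
  proof (rule AE_I2)
    fix x
    show "norm (?\<psi> x * (indicator K x * A (m + N) x)) \<le> \<bar>B\<bar> * \<bar>?\<psi> x\<bar>"
    proof (cases "x \<in> K")
      case True
      then have "\<bar>A (m + N) x\<bar> \<le> \<bar>B\<bar>" using B[of "m + N" x] by simp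
      then show ?thesis using True mult_left_mono[of "\<bar>A (m + N) x\<bar>" "\<bar>B\<bar>" "\<bar>\<psi> x\<bar>"]
        by (simp add: abs_mult mult.commute)
    qed simp
  qed
  have pB: "integrable lebesgue (\<lambda>x. \<bar>B\<bar> * \<bar>?\<psi> x\<bar>)"
    using integrable_abs[OF pi] by (rule integrable_mult_right)
  note m1 = borel_measurable_times[OF borel_measurable_integrable[OF pi] ma]
  note m2 = borel_measurable_times[OF borel_measurable_integrable[OF pi] mA]
  have eq: "indicator K x *\<^sub>R (\<psi> x * b x) = ?\<psi> x * (indicator K x * b x)" for b :: "real^'n \<Rightarrow> real" and x
    by (simp add: indicator_def)
  show "set_integrable lebesgue K (\<lambda>x. \<psi> x * a x)"
    unfolding set_integrable_def eq
    by (rule integrable_dominated_convergence[OF m1 m2 pB limAE' dom])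
  have "(\<lambda>m. LINT x|lebesgue. ?\<psi> x * (indicator K x * A (m + N) x)) \<longlonglongrightarrow> (LINT x|lebesgue. ?\<psi> x * (indicator K x * a x))"
    by (rule integral_dominated_convergence[OF m1 m2 pB limAE' dom])
  then show "(\<lambda>m. LINT x:K|lebesgue. \<psi> x * A m x) \<longlonglongrightarrow> (LINT x:K|lebesgue. \<psi> x * a x)"
    unfolding set_lebesgue_integral_def eq by (rule LIMSEQ_offset)
qed

lemma LINT_restrict:
  assumes "K \<subseteq> \<Omega>" "\<And>x. x \<notin> K \<Longrightarrow> f x = 0"
  shows "(LINT x:\<Omega>|M. f x) = (LINT x:K|M. f x)"
  unfolding set_lebesgue_integral_def
proof (rule Bochner_Integration.integral_cong[OF refl])
  fix x show "indicator \<Omega> x *\<^sub>R f x = indicator K x *\<^sub>R f x"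
    using assms by (cases "x \<in> K") auto
qed

lemma set_integrable_extend:
  assumes "set_integrable M K f" "K \<subseteq> \<Omega>" "\<And>x. x \<notin> K \<Longrightarrow> f x = 0"
  shows "set_integrable M \<Omega> (f :: _ \<Rightarrow> real)"
proof -
  have eq: "indicator \<Omega> x *\<^sub>R f x = indicator K x *\<^sub>R f x" for x
    using assms(2,3) by (cases "x \<in> K") auto
  show ?thesis using assms(1) unfolding set_integrable_def eq .
qed

lemma compact_between:
  fixes \<Omega> :: "(real^'n::finite) set"
  assumes "open \<Omega>" "compact K" "K \<subseteq> \<Omega>"
  obtains K' where "compact K'" "K \<subseteq> interior K'" "K' \<subseteq> \<Omega>"
proof -
  obtain C where C: "\<And>n. compact (C n)" "\<And>n. C n \<subseteq> \<Omega>" "\<And>n. C n \<subseteq> interior (C (Suc n))"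
    "\<And>K. compact K \<Longrightarrow> K \<subseteq> \<Omega> \<Longrightarrow> \<exists>N. \<forall>n\<ge>N. K \<subseteq> C n"
    using open_Union_compact_subsets[OF assms(1)] by metis
  obtain N where "K \<subseteq> C N" using C(4)[OF assms(2,3)] by blast
  then show thesis using that[of "C (Suc N)"] C by blast
qed

lemma pd_chain2:
  assumes F: "F differentiable (at x)" and H: "H differentiable (at x)"
    and \<Phi>: "(\<Phi> has_derivative (\<lambda>(s, t). \<Phi>a (F x, H x) * s + \<Phi>b (F x, H x) * t)) (at (F x, H x))"
  shows "(\<lambda>x. \<Phi> (F x, H x)) differentiable (at x)"
    and "pd i (\<lambda>x. \<Phi> (F x, H x)) x = \<Phi>a (F x, H x) * pd i F x + \<Phi>b (F x, H x) * pd i H x"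
proof -
  have "((\<lambda>x. (F x, H x)) has_derivative (\<lambda>h. (frechet_derivative F (at x) h, frechet_derivative H (at x) h))) (at x)"
    by (intro has_derivative_Pair differentiable_has_frechet F H)
  from has_derivative_compose[OF this \<Phi>]
  have hd: "((\<lambda>x. \<Phi> (F x, H x)) has_derivative
      (\<lambda>h. \<Phi>a (F x, H x) * frechet_derivative F (at x) h + \<Phi>b (F x, H x) * frechet_derivative H (at x) h)) (at x)"
    by simp
  then show "(\<lambda>x. \<Phi> (F x, H x)) differentiable (at x)" unfolding differentiable_def by blast
  show "pd i (\<lambda>x. \<Phi> (F x, H x)) x = \<Phi>a (F x, H x) * pd i F x + \<Phi>b (F x, H x) * pd i H x"
    using pd_eqI[OF hd, of i] by (simp add: pd_def)
qed

text \<open>The classical chain rule for \<open>\<Phi> (F m x, H m x)\<close>, integrated against a test function, passes to the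
  limit.\<close>

lemma has_wderiv_chain2:
  fixes \<Omega> :: "(real^'n::finite) set" and \<Phi> :: "real \<times> real \<Rightarrow> real"
  assumes \<Omega>: "open \<Omega>" and fc: "continuous_on \<Omega> f" and gc: "continuous_on \<Omega> g"
    and f: "smooth_approx \<Omega> f F Gf" and g: "smooth_approx \<Omega> g H Gg"
    and U: "open U" "\<And>x. x \<in> \<Omega> \<Longrightarrow> (f x, g x) \<in> U"
    and \<Phi>: "\<And>p. p \<in> U \<Longrightarrow> (\<Phi> has_derivative (\<lambda>(s, t). \<Phi>1 p * s + \<Phi>2 p * t)) (at p)"
    and \<Phi>c: "continuous_on U \<Phi>1" "continuous_on U \<Phi>2"
  shows "has_wderiv \<Omega> i (\<lambda>x. \<Phi> (f x, g x)) (\<lambda>x. \<Phi>1 (f x, g x) * Gf i x + \<Phi>2 (f x, g x) * Gg i x)"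
    (is "has_wderiv \<Omega> i ?h ?Dh")
proof -
  have \<Phi>cont: "continuous_on U \<Phi>"
    using \<Phi> U(1) has_derivative_continuous by (fastforce simp: continuous_on_eq_continuous_at)
  have hc: "continuous_on \<Omega> ?h"
    using U(2) by (intro continuous_on_compose2[OF \<Phi>cont] continuous_intros fc gc) auto
  define h where "h m x = \<Phi> (F m x, H m x)" for m x
  have key: "\<exists>B N. (\<forall>m\<ge>N. (\<forall>x\<in>K'. h m differentiable (at x) \<and> \<bar>h m x\<bar> \<le> B \<and> \<bar>pd i (h m) x\<bar> \<le> B) \<and>
        continuous_on K' (h m) \<and> continuous_on K' (pd i (h m))) \<and>
      (\<forall>x\<in>K'. (\<lambda>m. h m x) \<longlonglongrightarrow> ?h x) \<and>
      (AE x in lebesgue. x \<in> K' \<longrightarrow> (\<lambda>m. pd i (h m) x) \<longlonglongrightarrow> ?Dh x)"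
    if K': "compact K'" "K' \<subseteq> \<Omega>" for K'
  proof -
    let ?P = "(\<lambda>x. (f x, g x)) ` K'"
    have Pc: "compact ?P"
      by (intro compact_continuous_image continuous_intros continuous_on_subset[OF fc K'(2)] continuous_on_subset[OF gc K'(2)] K'(1))
    have PU: "?P \<subseteq> U" using U(2) K'(2) by auto
    obtain e where e: "e > 0" "(\<Union>p\<in>?P. cball p e) \<subseteq> U"
      using compact_subset_open_imp_cball_epsilon_subset[OF Pc U(1) PU] by metis
    \<comment> \<open>A compact neighbourhood of the values of \<open>(f, g)\<close> that contains the values of the approximations.\<close>
    define P' where "P' = {p + q | p q. p \<in> ?P \<and> q \<in> cball 0 e}"
    have P'c: "compact P'" unfolding P'_def by (rule compact_sums[OF Pc compact_cball])
    have P'U: "P' \<subseteq> U"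
    proof
      fix z assume "z \<in> P'"
      then obtain p q where pq: "z = p + q" "p \<in> ?P" "q \<in> cball 0 e" unfolding P'_def by blast
      then have "z \<in> cball p e" by (simp add: dist_norm)
      then show "z \<in> U" using e(2) pq(2) by blast
    qed
    have bd: "\<exists>B\<ge>0. \<forall>p\<in>P'. \<bar>\<Psi> p\<bar> \<le> B" if "continuous_on U \<Psi>" for \<Psi> :: "real \<times> real \<Rightarrow> real"
    proof -
      have "bounded (\<Psi> ` P')"
        by (intro compact_imp_bounded compact_continuous_image continuous_on_subset[OF that P'U] P'c)
      then obtain B where "B > 0" "\<forall>x\<in>\<Psi> ` P'. norm x \<le> B" unfolding bounded_pos by blast
      then show ?thesis by (intro exI[of _ B]) auto
    qed
    obtain B0 B1 B2 where B0: "B0 \<ge> 0" "\<And>p. p \<in> P' \<Longrightarrow> \<bar>\<Phi> p\<bar> \<le> B0" and B1: "B1 \<ge> 0" "\<And>p. p \<in> P' \<Longrightarrow> \<bar>\<Phi>1 p\<bar> \<le> B1"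
      and B2: "B2 \<ge> 0" "\<And>p. p \<in> P' \<Longrightarrow> \<bar>\<Phi>2 p\<bar> \<le> B2"
      using bd[OF \<Phi>cont] bd[OF \<Phi>c(1)] bd[OF \<Phi>c(2)] by blast
    obtain L1 where L1: "\<forall>\<^sub>F m in sequentially. \<forall>x\<in>K'. \<forall>i. \<bar>pd i (F m) x\<bar> \<le> L1"
      using smooth_approxD(3)[OF f K'] by blast
    obtain L2 where L2: "\<forall>\<^sub>F m in sequentially. \<forall>x\<in>K'. \<forall>i. \<bar>pd i (H m) x\<bar> \<le> L2"
      using smooth_approxD(3)[OF g K'] by blast
    have u1: "\<forall>\<^sub>F m in sequentially. \<forall>x\<in>K'. dist (F m x) (f x) < e / 2"
      using uniform_limitD[OF smooth_approxD(2)[OF f K'], of "e / 2"] e(1) by simp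
    have u2: "\<forall>\<^sub>F m in sequentially. \<forall>x\<in>K'. dist (H m x) (g x) < e / 2"
      using uniform_limitD[OF smooth_approxD(2)[OF g K'], of "e / 2"] e(1) by simp
    from eventually_conj[OF eventually_conj[OF L1 L2] eventually_conj[OF u1 u2]]
    obtain N where N: "\<And>m. m \<ge> N \<Longrightarrow> (\<forall>x\<in>K'. \<forall>i. \<bar>pd i (F m) x\<bar> \<le> L1)"
      "\<And>m. m \<ge> N \<Longrightarrow> (\<forall>x\<in>K'. \<forall>i. \<bar>pd i (H m) x\<bar> \<le> L2)"
      "\<And>m. m \<ge> N \<Longrightarrow> (\<forall>x\<in>K'. dist (F m x) (f x) < e / 2)"
      "\<And>m. m \<ge> N \<Longrightarrow> (\<forall>x\<in>K'. dist (H m x) (g x) < e / 2)"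
      unfolding eventually_sequentially by blast
    have inP: "(F m x, H m x) \<in> P'" if "m \<ge> N" "x \<in> K'" for m x
    proof -
      let ?q = "(F m x - f x, H m x - g x)"
      have "norm ?q \<le> norm (F m x - f x) + norm (H m x - g x)"
        by (rule norm_Pair_le)
      also have "\<dots> \<le> e" using N(3,4)[OF that(1)] that(2) by (force simp: dist_norm)
      finally have "?q \<in> cball 0 e" by simp
      moreover have "(F m x, H m x) = (f x, g x) + ?q" by simp
      ultimately show ?thesis unfolding P'_def using that(2) by blast
    qed
    have FH: "smooth (F m)" "smooth (H m)" for m using smooth_approxD(1)[OF f] smooth_approxD(1)[OF g] by blast+
    have hder: "h m differentiable (at x)"
      "pd i (h m) x = \<Phi>1 (F m x, H m x) * pd i (F m) x + \<Phi>2 (F m x, H m x) * pd i (H m) x"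
      if "m \<ge> N" "x \<in> K'" for m x
      using pd_chain2[where F = "F m" and H = "H m" and \<Phi> = \<Phi> and \<Phi>a = \<Phi>1 and \<Phi>b = \<Phi>2 and x = x, OF smooth_differentiable[OF FH(1)] smooth_differentiable[OF FH(2)] \<Phi>[OF subsetD[OF P'U inP[OF that]]]]
      unfolding h_def[abs_def] by blast+
    have cFH: "continuous_on K' (\<lambda>x. (F m x, H m x))" for m
      by (intro continuous_on_Pair smooth_continuous FH)
    have comp: "continuous_on K' (\<lambda>x. \<Psi> (F m x, H m x))" if "continuous_on U \<Psi>" "m \<ge> N" for \<Psi> :: "real \<times> real \<Rightarrow> real" and m
      by (rule continuous_on_compose2[OF that(1) cFH]) (use inP[OF that(2)] P'U in auto)
    have c1: "continuous_on K' (h m)" if "m \<ge> N" for m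
      unfolding h_def using comp[OF \<Phi>cont that] by simp
    have c2: "continuous_on K' (pd i (h m))" if "m \<ge> N" for m
    proof -
      have "continuous_on K' (\<lambda>x. \<Phi>1 (F m x, H m x) * pd i (F m) x + \<Phi>2 (F m x, H m x) * pd i (H m) x)"
        by (intro continuous_on_add continuous_on_mult comp[OF \<Phi>c(1) that] comp[OF \<Phi>c(2) that] smooth_continuous smooth_pd FH)
      then show ?thesis using hder(2)[OF that] by (simp cong: continuous_on_cong)
    qed
    define B where "B = B0 + (B1 * \<bar>L1\<bar> + B2 * \<bar>L2\<bar>)"
    have "\<bar>h m x\<bar> \<le> B" if "m \<ge> N" "x \<in> K'" for m x
    proof -
      have "\<bar>h m x\<bar> \<le> B0" unfolding h_def using B0(2)[OF inP[OF that]] .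
      moreover have "0 \<le> B1 * \<bar>L1\<bar> + B2 * \<bar>L2\<bar>" using B1(1) B2(1) by simp
      ultimately show ?thesis unfolding B_def by linarith
    qed
    moreover have "\<bar>pd i (h m) x\<bar> \<le> B" if "m \<ge> N" "x \<in> K'" for m x
    proof -
      have l1: "\<bar>pd i (F m) x\<bar> \<le> \<bar>L1\<bar>" using N(1)[OF that(1)] that(2) order_trans[OF _ abs_ge_self] by blast
      have l2: "\<bar>pd i (H m) x\<bar> \<le> \<bar>L2\<bar>" using N(2)[OF that(1)] that(2) order_trans[OF _ abs_ge_self] by blast
      have "\<bar>pd i (h m) x\<bar> \<le> \<bar>\<Phi>1 (F m x, H m x)\<bar> * \<bar>pd i (F m) x\<bar> + \<bar>\<Phi>2 (F m x, H m x)\<bar> * \<bar>pd i (H m) x\<bar>"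
        unfolding hder(2)[OF that] abs_mult[symmetric] by (rule abs_triangle_ineq)
      also have "\<dots> \<le> B1 * \<bar>L1\<bar> + B2 * \<bar>L2\<bar>"
        by (intro add_mono mult_mono B1 B2 l1 l2 inP[OF that]) auto
      finally show ?thesis unfolding B_def using B0(1) by linarith
    qed
    moreover have lim: "(\<lambda>m. (F m x, H m x)) \<longlonglongrightarrow> (f x, g x)" if "x \<in> K'" for x
      by (intro tendsto_Pair tendsto_uniform_limitI[OF smooth_approxD(2)[OF f K'] that]
          tendsto_uniform_limitI[OF smooth_approxD(2)[OF g K'] that])
    have lim\<Psi>: "(\<lambda>m. \<Psi> (F m x, H m x)) \<longlonglongrightarrow> \<Psi> (f x, g x)" if "x \<in> K'" "continuous_on U \<Psi>" for x and \<Psi> :: "real \<times> real \<Rightarrow> real"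
    proof -
      have "isCont \<Psi> (f x, g x)" using that U K'(2) by (auto simp: continuous_on_eq_continuous_at)
      then show ?thesis by (rule isCont_tendsto_compose[OF _ lim[OF that(1)]])
    qed
    have "\<forall>x\<in>K'. (\<lambda>m. h m x) \<longlonglongrightarrow> ?h x" unfolding h_def using lim\<Psi>[OF _ \<Phi>cont] by blast
    moreover have "AE x in lebesgue. x \<in> K' \<longrightarrow> (\<lambda>m. pd i (h m) x) \<longlonglongrightarrow> ?Dh x"
      using smooth_approxD(4)[OF f] smooth_approxD(4)[OF g]
    proof eventually_elim
      case (elim x)
      show ?case
      proof
        assume x: "x \<in> K'"
        then have x\<Omega>: "x \<in> \<Omega>" using K' by blast
        have "(\<lambda>m. \<Phi>1 (F m x, H m x) * pd i (F m) x + \<Phi>2 (F m x, H m x) * pd i (H m) x) \<longlonglongrightarrow> ?Dh x"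
          using elim x\<Omega> by (intro tendsto_add tendsto_mult lim\<Psi>[OF x] \<Phi>c) auto
        then show "(\<lambda>m. pd i (h m) x) \<longlonglongrightarrow> ?Dh x"
          by (rule Lim_transform_eventually)
             (use hder(2)[OF _ x] in \<open>auto intro!: eventually_sequentiallyI[of N]\<close>)
      qed
    qed
    ultimately show ?thesis using hder(1) c1 c2
      by (intro exI[of _ B] exI[of _ N] conjI allI impI ballI) auto
  qed
  have one: "set_integrable lebesgue K (\<lambda>x. 1::real)" if "compact K" for K :: "(real^'n) set"
    by (rule set_integrable_continuous_compact[OF that]) auto
  show ?thesis
    unfolding has_wderiv_def
  proof (intro conjI ballI)
    show "?h \<in> L1_loc \<Omega>" by (rule continuous_L1_loc[OF hc])
    show "?Dh \<in> L1_loc \<Omega>"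
      unfolding L1_loc_def
    proof (intro CollectI allI impI, elim conjE)
      fix K :: "(real^'n) set" assume K: "compact K" "K \<subseteq> \<Omega>"
      obtain B N where BN: "\<And>m. m \<ge> N \<Longrightarrow> continuous_on K (pd i (h m))"
        "\<And>m x. m \<ge> N \<Longrightarrow> x \<in> K \<Longrightarrow> \<bar>pd i (h m) x\<bar> \<le> B"
        "AE x in lebesgue. x \<in> K \<longrightarrow> (\<lambda>m. pd i (h m) x) \<longlonglongrightarrow> ?Dh x"
        using key[OF K] by blast
      from compact_dominated_convergence(1)[OF K(1) one[OF K(1)] BN]
      show "set_integrable lebesgue K ?Dh" by simp
    qed
    fix \<phi> assume \<phi>: "\<phi> \<in> test_fun \<Omega>"
    obtain K where K: "compact K" "K \<subseteq> \<Omega>" "\<And>x. x \<notin> K \<Longrightarrow> \<phi> x = 0" "\<And>i x. x \<notin> K \<Longrightarrow> pd i \<phi> x = 0"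
      using test_funE[OF \<phi>] by metis
    obtain K' where K': "compact K'" "K \<subseteq> interior K'" "K' \<subseteq> \<Omega>"
      using compact_between[OF \<Omega> K(1,2)] by metis
    have KK': "K \<subseteq> K'" using K'(2) interior_subset by blast
    obtain B N where BN: "\<And>m x. m \<ge> N \<Longrightarrow> x \<in> K' \<Longrightarrow> h m differentiable (at x)"
        "\<And>m x. m \<ge> N \<Longrightarrow> x \<in> K' \<Longrightarrow> \<bar>h m x\<bar> \<le> B"
        "\<And>m x. m \<ge> N \<Longrightarrow> x \<in> K' \<Longrightarrow> \<bar>pd i (h m) x\<bar> \<le> B"
        "\<And>m. m \<ge> N \<Longrightarrow> continuous_on K' (h m)" "\<And>m. m \<ge> N \<Longrightarrow> continuous_on K' (pd i (h m))"
        "\<And>x. x \<in> K' \<Longrightarrow> (\<lambda>m. h m x) \<longlonglongrightarrow> ?h x"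
        "AE x in lebesgue. x \<in> K' \<longrightarrow> (\<lambda>m. pd i (h m) x) \<longlonglongrightarrow> ?Dh x"
      using key[OF K'(1,3)] by blast
    have ibp: "(LINT x:\<Omega>|lebesgue. h m x * pd i \<phi> x) = - (LINT x:\<Omega>|lebesgue. pd i (h m) x * \<phi> x)" if m: "m \<ge> N" for m
    proof (rule integration_by_parts_test_fun[OF \<phi> K(1) K'(2) K(3)])
      show "interior K' \<subseteq> \<Omega>" using K'(3) interior_subset by blast
      show "h m differentiable (at x)" if "x \<in> interior K'" for x using BN(1)[OF m] that interior_subset by blast
      show "continuous_on (interior K') (pd i (h m))" using BN(5)[OF m] interior_subset continuous_on_subset by blast
    qed auto
    have \<psi>1: "set_integrable lebesgue K (pd i \<phi>)" and \<psi>2: "set_integrable lebesgue K \<phi>"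
      by (intro set_integrable_continuous_compact[OF K(1)] smooth_continuous smooth_pd test_fun_smooth[OF \<phi>]; simp)+
    have cK: "continuous_on K (h m)" "continuous_on K (pd i (h m))" if "m \<ge> N" for m
      using BN(4)[OF that] BN(5)[OF that] KK' continuous_on_subset by blast+
    have AEh: "AE x in lebesgue. x \<in> K \<longrightarrow> (\<lambda>m. h m x) \<longlonglongrightarrow> ?h x"
      by (rule AE_I2) (use BN(6) KK' in blast)
    have "(\<lambda>m. LINT x:K|lebesgue. pd i \<phi> x * h m x) \<longlonglongrightarrow> (LINT x:K|lebesgue. pd i \<phi> x * ?h x)"
      by (rule compact_dominated_convergence(2)[OF K(1) \<psi>1 cK(1) BN(2) AEh, where N = N]) (use KK' in auto)
    then have l1: "(\<lambda>m. LINT x:\<Omega>|lebesgue. h m x * pd i \<phi> x) \<longlonglongrightarrow> (LINT x:\<Omega>|lebesgue. ?h x * pd i \<phi> x)"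
      by (simp add: LINT_restrict[OF K(2)] K(4) mult.commute)
    have AEK: "AE x in lebesgue. x \<in> K \<longrightarrow> (\<lambda>m. pd i (h m) x) \<longlonglongrightarrow> ?Dh x"
      using BN(7) by eventually_elim (use KK' in blast)
    have "(\<lambda>m. LINT x:K|lebesgue. \<phi> x * pd i (h m) x) \<longlonglongrightarrow> (LINT x:K|lebesgue. \<phi> x * ?Dh x)"
      by (rule compact_dominated_convergence(2)[OF K(1) \<psi>2 cK(2) BN(3) AEK, where N = N]) (use KK' in auto)
    then have "(\<lambda>m. LINT x:\<Omega>|lebesgue. pd i (h m) x * \<phi> x) \<longlonglongrightarrow> (LINT x:\<Omega>|lebesgue. ?Dh x * \<phi> x)"
      by (simp add: LINT_restrict[OF K(2)] K(3) mult.commute)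
    then have "(\<lambda>m. - (LINT x:\<Omega>|lebesgue. pd i (h m) x * \<phi> x)) \<longlonglongrightarrow> - (LINT x:\<Omega>|lebesgue. ?Dh x * \<phi> x)"
      by (rule tendsto_minus)
    then have "(\<lambda>m. LINT x:\<Omega>|lebesgue. h m x * pd i \<phi> x) \<longlonglongrightarrow> - (LINT x:\<Omega>|lebesgue. ?Dh x * \<phi> x)"
      by (rule Lim_transform_eventually) (use ibp in \<open>auto intro!: eventually_sequentiallyI[of N]\<close>)
    then show "(LINT x:\<Omega>|lebesgue. ?h x * pd i \<phi> x) = - (LINT x:\<Omega>|lebesgue. ?Dh x * \<phi> x)"
      using l1 LIMSEQ_unique by blast
  qed
qed

lemma has_wderiv_smooth_approx:
  assumes "open \<Omega>" "continuous_on \<Omega> f" "smooth_approx \<Omega> f F G"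
  shows "has_wderiv \<Omega> i f (G i)"
proof -
  have "(fst has_derivative (\<lambda>(s, t). 1 * s + 0 * t)) (at p)" for p :: "real \<times> real"
  proof -
    have "(\<lambda>(s, t). 1 * s + 0 * t) = (fst :: real \<times> real \<Rightarrow> real)" by (auto simp: fun_eq_iff)
    then show ?thesis using bounded_linear_imp_has_derivative[OF bounded_linear_fst] by simp
  qed
  from has_wderiv_chain2[OF assms(1,2,2,3,3) open_UNIV _ this continuous_on_const continuous_on_const, of i]
  show ?thesis by simp
qed

text \<open>The formal identity \<open>\<integral> \<partial>\<^sub>iu \<partial>\<^sub>j(r\<phi>) = \<integral> \<partial>\<^sub>ju \<partial>\<^sub>i(r\<phi>)\<close>.  The symmetry of the second derivatives of the test
  functions \<open>F m * \<phi>\<close> gives it with \<open>F m\<close> in place of \<open>r\<close>.\<close>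

lemma wderiv_cross_symmetric:
  fixes \<Omega> :: "(real^'n::finite) set"
  assumes \<Omega>: "open \<Omega>" and rc: "continuous_on \<Omega> r" and r: "smooth_approx \<Omega> r F G"
    and ui: "has_wderiv \<Omega> i u ui" and uj: "has_wderiv \<Omega> j u uj" and \<phi>: "\<phi> \<in> test_fun \<Omega>"
  shows "set_integrable lebesgue \<Omega> (\<lambda>x. ui x * (r x * pd j \<phi> x + G j x * \<phi> x))"
    and "(LINT x:\<Omega>|lebesgue. ui x * (r x * pd j \<phi> x + G j x * \<phi> x))
       = (LINT x:\<Omega>|lebesgue. uj x * (r x * pd i \<phi> x + G i x * \<phi> x))"
proof -
  obtain K where K: "compact K" "K \<subseteq> \<Omega>" "\<And>x. x \<notin> K \<Longrightarrow> \<phi> x = 0" "\<And>i x. x \<notin> K \<Longrightarrow> pd i \<phi> x = 0"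
    using test_funE[OF \<phi>] by metis
  have \<phi>s: "smooth \<phi>" by (rule test_fun_smooth[OF \<phi>])
  have Fs: "smooth (F m)" for m by (rule smooth_approxD(1)[OF r])
  define w where "w m x = F m x * \<phi> x" for m x
  have ws: "smooth (w m)" for m unfolding w_def by (intro smooth_mult Fs \<phi>s)
  have wt: "w m \<in> test_fun \<Omega>" for m unfolding w_def by (rule test_fun_mult[OF Fs \<phi>])
  have pdw: "pd k (w m) x = F m x * pd k \<phi> x + pd k (F m) x * \<phi> x" for k m x
    unfolding w_def by (rule pd_mult[OF smooth_differentiable[OF Fs] smooth_differentiable[OF \<phi>s]])
  have sym: "(LINT x:\<Omega>|lebesgue. ui x * pd j (w m) x) = (LINT x:\<Omega>|lebesgue. uj x * pd i (w m) x)" for m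
  proof -
    have "(LINT x:\<Omega>|lebesgue. u x * pd i (pd j (w m)) x) = - (LINT x:\<Omega>|lebesgue. ui x * pd j (w m) x)"
      using ui test_fun_pd[OF wt] unfolding has_wderiv_def by blast
    moreover have "(LINT x:\<Omega>|lebesgue. u x * pd j (pd i (w m)) x) = - (LINT x:\<Omega>|lebesgue. uj x * pd i (w m) x)"
      using uj test_fun_pd[OF wt] unfolding has_wderiv_def by blast
    ultimately show ?thesis unfolding pd_commute[OF ws, of i j] by simp
  qed
  obtain L where L: "\<forall>\<^sub>F m in sequentially. \<forall>x\<in>K. \<forall>i. \<bar>pd i (F m) x\<bar> \<le> L"
    using smooth_approxD(3)[OF r K(1,2)] by blast
  obtain R where R: "\<And>x. x \<in> K \<Longrightarrow> \<bar>r x\<bar> \<le> R"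
    using continuous_on_compact_bound[OF K(1) continuous_on_subset[OF rc K(2)]] by blast
  have u1: "\<forall>\<^sub>F m in sequentially. \<forall>x\<in>K. dist (F m x) (r x) < 1"
    using uniform_limitD[OF smooth_approxD(2)[OF r K(1,2)], of 1] by simp
  from eventually_conj[OF L u1] obtain N where N: "\<And>m x i. m \<ge> N \<Longrightarrow> x \<in> K \<Longrightarrow> \<bar>pd i (F m) x\<bar> \<le> L"
    "\<And>m x. m \<ge> N \<Longrightarrow> x \<in> K \<Longrightarrow> dist (F m x) (r x) < 1"
    unfolding eventually_sequentially by blast
  have conv: "set_integrable lebesgue \<Omega> (\<lambda>x. v x * (r x * pd k \<phi> x + G k x * \<phi> x)) \<and>
      (\<lambda>m. LINT x:\<Omega>|lebesgue. v x * pd k (w m) x) \<longlonglongrightarrow> (LINT x:\<Omega>|lebesgue. v x * (r x * pd k \<phi> x + G k x * \<phi> x))"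
    if v: "v \<in> L1_loc \<Omega>" for v k
  proof -
    have vK: "set_integrable lebesgue K v" using v K unfolding L1_loc_def by blast
    obtain B1 where B1: "\<And>x. x \<in> K \<Longrightarrow> \<bar>pd k \<phi> x\<bar> \<le> B1"
      using continuous_on_compact_bound[OF K(1) smooth_continuous[OF smooth_pd[OF \<phi>s]]] by blast
    obtain B2 where B2: "\<And>x. x \<in> K \<Longrightarrow> \<bar>\<phi> x\<bar> \<le> B2"
      using continuous_on_compact_bound[OF K(1) smooth_continuous[OF \<phi>s]] by blast
    have bd: "\<bar>pd k (w m) x\<bar> \<le> (R + 1) * B1 + L * B2" if "m \<ge> N" "x \<in> K" for m x
    proof -
      have "\<bar>F m x\<bar> \<le> R + 1" using R[OF that(2)] N(2)[OF that] by (simp add: dist_real_def)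
      then have "\<bar>F m x\<bar> * \<bar>pd k \<phi> x\<bar> \<le> (R + 1) * B1" 
        using B1[OF that(2)] by (intro mult_mono) auto
      moreover have "\<bar>pd k (F m) x\<bar> * \<bar>\<phi> x\<bar> \<le> L * B2"
        using B2[OF that(2)] N(1)[OF that, of k] by (intro mult_mono) auto
      ultimately show ?thesis
        unfolding pdw using abs_triangle_ineq[of "F m x * pd k \<phi> x" "pd k (F m) x * \<phi> x"] by (simp add: abs_mult)
    qed
    have lim: "AE x in lebesgue. x \<in> K \<longrightarrow> (\<lambda>m. pd k (w m) x) \<longlonglongrightarrow> r x * pd k \<phi> x + G k x * \<phi> x"
      using smooth_approxD(4)[OF r]
    proof eventually_elim
      case (elim x)
      show ?case
      proof
        assume x: "x \<in> K"
        then have "(\<lambda>m. pd k (F m) x) \<longlonglongrightarrow> G k x" using elim K(2) by blast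
        then show "(\<lambda>m. pd k (w m) x) \<longlonglongrightarrow> r x * pd k \<phi> x + G k x * \<phi> x"
          unfolding pdw by (intro tendsto_add tendsto_mult tendsto_const tendsto_uniform_limitI[OF smooth_approxD(2)[OF r K(1,2)] x])
      qed
    qed
    have cw: "continuous_on K (pd k (w m))" for m by (intro smooth_continuous smooth_pd ws)
    note D = compact_dominated_convergence[OF K(1) vK cw bd lim]
    have "set_integrable lebesgue \<Omega> (\<lambda>x. v x * (r x * pd k \<phi> x + G k x * \<phi> x))"
    proof (rule set_integrable_extend[OF D(1) K(2)])
      fix x assume x: "x \<notin> K"
      show "v x * (r x * pd k \<phi> x + G k x * \<phi> x) = 0" unfolding K(3)[OF x] K(4)[OF x] by simp
    qed
    moreover have "(\<lambda>m. LINT x:\<Omega>|lebesgue. v x * pd k (w m) x) \<longlonglongrightarrow> (LINT x:\<Omega>|lebesgue. v x * (r x * pd k \<phi> x + G k x * \<phi> x))"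
    proof -
      have z: "pd k (w m) x = 0" "r x * pd k \<phi> x + G k x * \<phi> x = 0" if x: "x \<notin> K" for m x
        unfolding pdw K(3)[OF x] K(4)[OF x] by simp_all
      have e: "(LINT x:\<Omega>|lebesgue. v x * pd k (w m) x) = (LINT x:K|lebesgue. v x * pd k (w m) x)" for m
        by (rule LINT_restrict[OF K(2)]) (subst z(1), assumption, rule mult_zero_right)
      have e': "(LINT x:\<Omega>|lebesgue. v x * (r x * pd k \<phi> x + G k x * \<phi> x)) = (LINT x:K|lebesgue. v x * (r x * pd k \<phi> x + G k x * \<phi> x))"
        by (rule LINT_restrict[OF K(2)]) (subst z(2), assumption, rule mult_zero_right)
      show ?thesis unfolding e e' by (rule D(2))
    qed
    ultimately show ?thesis by blast
  qed
  have L1: "ui \<in> L1_loc \<Omega>" "uj \<in> L1_loc \<Omega>" using ui uj unfolding has_wderiv_def by auto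
  show "set_integrable lebesgue \<Omega> (\<lambda>x. ui x * (r x * pd j \<phi> x + G j x * \<phi> x))"
    using conv[OF L1(1)] by blast
  have a: "(\<lambda>m. LINT x:\<Omega>|lebesgue. ui x * pd j (w m) x) \<longlonglongrightarrow> (LINT x:\<Omega>|lebesgue. ui x * (r x * pd j \<phi> x + G j x * \<phi> x))"
    using conv[OF L1(1)] by blast
  have b: "(\<lambda>m. LINT x:\<Omega>|lebesgue. uj x * pd i (w m) x) \<longlonglongrightarrow> (LINT x:\<Omega>|lebesgue. uj x * (r x * pd i \<phi> x + G i x * \<phi> x))"
    using conv[OF L1(2)] by blast
  show "(LINT x:\<Omega>|lebesgue. ui x * (r x * pd j \<phi> x + G j x * \<phi> x))
       = (LINT x:\<Omega>|lebesgue. uj x * (r x * pd i \<phi> x + G i x * \<phi> x))"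
    using LIMSEQ_unique[OF a[unfolded sym] b] .
qed

section \<open>The quadratic form\<close>

definition outer :: "real^'n \<Rightarrow> real^'n \<Rightarrow> real^'n^'n" where
  "outer u v = (\<chi> \<alpha> h. u $ \<alpha> * v $ h)"

lemma inner_matrix: "(M::real^'n::finite^'n) \<bullet> N = (\<Sum>\<alpha>\<in>UNIV. \<Sum>h\<in>UNIV. M $ \<alpha> $ h * N $ \<alpha> $ h)"
  by (simp add: inner_vec_def)

lemma inner_outer: "M \<bullet> outer u v = u \<bullet> (M *v v)"
  by (simp add: inner_matrix outer_def inner_vec_def matrix_vector_mult_def sum_distrib_left mult_ac)

lemma transpose_outer: "transpose (outer u v) = outer v u"
  by (simp add: outer_def transpose_def mult.commute vec_eq_iff)

lemma trace_outer: "trace (outer u v) = u \<bullet> v"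
  by (simp add: trace_def outer_def inner_vec_def)

lemma outer_mult_vec: "outer u v *v w = (v \<bullet> w) *\<^sub>R u"
  by (simp add: outer_def matrix_vector_mult_def inner_vec_def vec_eq_iff sum_distrib_left mult_ac)

lemma inner_transpose: "transpose M \<bullet> N = M \<bullet> transpose (N::real^'n::finite^'n)"
  unfolding inner_matrix transpose_def by (subst sum.swap) simp

lemma inner_mat_1: "M \<bullet> mat 1 = trace (M::real^'n::finite^'n)"
  by (simp add: inner_matrix mat_def trace_def if_distrib cong: if_cong)

lemma norm_transpose: "norm (transpose M) = norm (M::real^'n::finite^'n)"
  by (simp add: norm_eq_sqrt_inner inner_transpose)

lemma abs_inner_transpose_le: "\<bar>transpose M \<bullet> M\<bar> \<le> M \<bullet> (M::real^'n::finite^'n)"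
  using Cauchy_Schwarz_ineq2[of "transpose M" M] by (simp add: norm_transpose dot_square_norm power2_eq_square)

lemma inner_mult_vec_transpose: "u \<bullet> (M *v v) = (transpose M *v u) \<bullet> (v::real^'n::finite)"
  by (metis dot_lmul_matrix inner_commute transpose_matrix_vector)

lemma A_form_lame:
  "A_form (lame_A lam mu r x) \<xi> \<eta>
     = mu x * (\<xi> \<bullet> \<eta>) + (lam x + r x) * trace \<xi> * trace \<eta> + (mu x - r x) * (transpose \<xi> \<bullet> \<eta>)"
proof -
  have e: "lame_A lam mu r x h k \<alpha> \<beta> * \<xi> $ \<beta> $ k * \<eta> $ \<alpha> $ h
     = (if k = h then if \<beta> = \<alpha> then mu x * \<xi> $ \<alpha> $ h * \<eta> $ \<alpha> $ h else 0 else 0)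
     + (if \<alpha> = h then if \<beta> = k then (lam x + r x) * \<xi> $ k $ k * \<eta> $ h $ h else 0 else 0)
     + (if \<beta> = h then if \<alpha> = k then (mu x - r x) * \<xi> $ h $ k * \<eta> $ k $ h else 0 else 0)" for h k \<alpha> \<beta>
    by (auto simp: lame_A_def kron_def algebra_simps)
  have s1: "(\<Sum>h\<in>UNIV. \<Sum>k\<in>UNIV. \<Sum>\<alpha>\<in>UNIV. \<Sum>\<beta>\<in>UNIV.
      (if k = h then if \<beta> = \<alpha> then mu x * \<xi> $ \<alpha> $ h * \<eta> $ \<alpha> $ h else 0 else 0)) = mu x * (\<xi> \<bullet> \<eta>)"
  proof -
    have "(\<Sum>h\<in>UNIV. \<Sum>k\<in>UNIV. \<Sum>\<alpha>\<in>UNIV. \<Sum>\<beta>\<in>UNIV.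
      (if k = h then if \<beta> = \<alpha> then mu x * \<xi> $ \<alpha> $ h * \<eta> $ \<alpha> $ h else 0 else 0))
      = (\<Sum>h\<in>UNIV. \<Sum>k\<in>UNIV. if k = h then \<Sum>\<alpha>\<in>UNIV. mu x * \<xi> $ \<alpha> $ h * \<eta> $ \<alpha> $ h else 0)"
      by (intro sum.cong refl) simp
    also have "\<dots> = (\<Sum>h\<in>UNIV. \<Sum>\<alpha>\<in>UNIV. mu x * \<xi> $ \<alpha> $ h * \<eta> $ \<alpha> $ h)" by simp
    also have "\<dots> = mu x * (\<xi> \<bullet> \<eta>)"
      unfolding inner_matrix by (subst sum.swap) (simp add: sum_distrib_left mult.assoc)
    finally show ?thesis .
  qed
  have s2: "(\<Sum>h\<in>UNIV. \<Sum>k\<in>UNIV. \<Sum>\<alpha>\<in>UNIV. \<Sum>\<beta>\<in>UNIV.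
      (if \<alpha> = h then if \<beta> = k then (lam x + r x) * \<xi> $ k $ k * \<eta> $ h $ h else 0 else 0))
      = (lam x + r x) * trace \<xi> * trace \<eta>"
  proof -
    have "(\<Sum>h\<in>UNIV. \<Sum>k\<in>UNIV. \<Sum>\<alpha>\<in>UNIV. \<Sum>\<beta>\<in>UNIV.
      (if \<alpha> = h then if \<beta> = k then (lam x + r x) * \<xi> $ k $ k * \<eta> $ h $ h else 0 else 0))
      = (\<Sum>h\<in>UNIV. \<Sum>k\<in>UNIV. \<Sum>\<alpha>\<in>UNIV. if \<alpha> = h then (lam x + r x) * \<xi> $ k $ k * \<eta> $ h $ h else 0)"
      by (intro sum.cong refl) simp
    also have "\<dots> = (\<Sum>h\<in>UNIV. \<Sum>k\<in>UNIV. (lam x + r x) * \<xi> $ k $ k * \<eta> $ h $ h)" by simp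
    also have "\<dots> = (lam x + r x) * trace \<xi> * trace \<eta>"
      unfolding trace_def by (simp add: sum_distrib_left[symmetric] sum_distrib_right[symmetric])
    finally show ?thesis .
  qed
  have s3: "(\<Sum>h\<in>UNIV. \<Sum>k\<in>UNIV. \<Sum>\<alpha>\<in>UNIV. \<Sum>\<beta>\<in>UNIV.
      (if \<beta> = h then if \<alpha> = k then (mu x - r x) * \<xi> $ h $ k * \<eta> $ k $ h else 0 else 0))
      = (mu x - r x) * (transpose \<xi> \<bullet> \<eta>)"
  proof -
    have "(\<Sum>h\<in>UNIV. \<Sum>k\<in>UNIV. \<Sum>\<alpha>\<in>UNIV. \<Sum>\<beta>\<in>UNIV.
      (if \<beta> = h then if \<alpha> = k then (mu x - r x) * \<xi> $ h $ k * \<eta> $ k $ h else 0 else 0))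
      = (\<Sum>h\<in>UNIV. \<Sum>k\<in>UNIV. \<Sum>\<alpha>\<in>UNIV. if \<alpha> = k then (mu x - r x) * \<xi> $ h $ k * \<eta> $ k $ h else 0)"
      by (intro sum.cong refl) simp
    also have "\<dots> = (\<Sum>h\<in>UNIV. \<Sum>k\<in>UNIV. (mu x - r x) * \<xi> $ h $ k * \<eta> $ k $ h)" by simp
    also have "\<dots> = (mu x - r x) * (transpose \<xi> \<bullet> \<eta>)"
      unfolding inner_matrix transpose_def by (subst sum.swap) (simp add: sum_distrib_left mult.assoc)
    finally show ?thesis .
  qed
  show ?thesis unfolding A_form_def e sum.distrib s1 s2 s3 ..
qed

text \<open>The value of the form at the rank one matrix \<open>(v / |v|) \<nabla>|v| = outer \<omega> g\<close>: there the squared trace and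
  the product with the transpose coincide, so \<open>r\<close> cancels.\<close>

definition radial_form :: "real \<Rightarrow> real \<Rightarrow> real^'n::finite \<Rightarrow> real^'n \<Rightarrow> real" where
  "radial_form a b \<omega> g = a * (g \<bullet> g) + (b - a) * (\<omega> \<bullet> g)\<^sup>2"

lemma A_form_outer:
  assumes "norm \<omega> = 1"
  shows "A_form (lame_A lam mu r x) (\<xi> - t *\<^sub>R outer \<omega> g) (\<xi> + t *\<^sub>R outer \<omega> g)
    = A_form (lame_A lam mu r x) \<xi> \<xi> - t\<^sup>2 * radial_form (mu x) (lam x + 2 * mu x) \<omega> g"
proof -
  have w: "\<omega> \<bullet> \<omega> = 1" using assms by (simp add: dot_square_norm)
  have tr: "trace (\<xi> - t *\<^sub>R outer \<omega> g) = trace \<xi> - t * (\<omega> \<bullet> g)" "trace (\<xi> + t *\<^sub>R outer \<omega> g) = trace \<xi> + t * (\<omega> \<bullet> g)"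
    using trace_outer[of \<omega> g] by (simp_all add: trace_def sum_subtractf sum.distrib sum_distrib_left[symmetric])
  have tp: "transpose (\<xi> - t *\<^sub>R outer \<omega> g) = transpose \<xi> - t *\<^sub>R outer g \<omega>"
    by (simp add: transpose_def outer_def vec_eq_iff mult.commute)
  have o1: "outer \<omega> g \<bullet> outer \<omega> g = g \<bullet> g" "outer g \<omega> \<bullet> outer \<omega> g = (\<omega> \<bullet> g)\<^sup>2"
    using w by (simp_all add: inner_outer outer_mult_vec inner_commute power2_eq_square)
  have o2: "outer g \<omega> \<bullet> \<xi> = transpose \<xi> \<bullet> outer \<omega> g"
    by (simp add: inner_transpose transpose_outer inner_commute)
  have o3: "outer \<omega> g \<bullet> \<xi> = \<xi> \<bullet> outer \<omega> g" by (rule inner_commute)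
  show ?thesis
    unfolding A_form_lame tr tp radial_form_def inner_diff_left inner_add_right inner_scaleR_left inner_scaleR_right o1 o2 o3
    by (simp add: algebra_simps power2_eq_square)
qed

lemma radial_form_ge:
  assumes "norm \<omega> = 1" "e \<le> a" "e \<le> b"
  shows "e * (g \<bullet> g) \<le> radial_form a b \<omega> g"
proof -
  have "(\<omega> \<bullet> g)\<^sup>2 \<le> g \<bullet> g"
    using Cauchy_Schwarz_ineq[of \<omega> g] assms(1) by (simp add: dot_square_norm)
  then have "0 \<le> (a - e) * (g \<bullet> g - (\<omega> \<bullet> g)\<^sup>2)" "0 \<le> (b - e) * (\<omega> \<bullet> g)\<^sup>2" using assms by auto
  then show ?thesis unfolding radial_form_def by (simp add: algebra_simps)
qed

lemma radial_form_le:
  assumes "norm \<omega> = 1" "a \<le> L" "b \<le> L" 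
  shows "radial_form a b \<omega> g \<le> L * (g \<bullet> g)"
proof -
  have "(\<omega> \<bullet> g)\<^sup>2 \<le> g \<bullet> g"
    using Cauchy_Schwarz_ineq[of \<omega> g] assms(1) by (simp add: dot_square_norm)
  then have "0 \<le> (L - a) * (g \<bullet> g - (\<omega> \<bullet> g)\<^sup>2)" "0 \<le> (L - b) * (\<omega> \<bullet> g)\<^sup>2" using assms by auto
  then show ?thesis unfolding radial_form_def by (simp add: algebra_simps)
qed

text \<open>Split \<open>\<xi>\<close> along \<open>\<omega>\<close> and remove the trace of the block orthogonal to \<open>\<omega>\<close>.  For the rest \<open>Z\<close> the
  inequality is Cauchy-Schwarz.  Two quadratic forms remain.  The one that couples \<open>\<xi> *v \<omega>\<close> and
  \<open>transpose \<xi> *v \<omega>\<close> orthogonally to \<open>\<omega>\<close> is a perfect square because of the factor \<open>1 - (\<rho> / a)\<^sup>2\<close>; the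
  one in the two traces along and across \<open>\<omega>\<close> is a perfect square by the hypothesis \<open>eq\<close>, which says that
  its discriminant vanishes.\<close>

lemma critical_form_ge:
  fixes \<xi> :: "real^'n::finite^'n" and \<omega> :: "real^'n"
  assumes n: "CARD('n) \<ge> 2" and a: "a > 0" and \<rho>: "\<bar>\<rho>\<bar> \<le> a" and \<omega>: "norm \<omega> = 1"
    and \<sigma>: "\<sigma> = b - a + \<rho>" and pos: "(real CARD('n) - 2) * \<sigma> + b > 0"
    and eq: "(real CARD('n) - 1) * \<sigma>\<^sup>2 = (\<rho> / a)\<^sup>2 * b * ((real CARD('n) - 2) * \<sigma> + b)"
  shows "a * (\<xi> \<bullet> \<xi>) + \<sigma> * (trace \<xi>)\<^sup>2 - \<rho> * (transpose \<xi> \<bullet> \<xi>)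
    \<ge> (1 - (\<rho> / a)\<^sup>2) * radial_form a b \<omega> (transpose \<xi> *v \<omega>)"
proof -
  define N where "N = real CARD('n) - 1"
  have N: "N > 0" using n unfolding N_def by linarith
  define g where "g = transpose \<xi> *v \<omega>"
  define g1 where "g1 = \<omega> \<bullet> g"
  define y where "y = \<xi> *v \<omega> - g1 *\<^sub>R \<omega>"
  define t where "t = trace \<xi> - g1"
  define c where "c = t / N"
  define P :: "real^'n^'n" where "P = mat 1 - outer \<omega> \<omega>"
  have ww: "\<omega> \<bullet> \<omega> = 1" using \<omega> by (simp add: dot_square_norm)
  have g1': "g1 = \<omega> \<bullet> (\<xi> *v \<omega>)" unfolding g1_def g_def by (simp add: inner_mult_vec_transpose inner_commute)
  have wy: "\<omega> \<bullet> y = 0" unfolding y_def inner_diff_right using ww g1' by simp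
  have yy: "y \<bullet> (\<xi> *v \<omega>) = y \<bullet> y"
  proof -
    have "\<xi> *v \<omega> = y + g1 *\<^sub>R \<omega>" unfolding y_def by simp
    then show ?thesis using wy by (simp add: inner_add_right inner_commute)
  qed
  \<comment> \<open>\<open>A\<close> collects the row and the column of \<open>\<xi>\<close> along \<open>\<omega>\<close> and the trace part of the orthogonal block.\<close>
  define A where "A = outer \<omega> g + outer y \<omega> + c *\<^sub>R P"
  define Z where "Z = \<xi> - A"
  have xiP: "M \<bullet> P = trace M - \<omega> \<bullet> (M *v \<omega>)" for M
    unfolding P_def inner_diff_right inner_mat_1 inner_outer ..
  have x1: "\<xi> \<bullet> outer \<omega> g = g \<bullet> g" by (simp add: inner_outer inner_mult_vec_transpose g_def)
  have x2: "\<xi> \<bullet> outer y \<omega> = y \<bullet> y" by (simp add: inner_outer yy)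
  have x3: "\<xi> \<bullet> P = t" by (simp add: xiP t_def g1')
  have p1: "outer u v \<bullet> outer u' v' = (u \<bullet> u') * (v \<bullet> v')" for u v u' v' :: "real^'n"
    by (simp add: inner_outer outer_mult_vec inner_commute mult.commute)
  have p2: "outer u v \<bullet> P = u \<bullet> v - (\<omega> \<bullet> u) * (\<omega> \<bullet> v)" for u v :: "real^'n"
    unfolding xiP trace_outer outer_mult_vec by (simp add: inner_commute mult.commute)
  have PP: "P \<bullet> P = N"
  proof -
    have "trace P = N"
    proof -
      have "trace P = trace (mat 1 :: real^'n^'n) - trace (outer \<omega> \<omega>)"
        unfolding P_def trace_def by (simp add: sum_subtractf)
      then show ?thesis using ww unfolding N_def by (simp add: trace_I trace_outer)
    qed
    moreover have "P *v \<omega> = 0"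
      unfolding P_def by (simp add: matrix_vector_mult_diff_rdistrib outer_mult_vec ww)
    ultimately show ?thesis unfolding xiP[of P] by simp
  qed
  have sym: "P \<bullet> outer u v = u \<bullet> v - (\<omega> \<bullet> u) * (\<omega> \<bullet> v)" for u v :: "real^'n"
    unfolding p2[symmetric] by (rule inner_commute)
  have AA: "A \<bullet> A = g \<bullet> g + y \<bullet> y + c\<^sup>2 * N"
    unfolding A_def inner_add_left inner_add_right inner_scaleR_left inner_scaleR_right p1 sym p2 PP
    using ww wy by (simp add: inner_commute power2_eq_square g1_def)
  have xA: "\<xi> \<bullet> A = g \<bullet> g + y \<bullet> y + c * t"
    unfolding A_def inner_add_right inner_scaleR_right x1 x2 x3 by simp
  have cN: "c * N = t" unfolding c_def using N by simp
  have c2N: "c\<^sup>2 * N = c * t" using cN by (simp add: power2_eq_square)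
  have ZZ: "Z \<bullet> Z = \<xi> \<bullet> \<xi> - g \<bullet> g - y \<bullet> y - c * t"
    unfolding Z_def inner_diff_left inner_diff_right inner_commute[of A \<xi>] xA AA c2N by simp
  have Pt: "transpose P = P"
    unfolding P_def by (simp add: vec_eq_iff transpose_def outer_def mat_def mult.commute)
  have At: "transpose A = outer g \<omega> + outer \<omega> y + c *\<^sub>R P"
  proof -
    have "transpose A = transpose (outer \<omega> g) + transpose (outer y \<omega>) + c *\<^sub>R transpose P"
      unfolding A_def by (simp add: transpose_def vec_eq_iff)
    then show ?thesis by (simp add: transpose_outer Pt)
  qed
  have t1: "transpose \<xi> \<bullet> outer \<omega> g = y \<bullet> g + g1\<^sup>2"
  proof -
    have "transpose \<xi> \<bullet> outer \<omega> g = (\<xi> *v \<omega>) \<bullet> g"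
      unfolding inner_outer inner_mult_vec_transpose transpose_transpose ..
    also have "\<xi> *v \<omega> = y + g1 *\<^sub>R \<omega>" unfolding y_def by simp
    finally show ?thesis by (simp add: inner_add_left g1_def power2_eq_square)
  qed
  have t2: "transpose \<xi> \<bullet> outer y \<omega> = y \<bullet> g" by (simp add: inner_outer g_def)
  have t3: "transpose \<xi> \<bullet> P = t" using x3 by (simp add: inner_transpose Pt)
  have tA: "transpose \<xi> \<bullet> A = 2 * (y \<bullet> g) + g1\<^sup>2 + c * t"
    unfolding A_def inner_add_right inner_scaleR_right t1 t2 t3 by simp
  have tAA: "transpose A \<bullet> A = g1\<^sup>2 + 2 * (y \<bullet> g) + c * t"
    unfolding At unfolding A_def inner_add_left inner_add_right inner_scaleR_left inner_scaleR_right p1 sym p2 PP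
    using ww wy c2N by (simp add: inner_commute power2_eq_square g1_def)
  have tZ: "transpose Z \<bullet> Z = transpose \<xi> \<bullet> \<xi> - g1\<^sup>2 - 2 * (y \<bullet> g) - c * t"
  proof -
    have "transpose Z = transpose \<xi> - transpose A" unfolding Z_def by (simp add: transpose_def vec_eq_iff)
    moreover have "transpose A \<bullet> \<xi> = transpose \<xi> \<bullet> A" by (rule trans[OF inner_transpose inner_commute])
    ultimately show ?thesis
      unfolding Z_def by (simp add: inner_diff_left inner_diff_right tA tAA)
  qed
  define s where "s = (\<rho> / a)\<^sup>2"
  \<comment> \<open>The coefficient of \<open>t\<^sup>2\<close> once \<open>Z\<close> is split off.\<close>
  define q where "q = ((real CARD('n) - 2) * \<sigma> + b) / N"
  have q: "q > 0" unfolding q_def using pos N by simp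
  have sq: "s * b * q = \<sigma>\<^sup>2"
  proof -
    have "s * b * q = ((\<rho> / a)\<^sup>2 * b * ((real CARD('n) - 2) * \<sigma> + b)) / N" by (simp add: q_def s_def)
    also have "\<dots> = (N * \<sigma>\<^sup>2) / N" unfolding eq[folded N_def, symmetric] ..
    finally show ?thesis using N by simp
  qed
  have qeq: "q = \<sigma> + (a - \<rho>) / N" unfolding q_def \<sigma> using N by (simp add: N_def field_simps)
  have trx: "trace \<xi> = g1 + t" unfolding t_def by simp
  have Zge: "0 \<le> a * (Z \<bullet> Z) - \<rho> * (transpose Z \<bullet> Z)"
  proof -
    have "\<bar>\<rho> * (transpose Z \<bullet> Z)\<bar> \<le> a * (Z \<bullet> Z)"
      unfolding abs_mult using \<rho> abs_inner_transpose_le[of Z] by (intro mult_mono) auto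
    then show ?thesis by linarith
  qed
  have B1: "0 \<le> s * a * (g \<bullet> g - g1\<^sup>2) + a * (y \<bullet> y) - 2 * \<rho> * (y \<bullet> g)"
  proof -
    define g' where "g' = g - g1 *\<^sub>R \<omega>"
    have gg': "g' \<bullet> g' = g \<bullet> g - g1\<^sup>2"
      unfolding g'_def using ww by (simp add: inner_diff_left inner_diff_right inner_commute g1_def power2_eq_square)
    have yg': "y \<bullet> g' = y \<bullet> g" unfolding g'_def using wy by (simp add: inner_diff_right inner_commute)
    have sa: "s * a * a = \<rho>\<^sup>2" unfolding s_def using a by (simp add: field_simps power2_eq_square)
    have "0 \<le> (\<rho> *\<^sub>R g' - a *\<^sub>R y) \<bullet> (\<rho> *\<^sub>R g' - a *\<^sub>R y)" by simp
    also have "\<dots> = \<rho>\<^sup>2 * (g' \<bullet> g') - 2 * \<rho> * a * (y \<bullet> g') + a * a * (y \<bullet> y)"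
      by (simp add: inner_diff_left inner_diff_right inner_commute power2_eq_square algebra_simps)
    also have "\<dots> = a * (s * a * (g \<bullet> g - g1\<^sup>2) + a * (y \<bullet> y) - 2 * \<rho> * (y \<bullet> g))"
      unfolding gg' yg' sa[symmetric] by (simp add: algebra_simps)
    finally show ?thesis using a by (simp add: zero_le_mult_iff)
  qed
  have B2: "0 \<le> s * b * g1\<^sup>2 + 2 * \<sigma> * g1 * t + q * t\<^sup>2"
  proof -
    have "0 \<le> (q * t + \<sigma> * g1)\<^sup>2" by simp
    also have "\<dots> = q * (q * t\<^sup>2 + 2 * \<sigma> * g1 * t) + \<sigma>\<^sup>2 * g1\<^sup>2"
      by (simp add: power2_eq_square algebra_simps)
    also have "\<dots> = q * (s * b * g1\<^sup>2 + 2 * \<sigma> * g1 * t + q * t\<^sup>2)"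
      unfolding sq[symmetric] by (simp add: algebra_simps)
    finally show ?thesis using q by (simp add: zero_le_mult_iff)
  qed
  have e1: "(\<sigma> + a) * (g1 * g1) = (\<rho> + b) * (g1 * g1)" unfolding \<sigma> by simp
  have ct: "c * t = t\<^sup>2 / N" unfolding c_def by (simp add: power2_eq_square)
  have qt: "q * t\<^sup>2 = \<sigma> * t\<^sup>2 + (a - \<rho>) * (c * t)" unfolding qeq ct by (simp add: algebra_simps)
  have "a * (\<xi> \<bullet> \<xi>) + \<sigma> * (trace \<xi>)\<^sup>2 - \<rho> * (transpose \<xi> \<bullet> \<xi>) - (1 - s) * radial_form a b \<omega> g
    = (a * (Z \<bullet> Z) - \<rho> * (transpose Z \<bullet> Z))
      + (s * a * (g \<bullet> g - g1\<^sup>2) + a * (y \<bullet> y) - 2 * \<rho> * (y \<bullet> g))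
      + (s * b * g1\<^sup>2 + 2 * \<sigma> * g1 * t + q * t\<^sup>2)"
    unfolding ZZ tZ qt radial_form_def trx g1_def[symmetric]
    using e1 by (simp add: algebra_simps power2_eq_square)
  then show ?thesis using Zge B1 B2 unfolding s_def g_def by linarith
qed

text \<open>The root in \<open>(0, 1)\<close> of \<open>\<kappa> b z\<^sup>2 - (a + b) z + a\<close> with \<open>\<kappa> = (n - 2) / (n - 1)\<close>, written so that it is
  smooth in \<open>a, b > 0\<close> and covers \<open>n = 2\<close>.  With \<open>\<rho> = - (b - a) z\<close> the two obstructions in
  \<open>critical_form_ge\<close> balance.\<close>

definition crit_disc :: "real \<Rightarrow> real \<Rightarrow> real \<Rightarrow> real" where
  "crit_disc n a b = (a + b)\<^sup>2 - 4 * ((n - 2) / (n - 1)) * (a * b)"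

definition crit_den :: "real \<Rightarrow> real \<Rightarrow> real \<Rightarrow> real" where
  "crit_den n a b = a + b + sqrt (crit_disc n a b)"

definition crit_rho :: "real \<Rightarrow> real \<Rightarrow> real \<Rightarrow> real" where
  "crit_rho n a b = - (b - a) * (2 * a / crit_den n a b)"

lemma crit_disc_gt:
  assumes "n \<ge> 2" "a > 0" "b > 0" shows "(b - a)\<^sup>2 < crit_disc n a b"
proof -
  have "crit_disc n a b - (b - a)\<^sup>2 = 4 * (a * b) / (n - 1)"
    unfolding crit_disc_def using assms(1) by (simp add: field_simps power2_eq_square)
  moreover have "\<dots> > 0" using assms by simp
  ultimately show ?thesis by linarith
qed

lemma crit_den_gt:
  assumes "n \<ge> 2" "a > 0" "b > 0" shows "2 * max a b < crit_den n a b"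
proof -
  have "\<bar>b - a\<bar> < sqrt (crit_disc n a b)"
    using real_sqrt_less_mono[OF crit_disc_gt[OF assms]] by simp
  then show ?thesis unfolding crit_den_def by (auto simp: max_def)
qed

text \<open>With \<open>z = 2 * a / crit_den n a b\<close> and \<open>y = 1 - z\<close>, the quadratic equation for \<open>z\<close> makes
  \<open>(n - 1) * ((n - 2) * \<sigma> + b)\<close> equal to \<open>b\<close> times a square; positivity and the equation between \<open>\<sigma>\<close> and \<open>\<rho>\<close>
  follow.\<close>

lemma crit_rho_properties:
  assumes n: "n \<ge> 2" and a: "a > 0" and b: "b > 0"
  defines "\<rho> \<equiv> crit_rho n a b" and "\<sigma> \<equiv> b - a + crit_rho n a b"
  shows "(n - 2) * \<sigma> + b > 0" and "(n - 1) * \<sigma>\<^sup>2 = (\<rho> / a)\<^sup>2 * b * ((n - 2) * \<sigma> + b)"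
    and "(\<rho> / a)\<^sup>2 = (b - a)\<^sup>2 * (2 / crit_den n a b)\<^sup>2"
    and "(\<rho> / a)\<^sup>2 \<le> ((b - a) / max a b)\<^sup>2"
proof -
  define q where "q = sqrt (crit_disc n a b)"
  define D where "D = crit_den n a b"
  define z where "z = 2 * a / D"
  define y where "y = 1 - z"
  define N where "N = n - 2"
  have N: "N \<ge> 0" using n unfolding N_def by simp
  have D: "D > 2 * max a b" "D > 0" unfolding D_def using crit_den_gt[OF n a b] a by auto
  have Dq: "D = a + b + q" unfolding D_def crit_den_def q_def ..
  have q2: "q\<^sup>2 = (a + b)\<^sup>2 - 4 * (N / (N + 1)) * (a * b)"
  proof -
    have "0 \<le> crit_disc n a b" using crit_disc_gt[OF n a b] zero_le_power2[of "b - a"] by linarith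
    then show ?thesis unfolding q_def by (simp add: crit_disc_def N_def)
  qed
  have z: "0 < z" "z < 1" unfolding z_def using D a by (auto simp: max_def split: if_splits)
  have y: "0 < y" "y < 1" unfolding y_def using z by auto
  have Dquad: "D\<^sup>2 = 2 * (a + b) * D - 4 * (N / (N + 1)) * (a * b)"
  proof -
    have "D\<^sup>2 = 2 * (a + b) * D - ((a + b)\<^sup>2 - q\<^sup>2)" unfolding Dq by (simp add: power2_eq_square algebra_simps)
    then show ?thesis unfolding q2 by simp
  qed
  have aD: "z * D = 2 * a" unfolding z_def using D(2) by simp
  have zquad: "(N + 1) * a = (N + 1) * (a + b) * z - N * b * z\<^sup>2"
  proof -
    have N1: "N + 1 \<noteq> 0" using N by simp
    have "z\<^sup>2 * ((N + 1) * D\<^sup>2) = z\<^sup>2 * (2 * (N + 1) * (a + b) * D - 4 * N * (a * b))"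
      unfolding Dquad using N1 by (simp add: field_simps)
    also have "z\<^sup>2 * ((N + 1) * D\<^sup>2) = (N + 1) * (z * D)\<^sup>2" by (simp add: power_mult_distrib)
    also have "z\<^sup>2 * (2 * (N + 1) * (a + b) * D - 4 * N * (a * b)) = 2 * (N + 1) * (a + b) * z * (z * D) - 4 * N * (a * b) * z\<^sup>2"
      by (simp add: power2_eq_square algebra_simps)
    finally have "(4 * a) * ((N + 1) * a) = (4 * a) * ((N + 1) * (a + b) * z - N * b * z\<^sup>2)"
      unfolding aD by (simp add: power2_eq_square algebra_simps)
    then show ?thesis using a by simp
  qed
  have ay: "(N + 1) * (a * y) = b * z * (1 + N * y)"
    using zquad unfolding y_def by (simp add: power2_eq_square algebra_simps)
  have \<rho>z: "\<rho> = - (b - a) * z" unfolding \<rho>_def crit_rho_def z_def D_def ..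
  have \<sigma>y: "\<sigma> = (b - a) * y" unfolding \<sigma>_def \<rho>_def[symmetric] \<rho>z y_def by (simp add: algebra_simps)
  have S: "(N + 1) * (N * \<sigma> + b) = b * (1 + N * y)\<^sup>2"
  proof -
    have "(N + 1) * (N * \<sigma> + b) = (N + 1) * b * (1 + N * y) - N * ((N + 1) * (a * y))"
      unfolding \<sigma>y by (simp add: algebra_simps)
    also have "\<dots> = b * (1 + N * y) * (N + 1 - N * z)" unfolding ay by (simp add: algebra_simps)
    also have "N + 1 - N * z = 1 + N * y" unfolding y_def by (simp add: algebra_simps)
    finally show ?thesis by (simp add: power2_eq_square)
  qed
  have "0 < (N + 1) * (N * \<sigma> + b)" unfolding S
  proof -
    have "0 < 1 + N * y" using N y by (simp add: add_pos_nonneg)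
    then show "0 < b * (1 + N * y)\<^sup>2" using b by simp
  qed
  then have P: "N * \<sigma> + b > 0" using N by (simp add: zero_less_mult_iff)
  then show "(n - 2) * \<sigma> + b > 0" unfolding N_def .
  have ra: "(\<rho> / a)\<^sup>2 = (b - a)\<^sup>2 * z\<^sup>2 / a\<^sup>2" unfolding \<rho>z
    by (simp only: power_divide power_mult_distrib power2_minus)
  have "(N + 1) * ((N + 1) * \<sigma>\<^sup>2) * a\<^sup>2 = (b - a)\<^sup>2 * ((N + 1) * (a * y))\<^sup>2"
    unfolding \<sigma>y by (simp add: power2_eq_square)
  also have "\<dots> = (b - a)\<^sup>2 * z\<^sup>2 * b * (b * (1 + N * y)\<^sup>2)" unfolding ay by (simp add: power2_eq_square)
  also have "\<dots> = (N + 1) * ((b - a)\<^sup>2 * z\<^sup>2 * b * (N * \<sigma> + b))" unfolding S[symmetric] by simp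
  finally have "(N + 1) * (((N + 1) * \<sigma>\<^sup>2) * a\<^sup>2) = (N + 1) * ((b - a)\<^sup>2 * z\<^sup>2 * b * (N * \<sigma> + b))"
    by (simp only: mult.assoc)
  moreover have "N + 1 \<noteq> 0" using N by simp
  ultimately have "((N + 1) * \<sigma>\<^sup>2) * a\<^sup>2 = (b - a)\<^sup>2 * z\<^sup>2 * b * (N * \<sigma> + b)"
    by (metis mult_left_cancel)
  then have "(N + 1) * \<sigma>\<^sup>2 = (\<rho> / a)\<^sup>2 * b * (N * \<sigma> + b)" unfolding ra using a by (simp add: field_simps)
  then show "(n - 1) * \<sigma>\<^sup>2 = (\<rho> / a)\<^sup>2 * b * ((n - 2) * \<sigma> + b)" unfolding N_def by simp
  have za: "z / a = 2 / D" unfolding z_def using a by simp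
  show R: "(\<rho> / a)\<^sup>2 = (b - a)\<^sup>2 * (2 / crit_den n a b)\<^sup>2"
    unfolding ra D_def[symmetric] za[symmetric] by (simp add: power_divide)
  have m: "max a b > 0" using a by simp
  have "2 / D \<le> 1 / max a b" using D m by (simp add: field_simps)
  then have "(2 / D)\<^sup>2 \<le> (1 / max a b)\<^sup>2" using D(2) by (intro power_mono) auto
  then have "(b - a)\<^sup>2 * (2 / D)\<^sup>2 \<le> (b - a)\<^sup>2 * (1 / max a b)\<^sup>2" by (intro mult_left_mono) auto
  then show "(\<rho> / a)\<^sup>2 \<le> ((b - a) / max a b)\<^sup>2" unfolding R D_def by (simp add: power_divide)
qed

text \<open>Coercivity at subcritical \<open>s\<close>: the form at \<open>s\<close> dominates a multiple of the form at \<open>s = 0\<close>, and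
  the critical inequality for the unit vectors \<open>axis \<alpha> 1\<close> bounds the latter from below.\<close>

lemma subcritical_form_ge:
  fixes \<xi> :: "real^'n::finite^'n" and \<omega> :: "real^'n"
  assumes n: "CARD('n) \<ge> 2" and e: "e > 0" "e \<le> a" "e \<le> b" and \<omega>: "norm \<omega> = 1"
    and \<rho>: "\<rho> = crit_rho (real CARD('n)) a b" and m: "(\<rho> / a)\<^sup>2 \<le> m" "m < 1" and s: "0 \<le> s" "s < 1 - m"
  shows "a * (\<xi> \<bullet> \<xi>) + (b - a + \<rho>) * (trace \<xi>)\<^sup>2 - \<rho> * (transpose \<xi> \<bullet> \<xi>)
      - s * radial_form a b \<omega> (transpose \<xi> *v \<omega>) \<ge> (1 - m - s) * e / real CARD('n) * (\<xi> \<bullet> \<xi>)"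
proof -
  let ?n = "real CARD('n)"
  have ab: "a > 0" "b > 0" using e by auto
  have n': "?n \<ge> 2" using n by simp
  define E where "E = a * (\<xi> \<bullet> \<xi>) + (b - a + \<rho>) * (trace \<xi>)\<^sup>2 - \<rho> * (transpose \<xi> \<bullet> \<xi>)"
  define t where "t = 1 - (\<rho> / a)\<^sup>2"
  have t: "1 - m \<le> t" "t > 0" unfolding t_def using m by auto
  have "(\<rho> / a)\<^sup>2 \<le> 1" using m by simp
  then have "\<bar>\<rho> / a\<bar> \<le> 1" using abs_square_le_1 by blast
  then have \<rho>a: "\<bar>\<rho>\<bar> \<le> a" using ab by (simp add: abs_divide)
  have crit: "t * radial_form a b \<nu> (transpose \<xi> *v \<nu>) \<le> E" if "norm \<nu> = 1" for \<nu>
    unfolding t_def E_def using crit_rho_properties(1,2)[OF n' ab] \<rho>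
    by (intro critical_form_ge[OF n ab(1) \<rho>a that refl]) auto
  have row: "t * e * ((\<xi> $ \<alpha>) \<bullet> (\<xi> $ \<alpha>)) \<le> E" for \<alpha>
  proof -
    have nu: "norm (axis \<alpha> 1 :: real^'n) = 1" by simp
    have "transpose \<xi> *v axis \<alpha> 1 = \<xi> $ \<alpha>"
      by (simp add: vec_eq_iff matrix_vector_mult_def transpose_def axis_def if_distrib cong: if_cong)
    then have "e * ((\<xi> $ \<alpha>) \<bullet> (\<xi> $ \<alpha>)) \<le> radial_form a b (axis \<alpha> 1) (transpose \<xi> *v axis \<alpha> 1)"
      using radial_form_ge[OF nu e(2,3), of "\<xi> $ \<alpha>"] by simp
    then have "t * (e * ((\<xi> $ \<alpha>) \<bullet> (\<xi> $ \<alpha>))) \<le> t * radial_form a b (axis \<alpha> 1) (transpose \<xi> *v axis \<alpha> 1)"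
      using t by (intro mult_left_mono) auto
    then show ?thesis using crit[OF nu] by (simp add: mult.assoc)
  qed
  have "(\<Sum>\<alpha>\<in>(UNIV::'n set). t * e * ((\<xi> $ \<alpha>) \<bullet> (\<xi> $ \<alpha>))) \<le> (\<Sum>\<alpha>\<in>(UNIV::'n set). E)"
    by (intro sum_mono row)
  then have nE: "t * e * (\<xi> \<bullet> \<xi>) \<le> ?n * E"
    by (simp add: inner_vec_def sum_distrib_left[symmetric])
  have sF: "s * radial_form a b \<omega> (transpose \<xi> *v \<omega>) \<le> (s / t) * E"
    using mult_left_mono[OF crit[OF \<omega>], of "s / t"] s t by simp
  have "(1 - m - s) * e * (\<xi> \<bullet> \<xi>) \<le> (t - s) * e * (\<xi> \<bullet> \<xi>)"
    using t e by (intro mult_right_mono) auto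
  also have "\<dots> = (1 - s / t) * (t * e * (\<xi> \<bullet> \<xi>))" using t by (simp add: field_simps)
  also have "\<dots> \<le> (1 - s / t) * (?n * E)" using s t nE by (intro mult_left_mono) auto
  finally have "(1 - m - s) * e / ?n * (\<xi> \<bullet> \<xi>) \<le> (1 - s / t) * E" using n' by (simp add: field_simps)
  then show ?thesis using sF unfolding E_def[symmetric] by (simp add: left_diff_distrib)
qed

section \<open>The modulus of a Sobolev function\<close>

lemma set_lebesgue_on:
  fixes f :: "real^'n::finite \<Rightarrow> real"
  assumes "S \<in> sets lebesgue"
  shows "set_integrable lebesgue S f \<longleftrightarrow> integrable (lebesgue_on S) f"
    and "(LINT x:S|lebesgue. f x) = integral\<^sup>L (lebesgue_on S) f"
  using assms by (simp_all add: set_integrable_def set_lebesgue_integral_def integrable_restrict_space integral_restrict_space)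

lemma AE_lebesgue_on_iff:
  assumes "S \<in> sets lebesgue"
  shows "(AE x in lebesgue_on S. P x) \<longleftrightarrow> (AE x in lebesgue. x \<in> S \<longrightarrow> P x)"
  using assms by (subst AE_restrict_space_iff) auto

lemma borel_measurable_lebesgue_on_AE:
  fixes f :: "real^'n::finite \<Rightarrow> real"
  assumes S: "S \<in> sets lebesgue" and f: "f \<in> borel_measurable (lebesgue_on S)"
    and ae: "AE x in lebesgue. x \<in> S \<longrightarrow> f x = g x"
  shows "g \<in> borel_measurable (lebesgue_on S)"
proof -
  have S': "S \<inter> space lebesgue \<in> sets lebesgue" using S by simp
  have "(\<lambda>x. indicator S x *\<^sub>R f x) \<in> borel_measurable lebesgue"
    using f borel_measurable_restrict_space_iff[OF S', of f] by blast
  moreover have "AE x in lebesgue. indicator S x *\<^sub>R f x = indicator S x *\<^sub>R g x"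
    using ae by eventually_elim (auto simp: indicator_def)
  ultimately have "(\<lambda>x. indicator S x *\<^sub>R g x) \<in> borel_measurable lebesgue"
    by (rule borel_measurable_AE)
  then show ?thesis using borel_measurable_restrict_space_iff[OF S', of g] by blast
qed

lemma L2_iff:
  assumes "S \<in> sets lebesgue"
  shows "f \<in> L2 S \<longleftrightarrow> f \<in> borel_measurable (lebesgue_on S) \<and> integrable (lebesgue_on S) (\<lambda>x. (f x)\<^sup>2)"
  unfolding L2_def set_lebesgue_on(1)[OF assms] by simp

lemma integrable_square_diff:
  fixes f g :: "'a \<Rightarrow> real"
  assumes [measurable]: "f \<in> borel_measurable M" "g \<in> borel_measurable M"
    and "integrable M (\<lambda>x. (f x)\<^sup>2)" "integrable M (\<lambda>x. (g x)\<^sup>2)"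
  shows "integrable M (\<lambda>x. (f x - g x)\<^sup>2)"
proof (rule Bochner_Integration.integrable_bound)
  show "integrable M (\<lambda>x. 2 * (f x)\<^sup>2 + 2 * (g x)\<^sup>2)" using assms by auto
  show "AE x in M. norm ((f x - g x)\<^sup>2) \<le> norm (2 * (f x)\<^sup>2 + 2 * (g x)\<^sup>2)"
  proof (rule AE_I2)
    fix x
    have "0 \<le> (f x + g x)\<^sup>2" by simp
    moreover have "2 * (f x)\<^sup>2 + 2 * (g x)\<^sup>2 = (f x + g x)\<^sup>2 + (f x - g x)\<^sup>2"
      by (simp add: power2_sum power2_diff)
    moreover have "norm ((f x - g x)\<^sup>2) = (f x - g x)\<^sup>2"
      "norm (2 * (f x)\<^sup>2 + 2 * (g x)\<^sup>2) = 2 * (f x)\<^sup>2 + 2 * (g x)\<^sup>2" by simp_all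
    ultimately show "norm ((f x - g x)\<^sup>2) \<le> norm (2 * (f x)\<^sup>2 + 2 * (g x)\<^sup>2)" by linarith
  qed
qed simp

lemma wderiv_L2:
  fixes \<Omega> :: "(real^'n::finite) set"
  assumes \<Omega>: "open \<Omega>" and f: "f \<in> W12 \<Omega>"
  shows "wderiv \<Omega> i f \<in> L2 \<Omega>" "has_wderiv \<Omega> i f (wderiv \<Omega> i f)"
proof -
  have S: "\<Omega> \<in> sets lebesgue" using \<Omega> by (simp add: borel_open)
  obtain g where g: "g \<in> L2 \<Omega>" "has_wderiv \<Omega> i f g" using f unfolding W12_def by blast
  show "has_wderiv \<Omega> i f (wderiv \<Omega> i f)" by (rule wderiv_has_wderiv[OF g(2)])
  have ae: "AE x in lebesgue. x \<in> \<Omega> \<longrightarrow> g x = wderiv \<Omega> i f x"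
    using wderiv_AE_eq[OF \<Omega> g(2)] by eventually_elim auto
  have gL: "g \<in> borel_measurable (lebesgue_on \<Omega>)" "integrable (lebesgue_on \<Omega>) (\<lambda>x. (g x)\<^sup>2)"
    using g(1) unfolding L2_iff[OF S] by auto
  have m: "wderiv \<Omega> i f \<in> borel_measurable (lebesgue_on \<Omega>)"
    by (rule borel_measurable_lebesgue_on_AE[OF S gL(1) ae])
  have "AE x in lebesgue_on \<Omega>. (g x)\<^sup>2 = (wderiv \<Omega> i f x)\<^sup>2"
    unfolding AE_lebesgue_on_iff[OF S] using ae by eventually_elim auto
  then have "integrable (lebesgue_on \<Omega>) (\<lambda>x. (wderiv \<Omega> i f x)\<^sup>2)"
    using integrable_cong_AE[of "\<lambda>x. (g x)\<^sup>2" "lebesgue_on \<Omega>" "\<lambda>x. (wderiv \<Omega> i f x)\<^sup>2"] gL m by simp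
  then show "wderiv \<Omega> i f \<in> L2 \<Omega>" unfolding L2_iff[OF S] using m by blast
qed

lemma test_fun_L2:
  fixes \<Omega> :: "(real^'n::finite) set"
  assumes \<Omega>: "open \<Omega>" and \<phi>: "\<phi> \<in> test_fun \<Omega>"
  shows "\<phi> \<in> L2 \<Omega>"
proof -
  have S: "\<Omega> \<in> sets lebesgue" using \<Omega> by (simp add: borel_open)
  obtain K where K: "compact K" "K \<subseteq> \<Omega>" "\<And>x. x \<notin> K \<Longrightarrow> \<phi> x = 0" using test_funE[OF \<phi>] by metis
  have c: "continuous_on A \<phi>" for A by (rule smooth_continuous[OF test_fun_smooth[OF \<phi>]])
  have "\<phi> \<in> borel_measurable lebesgue"
    by (rule measurable_completion) (simp add: borel_measurable_continuous_onI c)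
  then have "\<phi> \<in> borel_measurable (lebesgue_on \<Omega>)" by (rule measurable_restrict_space1)
  moreover have "set_integrable lebesgue \<Omega> (\<lambda>x. (\<phi> x)\<^sup>2)"
    by (rule set_integrable_continuous_compact[OF K(1,2)]) (use K(3) in \<open>auto intro!: continuous_intros c\<close>)
  ultimately show ?thesis unfolding L2_def by blast
qed

text \<open>By Cauchy-Schwarz, as the measure is finite.\<close>

lemma (in finite_measure) tendsto_L1_if_tendsto_L2:
  fixes d :: "nat \<Rightarrow> 'a \<Rightarrow> real"
  assumes [measurable]: "\<And>m. d m \<in> borel_measurable M" and sq: "\<And>m. integrable M (\<lambda>x. (d m x)\<^sup>2)"
    and lim: "(\<lambda>m. LINT x|M. (d m x)\<^sup>2) \<longlonglongrightarrow> 0"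
  shows "integrable M (d m)" "(\<lambda>m. LINT x|M. \<bar>d m x\<bar>) \<longlonglongrightarrow> 0"
proof -
  have pw: "\<bar>t\<bar> \<le> e + t\<^sup>2 / e" if "e > 0" for e t :: real
  proof (cases "\<bar>t\<bar> \<le> e")
    case True
    then show ?thesis using that by (simp add: add_increasing2)
  next
    case False
    then have "\<bar>t\<bar> * e \<le> \<bar>t\<bar> * \<bar>t\<bar>" using that by (intro mult_left_mono) auto
    then have "\<bar>t\<bar> \<le> t\<^sup>2 / e" using that by (simp add: field_simps power2_eq_square)
    then show ?thesis using that by simp
  qed
  have bi: "integrable M (\<lambda>x. e + (d m x)\<^sup>2 / e)" for e m using sq[of m] by simp
  show di: "integrable M (d m)" for m
    by (rule Bochner_Integration.integrable_bound[OF bi[of 1 m]]) (use pw[of 1] in auto)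
  show "(\<lambda>m. LINT x|M. \<bar>d m x\<bar>) \<longlonglongrightarrow> 0"
  proof (rule tendstoI)
    fix e :: real assume e: "e > 0"
    define c where "c = measure M (space M) + 1"
    have c: "c > 0" unfolding c_def by (simp add: add_nonneg_pos)
    define t where "t = e / (2 * c)"
    have t: "t > 0" unfolding t_def using e c by simp
    have "\<forall>\<^sub>F m in sequentially. (LINT x|M. (d m x)\<^sup>2) < t * (e / 2)"
      by (rule order_tendstoD(2)[OF lim]) (use t e in simp)
    then show "\<forall>\<^sub>F m in sequentially. dist (LINT x|M. \<bar>d m x\<bar>) 0 < e"
    proof eventually_elim
      case (elim m)
      have "(LINT x|M. \<bar>d m x\<bar>) \<le> (LINT x|M. t + (d m x)\<^sup>2 / t)"
        using di[of m] bi[of t m] pw[OF t] by (intro integral_mono) auto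
      also have "\<dots> = t * measure M (space M) + (LINT x|M. (d m x)\<^sup>2) / t"
        using sq[of m] by (simp add: mult.commute)
      also have "\<dots> < t * c + e / 2"
      proof (rule add_strict_mono)
        show "t * measure M (space M) < t * c" unfolding c_def using t by simp
        show "(LINT x|M. (d m x)\<^sup>2) / t < e / 2" using elim t by (simp add: field_simps)
      qed
      also have "\<dots> = e" unfolding t_def using c by (simp add: field_simps)
      finally show ?case by (simp add: Bochner_Integration.integral_nonneg)
    qed
  qed
qed

text \<open>A bounded factor that converges almost everywhere and a factor that converges in \<open>L\<^sup>2\<close>: in the
  integral, replace first \<open>B m\<close> by \<open>b\<close>, then \<open>A m\<close> by \<open>a\<close>.  Convergence of \<open>A m x * b x\<close> instead of
  \<open>A m x\<close> leaves out the points where \<open>b\<close> vanishes.\<close>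

lemma (in finite_measure) integral_bounded_times_L2_tendsto:
  fixes a b \<psi> :: "'a \<Rightarrow> real"
  assumes am [measurable]: "\<And>m. A m \<in> borel_measurable M" "a \<in> borel_measurable M"
    and bm [measurable]: "\<And>m. B m \<in> borel_measurable M" "b \<in> borel_measurable M" "\<psi> \<in> borel_measurable M"
    and a1: "\<And>m x. \<bar>A m x\<bar> \<le> 1" "\<And>x. \<bar>a x\<bar> \<le> 1" and alim: "AE x in M. (\<lambda>m. A m x * b x) \<longlonglongrightarrow> a x * b x"
    and \<psi>: "\<forall>x\<in>space M. \<bar>\<psi> x\<bar> \<le> C"
    and b2: "integrable M (\<lambda>x. (b x)\<^sup>2)" and d2: "\<And>m. integrable M (\<lambda>x. (B m x - b x)\<^sup>2)"
    and lim: "(\<lambda>m. LINT x|M. (B m x - b x)\<^sup>2) \<longlonglongrightarrow> 0"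
  shows "integrable M (\<lambda>x. A m x * B m x * \<psi> x)" "integrable M (\<lambda>x. a x * b x * \<psi> x)"
    "(\<lambda>m. LINT x|M. A m x * B m x * \<psi> x) \<longlonglongrightarrow> (LINT x|M. a x * b x * \<psi> x)"
proof -
  have C: "x \<in> space M \<Longrightarrow> \<bar>\<psi> x\<bar> \<le> \<bar>C\<bar>" for x using \<psi> by fastforce
  have bi: "integrable M b"
    using tendsto_L1_if_tendsto_L2(1)[of "\<lambda>m. b"] square_integrable_imp_integrable[OF bm(2) b2] by simp
  have dm: "(\<lambda>x. B m x - b x) \<in> borel_measurable M" for m by measurable
  note d1 = tendsto_L1_if_tendsto_L2[OF dm d2 lim]
  have ui: "integrable M (\<lambda>x. u x * w x * \<psi> x) \<and> (\<forall>x\<in>space M. \<bar>u x * w x * \<psi> x\<bar> \<le> \<bar>C\<bar> * \<bar>w x\<bar>)"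
    if "u \<in> borel_measurable M" "\<And>x. \<bar>u x\<bar> \<le> 1" "integrable M w" for u w
  proof -
    have le: "\<bar>u x * w x * \<psi> x\<bar> \<le> \<bar>C\<bar> * \<bar>w x\<bar>" if "x \<in> space M" for x
    proof -
      have "\<bar>u x\<bar> * (\<bar>w x\<bar> * \<bar>\<psi> x\<bar>) \<le> 1 * (\<bar>w x\<bar> * \<bar>C\<bar>)"
        using C[OF that] \<open>\<bar>u x\<bar> \<le> 1\<close> by (intro mult_mono) auto
      then show ?thesis by (simp add: abs_mult mult_ac)
    qed
    have "integrable M (\<lambda>x. u x * w x * \<psi> x)"
    proof (rule Bochner_Integration.integrable_bound)
      show "integrable M (\<lambda>x. \<bar>C\<bar> * \<bar>w x\<bar>)" using that(3) by auto
      show "(\<lambda>x. u x * w x * \<psi> x) \<in> borel_measurable M"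
        using that(1) borel_measurable_integrable[OF that(3)] bm(3) by (intro borel_measurable_times)
      show "AE x in M. norm (u x * w x * \<psi> x) \<le> norm (\<bar>C\<bar> * \<bar>w x\<bar>)" using le by (auto simp: abs_mult)
    qed
    then show ?thesis using le by blast
  qed
  show i1: "integrable M (\<lambda>x. a x * b x * \<psi> x)" using ui[OF am(2) a1(2) bi] by blast
  have Bi: "integrable M (B m)" for m
    using Bochner_Integration.integrable_add[OF d1(1)[of m] bi] by simp
  show i2: "integrable M (\<lambda>x. A m x * B m x * \<psi> x)" for m using ui[OF am(1) a1(1) Bi] by blast
  have i3: "integrable M (\<lambda>x. A m x * b x * \<psi> x)" for m using ui[OF am(1) a1(1) bi] by blast
  have i4: "integrable M (\<lambda>x. A m x * (B m x - b x) * \<psi> x)"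
    and l4: "x \<in> space M \<Longrightarrow> \<bar>A m x * (B m x - b x) * \<psi> x\<bar> \<le> \<bar>C\<bar> * \<bar>B m x - b x\<bar>" for m x
    using ui[OF am(1) a1(1) d1(1)] by blast+
  have t1: "(\<lambda>m. LINT x|M. A m x * b x * \<psi> x) \<longlonglongrightarrow> (LINT x|M. a x * b x * \<psi> x)"
  proof (rule integral_dominated_convergence[where w = "\<lambda>x. \<bar>C\<bar> * \<bar>b x\<bar>"])
    show "integrable M (\<lambda>x. \<bar>C\<bar> * \<bar>b x\<bar>)" using bi by auto
    show "AE x in M. (\<lambda>m. A m x * b x * \<psi> x) \<longlonglongrightarrow> a x * b x * \<psi> x"
      using alim by eventually_elim (rule tendsto_mult_right)
    show "AE x in M. norm (A m x * b x * \<psi> x) \<le> \<bar>C\<bar> * \<bar>b x\<bar>" for m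
      using ui[OF am(1) a1(1) bi, of m] by (intro AE_I2) auto
  qed auto
  have t2: "(\<lambda>m. LINT x|M. A m x * (B m x - b x) * \<psi> x) \<longlonglongrightarrow> 0"
  proof (rule Lim_null_comparison)
    show "(\<lambda>m. \<bar>C\<bar> * (LINT x|M. \<bar>B m x - b x\<bar>)) \<longlonglongrightarrow> 0"
      using tendsto_mult_left[OF d1(2), of "\<bar>C\<bar>"] by simp
    show "\<forall>\<^sub>F m in sequentially. norm (LINT x|M. A m x * (B m x - b x) * \<psi> x) \<le> \<bar>C\<bar> * (LINT x|M. \<bar>B m x - b x\<bar>)"
    proof (rule always_eventually, rule allI)
      fix m
      have "\<bar>LINT x|M. A m x * (B m x - b x) * \<psi> x\<bar> \<le> (LINT x|M. \<bar>C\<bar> * \<bar>B m x - b x\<bar>)"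
        by (rule order_trans[OF integral_abs_bound integral_mono[OF integrable_abs[OF i4]]])
          (use d1(1) l4 in auto)
      then show "norm (LINT x|M. A m x * (B m x - b x) * \<psi> x) \<le> \<bar>C\<bar> * (LINT x|M. \<bar>B m x - b x\<bar>)" by simp
    qed
  qed
  have "(LINT x|M. A m x * B m x * \<psi> x) = (LINT x|M. A m x * b x * \<psi> x) + (LINT x|M. A m x * (B m x - b x) * \<psi> x)" for m
    unfolding Bochner_Integration.integral_add[OF i3 i4, symmetric] by (simp add: algebra_simps)
  then show "(\<lambda>m. LINT x|M. A m x * B m x * \<psi> x) \<longlonglongrightarrow> (LINT x|M. a x * b x * \<psi> x)"
    using tendsto_add[OF t1 t2] by simp
qed

text \<open>A smooth regularisation of the norm for \<open>e > 0\<close>; the case \<open>e = 0\<close> is the norm itself, so one limit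
  lemma serves both \<open>V m\<close> converging to \<open>v\<close> and \<open>e\<close> tending to \<open>0\<close>.\<close>

definition regnorm :: "real \<Rightarrow> real^'n::finite \<Rightarrow> real" where
  "regnorm e y = sqrt (e\<^sup>2 + y \<bullet> y)"

lemma regnorm_0: "regnorm 0 y = norm y"
  by (simp add: regnorm_def norm_eq_sqrt_inner)

lemma regnorm_nonneg: "0 \<le> regnorm e y"
  by (simp add: regnorm_def)

lemma regnorm_pos: "e > 0 \<Longrightarrow> 0 < regnorm e y"
  by (simp add: regnorm_def add_pos_nonneg)

lemma regnorm_ge: "\<bar>e\<bar> \<le> regnorm e y" "\<bar>y $ \<alpha>\<bar> \<le> regnorm e y"
proof -
  show "\<bar>e\<bar> \<le> regnorm e y" unfolding regnorm_def by (rule real_le_rsqrt) simp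
  have "\<bar>y $ \<alpha>\<bar>\<^sup>2 \<le> (norm y)\<^sup>2" using component_le_norm_cart[of y \<alpha>] by (intro power_mono) auto
  also have "\<dots> \<le> e\<^sup>2 + y \<bullet> y" by (simp add: power2_norm_eq_inner)
  finally show "\<bar>y $ \<alpha>\<bar> \<le> regnorm e y" unfolding regnorm_def by (rule real_le_rsqrt)
qed

lemma regnorm_quotient_le: "\<bar>e / regnorm e y\<bar> \<le> 1" "\<bar>y $ \<alpha> / regnorm e y\<bar> \<le> 1"
  using regnorm_ge(1)[of e y] regnorm_ge(2)[of y \<alpha> e] regnorm_nonneg[of e y]
  by (auto simp: abs_divide divide_le_eq_1)

text \<open>This identity writes \<open>regnorm e y\<close>, like its derivatives, as a sum of products of a bounded factor
  and a factor that converges in \<open>L\<^sup>2\<close>.\<close>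

lemma regnorm_eq_sum:
  "regnorm e y = (\<Sum>\<alpha>\<in>UNIV. (y $ \<alpha> / regnorm e y) * y $ \<alpha>) + (e / regnorm e y) * e"
proof (cases "regnorm e y = 0")
  case True
  then show ?thesis by simp
next
  case False
  have "(regnorm e y)\<^sup>2 = e\<^sup>2 + y \<bullet> y" unfolding regnorm_def by simp
  also have "y \<bullet> y = (\<Sum>\<alpha>\<in>UNIV. y $ \<alpha> * y $ \<alpha>)" by (simp add: inner_vec_def)
  finally have "regnorm e y = ((\<Sum>\<alpha>\<in>UNIV. y $ \<alpha> * y $ \<alpha>) + e * e) / regnorm e y"
    using False by (simp add: field_simps power2_eq_square)
  also have "\<dots> = (\<Sum>\<alpha>\<in>UNIV. (y $ \<alpha> / regnorm e y) * y $ \<alpha>) + (e / regnorm e y) * e"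
    by (simp add: add_divide_distrib sum_divide_distrib)
  finally show ?thesis .
qed

text \<open>Applied with constant \<open>\<epsilon>\<close> and \<open>e > 0\<close>, and with constant \<open>V\<close> and \<open>e = 0\<close>.  At points where the limit of the regularised norm is \<open>0\<close> the quotients by it need not converge, which is why there
  all \<open>V m x\<close> are required to vanish.\<close>

lemma has_wderiv_regnorm_limit:
  fixes \<Omega> :: "(real^'n::finite) set" and v :: "real^'n \<Rightarrow> real^'n"
  assumes \<Omega>: "open \<Omega>"
    and V: "\<And>m \<alpha>. (\<lambda>x. V m x $ \<alpha>) \<in> L2 \<Omega>" and D: "\<And>m \<alpha>. (\<lambda>x. D m x $ \<alpha>) \<in> L2 \<Omega>"
    and v: "\<And>\<alpha>. (\<lambda>x. v x $ \<alpha>) \<in> L2 \<Omega>" and d: "\<And>\<alpha>. (\<lambda>x. d x $ \<alpha>) \<in> L2 \<Omega>"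
    and Vlim: "\<And>\<alpha>. (\<lambda>m. LINT x:\<Omega>|lebesgue. (V m x $ \<alpha> - v x $ \<alpha>)\<^sup>2) \<longlonglongrightarrow> 0"
    and Dlim: "\<And>\<alpha>. (\<lambda>m. LINT x:\<Omega>|lebesgue. (D m x $ \<alpha> - d x $ \<alpha>)\<^sup>2) \<longlonglongrightarrow> 0"
    and e: "\<epsilon> \<longlonglongrightarrow> e"
    and ae: "AE x in lebesgue. x \<in> \<Omega> \<longrightarrow> (\<lambda>m. regnorm (\<epsilon> m) (V m x)) \<longlonglongrightarrow> regnorm e (v x) \<and>
       (regnorm e (v x) \<noteq> 0 \<longrightarrow> (\<lambda>m. V m x) \<longlonglongrightarrow> v x) \<and> (regnorm e (v x) = 0 \<longrightarrow> (\<forall>m. V m x = 0))"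
    and h: "\<And>m. has_wderiv \<Omega> i (\<lambda>x. regnorm (\<epsilon> m) (V m x)) (\<lambda>x. \<Sum>\<alpha>\<in>UNIV. (V m x $ \<alpha> / regnorm (\<epsilon> m) (V m x)) * D m x $ \<alpha>)"
  shows "has_wderiv \<Omega> i (\<lambda>x. regnorm e (v x)) (\<lambda>x. \<Sum>\<alpha>\<in>UNIV. (v x $ \<alpha> / regnorm e (v x)) * d x $ \<alpha>)"
proof -
  have S: "\<Omega> \<in> sets lebesgue" using \<Omega> by (simp add: borel_open)
  have main: "integrable (lebesgue_on K) (\<lambda>x. \<psi> x * regnorm e (v x)) \<and>
      integrable (lebesgue_on K) (\<lambda>x. \<psi> x * (\<Sum>\<alpha>\<in>UNIV. (v x $ \<alpha> / regnorm e (v x)) * d x $ \<alpha>)) \<and>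
      (\<lambda>m. LINT x|lebesgue_on K. \<psi> x * regnorm (\<epsilon> m) (V m x)) \<longlonglongrightarrow> (LINT x|lebesgue_on K. \<psi> x * regnorm e (v x)) \<and>
      (\<lambda>m. LINT x|lebesgue_on K. \<psi> x * (\<Sum>\<alpha>\<in>UNIV. (V m x $ \<alpha> / regnorm (\<epsilon> m) (V m x)) * D m x $ \<alpha>)) \<longlonglongrightarrow>
        (LINT x|lebesgue_on K. \<psi> x * (\<Sum>\<alpha>\<in>UNIV. (v x $ \<alpha> / regnorm e (v x)) * d x $ \<alpha>))"
    if K: "compact K" "K \<subseteq> \<Omega>" and \<psi>: "continuous_on K \<psi>" for K \<psi>
  proof -
    have KS: "K \<in> sets lebesgue" using K(1) by (simp add: borel_compact)
    interpret finite_measure "lebesgue_on K"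
      by (rule finite_measure_lebesgue_on[OF lmeasurable_compact[OF K(1)]])
    have res: "f \<in> borel_measurable (lebesgue_on K)" if "f \<in> borel_measurable (lebesgue_on \<Omega>)" for f :: "real^'n \<Rightarrow> real"
      by (rule measurable_restrict_mono[OF that K(2)])
    have meas: "f \<in> borel_measurable (lebesgue_on K)" if "f \<in> L2 \<Omega>" for f
      using that res unfolding L2_iff[OF S] by blast
    have vecm: "(\<lambda>x. regnorm t (w x)) \<in> borel_measurable (lebesgue_on K)"
      if "\<And>\<alpha>. (\<lambda>x. w x $ \<alpha>) \<in> L2 \<Omega>" for w :: "real^'n \<Rightarrow> real^'n" and t
      unfolding regnorm_def inner_vec_def inner_real_def using meas[OF that] by measurable
    have quom: "(\<lambda>x. w x $ \<alpha> / regnorm t (w x)) \<in> borel_measurable (lebesgue_on K)"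
      if "\<And>\<alpha>. (\<lambda>x. w x $ \<alpha>) \<in> L2 \<Omega>" for w :: "real^'n \<Rightarrow> real^'n" and t \<alpha>
      using meas[OF that] vecm[OF that] by measurable
    have quom': "(\<lambda>x. t / regnorm t (w x)) \<in> borel_measurable (lebesgue_on K)"
      if "\<And>\<alpha>. (\<lambda>x. w x $ \<alpha>) \<in> L2 \<Omega>" for w :: "real^'n \<Rightarrow> real^'n" and t
      using vecm[OF that] by measurable
    have restr: "integrable (lebesgue_on K) f \<and> (LINT x|lebesgue_on K. f x) \<le> (LINT x|lebesgue_on \<Omega>. f x)"
      if "integrable (lebesgue_on \<Omega>) f" "\<And>x. 0 \<le> f x" for f :: "real^'n \<Rightarrow> real"
    proof -
      have s: "set_integrable lebesgue \<Omega> f" using that(1) set_lebesgue_on(1)[OF S] by blast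
      then have s': "set_integrable lebesgue K f" using set_integrable_subset[OF _ KS K(2)] by blast
      have "(LINT x:K|lebesgue. f x) \<le> (LINT x:\<Omega>|lebesgue. f x)"
        unfolding set_lebesgue_integral_def
        using s s' K(2) that(2) unfolding set_integrable_def
        by (intro integral_mono) (auto simp: indicator_def)
      then show ?thesis using s' unfolding set_lebesgue_on[OF KS] set_lebesgue_on[OF S] by blast
    qed
    have sqK: "integrable (lebesgue_on K) (\<lambda>x. (f x)\<^sup>2)" if "f \<in> L2 \<Omega>" for f
      using that restr unfolding L2_iff[OF S] by simp
    have sqd: "integrable (lebesgue_on \<Omega>) (\<lambda>x. (f x - g x)\<^sup>2)" if "f \<in> L2 \<Omega>" "g \<in> L2 \<Omega>" for f g
      using that unfolding L2_iff[OF S] by (intro integrable_square_diff) auto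
    have limK: "(\<lambda>m. LINT x|lebesgue_on K. (F m x - f x)\<^sup>2) \<longlonglongrightarrow> 0"
      if "\<And>m. F m \<in> L2 \<Omega>" "f \<in> L2 \<Omega>" "(\<lambda>m. LINT x:\<Omega>|lebesgue. (F m x - f x)\<^sup>2) \<longlonglongrightarrow> 0" for F f
    proof (rule tendsto_sandwich[OF _ _ tendsto_const that(3)])
      show "\<forall>\<^sub>F m in sequentially. 0 \<le> (LINT x|lebesgue_on K. (F m x - f x)\<^sup>2)"
        by (intro always_eventually allI Bochner_Integration.integral_nonneg) simp
      show "\<forall>\<^sub>F m in sequentially. (LINT x|lebesgue_on K. (F m x - f x)\<^sup>2) \<le> (LINT x:\<Omega>|lebesgue. (F m x - f x)\<^sup>2)"
        using restr[OF sqd[OF that(1,2)] zero_le_power2] unfolding set_lebesgue_on(2)[OF S] by (intro always_eventually allI) simp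
    qed
    obtain C where C: "\<And>x. x \<in> K \<Longrightarrow> \<bar>\<psi> x\<bar> \<le> C" using continuous_on_compact_bound[OF K(1) \<psi>] by blast
    then have C': "\<forall>x\<in>space (lebesgue_on K). \<bar>\<psi> x\<bar> \<le> C" by simp
    have \<psi>m: "\<psi> \<in> borel_measurable (lebesgue_on K)"
      using continuous_imp_measurable_on_sets_lebesgue[OF \<psi> KS] .
    have aeK: "AE x in lebesgue_on K. (\<lambda>m. regnorm (\<epsilon> m) (V m x)) \<longlonglongrightarrow> regnorm e (v x) \<and>
       (regnorm e (v x) \<noteq> 0 \<longrightarrow> (\<lambda>m. V m x) \<longlonglongrightarrow> v x) \<and> (regnorm e (v x) = 0 \<longrightarrow> (\<forall>m. V m x = 0))"
      unfolding AE_lebesgue_on_iff[OF KS] using ae by eventually_elim (use K(2) in blast)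
    have quolim: "AE x in lebesgue_on K. (\<lambda>m. (V m x $ \<alpha> / regnorm (\<epsilon> m) (V m x)) * b x) \<longlonglongrightarrow> (v x $ \<alpha> / regnorm e (v x)) * b x" for \<alpha> b
      using aeK
    proof eventually_elim
      case (elim x)
      show ?case
      proof (cases "regnorm e (v x) = 0")
        case True
        then show ?thesis using elim by simp
      next
        case False
        then show ?thesis using elim
          by (intro tendsto_mult tendsto_divide tendsto_vec_nth tendsto_const) auto
      qed
    qed
    have elim0: "AE x in lebesgue_on K. (\<lambda>m. (\<epsilon> m / regnorm (\<epsilon> m) (V m x)) * e) \<longlonglongrightarrow> (e / regnorm e (v x)) * e"
      using aeK
    proof eventually_elim
      case (elim x)
      show ?case
      proof (cases "e = 0")
        case False
        then have "regnorm e (v x) \<noteq> 0" using regnorm_ge(1)[of e "v x"] by auto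
        then show ?thesis using elim by (intro tendsto_mult tendsto_divide tendsto_const e) auto
      qed simp
    qed
    note P1 = integral_bounded_times_L2_tendsto[OF quom[OF V] quom[OF v] meas[OF V] meas[OF v] \<psi>m
        regnorm_quotient_le(2) regnorm_quotient_le(2) quolim C' sqK[OF v] conjunct1[OF restr[OF sqd[OF V v] zero_le_power2]] limK[OF V v Vlim]]
    note P2 = integral_bounded_times_L2_tendsto[OF quom[OF V] quom[OF v] meas[OF D] meas[OF d] \<psi>m
        regnorm_quotient_le(2) regnorm_quotient_le(2) quolim C' sqK[OF d] conjunct1[OF restr[OF sqd[OF D d] zero_le_power2]] limK[OF D d Dlim]]
    have ec: "(\<lambda>m. LINT x|lebesgue_on K. (\<epsilon> m - e)\<^sup>2) \<longlonglongrightarrow> 0"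
    proof -
      have "(\<lambda>m. measure (lebesgue_on K) (space (lebesgue_on K)) * (\<epsilon> m - e)\<^sup>2) \<longlonglongrightarrow> measure (lebesgue_on K) (space (lebesgue_on K)) * (e - e)\<^sup>2"
        by (intro tendsto_intros e)
      then show ?thesis by simp
    qed
    note P3 = integral_bounded_times_L2_tendsto[OF quom'[OF V] quom'[OF v] borel_measurable_const borel_measurable_const \<psi>m
        regnorm_quotient_le(1) regnorm_quotient_le(1) elim0 C' integrable_const integrable_const ec]
    have s1: "\<psi> x * regnorm t (w x) = (\<Sum>\<alpha>\<in>UNIV. (w x $ \<alpha> / regnorm t (w x)) * w x $ \<alpha> * \<psi> x) + (t / regnorm t (w x)) * t * \<psi> x"
      for t w x
      by (subst regnorm_eq_sum) (simp add: distrib_left sum_distrib_left mult_ac)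
    have s2: "\<psi> x * (\<Sum>\<alpha>\<in>UNIV. (w x $ \<alpha> / regnorm t (w x)) * z x $ \<alpha>) = (\<Sum>\<alpha>\<in>UNIV. (w x $ \<alpha> / regnorm t (w x)) * z x $ \<alpha> * \<psi> x)"
      for t w x and z :: "real^'n \<Rightarrow> real^'n"
      by (simp add: sum_distrib_left mult_ac)
    have I1: "integrable (lebesgue_on K) (\<lambda>x. \<psi> x * regnorm e (v x))"
      unfolding s1 by (intro Bochner_Integration.integrable_add Bochner_Integration.integrable_sum P1(2) P3(2))
    have I2: "integrable (lebesgue_on K) (\<lambda>x. \<psi> x * (\<Sum>\<alpha>\<in>UNIV. (v x $ \<alpha> / regnorm e (v x)) * d x $ \<alpha>))"
      unfolding s2 by (intro Bochner_Integration.integrable_sum P2(2))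
    have T1: "(\<lambda>m. LINT x|lebesgue_on K. \<psi> x * regnorm (\<epsilon> m) (V m x)) \<longlonglongrightarrow> (LINT x|lebesgue_on K. \<psi> x * regnorm e (v x))"
    proof -
      have l: "(LINT x|lebesgue_on K. \<psi> x * regnorm (\<epsilon> m) (V m x)) =
        (\<Sum>\<alpha>\<in>UNIV. LINT x|lebesgue_on K. (V m x $ \<alpha> / regnorm (\<epsilon> m) (V m x)) * V m x $ \<alpha> * \<psi> x)
        + (LINT x|lebesgue_on K. (\<epsilon> m / regnorm (\<epsilon> m) (V m x)) * \<epsilon> m * \<psi> x)" for m
        unfolding s1
        by (subst Bochner_Integration.integral_add[OF Bochner_Integration.integrable_sum[OF P1(1)] P3(1)])
           (subst Bochner_Integration.integral_sum[OF P1(1)], rule refl)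
      have r: "(LINT x|lebesgue_on K. \<psi> x * regnorm e (v x)) =
        (\<Sum>\<alpha>\<in>UNIV. LINT x|lebesgue_on K. (v x $ \<alpha> / regnorm e (v x)) * v x $ \<alpha> * \<psi> x)
        + (LINT x|lebesgue_on K. (e / regnorm e (v x)) * e * \<psi> x)"
        unfolding s1
        by (subst Bochner_Integration.integral_add[OF Bochner_Integration.integrable_sum[OF P1(2)] P3(2)])
           (subst Bochner_Integration.integral_sum[OF P1(2)], rule refl)
      show ?thesis unfolding l r by (intro tendsto_add tendsto_sum P1(3) P3(3))
    qed
    have T2: "(\<lambda>m. LINT x|lebesgue_on K. \<psi> x * (\<Sum>\<alpha>\<in>UNIV. (V m x $ \<alpha> / regnorm (\<epsilon> m) (V m x)) * D m x $ \<alpha>)) \<longlonglongrightarrow>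
        (LINT x|lebesgue_on K. \<psi> x * (\<Sum>\<alpha>\<in>UNIV. (v x $ \<alpha> / regnorm e (v x)) * d x $ \<alpha>))"
      unfolding s2 Bochner_Integration.integral_sum[OF P2(1)] Bochner_Integration.integral_sum[OF P2(2)]
      by (intro tendsto_sum P2(3))
    show ?thesis using I1 I2 T1 T2 by blast
  qed
  have loc: "f \<in> L1_loc \<Omega>" if "\<And>K \<psi>. compact K \<Longrightarrow> K \<subseteq> \<Omega> \<Longrightarrow> continuous_on K \<psi> \<Longrightarrow> integrable (lebesgue_on K) (\<lambda>x. \<psi> x * f x)" for f
    unfolding L1_loc_def
  proof (intro CollectI allI impI, elim conjE)
    fix K :: "(real^'n) set" assume K: "compact K" "K \<subseteq> \<Omega>"
    have KS: "K \<in> sets lebesgue" using K(1) by (simp add: borel_compact)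
    show "set_integrable lebesgue K f"
      unfolding set_lebesgue_on(1)[OF KS] using that[OF K continuous_on_const[of K 1]] by simp
  qed
  show ?thesis
    unfolding has_wderiv_def
  proof (intro conjI ballI)
    show "(\<lambda>x. regnorm e (v x)) \<in> L1_loc \<Omega>" by (rule loc) (use main in blast)
    show "(\<lambda>x. \<Sum>\<alpha>\<in>UNIV. (v x $ \<alpha> / regnorm e (v x)) * d x $ \<alpha>) \<in> L1_loc \<Omega>" by (rule loc) (use main in blast)
    fix \<phi> assume \<phi>: "\<phi> \<in> test_fun \<Omega>"
    obtain K where K: "compact K" "K \<subseteq> \<Omega>" "\<And>x. x \<notin> K \<Longrightarrow> \<phi> x = 0" "\<And>i x. x \<notin> K \<Longrightarrow> pd i \<phi> x = 0"
      using test_funE[OF \<phi>] by metis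
    have KS: "K \<in> sets lebesgue" using K(1) by (simp add: borel_compact)
    have e1: "(LINT x:\<Omega>|lebesgue. f x * pd i \<phi> x) = (LINT x|lebesgue_on K. pd i \<phi> x * f x)" for f
      unfolding set_lebesgue_on(2)[OF KS, symmetric] mult.commute[of _ "f x" for x]
      by (rule LINT_restrict[OF K(2)]) (subst K(4), assumption, rule mult_zero_right)
    have e2: "(LINT x:\<Omega>|lebesgue. f x * \<phi> x) = (LINT x|lebesgue_on K. \<phi> x * f x)" for f
      unfolding set_lebesgue_on(2)[OF KS, symmetric] mult.commute[of _ "f x" for x]
      by (rule LINT_restrict[OF K(2)]) (subst K(3), assumption, rule mult_zero_right)
    have c1: "continuous_on K (pd i \<phi>)" and c2: "continuous_on K \<phi>"
      by (intro smooth_continuous smooth_pd test_fun_smooth[OF \<phi>])+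
    have eq: "(LINT x|lebesgue_on K. pd i \<phi> x * regnorm (\<epsilon> m) (V m x)) =
       - (LINT x|lebesgue_on K. \<phi> x * (\<Sum>\<alpha>\<in>UNIV. (V m x $ \<alpha> / regnorm (\<epsilon> m) (V m x)) * D m x $ \<alpha>))" for m
      using h[of m] \<phi> unfolding has_wderiv_def e1[symmetric] e2[symmetric] by blast
    have m1: "(\<lambda>m. LINT x|lebesgue_on K. pd i \<phi> x * regnorm (\<epsilon> m) (V m x)) \<longlonglongrightarrow> (LINT x|lebesgue_on K. pd i \<phi> x * regnorm e (v x))"
      using main[OF K(1,2) c1] by blast
    have m2: "(\<lambda>m. LINT x|lebesgue_on K. \<phi> x * (\<Sum>\<alpha>\<in>UNIV. (V m x $ \<alpha> / regnorm (\<epsilon> m) (V m x)) * D m x $ \<alpha>)) \<longlonglongrightarrow>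
        (LINT x|lebesgue_on K. \<phi> x * (\<Sum>\<alpha>\<in>UNIV. (v x $ \<alpha> / regnorm e (v x)) * d x $ \<alpha>))"
      using main[OF K(1,2) c2] by blast
    show "(LINT x:\<Omega>|lebesgue. regnorm e (v x) * pd i \<phi> x) =
      - (LINT x:\<Omega>|lebesgue. (\<Sum>\<alpha>\<in>UNIV. (v x $ \<alpha> / regnorm e (v x)) * d x $ \<alpha>) * \<phi> x)"
      unfolding e1 e2 using LIMSEQ_unique[OF m1[unfolded eq] tendsto_minus[OF m2]] .
  qed
qed

lemma half_inverse_times_double: "inverse N / 2 * (2 * S) = S / (N::real)"
  by (simp add: field_simps)

lemma has_wderiv_regnorm_smooth:
  fixes V :: "real^'n::finite \<Rightarrow> real^'n"
  assumes \<Omega>: "open \<Omega>" and e: "e > 0" and V: "\<And>\<alpha>. smooth (\<lambda>x. V x $ \<alpha>)"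
  shows "has_wderiv \<Omega> i (\<lambda>x. regnorm e (V x)) (\<lambda>x. \<Sum>\<alpha>\<in>UNIV. (V x $ \<alpha> / regnorm e (V x)) * pd i (\<lambda>x. V x $ \<alpha>) x)"
proof -
  let ?h = "\<lambda>x. regnorm e (V x)"
  define p where "p x = e\<^sup>2 + (\<Sum>\<alpha>\<in>UNIV. V x $ \<alpha> * V x $ \<alpha>)" for x
  have eq: "?h = (\<lambda>x. sqrt (p x))"
    by (simp add: regnorm_def inner_vec_def p_def)
  have ps: "smooth p"
    unfolding p_def by (intro smooth_add smooth_const smooth_sum smooth_mult V)
  have pos: "0 < p x" for x
    unfolding p_def using e by (intro add_pos_nonneg sum_nonneg) auto
  have hd: "(p has_derivative
      (\<lambda>h. 0 + (\<Sum>\<alpha>\<in>UNIV. V x $ \<alpha> * frechet_derivative (\<lambda>x. V x $ \<alpha>) (at x) h + frechet_derivative (\<lambda>x. V x $ \<alpha>) (at x) h * V x $ \<alpha>))) (at x)" for x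
    unfolding p_def
    by (intro has_derivative_add has_derivative_const has_derivative_sum has_derivative_mult smooth_has_derivative V)
  have pdp: "pd i p x = 2 * (\<Sum>\<alpha>\<in>UNIV. V x $ \<alpha> * pd i (\<lambda>x. V x $ \<alpha>) x)" for x
  proof -
    note pd_eqI[OF hd, of i x]
    also have "0 + (\<Sum>\<alpha>\<in>UNIV. V x $ \<alpha> * frechet_derivative (\<lambda>x. V x $ \<alpha>) (at x) (axis i 1) + frechet_derivative (\<lambda>x. V x $ \<alpha>) (at x) (axis i 1) * V x $ \<alpha>)
        = 2 * (\<Sum>\<alpha>\<in>UNIV. V x $ \<alpha> * pd i (\<lambda>x. V x $ \<alpha>) x)"
      unfolding pd_def sum_distrib_left by (simp add: mult.commute)
    finally show ?thesis .
  qed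
  have hp: "regnorm e (V x) = sqrt (p x)" for x using fun_cong[OF eq] .
  have sq: "(sqrt has_real_derivative inverse (sqrt (p x)) / 2) (at (p x))" for x
    by (rule DERIV_real_sqrt[OF pos])
  have diff: "?h differentiable (at x)" for x
    unfolding hp by (rule differentiable_compose_real[OF smooth_differentiable[OF ps] sq])
  have pdh: "pd i ?h x = (\<Sum>\<alpha>\<in>UNIV. (V x $ \<alpha> / regnorm e (V x)) * pd i (\<lambda>x. V x $ \<alpha>) x)" for x
  proof -
    have "pd i ?h x = inverse (sqrt (p x)) / 2 * pd i p x"
      unfolding hp by (rule pd_compose[OF smooth_differentiable[OF ps] sq])
    also have "\<dots> = inverse (sqrt (p x)) / 2 * (2 * (\<Sum>\<alpha>\<in>UNIV. V x $ \<alpha> * pd i (\<lambda>x. V x $ \<alpha>) x))"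
      by (rule arg_cong[OF pdp])
    also have "\<dots> = (\<Sum>\<alpha>\<in>UNIV. V x $ \<alpha> * pd i (\<lambda>x. V x $ \<alpha>) x) / sqrt (p x)"
      by (rule half_inverse_times_double)
    also have "\<dots> = (\<Sum>\<alpha>\<in>UNIV. (V x $ \<alpha> / sqrt (p x)) * pd i (\<lambda>x. V x $ \<alpha>) x)"
      unfolding sum_divide_distrib by (intro sum.cong refl times_divide_eq_left[symmetric])
    finally show ?thesis unfolding hp .
  qed
  have hc: "continuous_on A ?h" for A
    unfolding hp by (intro continuous_on_real_sqrt smooth_continuous ps)
  have pc: "continuous_on A (pd i ?h)" for A
  proof -
    have "continuous_on A (\<lambda>x. \<Sum>\<alpha>\<in>UNIV. (V x $ \<alpha> / regnorm e (V x)) * pd i (\<lambda>x. V x $ \<alpha>) x)"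
      by (intro continuous_on_sum continuous_on_mult continuous_on_divide hc smooth_continuous smooth_pd V)
         (intro ballI less_imp_neq[OF regnorm_pos[OF e], symmetric])
    then show ?thesis unfolding pdh .
  qed
  have "has_wderiv \<Omega> i ?h (pd i ?h)"
    unfolding has_wderiv_def
  proof (intro conjI ballI continuous_L1_loc hc pc)
    fix \<phi> assume \<phi>: "\<phi> \<in> test_fun \<Omega>"
    obtain K where K: "compact K" "K \<subseteq> \<Omega>" "\<And>x. x \<notin> K \<Longrightarrow> \<phi> x = 0" using test_funE[OF \<phi>] by metis
    show "(LINT x:\<Omega>|lebesgue. ?h x * pd i \<phi> x) = - (LINT x:\<Omega>|lebesgue. pd i ?h x * \<phi> x)"
      by (rule integration_by_parts_test_fun[OF \<phi> K \<Omega> order_refl diff pc])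
  qed
  moreover have "pd i ?h = (\<lambda>x. \<Sum>\<alpha>\<in>UNIV. (V x $ \<alpha> / regnorm e (V x)) * pd i (\<lambda>x. V x $ \<alpha>) x)"
    by (rule ext) (rule pdh)
  ultimately show ?thesis by simp
qed

text \<open>First smooth functions converge to \<open>v\<close> at a fixed regularisation, then the regularisation is removed.
  Division by \<open>0\<close> gives the derivative \<open>0\<close> where \<open>v\<close> vanishes.\<close>

lemma has_wderiv_norm:
  fixes \<Omega> :: "(real^'n::finite) set" and v :: "real^'n \<Rightarrow> real^'n"
  assumes \<Omega>: "open \<Omega>" and v: "v \<in> W12_0_vec \<Omega>"
  shows "has_wderiv \<Omega> i (\<lambda>x. norm (v x)) (\<lambda>x. \<Sum>\<alpha>\<in>UNIV. (v x $ \<alpha> / norm (v x)) * wjac \<Omega> v x $ \<alpha> $ i)"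
proof -
  have S: "\<Omega> \<in> sets lebesgue" using \<Omega> by (simp add: borel_open)
  define d where "d x = (\<chi> \<alpha>. wderiv \<Omega> i (\<lambda>y. v y $ \<alpha>) x)" for x
  have v0: "(\<lambda>x. v x $ \<alpha>) \<in> W12_0 \<Omega>" for \<alpha> using v unfolding W12_0_vec_def by blast
  then have vW: "(\<lambda>x. v x $ \<alpha>) \<in> W12 \<Omega>" for \<alpha> unfolding W12_0_def by blast
  then have vL: "(\<lambda>x. v x $ \<alpha>) \<in> L2 \<Omega>" for \<alpha> unfolding W12_def by blast
  have dL: "(\<lambda>x. d x $ \<alpha>) \<in> L2 \<Omega>" for \<alpha> unfolding d_def using wderiv_L2(1)[OF \<Omega> vW] by simp
  have "\<forall>\<alpha>. \<exists>\<phi> :: nat \<Rightarrow> real^'n \<Rightarrow> real. (\<forall>m. \<phi> m \<in> test_fun \<Omega>) \<and>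
     (\<lambda>m. LINT x:\<Omega>|lebesgue. (v x $ \<alpha> - \<phi> m x)\<^sup>2) \<longlonglongrightarrow> 0 \<and>
     (\<lambda>m. LINT x:\<Omega>|lebesgue. (d x $ \<alpha> - pd i (\<phi> m) x)\<^sup>2) \<longlonglongrightarrow> 0"
  proof
    fix \<alpha>
    obtain \<phi> :: "nat \<Rightarrow> real^'n \<Rightarrow> real" where "\<And>m. \<phi> m \<in> test_fun \<Omega>"
      "(\<lambda>m. LINT x:\<Omega>|lebesgue. (v x $ \<alpha> - \<phi> m x)\<^sup>2) \<longlonglongrightarrow> 0"
      "\<And>i. (\<lambda>m. LINT x:\<Omega>|lebesgue. (wderiv \<Omega> i (\<lambda>x. v x $ \<alpha>) x - pd i (\<phi> m) x)\<^sup>2) \<longlonglongrightarrow> 0"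
      using v0[of \<alpha>] unfolding W12_0_def by blast
    then show "\<exists>\<phi> :: nat \<Rightarrow> real^'n \<Rightarrow> real. (\<forall>m. \<phi> m \<in> test_fun \<Omega>) \<and>
     (\<lambda>m. LINT x:\<Omega>|lebesgue. (v x $ \<alpha> - \<phi> m x)\<^sup>2) \<longlonglongrightarrow> 0 \<and>
     (\<lambda>m. LINT x:\<Omega>|lebesgue. (d x $ \<alpha> - pd i (\<phi> m) x)\<^sup>2) \<longlonglongrightarrow> 0"
      unfolding d_def by (intro exI[of _ \<phi>]) simp
  qed
  from choice[OF this] obtain \<phi> :: "'n \<Rightarrow> nat \<Rightarrow> real^'n \<Rightarrow> real" where \<phi>: "\<And>\<alpha> m. \<phi> \<alpha> m \<in> test_fun \<Omega>"
     "\<And>\<alpha>. (\<lambda>m. LINT x:\<Omega>|lebesgue. (v x $ \<alpha> - \<phi> \<alpha> m x)\<^sup>2) \<longlonglongrightarrow> 0"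
     "\<And>\<alpha>. (\<lambda>m. LINT x:\<Omega>|lebesgue. (d x $ \<alpha> - pd i (\<phi> \<alpha> m) x)\<^sup>2) \<longlonglongrightarrow> 0" by blast
  define V where "V m x = (\<chi> \<alpha>. \<phi> \<alpha> m x)" for m x
  define D where "D m x = (\<chi> \<alpha>. pd i (\<phi> \<alpha> m) x)" for m x
  have VL: "(\<lambda>x. V m x $ \<alpha>) \<in> L2 \<Omega>" and DL: "(\<lambda>x. D m x $ \<alpha>) \<in> L2 \<Omega>" for m \<alpha>
    unfolding V_def D_def by (simp_all add: test_fun_L2[OF \<Omega> \<phi>(1)] test_fun_L2[OF \<Omega> test_fun_pd[OF \<phi>(1)]])
  have Vlim: "(\<lambda>m. LINT x:\<Omega>|lebesgue. (V m x $ \<alpha> - v x $ \<alpha>)\<^sup>2) \<longlonglongrightarrow> 0" for \<alpha>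
    unfolding V_def using \<phi>(2)[of \<alpha>] by (simp add: power2_commute)
  have Dlim: "(\<lambda>m. LINT x:\<Omega>|lebesgue. (D m x $ \<alpha> - d x $ \<alpha>)\<^sup>2) \<longlonglongrightarrow> 0" for \<alpha>
    unfolding D_def using \<phi>(3)[of \<alpha>] by (simp add: power2_commute)
  have sqi: "integrable (lebesgue_on \<Omega>) (\<lambda>x. (V m x $ \<alpha> - v x $ \<alpha>)\<^sup>2)" for m \<alpha>
    using VL[of m \<alpha>] vL[of \<alpha>] unfolding L2_iff[OF S] by (intro integrable_square_diff) auto
  have "\<exists>s::nat\<Rightarrow>nat. strict_mono s \<and> (AE x in lebesgue_on \<Omega>. (\<lambda>m. \<Sum>\<alpha>\<in>UNIV. (V (s m) x $ \<alpha> - v x $ \<alpha>)\<^sup>2) \<longlonglongrightarrow> 0)"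
  proof (rule tendsto_L1_AE_subseq)
    show "integrable (lebesgue_on \<Omega>) (\<lambda>x. \<Sum>\<alpha>\<in>UNIV. (V m x $ \<alpha> - v x $ \<alpha>)\<^sup>2)" for m
      by (intro Bochner_Integration.integrable_sum sqi)
    have "(\<lambda>m. \<Sum>\<alpha>\<in>UNIV. LINT x|lebesgue_on \<Omega>. (V m x $ \<alpha> - v x $ \<alpha>)\<^sup>2) \<longlonglongrightarrow> (\<Sum>\<alpha>\<in>(UNIV::'n set). 0)"
      by (intro tendsto_sum Vlim[unfolded set_lebesgue_on(2)[OF S]])
    moreover have "(LINT x|lebesgue_on \<Omega>. norm (\<Sum>\<alpha>\<in>UNIV. (V m x $ \<alpha> - v x $ \<alpha>)\<^sup>2)) = (\<Sum>\<alpha>\<in>UNIV. LINT x|lebesgue_on \<Omega>. (V m x $ \<alpha> - v x $ \<alpha>)\<^sup>2)" for m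
      unfolding Bochner_Integration.integral_sum[OF sqi, symmetric] by (simp add: sum_nonneg)
    ultimately show "(\<lambda>m. LINT x|lebesgue_on \<Omega>. norm (\<Sum>\<alpha>\<in>UNIV. (V m x $ \<alpha> - v x $ \<alpha>)\<^sup>2)) \<longlonglongrightarrow> 0" by simp
  qed
  then obtain s :: "nat \<Rightarrow> nat" where s: "strict_mono s"
    "AE x in lebesgue_on \<Omega>. (\<lambda>m. \<Sum>\<alpha>\<in>UNIV. (V (s m) x $ \<alpha> - v x $ \<alpha>)\<^sup>2) \<longlonglongrightarrow> 0" by blast
  have AEV: "AE x in lebesgue. x \<in> \<Omega> \<longrightarrow> (\<lambda>m. V (s m) x) \<longlonglongrightarrow> v x"
    using s(2) unfolding AE_lebesgue_on_iff[OF S]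
  proof eventually_elim
    case (elim x)
    show ?case
    proof
      assume x: "x \<in> \<Omega>"
      show "(\<lambda>m. V (s m) x) \<longlonglongrightarrow> v x"
      proof (rule vec_tendstoI)
        fix \<alpha>
        have "(\<lambda>m. (V (s m) x $ \<alpha> - v x $ \<alpha>)\<^sup>2) \<longlonglongrightarrow> 0"
        proof (rule tendsto_sandwich[OF _ _ tendsto_const elim[rule_format, OF x]])
          show "\<forall>\<^sub>F m in sequentially. (V (s m) x $ \<alpha> - v x $ \<alpha>)\<^sup>2 \<le> (\<Sum>\<alpha>\<in>UNIV. (V (s m) x $ \<alpha> - v x $ \<alpha>)\<^sup>2)"
            by (intro always_eventually allI member_le_sum) auto
        qed simp
        then have "(\<lambda>m. V (s m) x $ \<alpha> - v x $ \<alpha>) \<longlonglongrightarrow> 0" by simp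
        then show "(\<lambda>m. V (s m) x $ \<alpha>) \<longlonglongrightarrow> v x $ \<alpha>" by (rule LIM_zero_cancel)
      qed
    qed
  qed
  have step1: "has_wderiv \<Omega> i (\<lambda>x. regnorm e (v x)) (\<lambda>x. \<Sum>\<alpha>\<in>UNIV. (v x $ \<alpha> / regnorm e (v x)) * d x $ \<alpha>)" if e: "e > 0" for e
  proof (rule has_wderiv_regnorm_limit[OF \<Omega> VL DL vL dL _ _ tendsto_const])
    show "(\<lambda>m. LINT x:\<Omega>|lebesgue. (V (s m) x $ \<alpha> - v x $ \<alpha>)\<^sup>2) \<longlonglongrightarrow> 0" for \<alpha>
      using LIMSEQ_subseq_LIMSEQ[OF Vlim s(1)] by (simp add: o_def)
    show "(\<lambda>m. LINT x:\<Omega>|lebesgue. (D (s m) x $ \<alpha> - d x $ \<alpha>)\<^sup>2) \<longlonglongrightarrow> 0" for \<alpha>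
      using LIMSEQ_subseq_LIMSEQ[OF Dlim s(1)] by (simp add: o_def)
    show "AE x in lebesgue. x \<in> \<Omega> \<longrightarrow> (\<lambda>m. regnorm e (V (s m) x)) \<longlonglongrightarrow> regnorm e (v x) \<and>
       (regnorm e (v x) \<noteq> 0 \<longrightarrow> (\<lambda>m. V (s m) x) \<longlonglongrightarrow> v x) \<and> (regnorm e (v x) = 0 \<longrightarrow> (\<forall>m. V (s m) x = 0))"
      using AEV
    proof eventually_elim
      case (elim x)
      show ?case
      proof
        assume "x \<in> \<Omega>"
        then have l: "(\<lambda>m. V (s m) x) \<longlonglongrightarrow> v x" using elim by blast
        then have "(\<lambda>m. regnorm e (V (s m) x)) \<longlonglongrightarrow> regnorm e (v x)" unfolding regnorm_def by (intro tendsto_intros)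
        then show "(\<lambda>m. regnorm e (V (s m) x)) \<longlonglongrightarrow> regnorm e (v x) \<and>
          (regnorm e (v x) \<noteq> 0 \<longrightarrow> (\<lambda>m. V (s m) x) \<longlonglongrightarrow> v x) \<and> (regnorm e (v x) = 0 \<longrightarrow> (\<forall>m. V (s m) x = 0))"
          using l regnorm_pos[OF e, of "v x"] by simp
      qed
    qed
    have sm: "smooth (\<lambda>x. V (s m) x $ \<alpha>)" for m \<alpha> unfolding V_def by (simp add: test_fun_smooth[OF \<phi>(1)])
    have "pd i (\<lambda>x. V (s m) x $ \<alpha>) x = D (s m) x $ \<alpha>" for m \<alpha> x unfolding V_def D_def by simp
    then show "has_wderiv \<Omega> i (\<lambda>x. regnorm e (V (s m) x)) (\<lambda>x. \<Sum>\<alpha>\<in>UNIV. (V (s m) x $ \<alpha> / regnorm e (V (s m) x)) * D (s m) x $ \<alpha>)" for m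
      using has_wderiv_regnorm_smooth[OF \<Omega> e sm, of i m] by simp
  qed
  have "has_wderiv \<Omega> i (\<lambda>x. regnorm 0 (v x)) (\<lambda>x. \<Sum>\<alpha>\<in>UNIV. (v x $ \<alpha> / regnorm 0 (v x)) * d x $ \<alpha>)"
  proof (rule has_wderiv_regnorm_limit[OF \<Omega> vL dL vL dL _ _ inverse_Suc_tendsto_0])
    show "has_wderiv \<Omega> i (\<lambda>x. regnorm (1 / real (Suc m)) (v x)) (\<lambda>x. \<Sum>\<alpha>\<in>UNIV. (v x $ \<alpha> / regnorm (1 / real (Suc m)) (v x)) * d x $ \<alpha>)" for m
      by (rule step1) simp
    have "(\<lambda>m. regnorm (1 / real (Suc m)) (v x)) \<longlonglongrightarrow> regnorm 0 (v x)" for x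
      unfolding regnorm_def by (intro tendsto_intros inverse_Suc_tendsto_0)
    then show "AE x in lebesgue. x \<in> \<Omega> \<longrightarrow> (\<lambda>m. regnorm (1 / real (Suc m)) (v x)) \<longlonglongrightarrow> regnorm 0 (v x) \<and>
       (regnorm 0 (v x) \<noteq> 0 \<longrightarrow> (\<lambda>m. v x) \<longlonglongrightarrow> v x) \<and> (regnorm 0 (v x) = 0 \<longrightarrow> (\<forall>m::nat. v x = 0))"
      by (intro AE_I2) (simp add: regnorm_0 del: of_nat_Suc)
  qed simp_all
  then show ?thesis unfolding regnorm_0 d_def wjac_def by simp
qed

section \<open>The equivalent form of the system\<close>

text \<open>A region above a graph is open because the graph function is continuous, and it contains a point
  above each point of the hyperplane.\<close>

lemma lipschitz_domain_open_nonempty: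
  fixes \<Omega> :: "(real^'n::finite) set"
  assumes "bounded_lipschitz_domain \<Omega> \<or> lipschitz_graph_domain \<Omega>"
  shows "open \<Omega>" "\<Omega> \<noteq> {}"
proof -
  have "open \<Omega> \<and> \<Omega> \<noteq> {}" if "lipschitz_graph_domain \<Omega>"
  proof -
    obtain e \<psi> L where e: "norm e = 1" and L: "L-lipschitz_on {y. y \<bullet> e = 0} \<psi>" and \<Omega>: "\<Omega> = above_graph e \<psi>"
      using \<open>lipschitz_graph_domain \<Omega>\<close> unfolding lipschitz_graph_domain_def lipschitz_graph_fun_def by blast
    have ee: "e \<bullet> e = 1" using e by (simp add: dot_square_norm)
    have "continuous_on UNIV (\<lambda>x. \<psi> (x - (x \<bullet> e) *\<^sub>R e))"
      by (rule continuous_on_compose2[OF lipschitz_on_continuous_on[OF L]])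
         (auto intro!: continuous_intros simp: inner_diff_left ee)
    then have "open {x. \<psi> (x - (x \<bullet> e) *\<^sub>R e) < x \<bullet> e}"
      by (intro open_Collect_less continuous_intros)
    moreover have "(\<psi> 0 + 1) *\<^sub>R e \<in> \<Omega>" unfolding \<Omega> above_graph_def by (simp add: ee)
    ultimately show ?thesis unfolding \<Omega> above_graph_def by blast
  qed
  then show "open \<Omega>" "\<Omega> \<noteq> {}" using assms unfolding bounded_lipschitz_domain_def by blast+
qed

lemma lame_B_eq:
  "lame_B \<Omega> r x h \<alpha> \<beta> = (if h = \<alpha> then wderiv \<Omega> \<beta> r x else 0) - (if h = \<beta> then wderiv \<Omega> \<alpha> r x else 0)"
proof -
  have "wderiv \<Omega> k r x * (kron h \<alpha> * kron k \<beta> - kron h \<beta> * kron k \<alpha>)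
     = (if k = \<beta> then if h = \<alpha> then wderiv \<Omega> \<beta> r x else 0 else 0) - (if k = \<alpha> then if h = \<beta> then wderiv \<Omega> \<alpha> r x else 0 else 0)" for k
    by (auto simp: kron_def)
  then show ?thesis unfolding lame_B_def by (simp add: sum_subtractf)
qed

text \<open>The terms with \<open>r\<close> are separated from the stress.\<close>

lemma lame_A_contraction:
  "(\<Sum>h\<in>UNIV. \<Sum>k\<in>UNIV. \<Sum>\<beta>\<in>UNIV. lame_A lam mu r x h k \<alpha> \<beta> * wjac \<Omega> u x $ \<beta> $ k * p h)
   = (\<Sum>h\<in>UNIV. lame_stress \<Omega> lam mu u x $ \<alpha> $ h * p h)
     + (\<Sum>h\<in>UNIV. r x * (wjac \<Omega> u x $ h $ h * p \<alpha> - wjac \<Omega> u x $ h $ \<alpha> * p h))"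
proof -
  let ?\<xi> = "wjac \<Omega> u x"
  have e: "lame_A lam mu r x h k \<alpha> \<beta> * ?\<xi> $ \<beta> $ k * p h
     = (if k = h then if \<beta> = \<alpha> then mu x * ?\<xi> $ \<alpha> $ h * p h else 0 else 0)
     + (if h = \<alpha> then if \<beta> = k then (lam x + r x) * ?\<xi> $ k $ k * p \<alpha> else 0 else 0)
     + (if k = \<alpha> then if \<beta> = h then (mu x - r x) * ?\<xi> $ h $ \<alpha> * p h else 0 else 0)" for h k \<beta>
    by (auto simp: lame_A_def kron_def algebra_simps)
  have "(\<Sum>h\<in>UNIV. \<Sum>k\<in>UNIV. \<Sum>\<beta>\<in>UNIV. if k = h then if \<beta> = \<alpha> then mu x * ?\<xi> $ \<alpha> $ h * p h else 0 else 0)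
      = (\<Sum>h\<in>UNIV. \<Sum>k\<in>UNIV. if k = h then mu x * ?\<xi> $ \<alpha> $ h * p h else 0)"
    by (intro sum.cong refl) simp
  then have s1: "(\<Sum>h\<in>UNIV. \<Sum>k\<in>UNIV. \<Sum>\<beta>\<in>UNIV. if k = h then if \<beta> = \<alpha> then mu x * ?\<xi> $ \<alpha> $ h * p h else 0 else 0)
      = (\<Sum>h\<in>UNIV. mu x * ?\<xi> $ \<alpha> $ h * p h)" by simp
  have "(\<Sum>h\<in>UNIV. \<Sum>k\<in>UNIV. \<Sum>\<beta>\<in>UNIV. if h = \<alpha> then if \<beta> = k then (lam x + r x) * ?\<xi> $ k $ k * p \<alpha> else 0 else 0)
      = (\<Sum>h\<in>UNIV. if h = \<alpha> then \<Sum>k\<in>UNIV. (lam x + r x) * ?\<xi> $ k $ k * p \<alpha> else 0)"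
    by (intro sum.cong refl) simp
  then have s2: "(\<Sum>h\<in>UNIV. \<Sum>k\<in>UNIV. \<Sum>\<beta>\<in>UNIV. if h = \<alpha> then if \<beta> = k then (lam x + r x) * ?\<xi> $ k $ k * p \<alpha> else 0 else 0)
      = (\<Sum>h\<in>UNIV. (lam x + r x) * ?\<xi> $ h $ h * p \<alpha>)" by simp
  have "(\<Sum>h\<in>UNIV. \<Sum>k\<in>UNIV. \<Sum>\<beta>\<in>UNIV. if k = \<alpha> then if \<beta> = h then (mu x - r x) * ?\<xi> $ h $ \<alpha> * p h else 0 else 0)
      = (\<Sum>h\<in>UNIV. \<Sum>k\<in>UNIV. if k = \<alpha> then (mu x - r x) * ?\<xi> $ h $ \<alpha> * p h else 0)"
    by (intro sum.cong refl) simp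
  then have s3: "(\<Sum>h\<in>UNIV. \<Sum>k\<in>UNIV. \<Sum>\<beta>\<in>UNIV. if k = \<alpha> then if \<beta> = h then (mu x - r x) * ?\<xi> $ h $ \<alpha> * p h else 0 else 0)
      = (\<Sum>h\<in>UNIV. (mu x - r x) * ?\<xi> $ h $ \<alpha> * p h)" by simp
  have st: "lame_stress \<Omega> lam mu u x $ \<alpha> $ h * p h
      = (if h = \<alpha> then lam x * trace ?\<xi> * p \<alpha> else 0) + mu x * (?\<xi> $ \<alpha> $ h + ?\<xi> $ h $ \<alpha>) * p h" for h
    by (auto simp: lame_stress_def mat_def transpose_def algebra_simps)
  have "(\<Sum>h\<in>UNIV. lame_stress \<Omega> lam mu u x $ \<alpha> $ h * p h)
      = lam x * trace ?\<xi> * p \<alpha> + (\<Sum>h\<in>UNIV. mu x * (?\<xi> $ \<alpha> $ h + ?\<xi> $ h $ \<alpha>) * p h)"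
    unfolding st sum.distrib by simp
  also have "lam x * trace ?\<xi> * p \<alpha> = (\<Sum>h\<in>UNIV. lam x * ?\<xi> $ h $ h * p \<alpha>)"
    unfolding trace_def by (simp add: sum_distrib_left sum_distrib_right)
  finally have st': "(\<Sum>h\<in>UNIV. lame_stress \<Omega> lam mu u x $ \<alpha> $ h * p h)
      = (\<Sum>h\<in>UNIV. lam x * ?\<xi> $ h $ h * p \<alpha>) + (\<Sum>h\<in>UNIV. mu x * (?\<xi> $ \<alpha> $ h + ?\<xi> $ h $ \<alpha>) * p h)" .
  show ?thesis
    unfolding e sum.distrib s1 s2 s3 st' unfolding sum.distrib[symmetric]
    by (intro sum.cong refl) (simp add: algebra_simps)
qed

lemma lame_B_contraction:
  "(\<Sum>h\<in>UNIV. \<Sum>\<beta>\<in>UNIV. lame_B \<Omega> r x h \<alpha> \<beta> * \<xi> $ \<beta> $ h * t)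
   = (\<Sum>h\<in>UNIV. (wderiv \<Omega> h r x * \<xi> $ h $ \<alpha> - wderiv \<Omega> \<alpha> r x * \<xi> $ h $ h) * t)"
proof -
  have e: "lame_B \<Omega> r x h \<alpha> \<beta> * \<xi> $ \<beta> $ h * t
      = (if h = \<alpha> then wderiv \<Omega> \<beta> r x * \<xi> $ \<beta> $ \<alpha> * t else 0) - (if \<beta> = h then wderiv \<Omega> \<alpha> r x * \<xi> $ h $ h * t else 0)" for h \<beta>
    unfolding lame_B_eq by (auto simp: algebra_simps)
  have "(\<Sum>h\<in>UNIV. \<Sum>\<beta>\<in>UNIV. if h = \<alpha> then wderiv \<Omega> \<beta> r x * \<xi> $ \<beta> $ \<alpha> * t else 0)
      = (\<Sum>h\<in>UNIV. if h = \<alpha> then \<Sum>\<beta>\<in>UNIV. wderiv \<Omega> \<beta> r x * \<xi> $ \<beta> $ \<alpha> * t else 0)"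
    by (intro sum.cong refl) simp
  then have "(\<Sum>h\<in>UNIV. \<Sum>\<beta>\<in>UNIV. if h = \<alpha> then wderiv \<Omega> \<beta> r x * \<xi> $ \<beta> $ \<alpha> * t else 0)
      = (\<Sum>h\<in>UNIV. wderiv \<Omega> h r x * \<xi> $ h $ \<alpha> * t)" by simp
  then show ?thesis unfolding e sum_subtractf by (simp add: sum_subtractf left_diff_distrib)
qed

lemma set_integral_sums:
  fixes f :: "'i \<Rightarrow> 'a \<Rightarrow> real"
  assumes "\<And>h. set_integrable M A (f h)"
  shows "set_integrable M A (\<lambda>x. \<Sum>h\<in>I. f h x)" "(LINT x:A|M. \<Sum>h\<in>I. f h x) = (\<Sum>h\<in>I. LINT x:A|M. f h x)"
  using assms unfolding set_integrable_def set_lebesgue_integral_def scaleR_sum_right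
  by (auto intro!: Bochner_Integration.integrable_sum Bochner_Integration.integral_sum)

text \<open>The terms with \<open>r\<close> form a null Lagrangian up to derivatives of \<open>r\<close>, and these are what \<open>lame_B\<close>
  collects.\<close>

lemma lame_op_eq_system_op:
  fixes \<Omega> :: "(real^'n::finite) set"
  assumes \<Omega>: "open \<Omega>" and lc: "continuous_on \<Omega> lam" and mc: "continuous_on \<Omega> mu" and rc: "continuous_on \<Omega> r"
    and r: "smooth_approx \<Omega> r F G" and u: "u \<in> W12_loc_vec \<Omega>" and \<phi>: "\<phi> \<in> test_fun \<Omega>"
  shows "lame_op \<Omega> lam mu u \<alpha> \<phi> = system_op \<Omega> (lame_A lam mu r) (lame_B \<Omega> r) u \<alpha> \<phi>"
proof -
  let ?\<xi> = "wjac \<Omega> u"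
  obtain K where K: "compact K" "K \<subseteq> \<Omega>" "\<And>x. x \<notin> K \<Longrightarrow> \<phi> x = 0" "\<And>i x. x \<notin> K \<Longrightarrow> pd i \<phi> x = 0"
    using test_funE[OF \<phi>] by metis
  have \<phi>s: "smooth \<phi>" by (rule test_fun_smooth[OF \<phi>])
  have wd: "has_wderiv \<Omega> k (\<lambda>y. u y $ \<beta>) (\<lambda>x. ?\<xi> x $ \<beta> $ k)" for k \<beta>
  proof -
    obtain g where "has_wderiv \<Omega> k (\<lambda>y. u y $ \<beta>) g" using u unfolding W12_loc_vec_def W12_loc_def by blast
    from wderiv_has_wderiv[OF this] show ?thesis by (simp add: wjac_def)
  qed
  have L1: "(\<lambda>x. ?\<xi> x $ \<beta> $ k) \<in> L1_loc \<Omega>" for k \<beta> using wd unfolding has_wderiv_def by blast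
  have int: "set_integrable lebesgue \<Omega> (\<lambda>x. ?\<xi> x $ \<beta> $ k * (c x * pd h \<phi> x))" if "continuous_on \<Omega> c" for c \<beta> k h
  proof (rule set_integrable_mult_continuous[OF _ K(1,2)])
    show "set_integrable lebesgue K (\<lambda>x. ?\<xi> x $ \<beta> $ k)" using L1 K unfolding L1_loc_def by blast
    show "continuous_on K (\<lambda>x. c x * pd h \<phi> x)"
      by (intro continuous_on_mult continuous_on_subset[OF that K(2)] smooth_continuous smooth_pd \<phi>s)
    show "?\<xi> x $ \<beta> $ k * (c x * pd h \<phi> x) = 0" if "x \<in> \<Omega> - K" for x using that K(4)[of x h] by simp
  qed
  define st where "st x = (\<Sum>h\<in>UNIV. lame_stress \<Omega> lam mu u x $ \<alpha> $ h * pd h \<phi> x)" for x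
  define p where "p h x = r x * (?\<xi> x $ h $ h * pd \<alpha> \<phi> x - ?\<xi> x $ h $ \<alpha> * pd h \<phi> x)" for h x
  define t where "t h x = ?\<xi> x $ h $ h * (r x * pd \<alpha> \<phi> x + G \<alpha> x * \<phi> x) - ?\<xi> x $ h $ \<alpha> * (r x * pd h \<phi> x + G h x * \<phi> x)" for h x
  have ist: "set_integrable lebesgue \<Omega> st"
  proof -
    have e: "st x = (\<Sum>h\<in>UNIV. (\<Sum>j\<in>UNIV. ?\<xi> x $ j $ j * ((if \<alpha> = h then lam x else 0) * pd h \<phi> x))
        + (?\<xi> x $ \<alpha> $ h * (mu x * pd h \<phi> x) + ?\<xi> x $ h $ \<alpha> * (mu x * pd h \<phi> x)))" for x
      unfolding st_def
      by (intro sum.cong refl)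
         (simp add: lame_stress_def mat_def transpose_def trace_def sum_distrib_left sum_distrib_right algebra_simps)
    have c: "continuous_on \<Omega> (\<lambda>x. if \<alpha> = h then lam x else 0)" for h using lc by (cases "\<alpha> = h") auto
    show ?thesis
      unfolding e by (intro set_integral_sums(1) set_integral_add(1) int c mc)
  qed
  have ip: "set_integrable lebesgue \<Omega> (p h)" for h
  proof -
    have e: "p h x = ?\<xi> x $ h $ h * (r x * pd \<alpha> \<phi> x) - ?\<xi> x $ h $ \<alpha> * (r x * pd h \<phi> x)" for x
      unfolding p_def by (simp add: algebra_simps)
    show ?thesis unfolding e[abs_def] by (intro set_integral_diff(1) int rc)
  qed
  note cs1 = wderiv_cross_symmetric(1)[OF \<Omega> rc r wd wd \<phi>]
  note cs2 = wderiv_cross_symmetric(2)[OF \<Omega> rc r wd wd \<phi>]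
  have it: "set_integrable lebesgue \<Omega> (t h)" for h
    unfolding t_def by (intro set_integral_diff(1) cs1)
  have t0: "(LINT x:\<Omega>|lebesgue. t h x) = 0" for h
    unfolding t_def by (subst set_integral_diff(2)[OF cs1 cs1]) (simp add: cs2[where i = h and j = \<alpha>])
  define S2 where "S2 x = (\<Sum>h\<in>UNIV. \<Sum>\<beta>\<in>UNIV. lame_B \<Omega> r x h \<alpha> \<beta> * ?\<xi> x $ \<beta> $ h * \<phi> x)" for x
  \<comment> \<open>The integral of \<open>t h\<close> vanishes, and \<open>p h - t h\<close> contains \<open>\<phi>\<close> itself only: it is the contribution of
    \<open>lame_B\<close>.\<close>
  define S2' where "S2' x = (\<Sum>h\<in>UNIV. p h x - t h x)" for x
  have iS2': "set_integrable lebesgue \<Omega> S2'"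
    unfolding S2'_def by (intro set_integral_sums(1) set_integral_diff(1) ip it)
  have ae: "AE x in lebesgue. indicator \<Omega> x *\<^sub>R S2' x = indicator \<Omega> x *\<^sub>R S2 x"
  proof -
    have "AE x in lebesgue. \<forall>k. x \<in> \<Omega> \<longrightarrow> wderiv \<Omega> k r x = G k x"
      unfolding AE_all_countable by (intro allI wderiv_AE_eq[OF \<Omega> has_wderiv_smooth_approx[OF \<Omega> rc r]])
    then show ?thesis
    proof eventually_elim
      case (elim x)
      show ?case
      proof (cases "x \<in> \<Omega>")
        case True
        then have w: "wderiv \<Omega> k r x = G k x" for k using elim by blast
        have "S2 x = S2' x"
          unfolding S2_def S2'_def lame_B_contraction w p_def t_def
          by (intro sum.cong refl) (simp add: algebra_simps)
        then show ?thesis by simp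
      qed simp
    qed
  qed
  have mS2': "(\<lambda>x. indicator \<Omega> x *\<^sub>R S2' x) \<in> borel_measurable lebesgue"
    using iS2' unfolding set_integrable_def by (rule borel_measurable_integrable)
  have IS2: "(LINT x:\<Omega>|lebesgue. S2 x) = (LINT x:\<Omega>|lebesgue. S2' x)"
    unfolding set_lebesgue_integral_def
    using integral_cong_AE[OF mS2' borel_measurable_AE[OF mS2' ae] ae] by simp
  have IS2': "(LINT x:\<Omega>|lebesgue. S2' x) = (\<Sum>h\<in>UNIV. LINT x:\<Omega>|lebesgue. p h x)"
  proof -
    have "(LINT x:\<Omega>|lebesgue. S2' x) = (\<Sum>h\<in>UNIV. LINT x:\<Omega>|lebesgue. p h x - t h x)"
      unfolding S2'_def by (intro set_integral_sums(2) set_integral_diff(1) ip it)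
    then show ?thesis unfolding set_integral_diff(2)[OF ip it] t0 by simp
  qed
  have IS1: "(LINT x:\<Omega>|lebesgue. st x + (\<Sum>h\<in>UNIV. p h x)) = (LINT x:\<Omega>|lebesgue. st x) + (\<Sum>h\<in>UNIV. LINT x:\<Omega>|lebesgue. p h x)"
  proof -
    have isp: "set_integrable lebesgue \<Omega> (\<lambda>x. \<Sum>h\<in>UNIV. p h x)" by (intro set_integral_sums(1) ip)
    have "(LINT x:\<Omega>|lebesgue. \<Sum>h\<in>UNIV. p h x) = (\<Sum>h\<in>UNIV. LINT x:\<Omega>|lebesgue. p h x)"
      by (rule set_integral_sums(2)[OF ip])
    then show ?thesis unfolding set_integral_add(2)[OF ist isp] by simp
  qed
  show ?thesis
    unfolding lame_op_def system_op_def lame_A_contraction st_def[symmetric] p_def[symmetric] S2_def[symmetric]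
    unfolding IS1 IS2 IS2' by simp
qed

lemma coeff_norm_lame_B_le:
  fixes \<Omega> :: "(real^'n::finite) set"
  shows "coeff_norm (lame_B \<Omega> r x) \<le> sqrt (real CARD('n) ^ 3 * 4) * norm (wgrad \<Omega> r x)"
proof -
  let ?w = "norm (wgrad \<Omega> r x)"
  have w: "\<bar>wderiv \<Omega> i r x\<bar> \<le> ?w" for i
    using component_le_norm_cart[of "wgrad \<Omega> r x" i] by (simp add: wgrad_def)
  have "(lame_B \<Omega> r x h \<alpha> \<beta>)\<^sup>2 \<le> 4 * ?w\<^sup>2" for h \<alpha> \<beta>
  proof -
    have "\<bar>lame_B \<Omega> r x h \<alpha> \<beta>\<bar> \<le> \<bar>wderiv \<Omega> \<beta> r x\<bar> + \<bar>wderiv \<Omega> \<alpha> r x\<bar>"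
      unfolding lame_B_eq by auto
    also have "\<dots> \<le> 2 * ?w" using w[of \<alpha>] w[of \<beta>] by simp
    finally have "\<bar>lame_B \<Omega> r x h \<alpha> \<beta>\<bar>\<^sup>2 \<le> (2 * ?w)\<^sup>2" by (intro power_mono) auto
    then show ?thesis by (simp add: power_mult_distrib)
  qed
  then have "(\<Sum>h\<in>UNIV. \<Sum>\<alpha>\<in>UNIV. \<Sum>\<beta>\<in>UNIV. (lame_B \<Omega> r x h \<alpha> \<beta>)\<^sup>2)
      \<le> (\<Sum>h\<in>(UNIV::'n set). \<Sum>\<alpha>\<in>(UNIV::'n set). \<Sum>\<beta>\<in>(UNIV::'n set). 4 * ?w\<^sup>2)"
    by (intro sum_mono)
  also have "\<dots> = (real CARD('n) ^ 3 * 4) * ?w\<^sup>2" by (simp add: power3_eq_cube)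
  finally have "coeff_norm (lame_B \<Omega> r x) \<le> sqrt ((real CARD('n) ^ 3 * 4) * ?w\<^sup>2)"
    unfolding coeff_norm_def by (rule real_sqrt_le_mono)
  then show ?thesis by (simp add: real_sqrt_mult)
qed

section \<open>The choice of the auxiliary function\<close>

text \<open>The auxiliary function \<open>r\<close> as a function of \<open>(\<lambda>, \<mu>)\<close>.\<close>

definition aux_coeff :: "real \<Rightarrow> real \<times> real \<Rightarrow> real" where
  "aux_coeff n = (\<lambda>(l, m). m + crit_rho n m (l + 2 * m))"

definition elliptic_cone :: "(real \<times> real) set" where
  "elliptic_cone = {p. 0 < snd p \<and> 0 < fst p + 2 * snd p}"

lemma open_elliptic_cone: "open elliptic_cone"
  unfolding elliptic_cone_def by (intro open_Collect_conj open_Collect_less continuous_intros)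

text \<open>The discriminant is positive on the cone, so the square root in \<open>crit_den\<close> is differentiable there.\<close>

lemma aux_coeff_derivative:
  assumes n: "n \<ge> 2"
  obtains \<Phi>1 \<Phi>2 :: "real \<times> real \<Rightarrow> real" where
    "\<And>p. p \<in> elliptic_cone \<Longrightarrow> (aux_coeff n has_derivative (\<lambda>(s, t). \<Phi>1 p * s + \<Phi>2 p * t)) (at p)"
    "continuous_on elliptic_cone \<Phi>1" "continuous_on elliptic_cone \<Phi>2"
proof -
  define \<kappa> where "\<kappa> = (n - 2) / (n - 1)"
  define disc where "disc p = (fst p + 3 * snd p)\<^sup>2 - 4 * \<kappa> * (snd p * (fst p + 2 * snd p))" for p :: "real \<times> real"
  define q where "q p = sqrt (disc p)" for p
  define den where "den p = fst p + 3 * snd p + q p" for p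
  define num where "num p = 2 * ((fst p + snd p) * snd p)" for p :: "real \<times> real"
  define ql where "ql p = (2 * (fst p + 3 * snd p) - 4 * \<kappa> * snd p) * (inverse (q p) / 2)" for p
  define qm where "qm p = (6 * (fst p + 3 * snd p) - 4 * \<kappa> * (fst p + 4 * snd p)) * (inverse (q p) / 2)" for p
  define \<Phi>1 where "\<Phi>1 p = - ((2 * snd p * den p - num p * (1 + ql p)) / (den p * den p))" for p
  define \<Phi>2 where "\<Phi>2 p = 1 - ((2 * fst p + 4 * snd p) * den p - num p * (3 + qm p)) / (den p * den p)" for p
  have pos: "0 < disc p" "0 < q p" "0 < den p" if "p \<in> elliptic_cone" for p
  proof -
    have c: "0 < snd p" "0 < fst p + 2 * snd p" using that unfolding elliptic_cone_def by auto
    have "(fst p + 2 * snd p - snd p)\<^sup>2 < crit_disc n (snd p) (fst p + 2 * snd p)" by (rule crit_disc_gt[OF n c])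
    moreover have "crit_disc n (snd p) (fst p + 2 * snd p) = disc p"
      unfolding crit_disc_def disc_def \<kappa>_def by (simp add: algebra_simps)
    ultimately show d: "0 < disc p" using zero_le_power2 by (metis le_less_trans)
    then show "0 < q p" unfolding q_def by simp
    then show "0 < den p" unfolding den_def using c by simp
  qed
  have aux: "aux_coeff n p = snd p - num p / den p" for p
  proof -
    have "crit_den n (snd p) (fst p + 2 * snd p) = den p"
      unfolding crit_den_def crit_disc_def den_def q_def disc_def \<kappa>_def by (simp add: algebra_simps)
    then have "aux_coeff n p = snd p + - (fst p + 2 * snd p - snd p) * (2 * snd p / den p)"
      unfolding aux_coeff_def crit_rho_def by (simp only: case_prod_beta)
    also have "\<dots> = snd p - (fst p + 2 * snd p - snd p) * (2 * snd p) / den p"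
      by (simp only: mult_minus_left times_divide_eq_right diff_conv_add_uminus)
    also have "(fst p + 2 * snd p - snd p) * (2 * snd p) = num p" unfolding num_def by (simp add: algebra_simps)
    finally show ?thesis .
  qed
  have hd: "(aux_coeff n has_derivative (\<lambda>(s, t). \<Phi>1 p * s + \<Phi>2 p * t)) (at p)" if p: "p \<in> elliptic_cone" for p
  proof -
    have ddisc: "(disc has_derivative (\<lambda>h. (2 * (fst p + 3 * snd p) - 4 * \<kappa> * snd p) * fst h
        + (6 * (fst p + 3 * snd p) - 4 * \<kappa> * (fst p + 4 * snd p)) * snd h)) (at p)"
      unfolding disc_def by (auto intro!: derivative_eq_intros simp: fun_eq_iff algebra_simps power2_eq_square)
    have "(q has_derivative (\<lambda>h. ((2 * (fst p + 3 * snd p) - 4 * \<kappa> * snd p) * fst h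
        + (6 * (fst p + 3 * snd p) - 4 * \<kappa> * (fst p + 4 * snd p)) * snd h) * (inverse (sqrt (disc p)) / 2))) (at p)"
      unfolding q_def by (rule DERIV_compose_FDERIV[OF DERIV_real_sqrt[OF pos(1)[OF p]] ddisc])
    then have dq: "(q has_derivative (\<lambda>h. ql p * fst h + qm p * snd h)) (at p)"
      unfolding q_def[of p, symmetric] ql_def qm_def by (simp add: algebra_simps)
    have dden: "(den has_derivative (\<lambda>h. (1 + ql p) * fst h + (3 + qm p) * snd h)) (at p)"
      unfolding den_def by (auto intro!: derivative_eq_intros dq simp: fun_eq_iff algebra_simps)
    have dnum: "(num has_derivative (\<lambda>h. 2 * snd p * fst h + (2 * fst p + 4 * snd p) * snd h)) (at p)"
      unfolding num_def by (auto intro!: derivative_eq_intros simp: fun_eq_iff algebra_simps)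
    have dp: "den p \<noteq> 0" using pos(3)[OF p] by simp
    note dquo = has_derivative_divide'[OF dnum dden dp]
    note dall = has_derivative_diff[OF has_derivative_snd[OF has_derivative_ident] dquo]
    have "(\<lambda>h. snd h - ((2 * snd p * fst h + (2 * fst p + 4 * snd p) * snd h) * den p
        - num p * ((1 + ql p) * fst h + (3 + qm p) * snd h)) / (den p * den p)) = (\<lambda>(s, t). \<Phi>1 p * s + \<Phi>2 p * t)"
      unfolding \<Phi>1_def \<Phi>2_def using dp by (auto simp: fun_eq_iff field_simps)
    then show ?thesis using dall unfolding aux[abs_def] by simp
  qed
  have cq: "continuous_on elliptic_cone q"
    unfolding q_def disc_def by (intro continuous_intros)
  have cden: "continuous_on elliptic_cone den" unfolding den_def by (intro continuous_intros cq)
  have cnum: "continuous_on elliptic_cone num" unfolding num_def by (intro continuous_intros)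
  have nz: "\<forall>p\<in>elliptic_cone. q p \<noteq> 0" "\<forall>p\<in>elliptic_cone. den p * den p \<noteq> 0"
  proof -
    show "\<forall>p\<in>elliptic_cone. q p \<noteq> 0" by (intro ballI less_imp_neq[OF pos(2), symmetric])
    show "\<forall>p\<in>elliptic_cone. den p * den p \<noteq> 0"
    proof
      fix p assume "p \<in> elliptic_cone"
      from pos(3)[OF this] show "den p * den p \<noteq> 0" by simp
    qed
  qed
  have cinv: "continuous_on elliptic_cone (\<lambda>p. inverse (q p) / 2)"
    by (rule continuous_on_divide[OF continuous_on_inverse[OF cq nz(1)] continuous_on_const]) simp
  have cql: "continuous_on elliptic_cone ql"
    unfolding ql_def by (rule continuous_on_mult[OF _ cinv]) (intro continuous_intros)
  have cqm: "continuous_on elliptic_cone qm"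
    unfolding qm_def by (rule continuous_on_mult[OF _ cinv]) (intro continuous_intros)
  have cf: "continuous_on elliptic_cone (\<lambda>p. (2 * fst p + 4 * snd p) * den p - num p * (3 + qm p))"
    "continuous_on elliptic_cone (\<lambda>p. 2 * snd p * den p - num p * (1 + ql p))"
    by (intro continuous_intros cden cnum cqm cql)+
  have cd2: "continuous_on elliptic_cone (\<lambda>p. den p * den p)" by (rule continuous_on_mult[OF cden cden])
  have c1: "continuous_on elliptic_cone \<Phi>1"
    unfolding \<Phi>1_def by (rule continuous_on_minus[OF continuous_on_divide[OF cf(2) cd2 nz(2)]])
  have c2: "continuous_on elliptic_cone \<Phi>2"
    unfolding \<Phi>2_def by (rule continuous_on_diff[OF continuous_on_const continuous_on_divide[OF cf(1) cd2 nz(2)]])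
  show thesis by (rule that[of \<Phi>1 \<Phi>2]; (rule c1 c2 | rule hd, assumption))
qed

lemma Lip_locE:
  assumes "f \<in> Lip_loc \<Omega>" "x \<in> \<Omega>"
  obtains u L where "u > 0" "L-lipschitz_on (cball x u \<inter> \<Omega>) f"
proof -
  have "local_lipschitz (UNIV :: real set) \<Omega> (\<lambda>_. f)" using assms(1) unfolding Lip_loc_def by simp
  from this[unfolded local_lipschitz_def, rule_format, OF assms(2), of 0]
  obtain u L where u: "u > 0" "\<forall>t\<in>cball (0::real) u \<inter> UNIV. L-lipschitz_on (cball x u \<inter> \<Omega>) f" by auto
  have "(0::real) \<in> cball 0 u \<inter> UNIV" using u(1) by simp
  from u(2)[rule_format, OF this] u(1) show thesis by (rule that[rotated])
qed

lemma Lip_loc_chain2: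
  fixes f g :: "'a::metric_space \<Rightarrow> real" and \<Phi> :: "real \<times> real \<Rightarrow> real"
  assumes f: "f \<in> Lip_loc \<Omega>" and g: "g \<in> Lip_loc \<Omega>"
    and B: "\<And>x y. x \<in> \<Omega> \<Longrightarrow> y \<in> \<Omega> \<Longrightarrow> \<bar>\<Phi> (f x, g x) - \<Phi> (f y, g y)\<bar> \<le> B * (\<bar>f x - f y\<bar> + \<bar>g x - g y\<bar>)" "B \<ge> 0"
  shows "(\<lambda>x. \<Phi> (f x, g x)) \<in> Lip_loc \<Omega>"
  unfolding Lip_loc_def
proof (intro CollectI local_lipschitzI)
  fix t :: real and x assume x: "x \<in> \<Omega>"
  obtain u1 L1 where 1: "u1 > 0" "L1-lipschitz_on (cball x u1 \<inter> \<Omega>) f"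
    using Lip_locE[OF f x] by blast
  obtain u2 L2 where 2: "u2 > 0" "L2-lipschitz_on (cball x u2 \<inter> \<Omega>) g"
    using Lip_locE[OF g x] by blast
  have "(B * (L1 + L2))-lipschitz_on (cball x (min u1 u2) \<inter> \<Omega>) (\<lambda>x. \<Phi> (f x, g x))"
  proof (rule lipschitz_onI)
    show "0 \<le> B * (L1 + L2)" using B(2) lipschitz_on_nonneg[OF 1(2)] lipschitz_on_nonneg[OF 2(2)] by simp
    fix y z assume y: "y \<in> cball x (min u1 u2) \<inter> \<Omega>" and z: "z \<in> cball x (min u1 u2) \<inter> \<Omega>"
    have "\<bar>f y - f z\<bar> \<le> L1 * dist y z" using lipschitz_onD[OF 1(2), of y z] y z by (simp add: dist_real_def)
    moreover have "\<bar>g y - g z\<bar> \<le> L2 * dist y z" using lipschitz_onD[OF 2(2), of y z] y z by (simp add: dist_real_def)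
    ultimately have "B * (\<bar>f y - f z\<bar> + \<bar>g y - g z\<bar>) \<le> B * ((L1 + L2) * dist y z)"
      using B(2) by (intro mult_left_mono) (auto simp: distrib_right)
    then show "dist (\<Phi> (f y, g y)) (\<Phi> (f z, g z)) \<le> B * (L1 + L2) * dist y z"
      using B(1)[of y z] y z by (simp add: dist_real_def mult.assoc)
  qed
  then show "\<exists>u>0. \<exists>L. \<forall>t\<in>cball t u \<inter> UNIV. L-lipschitz_on (cball x u \<inter> \<Omega>) (\<lambda>x. \<Phi> (f x, g x))"
    using 1(1) 2(1) by (intro exI[of _ "min u1 u2"]) auto
qed

text \<open>The admissible values of \<open>(\<lambda>, \<mu>)\<close> form a compact convex subset of the cone, so bounds for the partial
  derivatives are Lipschitz constants.\<close>

lemma aux_coeff_lipschitz: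
  assumes n: "n \<ge> 2" and e: "e > 0"
  obtains B and \<Phi>1 \<Phi>2 :: "real \<times> real \<Rightarrow> real" where "B \<ge> 0"
    "\<And>p. p \<in> elliptic_cone \<Longrightarrow> (aux_coeff n has_derivative (\<lambda>(s, t). \<Phi>1 p * s + \<Phi>2 p * t)) (at p)"
    "continuous_on elliptic_cone \<Phi>1" "continuous_on elliptic_cone \<Phi>2"
    "\<And>l m. \<bar>l\<bar> \<le> L \<Longrightarrow> \<bar>m\<bar> \<le> L \<Longrightarrow> e \<le> m \<Longrightarrow> e \<le> l + 2 * m \<Longrightarrow> \<bar>\<Phi>1 (l, m)\<bar> \<le> B \<and> \<bar>\<Phi>2 (l, m)\<bar> \<le> B"
    "\<And>l m l' m'. \<bar>l\<bar> \<le> L \<Longrightarrow> \<bar>m\<bar> \<le> L \<Longrightarrow> e \<le> m \<Longrightarrow> e \<le> l + 2 * m \<Longrightarrow> \<bar>l'\<bar> \<le> L \<Longrightarrow> \<bar>m'\<bar> \<le> L \<Longrightarrow> e \<le> m' \<Longrightarrow> e \<le> l' + 2 * m'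
      \<Longrightarrow> \<bar>aux_coeff n (l, m) - aux_coeff n (l', m')\<bar> \<le> B * (\<bar>l - l'\<bar> + \<bar>m - m'\<bar>)"
proof -
  define T where "T = cbox (- L, - L) (L, L) \<inter> {p :: real \<times> real. e \<le> snd p} \<inter> {p. e \<le> fst p + 2 * snd p}"
  have Tc: "compact T"
    unfolding T_def by (intro compact_Int_closed compact_cbox closed_Collect_le continuous_intros)
  have Tconv: "convex T"
  proof -
    have "convex {p :: real \<times> real. e \<le> snd p}"
      using convex_halfspace_ge[of e "(0, 1) :: real \<times> real"] by (simp add: inner_prod_def)
    moreover have "convex {p :: real \<times> real. e \<le> fst p + 2 * snd p}"
      using convex_halfspace_ge[of e "(1, 2) :: real \<times> real"] by (simp add: inner_prod_def)
    ultimately show ?thesis unfolding T_def by (intro convex_Int convex_box)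
  qed
  have TU: "T \<subseteq> elliptic_cone" unfolding T_def elliptic_cone_def using e by auto
  obtain \<Phi>1 \<Phi>2 :: "real \<times> real \<Rightarrow> real" where
    \<Phi>: "\<And>p. p \<in> elliptic_cone \<Longrightarrow> (aux_coeff n has_derivative (\<lambda>(s, t). \<Phi>1 p * s + \<Phi>2 p * t)) (at p)"
    "continuous_on elliptic_cone \<Phi>1" "continuous_on elliptic_cone \<Phi>2"
    by (rule aux_coeff_derivative[OF n]) (rule that; assumption)
  obtain B1 where B1: "\<And>p. p \<in> T \<Longrightarrow> \<bar>\<Phi>1 p\<bar> \<le> B1"
    using continuous_on_compact_bound[OF Tc continuous_on_subset[OF \<Phi>(2) TU]] by blast
  obtain B2 where B2: "\<And>p. p \<in> T \<Longrightarrow> \<bar>\<Phi>2 p\<bar> \<le> B2"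
    using continuous_on_compact_bound[OF Tc continuous_on_subset[OF \<Phi>(3) TU]] by blast
  define B where "B = \<bar>B1\<bar> + \<bar>B2\<bar>"
  have lip: "norm (aux_coeff n p - aux_coeff n p') \<le> B * norm (p - p')" if "p \<in> T" "p' \<in> T" for p p'
  proof (rule differentiable_bound[OF Tconv _ _ that])
    fix z assume z: "z \<in> T"
    show "(aux_coeff n has_derivative (\<lambda>(s, t). \<Phi>1 z * s + \<Phi>2 z * t)) (at z within T)"
      using \<Phi>(1)[OF subsetD[OF TU z]] by (rule has_derivative_at_withinI)
    show "onorm (\<lambda>(s, t). \<Phi>1 z * s + \<Phi>2 z * t) \<le> B"
    proof (rule onorm_le)
      fix h :: "real \<times> real"
      have "\<bar>\<Phi>1 z * fst h + \<Phi>2 z * snd h\<bar> \<le> \<bar>\<Phi>1 z\<bar> * \<bar>fst h\<bar> + \<bar>\<Phi>2 z\<bar> * \<bar>snd h\<bar>"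
        unfolding abs_mult[symmetric] by (rule abs_triangle_ineq)
      also have "\<dots> \<le> \<bar>B1\<bar> * norm h + \<bar>B2\<bar> * norm h"
        using B1[OF z] B2[OF z] norm_fst_le[of "fst h" "snd h"] norm_snd_le[of "snd h" "fst h"]
        by (intro add_mono mult_mono) (auto simp: order_trans[OF _ abs_ge_self])
      finally show "norm (case h of (s, t) \<Rightarrow> \<Phi>1 z * s + \<Phi>2 z * t) \<le> B * norm h"
        unfolding B_def by (simp add: case_prod_beta distrib_right)
    qed
  qed
  show thesis
  proof (rule that[of B \<Phi>1 \<Phi>2])
    show "(aux_coeff n has_derivative (\<lambda>(s, t). \<Phi>1 p * s + \<Phi>2 p * t)) (at p)" if "p \<in> elliptic_cone" for p
      by (rule \<Phi>(1)[OF that])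
    show "continuous_on elliptic_cone \<Phi>1" "continuous_on elliptic_cone \<Phi>2" by (rule \<Phi>(2,3))+
    show "B \<ge> 0" unfolding B_def by simp
    show "\<bar>\<Phi>1 (l, m)\<bar> \<le> B \<and> \<bar>\<Phi>2 (l, m)\<bar> \<le> B"
      if "\<bar>l\<bar> \<le> L" "\<bar>m\<bar> \<le> L" "e \<le> m" "e \<le> l + 2 * m" for l m
    proof -
      have "(l, m) \<in> T" using that unfolding T_def by (auto simp: cbox_Pair_iff abs_le_iff)
      from B1[OF this] B2[OF this] show ?thesis unfolding B_def by linarith
    qed
    fix l m l' m' assume a: "\<bar>l\<bar> \<le> L" "\<bar>m\<bar> \<le> L" "e \<le> m" "e \<le> l + 2 * m" "\<bar>l'\<bar> \<le> L" "\<bar>m'\<bar> \<le> L" "e \<le> m'" "e \<le> l' + 2 * m'"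
    have T: "(l, m) \<in> T" "(l', m') \<in> T" using a unfolding T_def by (auto simp: cbox_Pair_iff abs_le_iff)
    have "\<bar>aux_coeff n (l, m) - aux_coeff n (l', m')\<bar> \<le> B * norm ((l, m) - (l', m'))" using lip[OF T] by simp
    also have "\<dots> \<le> B * (\<bar>l - l'\<bar> + \<bar>m - m'\<bar>)"
      using norm_Pair_le[of "l - l'" "m - m'"] by (intro mult_left_mono) (auto simp: B_def)
    finally show "\<bar>aux_coeff n (l, m) - aux_coeff n (l', m')\<bar> \<le> B * (\<bar>l - l'\<bar> + \<bar>m - m'\<bar>)" .
  qed
qed

section \<open>Essential bounds of continuous functions\<close>

text \<open>The set where the inequality fails is open and a null set, hence empty.\<close>

lemma AE_le_imp_all_le:
  fixes \<Omega> :: "(real^'n::finite) set" and g :: "real^'n \<Rightarrow> real"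
  assumes \<Omega>: "open \<Omega>" and g: "continuous_on \<Omega> g" and ae: "AE x in lebesgue_on \<Omega>. g x \<le> c" and x: "x \<in> \<Omega>"
  shows "g x \<le> c"
proof (rule ccontr)
  assume "\<not> g x \<le> c"
  have S: "\<Omega> \<in> sets lebesgue" using \<Omega> by (simp add: borel_open)
  let ?A = "g -` {c<..} \<inter> \<Omega>"
  have op: "open ?A" using g \<Omega> by (simp add: continuous_on_open_vimage)
  have "AE x in lebesgue. x \<notin> ?A"
    using ae unfolding AE_lebesgue_on_iff[OF S] by eventually_elim auto
  then have "?A \<in> null_sets lebesgue" using op by (subst (asm) AE_iff_null_sets[symmetric]) (auto simp: borel_open)
  then have "negligible ?A" by (simp add: negligible_iff_null_sets)
  moreover have "x \<in> ?A" using x \<open>\<not> g x \<le> c\<close> by (simp add: not_le)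
  ultimately show False using open_not_negligible[OF op] by blast
qed

lemma continuous_measurable_lebesgue_on:
  fixes g :: "real^'n::finite \<Rightarrow> real"
  assumes "open \<Omega>" "continuous_on \<Omega> g"
  shows "g \<in> borel_measurable (lebesgue_on \<Omega>)"
  using assms by (intro continuous_imp_measurable_on_sets_lebesgue) (simp_all add: borel_open)

lemma esssup_continuous:
  fixes \<Omega> :: "(real^'n::finite) set" and g :: "real^'n \<Rightarrow> real"
  assumes \<Omega>: "open \<Omega>" "\<Omega> \<noteq> {}" and g: "continuous_on \<Omega> g" and bd: "bdd_above (g ` \<Omega>)"
  shows "esssup (lebesgue_on \<Omega>) (\<lambda>x. ereal (g x)) = ereal (SUP x\<in>\<Omega>. g x)"
proof (rule antisym)
  have m: "(\<lambda>x. ereal (g x)) \<in> borel_measurable (lebesgue_on \<Omega>)"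
    using continuous_measurable_lebesgue_on[OF \<Omega>(1) g] by simp
  show "esssup (lebesgue_on \<Omega>) (\<lambda>x. ereal (g x)) \<le> ereal (SUP x\<in>\<Omega>. g x)"
    by (rule esssup_I[OF m]) (auto intro!: AE_I2 cSUP_upper bd)
  show "ereal (SUP x\<in>\<Omega>. g x) \<le> esssup (lebesgue_on \<Omega>) (\<lambda>x. ereal (g x))"
  proof (rule ccontr)
    assume "\<not> ?thesis"
    then obtain c where c: "esssup (lebesgue_on \<Omega>) (\<lambda>x. ereal (g x)) < ereal c" "ereal c < ereal (SUP x\<in>\<Omega>. g x)"
      using ereal_dense2 by (metis not_le)
    have "AE x in lebesgue_on \<Omega>. g x \<le> c"
      using esssup_AE[of "\<lambda>x. ereal (g x)" "lebesgue_on \<Omega>"]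
    proof eventually_elim
      case (elim x)
      then have "ereal (g x) \<le> ereal c" using c(1) by order
      then show ?case by simp
    qed
    then have "g x \<le> c" if "x \<in> \<Omega>" for x using AE_le_imp_all_le[OF \<Omega>(1) g _ that] by blast
    then have "(SUP x\<in>\<Omega>. g x) \<le> c" using \<Omega>(2) by (intro cSUP_least) auto
    then show False using c(2) by simp
  qed
qed

lemma essinf_continuous_pos:
  fixes \<Omega> :: "(real^'n::finite) set" and g :: "real^'n \<Rightarrow> real"
  assumes \<Omega>: "open \<Omega>" and g: "continuous_on \<Omega> g" and pos: "essinf (lebesgue_on \<Omega>) (\<lambda>x. ereal (g x)) > 0"
  obtains e where "e > 0" "\<And>x. x \<in> \<Omega> \<Longrightarrow> e \<le> g x"
proof -
  have "esssup (lebesgue_on \<Omega>) (\<lambda>x. - ereal (g x)) < 0"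
    using pos unfolding essinf_def by (simp add: ereal_less_uminus_reorder)
  then obtain c where c: "esssup (lebesgue_on \<Omega>) (\<lambda>x. - ereal (g x)) < ereal c" "ereal c < 0"
    using ereal_dense2 by blast
  have "AE x in lebesgue_on \<Omega>. - g x \<le> c"
    using esssup_AE[of "\<lambda>x. - ereal (g x)" "lebesgue_on \<Omega>"]
  proof eventually_elim
    case (elim x)
    then have "- ereal (g x) \<le> ereal c" using c(1) by order
    then show ?case by simp
  qed
  then have "- g x \<le> c" if "x \<in> \<Omega>" for x
    using AE_le_imp_all_le[OF \<Omega> continuous_on_minus[OF g] _ that] by blast
  then show thesis using c(2) that[of "- c"] by fastforce
qed

section \<open>Integral ellipticity as a condition on a real parameter\<close>

text \<open>The polar form of the integrand: the energy of \<open>\<xi>\<close> minus \<open>s\<close> times the radial form in direction \<open>w\<close>.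
  Bilinearity is needed to expand the energy of the oscillating functions below.\<close>

definition lame_qform :: "real \<Rightarrow> real \<Rightarrow> real \<Rightarrow> real \<Rightarrow> real^'n::finite \<Rightarrow> real^'n^'n \<Rightarrow> real^'n^'n \<Rightarrow> real" where
  "lame_qform l m r s w \<xi> \<zeta> =
     m * (\<xi> \<bullet> \<zeta>) + (l + r) * (trace \<xi> * trace \<zeta>) + (m - r) * (transpose \<xi> \<bullet> \<zeta>)
     - s * (m * ((transpose \<xi> *v w) \<bullet> (transpose \<zeta> *v w))
            + (l + m) * ((w \<bullet> (transpose \<xi> *v w)) * (w \<bullet> (transpose \<zeta> *v w))))"

lemma lame_qform_diag:
  "lame_qform (lam x) (mu x) (r x) s w \<xi> \<xi>
   = A_form (lame_A lam mu r x) \<xi> \<xi> - s * radial_form (mu x) (lam x + 2 * mu x) w (transpose \<xi> *v w)"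
  unfolding lame_qform_def A_form_lame radial_form_def by (simp add: power2_eq_square algebra_simps)

lemma lame_qform_add:
  "lame_qform l m r s w (\<xi> + t *\<^sub>R \<zeta>) (\<xi> + t *\<^sub>R \<zeta>)
   = lame_qform l m r s w \<xi> \<xi> + 2 * t * lame_qform l m r s w \<xi> \<zeta> + t\<^sup>2 * lame_qform l m r s w \<zeta> \<zeta>"
proof -
  have tr: "trace (\<xi> + t *\<^sub>R \<zeta>) = trace \<xi> + t * trace \<zeta>"
    by (simp add: trace_def sum.distrib sum_distrib_left)
  have tp: "transpose (\<xi> + t *\<^sub>R \<zeta>) = transpose \<xi> + t *\<^sub>R transpose \<zeta>"
    by (simp add: transpose_def vec_eq_iff)
  have mv: "(transpose \<xi> + t *\<^sub>R transpose \<zeta>) *v w = transpose \<xi> *v w + t *\<^sub>R (transpose \<zeta> *v w)"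
    by (simp only: matrix_vector_mult_add_rdistrib scaleR_matrix_vector_assoc)
  have c1: "\<zeta> \<bullet> \<xi> = \<xi> \<bullet> \<zeta>" "(transpose \<zeta> *v w) \<bullet> (transpose \<xi> *v w) = (transpose \<xi> *v w) \<bullet> (transpose \<zeta> *v w)"
    by (simp_all only: inner_commute)
  have c2: "transpose \<zeta> \<bullet> \<xi> = transpose \<xi> \<bullet> \<zeta>" by (rule trans[OF inner_transpose inner_commute])
  show ?thesis
    unfolding lame_qform_def tr tp mv inner_add_left inner_add_right inner_scaleR_left inner_scaleR_right c1 c2
    by (simp add: algebra_simps power2_eq_square)
qed

lemma norm_outer: "norm (outer u v) = norm u * norm (v::real^'n::finite)"
proof -
  have "outer u v \<bullet> outer u v = (u \<bullet> u) * (v \<bullet> v)"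
    by (simp add: inner_outer outer_mult_vec inner_commute mult.commute)
  then show ?thesis by (simp add: norm_eq_sqrt_inner real_sqrt_mult)
qed

lemma norm_transpose_mult_le:
  fixes \<xi> :: "real^'n::finite^'n"
  shows "norm (transpose \<xi> *v w) \<le> norm \<xi> * norm w"
proof -
  let ?g = "transpose \<xi> *v w"
  have "?g \<bullet> ?g = \<xi> \<bullet> outer w ?g" unfolding inner_outer inner_mult_vec_transpose[of w \<xi> ?g] ..
  also have "\<dots> \<le> norm \<xi> * norm (outer w ?g)" by (rule norm_cauchy_schwarz)
  finally have "norm ?g * norm ?g \<le> (norm \<xi> * norm w) * norm ?g"
    by (simp add: norm_outer dot_square_norm power2_eq_square mult_ac)
  then show ?thesis by (cases "norm ?g = 0") (auto simp: mult_le_cancel_right)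
qed

lemma abs_trace_le: "\<bar>trace \<xi>\<bar> \<le> real CARD('n) * norm (\<xi>::real^'n::finite^'n)"
proof -
  have "\<bar>trace \<xi>\<bar> \<le> (\<Sum>i\<in>UNIV. \<bar>\<xi> $ i $ i\<bar>)" unfolding trace_def by (rule sum_abs)
  also have "\<dots> \<le> (\<Sum>i\<in>(UNIV::'n set). norm \<xi>)"
    by (intro sum_mono order_trans[OF component_le_norm_cart Finite_Cartesian_Product.norm_nth_le])
  finally show ?thesis by simp
qed

lemma abs_lame_qform_le:
  fixes w :: "real^'n::finite"
  assumes L: "\<bar>m\<bar> \<le> L" "\<bar>l + r\<bar> \<le> L" "\<bar>m - r\<bar> \<le> L" "\<bar>l + m\<bar> \<le> L" and w: "norm w \<le> 1" and s: "0 \<le> s"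
  shows "\<bar>lame_qform l m r s w \<xi> \<zeta>\<bar> \<le> L * (2 + (real CARD('n))\<^sup>2 + 2 * s) * (norm \<xi> * norm \<zeta>)"
proof -
  let ?n = "real CARD('n)" and ?N = "norm \<xi> * norm \<zeta>"
  have L0: "0 \<le> L" using L(1) by linarith
  have g: "norm (transpose \<xi> *v w) \<le> norm \<xi>" for \<xi> :: "real^'n^'n"
    using norm_transpose_mult_le[of \<xi> w] mult_left_mono[OF w, of "norm \<xi>"] by simp
  have wg: "\<bar>w \<bullet> (transpose \<xi> *v w)\<bar> \<le> norm \<xi>" for \<xi> :: "real^'n^'n"
  proof -
    have "\<bar>w \<bullet> (transpose \<xi> *v w)\<bar> \<le> norm w * norm (transpose \<xi> *v w)" by (rule Cauchy_Schwarz_ineq2)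
    also have "\<dots> \<le> 1 * norm \<xi>" by (intro mult_mono w g) auto
    finally show ?thesis by simp
  qed
  have a1: "\<bar>m * (\<xi> \<bullet> \<zeta>)\<bar> \<le> L * ?N"
    unfolding abs_mult by (intro mult_mono L Cauchy_Schwarz_ineq2 L0) auto
  have a2: "\<bar>(l + r) * (trace \<xi> * trace \<zeta>)\<bar> \<le> L * ((?n * norm \<xi>) * (?n * norm \<zeta>))"
    unfolding abs_mult by (intro mult_mono L abs_trace_le L0) auto
  have a3: "\<bar>(m - r) * (transpose \<xi> \<bullet> \<zeta>)\<bar> \<le> L * ?N"
    unfolding abs_mult using Cauchy_Schwarz_ineq2[of "transpose \<xi>" \<zeta>]
    by (intro mult_mono L L0) (auto simp: norm_transpose)
  have a4: "\<bar>m * ((transpose \<xi> *v w) \<bullet> (transpose \<zeta> *v w))\<bar> \<le> L * ?N"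
    unfolding abs_mult
    by (intro mult_mono L L0 order_trans[OF Cauchy_Schwarz_ineq2] g) auto
  have a5: "\<bar>(l + m) * ((w \<bullet> (transpose \<xi> *v w)) * (w \<bullet> (transpose \<zeta> *v w)))\<bar> \<le> L * ?N"
    unfolding abs_mult by (intro mult_mono L L0 wg) auto
  have a6: "\<bar>s * (m * ((transpose \<xi> *v w) \<bullet> (transpose \<zeta> *v w))
            + (l + m) * ((w \<bullet> (transpose \<xi> *v w)) * (w \<bullet> (transpose \<zeta> *v w))))\<bar> \<le> s * (2 * (L * ?N))"
    unfolding abs_mult[of s] using s a4 a5 by (intro mult_mono) auto
  have "\<bar>lame_qform l m r s w \<xi> \<zeta>\<bar> \<le> L * ?N + L * ((?n * norm \<xi>) * (?n * norm \<zeta>)) + L * ?N + s * (2 * (L * ?N))"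
    unfolding lame_qform_def using a1 a2 a3 a6 by linarith
  also have "\<dots> = L * (2 + ?n\<^sup>2 + 2 * s) * ?N" by (simp add: algebra_simps power2_eq_square)
  finally show ?thesis .
qed

lemma test_fun_W12_0:
  fixes \<Omega> :: "(real^'n::finite) set"
  assumes \<Omega>: "open \<Omega>" and f: "f \<in> test_fun \<Omega>"
  shows "f \<in> W12_0 \<Omega>"
proof -
  have S: "\<Omega> \<in> sets lebesgue" using \<Omega> by (simp add: borel_open)
  have wd: "has_wderiv \<Omega> i f (pd i f)" for i by (rule has_wderiv_smooth[OF \<Omega> test_fun_smooth[OF f]])
  have "f \<in> W12 \<Omega>"
    unfolding W12_def using test_fun_L2[OF \<Omega> f] test_fun_L2[OF \<Omega> test_fun_pd[OF f]] wd by blast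
  moreover have "(LINT x:\<Omega>|lebesgue. (wderiv \<Omega> i f x - pd i f x)\<^sup>2) = 0" for i
    unfolding set_lebesgue_on(2)[OF S]
  proof (rule integral_eq_zero_AE)
    show "AE x in lebesgue_on \<Omega>. (wderiv \<Omega> i f x - pd i f x)\<^sup>2 = 0"
      unfolding AE_lebesgue_on_iff[OF S] using wderiv_AE_eq[OF \<Omega> wd] by eventually_elim simp
  qed
  ultimately show ?thesis
    unfolding W12_0_def using f by (intro CollectI conjI exI[of _ "\<lambda>_. f"]) auto
qed

text \<open>The constant \<open>e\<close> is the ellipticity bound; \<open>L\<close> bounds the coefficients of both quadratic forms.\<close>

locale lame_setting =
  fixes \<Omega> :: "(real^'n::finite) set" and lam mu r :: "real^'n \<Rightarrow> real" and e L :: real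
  assumes dim: "CARD('n) \<ge> 2" and \<Omega>: "open \<Omega>"
    and cont: "continuous_on \<Omega> lam" "continuous_on \<Omega> mu" "continuous_on \<Omega> r"
    and e: "e > 0" "\<And>x. x \<in> \<Omega> \<Longrightarrow> e \<le> mu x" "\<And>x. x \<in> \<Omega> \<Longrightarrow> e \<le> lam x + 2 * mu x"
    and L: "\<And>x. x \<in> \<Omega> \<Longrightarrow> \<bar>mu x\<bar> \<le> L" "\<And>x. x \<in> \<Omega> \<Longrightarrow> \<bar>lam x + r x\<bar> \<le> L" "\<And>x. x \<in> \<Omega> \<Longrightarrow> \<bar>mu x - r x\<bar> \<le> L"
      "\<And>x. x \<in> \<Omega> \<Longrightarrow> \<bar>lam x + mu x\<bar> \<le> L" "\<And>x. x \<in> \<Omega> \<Longrightarrow> lam x + 2 * mu x \<le> L"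
begin

definition grad_energy :: "(real^'n \<Rightarrow> real^'n) \<Rightarrow> real^'n \<Rightarrow> real" where
  "grad_energy v x = A_form (lame_A lam mu r x) (wjac \<Omega> v x) (wjac \<Omega> v x)"

text \<open>\<open>sgn\<close> is \<open>v / |v|\<close>, and \<open>0\<close> where \<open>v = 0\<close>.\<close>

definition radial_energy :: "(real^'n \<Rightarrow> real^'n) \<Rightarrow> real^'n \<Rightarrow> real" where
  "radial_energy v x = radial_form (mu x) (lam x + 2 * mu x) (sgn (v x)) (transpose (wjac \<Omega> v x) *v sgn (v x))"

text \<open>Integral ellipticity with \<open>(1 - 2 / p)\<^sup>2\<close> replaced by a real parameter.\<close>

definition elliptic_at :: "real \<Rightarrow> bool" where
  "elliptic_at s \<longleftrightarrow> (\<exists>c>0. \<forall>v\<in>W12_0_vec \<Omega>.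
     c * (LINT x|lebesgue_on \<Omega>. (norm (wjac \<Omega> v x))\<^sup>2) \<le> (LINT x|lebesgue_on \<Omega>. grad_energy v x - s * radial_energy v x))"

lemma \<Omega>_sets: "\<Omega> \<in> sets lebesgue" using \<Omega> by (simp add: borel_open)

lemma energy_eq_qform:
  "grad_energy v x - s * radial_energy v x = lame_qform (lam x) (mu x) (r x) s (sgn (v x)) (wjac \<Omega> v x) (wjac \<Omega> v x)"
  unfolding grad_energy_def radial_energy_def lame_qform_diag ..

lemma abs_qform_le:
  fixes w :: "real^'n"
  assumes "x \<in> \<Omega>" "norm w \<le> 1" "0 \<le> s"
  shows "\<bar>lame_qform (lam x) (mu x) (r x) s w \<xi> \<zeta>\<bar> \<le> L * (2 + (real CARD('n))\<^sup>2 + 2 * s) * (norm \<xi> * norm \<zeta>)"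
  by (rule abs_lame_qform_le[OF L(1-4)[OF assms(1)] assms(2,3)])

lemma norm_sgn_le: "norm (sgn (y :: real^'n)) \<le> 1"
  by (simp add: norm_sgn)

lemma radial_energy_bounds:
  assumes "x \<in> \<Omega>"
  shows "0 \<le> radial_energy v x" "radial_energy v x \<le> L * (norm (wjac \<Omega> v x))\<^sup>2"
proof -
  let ?g = "transpose (wjac \<Omega> v x) *v sgn (v x)"
  have L0: "0 \<le> L" using L(1)[OF assms] by linarith
  show "0 \<le> radial_energy v x"
  proof (cases "v x = 0")
    case True
    then show ?thesis by (simp add: radial_energy_def radial_form_def)
  next
    case False
    then have "norm (sgn (v x)) = 1" by (simp add: norm_sgn)
    from radial_form_ge[OF this e(2,3)[OF assms], of ?g] have "e * (?g \<bullet> ?g) \<le> radial_energy v x"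
      unfolding radial_energy_def .
    moreover have "0 \<le> e * (?g \<bullet> ?g)" using e(1) by simp
    ultimately show ?thesis by linarith
  qed
  show "radial_energy v x \<le> L * (norm (wjac \<Omega> v x))\<^sup>2"
  proof (cases "v x = 0")
    case True
    then show ?thesis using L0 by (simp add: radial_energy_def radial_form_def)
  next
    case False
    then have n1: "norm (sgn (v x)) = 1" by (simp add: norm_sgn)
    have "mu x \<le> L" using L(1)[OF assms] by linarith
    from radial_form_le[OF n1 this L(5)[OF assms], of ?g] have "radial_energy v x \<le> L * (norm ?g)\<^sup>2"
      unfolding radial_energy_def by (simp add: dot_square_norm)
    also have "\<dots> \<le> L * (norm (wjac \<Omega> v x))\<^sup>2"
      using norm_transpose_mult_le[of "wjac \<Omega> v x" "sgn (v x)"] n1 L0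
      by (intro mult_left_mono power_mono) auto
    finally show ?thesis .
  qed
qed

lemma energy_integrable:
  assumes v: "v \<in> W12_0_vec \<Omega>"
  shows "integrable (lebesgue_on \<Omega>) (\<lambda>x. (norm (wjac \<Omega> v x))\<^sup>2)"
    and "integrable (lebesgue_on \<Omega>) (grad_energy v)" and "integrable (lebesgue_on \<Omega>) (radial_energy v)"
proof -
  let ?M = "lebesgue_on \<Omega>"
  have W: "(\<lambda>x. v x $ \<alpha>) \<in> W12 \<Omega>" for \<alpha> using v unfolding W12_0_vec_def W12_0_def by blast
  have J: "(\<lambda>x. wjac \<Omega> v x $ \<alpha> $ h) \<in> L2 \<Omega>" for \<alpha> h
    using wderiv_L2(1)[OF \<Omega> W[of \<alpha>], of h] by (simp add: wjac_def)
  have Jm [measurable]: "(\<lambda>x. wjac \<Omega> v x $ \<alpha> $ h) \<in> borel_measurable ?M" for \<alpha> h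
    using J unfolding L2_iff[OF \<Omega>_sets] by blast
  have J2: "integrable ?M (\<lambda>x. (wjac \<Omega> v x $ \<alpha> $ h)\<^sup>2)" for \<alpha> h
    using J unfolding L2_iff[OF \<Omega>_sets] by blast
  have vm [measurable]: "(\<lambda>x. v x $ \<alpha>) \<in> borel_measurable ?M" for \<alpha>
    using W[of \<alpha>] unfolding W12_def L2_iff[OF \<Omega>_sets] by blast
  have lm [measurable]: "lam \<in> borel_measurable ?M" "mu \<in> borel_measurable ?M" "r \<in> borel_measurable ?M"
    using continuous_measurable_lebesgue_on[OF \<Omega>] cont by blast+
  have eqN: "(norm (wjac \<Omega> v x))\<^sup>2 = (\<Sum>\<alpha>\<in>UNIV. \<Sum>h\<in>UNIV. (wjac \<Omega> v x $ \<alpha> $ h)\<^sup>2)" for x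
    unfolding power2_norm_eq_inner inner_matrix by (simp only: power2_eq_square)
  show iN: "integrable ?M (\<lambda>x. (norm (wjac \<Omega> v x))\<^sup>2)"
    unfolding eqN by (intro Bochner_Integration.integrable_sum J2)
  have mE: "grad_energy v \<in> borel_measurable ?M"
    unfolding grad_energy_def[abs_def] A_form_lame inner_matrix trace_def transpose_def vec_lambda_beta by measurable
  show "integrable ?M (grad_energy v)"
  proof (rule Bochner_Integration.integrable_bound[OF _ mE])
    let ?C = "L * (2 + (real CARD('n))\<^sup>2 + 2 * 0)"
    show "integrable ?M (\<lambda>x. ?C * (norm (wjac \<Omega> v x))\<^sup>2)" using iN by simp
    show "AE x in ?M. norm (grad_energy v x) \<le> norm (?C * (norm (wjac \<Omega> v x))\<^sup>2)"
    proof (rule AE_I2)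
      fix x assume "x \<in> space ?M"
      then have x: "x \<in> \<Omega>" by simp
      have "\<bar>grad_energy v x\<bar> \<le> ?C * (norm (wjac \<Omega> v x) * norm (wjac \<Omega> v x))"
        using abs_qform_le[OF x norm_sgn_le order_refl, of "v x" "wjac \<Omega> v x" "wjac \<Omega> v x"]
        unfolding energy_eq_qform[symmetric] by simp
      then show "norm (grad_energy v x) \<le> norm (?C * (norm (wjac \<Omega> v x))\<^sup>2)"
        unfolding power2_eq_square real_norm_def by linarith
    qed
  qed
  have sg: "sgn (v x) $ \<alpha> = v x $ \<alpha> / sqrt (\<Sum>\<beta>\<in>UNIV. v x $ \<beta> * v x $ \<beta>)" for x \<alpha>
    by (simp add: sgn_div_norm norm_eq_sqrt_inner inner_vec_def divide_inverse_commute)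
  have mR: "radial_energy v \<in> borel_measurable ?M"
    unfolding radial_energy_def[abs_def] radial_form_def inner_vec_def inner_real_def matrix_vector_mult_def transpose_def vec_lambda_beta sg
    by measurable
  show "integrable ?M (radial_energy v)"
  proof (rule Bochner_Integration.integrable_bound[OF _ mR])
    show "integrable ?M (\<lambda>x. L * (norm (wjac \<Omega> v x))\<^sup>2)" using iN by simp
    show "AE x in ?M. norm (radial_energy v x) \<le> norm (L * (norm (wjac \<Omega> v x))\<^sup>2)"
    proof (rule AE_I2)
      fix x assume "x \<in> space ?M"
      then have x: "x \<in> \<Omega>" by simp
      show "norm (radial_energy v x) \<le> norm (L * (norm (wjac \<Omega> v x))\<^sup>2)"
        using radial_energy_bounds[OF x, of v] unfolding real_norm_def by linarith
    qed
  qed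
qed

text \<open>By the chain rule for the modulus, \<open>radial_jac\<close> is the rank one matrix formed from \<open>v / |v|\<close> and
  \<open>transpose (wjac \<Omega> v x) *v (v / |v|)\<close>; the symmetry of the form removes the mixed terms.\<close>

lemma p_form_AE_eq:
  assumes v: "v \<in> W12_0_vec \<Omega>"
  shows "AE x in lebesgue. x \<in> \<Omega> \<longrightarrow> grad_energy v x - t\<^sup>2 * radial_energy v x =
    A_form (lame_A lam mu r x) (wjac \<Omega> v x - t *\<^sub>R radial_jac \<Omega> v x) (wjac \<Omega> v x + t *\<^sub>R radial_jac \<Omega> v x)"
proof -
  have "AE x in lebesgue. \<forall>h. x \<in> \<Omega> \<longrightarrow> wderiv \<Omega> h (\<lambda>y. norm (v y)) x
      = (\<Sum>\<alpha>\<in>UNIV. (v x $ \<alpha> / norm (v x)) * wjac \<Omega> v x $ \<alpha> $ h)"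
    unfolding AE_all_countable by (intro allI wderiv_AE_eq[OF \<Omega> has_wderiv_norm[OF \<Omega> v]])
  then show ?thesis
  proof eventually_elim
    case (elim x)
    show ?case
    proof
      assume x: "x \<in> \<Omega>"
      let ?w = "sgn (v x)" let ?g = "transpose (wjac \<Omega> v x) *v sgn (v x)"
      show "grad_energy v x - t\<^sup>2 * radial_energy v x =
        A_form (lame_A lam mu r x) (wjac \<Omega> v x - t *\<^sub>R radial_jac \<Omega> v x) (wjac \<Omega> v x + t *\<^sub>R radial_jac \<Omega> v x)"
      proof (cases "v x = 0")
        case True
        then show ?thesis by (simp add: grad_energy_def radial_energy_def radial_form_def radial_jac_def)
      next
        case False
        then have n1: "norm ?w = 1" by (simp add: norm_sgn)
        have sg: "?w $ \<alpha> = v x $ \<alpha> / norm (v x)" for \<alpha>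
          by (simp add: sgn_div_norm divide_inverse_commute)
        have "wderiv \<Omega> h (\<lambda>y. norm (v y)) x = ?g $ h" for h
          using elim x by (simp add: matrix_vector_mult_def transpose_def sg mult.commute)
        then have "radial_jac \<Omega> v x = outer ?w ?g"
          using False by (simp add: radial_jac_def outer_def vec_eq_iff sg)
        then show ?thesis
          unfolding grad_energy_def radial_energy_def using A_form_outer[OF n1, of lam mu r x "wjac \<Omega> v x" t ?g] by simp
      qed
    qed
  qed
qed

lemma integral_p_elliptic_iff:
  "integral_p_elliptic \<Omega> p (lame_A lam mu r) \<longleftrightarrow> elliptic_at ((1 - 2 / p)\<^sup>2)"
proof -
  have "(LINT x:\<Omega>|lebesgue. A_form (lame_A lam mu r x)
            (wjac \<Omega> v x - (1 - 2 / p) *\<^sub>R radial_jac \<Omega> v x) (wjac \<Omega> v x + (1 - 2 / p) *\<^sub>R radial_jac \<Omega> v x))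
    = (LINT x|lebesgue_on \<Omega>. grad_energy v x - (1 - 2 / p)\<^sup>2 * radial_energy v x)" if v: "v \<in> W12_0_vec \<Omega>" for v
  proof -
    have m: "(\<lambda>x. grad_energy v x - (1 - 2 / p)\<^sup>2 * radial_energy v x) \<in> borel_measurable (lebesgue_on \<Omega>)"
      using energy_integrable(2,3)[OF v] by (intro borel_measurable_diff borel_measurable_times) auto
    note ae = p_form_AE_eq[OF v, of "1 - 2 / p"]
    show ?thesis
      unfolding set_lebesgue_on(2)[OF \<Omega>_sets]
      using integral_cong_AE[OF m borel_measurable_lebesgue_on_AE[OF \<Omega>_sets m ae] ae[folded AE_lebesgue_on_iff[OF \<Omega>_sets]]]
      by simp
  qed
  then show ?thesis
    unfolding integral_p_elliptic_def elliptic_at_def set_lebesgue_on(2)[OF \<Omega>_sets] by simp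
qed

lemma LINT_energy_diff:
  assumes "v \<in> W12_0_vec \<Omega>"
  shows "(LINT x|lebesgue_on \<Omega>. grad_energy v x - s * radial_energy v x)
    = integral\<^sup>L (lebesgue_on \<Omega>) (grad_energy v) - s * integral\<^sup>L (lebesgue_on \<Omega>) (radial_energy v)"
  using energy_integrable(2,3)[OF assms] by simp

lemma LINT_radial_bounds:
  assumes "v \<in> W12_0_vec \<Omega>"
  shows "0 \<le> integral\<^sup>L (lebesgue_on \<Omega>) (radial_energy v)"
    and "integral\<^sup>L (lebesgue_on \<Omega>) (radial_energy v) \<le> L * (LINT x|lebesgue_on \<Omega>. (norm (wjac \<Omega> v x))\<^sup>2)"
proof -
  show "0 \<le> integral\<^sup>L (lebesgue_on \<Omega>) (radial_energy v)"
    by (rule Bochner_Integration.integral_nonneg) (simp add: radial_energy_bounds(1))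
  have "integral\<^sup>L (lebesgue_on \<Omega>) (radial_energy v) \<le> (LINT x|lebesgue_on \<Omega>. L * (norm (wjac \<Omega> v x))\<^sup>2)"
    using energy_integrable(1,3)[OF assms] by (intro integral_mono) (auto simp: radial_energy_bounds(2))
  then show "integral\<^sup>L (lebesgue_on \<Omega>) (radial_energy v) \<le> L * (LINT x|lebesgue_on \<Omega>. (norm (wjac \<Omega> v x))\<^sup>2)"
    by simp
qed

lemma elliptic_at_mono: "elliptic_at s \<Longrightarrow> s' \<le> s \<Longrightarrow> elliptic_at s'"
  unfolding elliptic_at_def
proof (elim exE conjE)
  fix c assume c: "c > 0" "\<forall>v\<in>W12_0_vec \<Omega>. c * (LINT x|lebesgue_on \<Omega>. (norm (wjac \<Omega> v x))\<^sup>2) \<le>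
      (LINT x|lebesgue_on \<Omega>. grad_energy v x - s * radial_energy v x)" and s: "s' \<le> s"
  show "\<exists>c>0. \<forall>v\<in>W12_0_vec \<Omega>. c * (LINT x|lebesgue_on \<Omega>. (norm (wjac \<Omega> v x))\<^sup>2) \<le>
      (LINT x|lebesgue_on \<Omega>. grad_energy v x - s' * radial_energy v x)"
  proof (intro exI[of _ c] conjI ballI c(1))
    fix v assume v: "v \<in> W12_0_vec \<Omega>"
    have "s' * integral\<^sup>L (lebesgue_on \<Omega>) (radial_energy v) \<le> s * integral\<^sup>L (lebesgue_on \<Omega>) (radial_energy v)"
      by (rule mult_right_mono[OF s LINT_radial_bounds(1)[OF v]])
    then show "c * (LINT x|lebesgue_on \<Omega>. (norm (wjac \<Omega> v x))\<^sup>2) \<le>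
      (LINT x|lebesgue_on \<Omega>. grad_energy v x - s' * radial_energy v x)"
      using c(2)[rule_format, OF v] unfolding LINT_energy_diff[OF v] by linarith
  qed
qed

lemma elliptic_at_open:
  assumes "elliptic_at s" "\<Omega> \<noteq> {}"
  shows "\<exists>s'>s. elliptic_at s'"
proof -
  obtain c where c: "c > 0" "\<forall>v\<in>W12_0_vec \<Omega>. c * (LINT x|lebesgue_on \<Omega>. (norm (wjac \<Omega> v x))\<^sup>2) \<le>
      (LINT x|lebesgue_on \<Omega>. grad_energy v x - s * radial_energy v x)"
    using assms(1) unfolding elliptic_at_def by blast
  obtain x where x: "x \<in> \<Omega>" using assms(2) by blast
  have L0: "L > 0" using L(1)[OF x] e(1) e(2)[OF x] by linarith
  \<comment> \<open>Raising \<open>s\<close> by \<open>d\<close> costs at most half of the ellipticity constant.\<close>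
  define d where "d = c / (2 * L)"
  have d: "d > 0" "d * L = c / 2" unfolding d_def using c(1) L0 by auto
  have "elliptic_at (s + d)"
    unfolding elliptic_at_def
  proof (intro exI[of _ "c / 2"] conjI ballI)
    show "c / 2 > 0" using c(1) by simp
    fix v assume v: "v \<in> W12_0_vec \<Omega>"
    have "d * integral\<^sup>L (lebesgue_on \<Omega>) (radial_energy v) \<le> d * (L * (LINT x|lebesgue_on \<Omega>. (norm (wjac \<Omega> v x))\<^sup>2))"
      using LINT_radial_bounds(2)[OF v] d(1) by (intro mult_left_mono) auto
    also have "\<dots> = c / 2 * (LINT x|lebesgue_on \<Omega>. (norm (wjac \<Omega> v x))\<^sup>2)" using d(2) by (simp add: mult.assoc[symmetric])
    finally show "c / 2 * (LINT x|lebesgue_on \<Omega>. (norm (wjac \<Omega> v x))\<^sup>2) \<le>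
      (LINT x|lebesgue_on \<Omega>. grad_energy v x - (s + d) * radial_energy v x)"
      using c(2)[rule_format, OF v] unfolding LINT_energy_diff[OF v] by (simp add: distrib_right)
  qed
  then show ?thesis using d(1) by (intro exI[of _ "s + d"]) simp
qed

lemma elliptic_at_subcritical:
  assumes r: "\<And>x. x \<in> \<Omega> \<Longrightarrow> r x = mu x + crit_rho (real CARD('n)) (mu x) (lam x + 2 * mu x)"
    and m: "\<And>x. x \<in> \<Omega> \<Longrightarrow> (crit_rho (real CARD('n)) (mu x) (lam x + 2 * mu x) / mu x)\<^sup>2 \<le> m" "m < 1"
    and s: "0 \<le> s" "s < 1 - m"
  shows "elliptic_at s"
  unfolding elliptic_at_def
proof (intro exI[of _ "(1 - m - s) * e / real CARD('n)"] conjI ballI)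
  let ?c = "(1 - m - s) * e / real CARD('n)"
  show "?c > 0" using s e(1) dim by simp
  fix v assume v: "v \<in> W12_0_vec \<Omega>"
  have pw: "?c * (norm (wjac \<Omega> v x))\<^sup>2 \<le> grad_energy v x - s * radial_energy v x" if x: "x \<in> \<Omega>" for x
  proof -
    let ?\<xi> = "wjac \<Omega> v x" let ?a = "mu x" let ?b = "lam x + 2 * mu x"
    define \<rho> where "\<rho> = crit_rho (real CARD('n)) ?a ?b"
    have E: "grad_energy v x = ?a * (?\<xi> \<bullet> ?\<xi>) + (?b - ?a + \<rho>) * (trace ?\<xi>)\<^sup>2 - \<rho> * (transpose ?\<xi> \<bullet> ?\<xi>)"
      unfolding grad_energy_def A_form_lame r[OF x] \<rho>_def[symmetric] by (simp add: power2_eq_square algebra_simps)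
    have main: "?c * (?\<xi> \<bullet> ?\<xi>) \<le> grad_energy v x - s * radial_form ?a ?b w (transpose ?\<xi> *v w)" if "norm w = 1" for w
      unfolding E using subcritical_form_ge[OF dim e(1) e(2,3)[OF x] that \<rho>_def m(1)[OF x, folded \<rho>_def] m(2) s, of ?\<xi>] by simp
    show ?thesis
    proof (cases "v x = 0")
      case False
      then have "norm (sgn (v x)) = 1" by (simp add: norm_sgn)
      from main[OF this] show ?thesis unfolding radial_energy_def by (simp add: power2_norm_eq_inner)
    next
      case True
      obtain w :: "real^'n" where w: "norm w = 1" using norm_axis_1 by blast
      have "0 \<le> e * ((transpose ?\<xi> *v w) \<bullet> (transpose ?\<xi> *v w))" using e(1) by simp
      then have "0 \<le> radial_form ?a ?b w (transpose ?\<xi> *v w)"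
        using radial_form_ge[OF w e(2,3)[OF x]] by (rule order_trans)
      then have "0 \<le> s * radial_form ?a ?b w (transpose ?\<xi> *v w)" using s(1) by simp
      moreover have "radial_energy v x = 0" using True by (simp add: radial_energy_def radial_form_def)
      ultimately show ?thesis using main[OF w] by (simp add: power2_norm_eq_inner)
    qed
  qed
  have "(LINT x|lebesgue_on \<Omega>. ?c * (norm (wjac \<Omega> v x))\<^sup>2) \<le> (LINT x|lebesgue_on \<Omega>. grad_energy v x - s * radial_energy v x)"
  proof (rule integral_mono)
    show "integrable (lebesgue_on \<Omega>) (\<lambda>x. ?c * (norm (wjac \<Omega> v x))\<^sup>2)" using energy_integrable(1)[OF v] by simp
    show "integrable (lebesgue_on \<Omega>) (\<lambda>x. grad_energy v x - s * radial_energy v x)"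
      using energy_integrable(2,3)[OF v] by simp
  qed (use pw in simp)
  then show "?c * (LINT x|lebesgue_on \<Omega>. (norm (wjac \<Omega> v x))\<^sup>2) \<le> (LINT x|lebesgue_on \<Omega>. grad_energy v x - s * radial_energy v x)"
    by simp
qed

section \<open>Oscillating test functions\<close>

lemma qform_outer_unit:
  assumes "norm \<kappa> = 1"
  shows "lame_qform l m r' s w (outer \<eta> \<kappa>) (outer \<eta> \<kappa>)
     = m * (\<eta> \<bullet> \<eta>) + (l + m) * (\<eta> \<bullet> \<kappa>)\<^sup>2 - s * ((w \<bullet> \<eta>)\<^sup>2 * (m + (l + m) * (w \<bullet> \<kappa>)\<^sup>2))"
proof -
  have k: "\<kappa> \<bullet> \<kappa> = 1" using assms by (simp add: dot_square_norm)
  have o: "outer \<eta> \<kappa> \<bullet> outer \<eta> \<kappa> = \<eta> \<bullet> \<eta>" "outer \<kappa> \<eta> \<bullet> outer \<eta> \<kappa> = (\<eta> \<bullet> \<kappa>)\<^sup>2"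
    using k by (simp_all add: inner_outer outer_mult_vec inner_commute power2_eq_square)
  have c: "\<eta> \<bullet> w = w \<bullet> \<eta>" by (rule inner_commute)
  show ?thesis
    unfolding lame_qform_def transpose_outer trace_outer o outer_mult_vec inner_scaleR_left inner_scaleR_right k c
    by (simp add: algebra_simps power2_eq_square)
qed

text \<open>With \<open>\<omega> = axis i 1\<close> and \<open>\<kappa>\<close> bisecting the two axes, \<open>q\<close> is the amplitude of the transversal component of
  \<open>\<eta>\<close> that minimises the form.\<close>

lemma critical_direction:
  fixes i j :: 'n
  assumes ij: "i \<noteq> j" and x0: "x0 \<in> \<Omega>"
  defines "q \<equiv> (lam x0 + mu x0) / (lam x0 + 3 * mu x0)"
  defines "\<kappa> \<equiv> (1 / sqrt 2) *\<^sub>R (axis i 1 + axis j (1::real)) :: real^'n" and "\<eta> \<equiv> axis i 1 - q *\<^sub>R axis j (1::real) :: real^'n"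
  shows "norm \<kappa> = 1"
    and "mu x0 * (\<eta> \<bullet> \<eta>) + (lam x0 + mu x0) * (\<eta> \<bullet> \<kappa>)\<^sup>2
       - s * ((axis i 1 \<bullet> \<eta>)\<^sup>2 * (mu x0 + (lam x0 + mu x0) * (axis i 1 \<bullet> \<kappa>)\<^sup>2))
       = (lam x0 + 3 * mu x0) / 2 * (1 - q\<^sup>2 - s)"
proof -
  have ax: "axis i 1 \<bullet> (axis i 1 :: real^'n) = 1" "axis j 1 \<bullet> (axis j 1 :: real^'n) = 1"
    "axis i 1 \<bullet> (axis j 1 :: real^'n) = 0" "axis j 1 \<bullet> (axis i 1 :: real^'n) = 0"
    using ij by (simp_all add: inner_axis_axis)
  have s2: "(1 / sqrt 2) * (1 / sqrt 2) = (1 / 2 :: real)" by simp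
  have "\<kappa> \<bullet> \<kappa> = 1" unfolding \<kappa>_def by (simp add: inner_add_left inner_add_right ax s2)
  then show "norm \<kappa> = 1" by (simp add: norm_eq_sqrt_inner)
  have ee: "\<eta> \<bullet> \<eta> = 1 + q\<^sup>2" unfolding \<eta>_def by (simp add: inner_diff_left inner_diff_right ax power2_eq_square)
  have ek: "(\<eta> \<bullet> \<kappa>)\<^sup>2 = (1 - q)\<^sup>2 / 2"
    unfolding \<eta>_def \<kappa>_def by (simp add: inner_diff_left inner_add_right ax power_divide)
  have ie: "axis i 1 \<bullet> \<eta> = 1" unfolding \<eta>_def by (simp add: inner_diff_right ax)
  have ik: "(axis i 1 \<bullet> \<kappa>)\<^sup>2 = 1 / 2" unfolding \<kappa>_def by (simp add: inner_add_right ax power_divide)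
  define c where "c = lam x0 + 3 * mu x0"
  have c: "c > 0" unfolding c_def using e(1) e(2,3)[OF x0] by linarith
  have k: "lam x0 + mu x0 = q * c" unfolding q_def c_def[symmetric] using c by simp
  have mu: "mu x0 = (c - q * c) / 2" using k unfolding c_def by simp
  show "mu x0 * (\<eta> \<bullet> \<eta>) + (lam x0 + mu x0) * (\<eta> \<bullet> \<kappa>)\<^sup>2
       - s * ((axis i 1 \<bullet> \<eta>)\<^sup>2 * (mu x0 + (lam x0 + mu x0) * (axis i 1 \<bullet> \<kappa>)\<^sup>2))
       = (lam x0 + 3 * mu x0) / 2 * (1 - q\<^sup>2 - s)"
    unfolding ee ek ie ik c_def[symmetric] k unfolding mu by (simp add: power2_eq_square field_simps)
qed

end

text \<open>A large constant vector plus an oscillation of frequency \<open>\<tau>\<close>, cut off near \<open>x0\<close>: the direction of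
  the sum hardly varies, so the form acts on the oscillation as with a frozen \<open>\<omega>\<close>.\<close>

definition wave :: "(real^'n::finite \<Rightarrow> real) \<Rightarrow> real^'n \<Rightarrow> real^'n \<Rightarrow> real^'n \<Rightarrow> real \<Rightarrow> real \<Rightarrow> real^'n \<Rightarrow> real^'n" where
  "wave \<zeta> a \<eta> \<kappa> \<tau> \<theta> x = \<zeta> x *\<^sub>R (a + sin (\<tau> * (\<kappa> \<bullet> x) + \<theta>) *\<^sub>R \<eta>)"

lemma wave_component_smooth:
  assumes "smooth \<zeta>"
  shows "smooth (\<lambda>x. wave \<zeta> a \<eta> \<kappa> \<tau> \<theta> x $ \<alpha>)"
proof -
  have "smooth (\<lambda>x. \<zeta> x * (a $ \<alpha> + sin (\<tau> * (\<kappa> \<bullet> x) + \<theta>) * \<eta> $ \<alpha>))"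
    by (intro smooth_mult smooth_add smooth_sin smooth_const smooth_inner assms)
  then show ?thesis by (simp add: wave_def)
qed

lemma pd_wave:
  assumes "smooth \<zeta>"
  shows "pd h (\<lambda>x. wave \<zeta> a \<eta> \<kappa> \<tau> \<theta> x $ \<alpha>) x
    = pd h \<zeta> x * (a + sin (\<tau> * (\<kappa> \<bullet> x) + \<theta>) *\<^sub>R \<eta>) $ \<alpha> + \<tau> * \<zeta> x * cos (\<tau> * (\<kappa> \<bullet> x) + \<theta>) * (\<eta> $ \<alpha> * \<kappa> $ h)"
proof -
  let ?D = "frechet_derivative \<zeta> (at x)"
  have "((\<lambda>x. \<zeta> x * (a $ \<alpha> + sin (\<tau> * (\<kappa> \<bullet> x) + \<theta>) * \<eta> $ \<alpha>)) has_derivative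
      (\<lambda>v. \<zeta> x * (cos (\<tau> * (\<kappa> \<bullet> x) + \<theta>) * (\<tau> * (\<kappa> \<bullet> v)) * \<eta> $ \<alpha>) + ?D v * (a $ \<alpha> + sin (\<tau> * (\<kappa> \<bullet> x) + \<theta>) * \<eta> $ \<alpha>))) (at x)"
    by (rule has_derivative_mult[OF smooth_has_derivative[OF assms]])
       (auto intro!: derivative_eq_intros)
  from pd_eqI[OF this, of h] show ?thesis
    by (simp add: wave_def pd_def inner_axis algebra_simps)
qed

context lame_setting
begin

text \<open>Up to bounded errors, the energy of the wave is \<open>\<tau>\<^sup>2 * (\<zeta> x)\<^sup>2 * (cos (\<tau> * (\<kappa> \<bullet> x) + \<theta>))\<^sup>2\<close> times a form that is
  less than \<open>- \<delta>\<close>; the sum over two phases is of order \<open>- \<tau>\<^sup>2\<close>, while ellipticity makes it nonnegative.\<close>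

lemma not_elliptic_at_supercritical:
  assumes x0: "x0 \<in> \<Omega>" and s: "0 \<le> s" "1 - ((lam x0 + mu x0) / (lam x0 + 3 * mu x0))\<^sup>2 < s"
  shows "\<not> elliptic_at s"
proof
  assume ell: "elliptic_at s"
  obtain i j :: 'n where ij: "i \<noteq> j"
  proof -
    have "\<not> CARD('n) \<le> Suc 0" using dim by simp
    then show thesis using that by (auto simp: card_le_Suc0_iff_eq)
  qed
  define q where "q = (lam x0 + mu x0) / (lam x0 + 3 * mu x0)"
  define \<kappa> where "\<kappa> = ((1 / sqrt 2) *\<^sub>R (axis i 1 + axis j (1::real)) :: real^'n)"
  define \<eta> where "\<eta> = (axis i 1 - q *\<^sub>R axis j (1::real) :: real^'n)"
  \<comment> \<open>The form at \<open>outer \<eta> \<kappa>\<close>, as a function of the point and of the direction \<open>w\<close> of the field.\<close>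
  define H where "H x w = mu x * (\<eta> \<bullet> \<eta>) + (lam x + mu x) * (\<eta> \<bullet> \<kappa>)\<^sup>2
       - s * ((w \<bullet> \<eta>)\<^sup>2 * (mu x + (lam x + mu x) * (w \<bullet> \<kappa>)\<^sup>2))" for x and w :: "real^'n"
  have cd: "norm \<kappa> = 1"
    "mu x0 * (\<eta> \<bullet> \<eta>) + (lam x0 + mu x0) * (\<eta> \<bullet> \<kappa>)\<^sup>2
       - s * ((axis i 1 \<bullet> \<eta>)\<^sup>2 * (mu x0 + (lam x0 + mu x0) * (axis i 1 \<bullet> \<kappa>)\<^sup>2))
       = (lam x0 + 3 * mu x0) / 2 * (1 - q\<^sup>2 - s)"
    unfolding \<kappa>_def \<eta>_def q_def by (fact critical_direction[OF ij x0])+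
  have H0: "H x0 (axis i 1) = (lam x0 + 3 * mu x0) / 2 * (1 - q\<^sup>2 - s)" unfolding H_def by (rule cd(2))
  have cpos: "lam x0 + 3 * mu x0 > 0" using e(1) e(2,3)[OF x0] by linarith
  have "H x0 (axis i 1) < 0" unfolding H0 using cpos s(2) unfolding q_def[symmetric] by (intro mult_pos_neg) auto
  define \<delta> where "\<delta> = - H x0 (axis i 1) / 2"
  have \<delta>: "\<delta> > 0" "H x0 (axis i 1) < - \<delta>" unfolding \<delta>_def using \<open>H x0 (axis i 1) < 0\<close> by auto
  \<comment> \<open>Neighbourhoods on which the coefficients and the direction may be frozen.\<close>
  have cf: "continuous_on (\<Omega> \<times> UNIV) (\<lambda>p::(real^'n) \<times> (real^'n). f (fst p))" if "continuous_on \<Omega> f" for f :: "real^'n \<Rightarrow> real"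
    by (rule continuous_on_compose2[OF that]) (auto intro!: continuous_intros)
  have "continuous_on (\<Omega> \<times> UNIV) (\<lambda>p. H (fst p) (snd p))"
    unfolding H_def by (intro continuous_intros cf cont)
  from continuous_open_preimage[OF this open_Times[OF \<Omega> open_UNIV], of "{..<- \<delta>}"]
  have "open ((\<Omega> \<times> UNIV) \<inter> (\<lambda>p. H (fst p) (snd p)) -` {..<- \<delta>})" by simp
  moreover have "(x0, axis i 1) \<in> (\<Omega> \<times> UNIV) \<inter> (\<lambda>p. H (fst p) (snd p)) -` {..<- \<delta>}" using x0 \<delta>(2) by simp
  ultimately obtain A B where A: "open A" and B: "open B" and mem: "(x0, axis i 1) \<in> A \<times> B"
    and sub: "A \<times> B \<subseteq> (\<Omega> \<times> UNIV) \<inter> (\<lambda>p. H (fst p) (snd p)) -` {..<- \<delta>}"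
    by (rule open_prod_elim)
  have "x0 \<in> A" "axis i 1 \<in> B" using mem by simp_all
  note AB = A B this sub
  have HAB: "x \<in> \<Omega> \<and> H x w < - \<delta>" if "x \<in> A" "w \<in> B" for x w using AB(5) that by auto
  obtain d where d: "d > 0" "cball x0 d \<subseteq> A" using AB(1,3) open_contains_cball by blast
  have d\<Omega>: "cball x0 d \<subseteq> \<Omega>" using d(2) HAB AB(4) by blast
  have ax1: "norm (axis i 1 :: real^'n) = 1" by simp
  have sgn_ax: "sgn (axis i 1 :: real^'n) = axis i 1" using ax1 by (simp add: sgn_div_norm)
  have "(sgn \<longlongrightarrow> sgn (axis i 1)) (at (axis i 1 :: real^'n))"
    by (rule tendsto_sgn[OF tendsto_ident_at]) simp
  then have "\<forall>\<^sub>F z in at (axis i 1). sgn z \<in> B" using AB(2,4) unfolding sgn_ax by (rule topological_tendstoD)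
  then obtain \<rho>0 where \<rho>0: "\<rho>0 > 0" "\<And>z. z \<noteq> axis i 1 \<Longrightarrow> dist z (axis i 1) < \<rho>0 \<Longrightarrow> sgn z \<in> B"
    unfolding eventually_at by auto
  define \<rho> where "\<rho> = min \<rho>0 1"
  have \<rho>: "\<rho> > 0" unfolding \<rho>_def using \<rho>0(1) by simp
  have sgnB: "sgn z \<in> B \<and> z \<noteq> 0" if "dist z (axis i 1) < \<rho>" for z
  proof -
    have "sgn z \<in> B" using \<rho>0(2)[of z] that AB(4) sgn_ax unfolding \<rho>_def by (cases "z = axis i 1") auto
    moreover have "z \<noteq> 0" using that ax1 unfolding \<rho>_def by (auto simp: dist_norm)
    ultimately show ?thesis by blast
  qed
  \<comment> \<open>So large that adding a multiple \<open>t *\<^sub>R \<eta>\<close> with \<open>\<bar>t\<bar> \<le> 1\<close> turns the direction by less than allowed by \<open>\<rho>\<close>.\<close>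
  define N where "N = norm \<eta> / \<rho> + 1"
  have N: "N > 0" "norm \<eta> < N * \<rho>"
  proof -
    have "0 \<le> norm \<eta> / \<rho>" using \<rho> by simp
    then show "N > 0" unfolding N_def by linarith
    have "N * \<rho> = norm \<eta> + \<rho>" unfolding N_def using \<rho> by (simp add: distrib_right)
    then show "norm \<eta> < N * \<rho>" using \<rho> by simp
  qed
  define a where "a = N *\<^sub>R (axis i 1 :: real^'n)"
  have near: "sgn (a + t *\<^sub>R \<eta>) \<in> B \<and> a + t *\<^sub>R \<eta> \<noteq> 0" if t: "\<bar>t\<bar> \<le> 1" for t
  proof -
    let ?z = "axis i 1 + (t / N) *\<^sub>R \<eta>"
    have eq: "a + t *\<^sub>R \<eta> = N *\<^sub>R ?z" unfolding a_def using N(1) by (simp add: scaleR_add_right)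
    have "dist ?z (axis i 1) = \<bar>t\<bar> * norm \<eta> / N" using N(1) by (simp add: dist_norm)
    also have "\<dots> \<le> 1 * norm \<eta> / N" using t N(1) by (intro divide_right_mono mult_right_mono) auto
    also have "\<dots> < \<rho>" using N by (simp add: field_simps)
    finally have "sgn ?z \<in> B \<and> ?z \<noteq> 0" by (rule sgnB)
    moreover have "sgn (N *\<^sub>R ?z) = sgn ?z" using N(1) by (simp add: sgn_scaleR)
    ultimately show ?thesis unfolding eq using N(1) by simp
  qed
  obtain \<zeta> :: "real^'n \<Rightarrow> real" where \<zeta>: "smooth \<zeta>" "\<And>x. 0 \<le> \<zeta> x" "\<And>x. \<zeta> x \<le> 1"
    "\<And>x. 0 < \<zeta> x \<longleftrightarrow> x \<in> ball x0 d" "\<And>x. x \<notin> cball x0 d \<Longrightarrow> \<zeta> x = 0"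
    using ball_bump[OF d(1), of x0] by metis
  define g\<zeta> where "g\<zeta> x = (\<chi> h. pd h \<zeta> x)" for x
  have g\<zeta>c: "continuous_on S (\<lambda>x. norm (g\<zeta> x))" for S
    unfolding g\<zeta>_def by (intro continuous_on_norm continuous_on_vec_lambda smooth_continuous smooth_pd \<zeta>(1))
  obtain G where "\<And>x. x \<in> cball x0 d \<Longrightarrow> \<bar>norm (g\<zeta> x)\<bar> \<le> G"
    using continuous_on_compact_bound[OF compact_cball g\<zeta>c] by blast
  then have G: "norm (g\<zeta> x) \<le> G" if "x \<in> cball x0 d" for x using that by fastforce
  have G0: "0 \<le> G" using order_trans[OF norm_ge_zero G[of x0]] d(1) by simp
  define C1 where "C1 = L * (2 + (real CARD('n))\<^sup>2 + 2 * s)"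
  have C1: "0 \<le> C1" unfolding C1_def using L(1)[OF x0] s(1) by (intro mult_nonneg_nonneg) auto
  define R where "R = (N + norm \<eta>) * G"
  have R0: "0 \<le> R" unfolding R_def using N(1) G0 by simp
  \<comment> \<open>The contribution of the gradient of the cutoff: its own energy and what Young's inequality leaves of
    the mixed term.\<close>
  define C2 where "C2 = C1 * (R * R) + (2 / \<delta>) * (C1 * (R * norm \<eta>))\<^sup>2"
  let ?M = "lebesgue_on \<Omega>"
  let ?I = "\<lambda>x. indicator (cball x0 d) x :: real"
  have est: "(LINT x|?M. ?I x * (C2 - \<delta> / 2 * (\<tau> * \<zeta> x * cos (\<tau> * (\<kappa> \<bullet> x) + \<theta>))\<^sup>2)) \<ge> 0 \<and>
     integrable ?M (\<lambda>x. ?I x * (C2 - \<delta> / 2 * (\<tau> * \<zeta> x * cos (\<tau> * (\<kappa> \<bullet> x) + \<theta>))\<^sup>2))" for \<tau> \<theta>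
  proof -
    let ?v = "wave \<zeta> a \<eta> \<kappa> \<tau> \<theta>"
    let ?sn = "\<lambda>x. sin (\<tau> * (\<kappa> \<bullet> x) + \<theta>)" let ?cs = "\<lambda>x. cos (\<tau> * (\<kappa> \<bullet> x) + \<theta>)"
    let ?b = "\<lambda>x. ?I x * (C2 - \<delta> / 2 * (\<tau> * \<zeta> x * ?cs x)\<^sup>2)"
    have vs: "smooth (\<lambda>x. ?v x $ \<alpha>)" for \<alpha> by (rule wave_component_smooth[OF \<zeta>(1)])
    have vt: "(\<lambda>x. ?v x $ \<alpha>) \<in> test_fun \<Omega>" for \<alpha>
      by (rule test_funI[OF vs compact_cball d\<Omega>]) (simp add: wave_def \<zeta>(5))
    have v: "?v \<in> W12_0_vec \<Omega>" unfolding W12_0_vec_def using test_fun_W12_0[OF \<Omega> vt] by blast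
    have ib: "integrable ?M ?b"
    proof -
      have "set_integrable lebesgue \<Omega> ?b"
      proof (rule set_integrable_continuous_compact[OF compact_cball d\<Omega>])
        have "continuous_on (cball x0 d) (\<lambda>x. C2 - \<delta> / 2 * (\<tau> * \<zeta> x * ?cs x)\<^sup>2)"
          by (intro continuous_intros smooth_continuous \<zeta>(1))
        then show "continuous_on (cball x0 d) ?b" by (rule continuous_on_eq) simp
      qed simp
      then show ?thesis unfolding set_lebesgue_on(1)[OF \<Omega>_sets] .
    qed
    have "AE x in lebesgue. \<forall>\<alpha> h. x \<in> \<Omega> \<longrightarrow> wderiv \<Omega> h (\<lambda>x. ?v x $ \<alpha>) x = pd h (\<lambda>x. ?v x $ \<alpha>) x"
      unfolding AE_all_countable by (intro allI wderiv_AE_eq[OF \<Omega> has_wderiv_smooth[OF \<Omega> vs]])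
    then have ae: "AE x in lebesgue. x \<in> \<Omega> \<longrightarrow> grad_energy ?v x - s * radial_energy ?v x \<le> ?b x"
    proof eventually_elim
      case (elim x)
      show ?case
      proof
        assume x: "x \<in> \<Omega>"
        let ?f = "a + ?sn x *\<^sub>R \<eta>"
        let ?\<xi>0 = "outer ?f (g\<zeta> x)" let ?\<xi>1 = "outer \<eta> \<kappa>"
        define T where "T = \<tau> * \<zeta> x * ?cs x"
        have \<xi>: "wjac \<Omega> ?v x = ?\<xi>0 + T *\<^sub>R ?\<xi>1"
          using elim x unfolding wjac_def pd_wave[OF \<zeta>(1)] T_def
          by (simp add: vec_eq_iff outer_def g\<zeta>_def mult_ac)
        show "grad_energy ?v x - s * radial_energy ?v x \<le> ?b x"
        proof (cases "x \<in> cball x0 d")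
          case False
          have z0: "\<zeta> x = 0" by (rule \<zeta>(5)[OF False])
          have "g\<zeta> x = 0"
            unfolding g\<zeta>_def using pd_eq_0_outside[OF closed_cball \<zeta>(5) False] by (simp add: vec_eq_iff)
          then have "wjac \<Omega> ?v x = 0" unfolding \<xi> T_def z0 by (simp add: vec_eq_iff outer_def)
          then show ?thesis
            unfolding energy_eq_qform using False
            by (simp add: lame_qform_def trace_def transpose_def inner_matrix matrix_vector_mult_def inner_vec_def)
        next
          case True
          let ?w = "sgn (?v x)"
          let ?Q = "lame_qform (lam x) (mu x) (r x) s ?w"
          have nf: "norm ?f \<le> N + norm \<eta>"
          proof -
            have "norm ?f \<le> norm a + norm (?sn x *\<^sub>R \<eta>)" by (rule norm_triangle_ineq)
            also have "norm a = N" unfolding a_def using N(1) by simp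
            also have "norm (?sn x *\<^sub>R \<eta>) \<le> 1 * norm \<eta>" unfolding norm_scaleR by (intro mult_right_mono) auto
            finally show ?thesis by simp
          qed
          have n0: "norm ?\<xi>0 \<le> R"
            unfolding norm_outer R_def using nf G[OF True] N(1) by (intro mult_mono) auto
          have n1: "norm ?\<xi>1 = norm \<eta>" unfolding norm_outer cd(1) by simp
          have b00: "?Q ?\<xi>0 ?\<xi>0 \<le> C1 * (R * R)"
          proof -
            have "\<bar>?Q ?\<xi>0 ?\<xi>0\<bar> \<le> C1 * (norm ?\<xi>0 * norm ?\<xi>0)"
              unfolding C1_def by (rule abs_qform_le[OF x norm_sgn_le s(1)])
            also have "\<dots> \<le> C1 * (R * R)" by (intro mult_left_mono mult_mono n0 C1 R0) auto
            finally show ?thesis by linarith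
          qed
          have b01: "\<bar>?Q ?\<xi>0 ?\<xi>1\<bar> \<le> C1 * (R * norm \<eta>)"
          proof -
            have "\<bar>?Q ?\<xi>0 ?\<xi>1\<bar> \<le> C1 * (norm ?\<xi>0 * norm ?\<xi>1)"
              unfolding C1_def by (rule abs_qform_le[OF x norm_sgn_le s(1)])
            also have "\<dots> \<le> C1 * (R * norm \<eta>)" unfolding n1 by (intro mult_left_mono mult_right_mono n0 C1) auto
            finally show ?thesis .
          qed
          have b11: "T\<^sup>2 * ?Q ?\<xi>1 ?\<xi>1 \<le> - \<delta> * T\<^sup>2"
          proof (cases "\<zeta> x = 0")
            case True
            then show ?thesis unfolding T_def by simp
          next
            case False
            then have zp: "\<zeta> x > 0" using \<zeta>(2)[of x] by linarith
            have "?w = sgn ?f" unfolding wave_def using zp by (simp add: sgn_scaleR)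
            then have "?w \<in> B" using near[of "?sn x"] by simp
            moreover have "x \<in> A" using True d(2) by blast
            ultimately have "H x ?w < - \<delta>" using HAB by blast
            moreover have "?Q ?\<xi>1 ?\<xi>1 = H x ?w" unfolding H_def qform_outer_unit[OF cd(1)] ..
            ultimately have "T\<^sup>2 * ?Q ?\<xi>1 ?\<xi>1 \<le> T\<^sup>2 * (- \<delta>)" by (intro mult_left_mono) auto
            then show ?thesis by (simp add: mult.commute)
          qed
          \<comment> \<open>Young's inequality absorbs the mixed term.\<close>
          have young: "2 * T * ?Q ?\<xi>0 ?\<xi>1 \<le> \<delta> / 2 * T\<^sup>2 + (2 / \<delta>) * (C1 * (R * norm \<eta>))\<^sup>2"
          proof -
            define y where "y = ?Q ?\<xi>0 ?\<xi>1"
            have y2: "y\<^sup>2 \<le> (C1 * (R * norm \<eta>))\<^sup>2" using power_mono[OF b01 abs_ge_zero, of 2] unfolding y_def by simp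
            have "0 \<le> (\<delta> * T - 2 * y)\<^sup>2 / (2 * \<delta>)" using \<delta>(1) by simp
            also have "\<dots> = \<delta> / 2 * T\<^sup>2 - 2 * T * y + (2 / \<delta>) * y\<^sup>2"
              using \<delta>(1) by (simp add: power2_eq_square field_simps)
            also have "(2 / \<delta>) * y\<^sup>2 \<le> (2 / \<delta>) * (C1 * (R * norm \<eta>))\<^sup>2"
              using y2 \<delta>(1) by (intro mult_left_mono) auto
            finally show ?thesis unfolding y_def by simp
          qed
          have "grad_energy ?v x - s * radial_energy ?v x
              = ?Q ?\<xi>0 ?\<xi>0 + 2 * T * ?Q ?\<xi>0 ?\<xi>1 + T\<^sup>2 * ?Q ?\<xi>1 ?\<xi>1"
            unfolding energy_eq_qform \<xi> by (rule lame_qform_add)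
          also have "\<dots> \<le> C2 - \<delta> / 2 * T\<^sup>2" using b00 young b11 unfolding C2_def by linarith
          finally show ?thesis using True unfolding T_def by simp
        qed
      qed
    qed
    obtain c where c: "c > 0" "\<forall>v\<in>W12_0_vec \<Omega>. c * (LINT x|?M. (norm (wjac \<Omega> v x))\<^sup>2) \<le>
       (LINT x|?M. grad_energy v x - s * radial_energy v x)"
      using ell unfolding elliptic_at_def by blast
    have "0 \<le> c * (LINT x|?M. (norm (wjac \<Omega> ?v x))\<^sup>2)"
      using c(1) by (intro mult_nonneg_nonneg Bochner_Integration.integral_nonneg) auto
    also have "\<dots> \<le> (LINT x|?M. grad_energy ?v x - s * radial_energy ?v x)" using c(2) v by blast
    also have "\<dots> \<le> (LINT x|?M. ?b x)"
    proof (rule integral_mono_AE[OF _ ib])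
      show "integrable ?M (\<lambda>x. grad_energy ?v x - s * radial_energy ?v x)"
        using energy_integrable(2,3)[OF v] by simp
      show "AE x in ?M. grad_energy ?v x - s * radial_energy ?v x \<le> ?b x"
        unfolding AE_lebesgue_on_iff[OF \<Omega>_sets] by (rule ae)
    qed
    finally show ?thesis using ib by blast
  qed
  define X where "X = (LINT x|?M. ?I x * (\<zeta> x)\<^sup>2)"
  define Y where "Y = (LINT x|?M. ?I x)"
  have iI: "integrable ?M (\<lambda>x. ?I x * (\<zeta> x)\<^sup>2)" "integrable ?M (\<lambda>x. ?I x)"
  proof -
    have c1: "continuous_on (cball x0 d) (\<lambda>x. ?I x * (\<zeta> x)\<^sup>2)"
    proof -
      have "continuous_on (cball x0 d) (\<lambda>x. (\<zeta> x)\<^sup>2)" by (intro continuous_intros smooth_continuous \<zeta>(1))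
      then show ?thesis by (rule continuous_on_eq) simp
    qed
    have c2: "continuous_on (cball x0 d) ?I"
    proof -
      have "continuous_on (cball x0 d) (\<lambda>x. 1::real)" by simp
      then show ?thesis by (rule continuous_on_eq) simp
    qed
    show "integrable ?M (\<lambda>x. ?I x * (\<zeta> x)\<^sup>2)" "integrable ?M (\<lambda>x. ?I x)"
      unfolding set_lebesgue_on(1)[OF \<Omega>_sets, symmetric]
      by (rule set_integrable_continuous_compact[OF compact_cball d\<Omega> c1], simp)
         (rule set_integrable_continuous_compact[OF compact_cball d\<Omega> c2], simp)
  qed
  have X: "X > 0"
  proof -
    have "0 \<le> X" unfolding X_def by (intro Bochner_Integration.integral_nonneg) auto
    moreover have "X \<noteq> 0"
    proof
      assume "X = 0"
      then have "AE x in ?M. ?I x * (\<zeta> x)\<^sup>2 = 0"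
        using integral_nonneg_eq_0_iff_AE[OF iI(1)] unfolding X_def by auto
      then have "AE x in ?M. \<zeta> x \<le> 0"
      proof eventually_elim
        case (elim x)
        then show ?case using \<zeta>(5)[of x] by (cases "x \<in> cball x0 d") auto
      qed
      then have "\<zeta> x0 \<le> 0" using AE_le_imp_all_le[OF \<Omega> smooth_continuous[OF \<zeta>(1)] _ x0] by blast
      then show False using \<zeta>(4)[of x0] d(1) by simp
    qed
    ultimately show ?thesis by simp
  qed
  \<comment> \<open>The two phases add up to \<open>cos\<^sup>2 + sin\<^sup>2 = 1\<close>.\<close>
  have sum: "0 \<le> 2 * C2 * Y - \<delta> / 2 * \<tau>\<^sup>2 * X" for \<tau>
  proof -
    let ?b = "\<lambda>\<theta> x. ?I x * (C2 - \<delta> / 2 * (\<tau> * \<zeta> x * cos (\<tau> * (\<kappa> \<bullet> x) + \<theta>))\<^sup>2)"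
    have "0 \<le> (LINT x|?M. ?b 0 x) + (LINT x|?M. ?b (pi / 2) x)"
      using est[of \<tau> 0] est[of \<tau> "pi / 2"] by linarith
    also have "\<dots> = (LINT x|?M. ?b 0 x + ?b (pi / 2) x)"
      using est[of \<tau> 0] est[of \<tau> "pi / 2"] by (intro Bochner_Integration.integral_add[symmetric]) auto
    also have "\<dots> = (LINT x|?M. 2 * C2 * ?I x - \<delta> / 2 * \<tau>\<^sup>2 * (?I x * (\<zeta> x)\<^sup>2))"
    proof (rule Bochner_Integration.integral_cong[OF refl])
      fix x
      let ?p = "\<tau> * (\<kappa> \<bullet> x)"
      have cs: "cos (?p + pi / 2) = - sin ?p" by (simp add: cos_add)
      have e1: "(\<tau> * \<zeta> x * cos (?p + 0))\<^sup>2 + (\<tau> * \<zeta> x * cos (?p + pi / 2))\<^sup>2 = \<tau>\<^sup>2 * (\<zeta> x)\<^sup>2"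
        unfolding cs add_0_right power_mult_distrib power2_minus distrib_left[symmetric] sin_cos_squared_add2 mult_1_right ..
      have "?b 0 x + ?b (pi / 2) x = ?I x * (2 * C2 - \<delta> / 2 * ((\<tau> * \<zeta> x * cos (?p + 0))\<^sup>2 + (\<tau> * \<zeta> x * cos (?p + pi / 2))\<^sup>2))"
        by (simp add: algebra_simps)
      also have "\<dots> = 2 * C2 * ?I x - \<delta> / 2 * \<tau>\<^sup>2 * (?I x * (\<zeta> x)\<^sup>2)"
        unfolding e1 by (simp add: algebra_simps)
      finally show "?b 0 x + ?b (pi / 2) x = 2 * C2 * ?I x - \<delta> / 2 * \<tau>\<^sup>2 * (?I x * (\<zeta> x)\<^sup>2)" .
    qed
    also have "\<dots> = 2 * C2 * Y - \<delta> / 2 * \<tau>\<^sup>2 * X"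
      unfolding X_def Y_def using iI by simp
    finally show ?thesis .
  qed
  \<comment> \<open>The square of a frequency at which the negative part exceeds the error.\<close>
  define u where "u = (2 * \<bar>C2 * Y\<bar> + 1) / (\<delta> / 2 * X)"
  have u: "u \<ge> 0" "\<delta> / 2 * u * X = 2 * \<bar>C2 * Y\<bar> + 1" unfolding u_def using \<delta>(1) X by auto
  have "0 \<le> 2 * C2 * Y - \<delta> / 2 * u * X" using sum[of "sqrt u"] u(1) by simp
  then show False unfolding u(2) by linarith
qed

end

section \<open>The threshold\<close>

text \<open>Rationalise the bracket: with \<open>Q = sqrt (crit_disc n m b)\<close> it is \<open>(m + b - Q) / 2\<close>, and
  \<open>(m + b - Q) * (m + b + Q)\<close> is a multiple of \<open>m * b\<close>.\<close>

lemma crit_rho_statement_form: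
  fixes l m n :: real
  assumes n: "n \<ge> 3" and m: "m > 0" and b: "l + 2 * m > 0"
  shows "(1 + 1 / (n - 2))\<^sup>2 * ((l + m) / (m * (l + 2 * m)))\<^sup>2
      * ((l + 3 * m) / 2 - sqrt (((l + m) / 2)\<^sup>2 + m * (l + 2 * m) / (n - 1)))\<^sup>2
    = (crit_rho n m (l + 2 * m) / m)\<^sup>2"
proof -
  define b where "b = l + 2 * m"
  have b: "b > 0" and l: "l = b - 2 * m" unfolding b_def using assms by auto
  have n2: "n \<ge> 2" using n by simp
  define Q where "Q = sqrt (crit_disc n m b)"
  define k where "k = (n - 2) / (n - 1)"
  have k: "k > 0" unfolding k_def using n by simp
  have "0 \<le> crit_disc n m b" using crit_disc_gt[OF n2 m b] zero_le_power2[of "b - m"] by linarith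
  then have Q2: "Q\<^sup>2 = (m + b)\<^sup>2 - 4 * k * (m * b)" unfolding Q_def by (simp add: crit_disc_def k_def)
  have Q0: "0 \<le> Q" unfolding Q_def using \<open>0 \<le> crit_disc n m b\<close> by simp
  have "((l + m) / 2)\<^sup>2 + m * b / (n - 1) = (Q / 2)\<^sup>2"
    unfolding power_divide Q2 l k_def using n by (simp add: field_simps power2_eq_square)
  then have sq: "sqrt (((l + m) / 2)\<^sup>2 + m * b / (n - 1)) = Q / 2" using Q0 by (simp add: real_sqrt_divide)
  have den: "crit_den n m b = m + b + Q" unfolding crit_den_def Q_def ..
  have dpos: "m + b + Q > 0" using m b Q0 by linarith
  have prod: "(m + b - Q) * (m + b + Q) = 4 * k * (m * b)"
  proof -
    have "(m + b - Q) * (m + b + Q) = (m + b)\<^sup>2 - Q\<^sup>2" by (simp add: power2_eq_square algebra_simps)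
    then show ?thesis unfolding Q2 by simp
  qed
  have n1: "1 + 1 / (n - 2) = 1 / k" unfolding k_def using n by (simp add: field_simps)
  have "(1 + 1 / (n - 2)) * ((l + m) / (m * b)) * ((l + 3 * m) / 2 - Q / 2) = (b - m) * (2 / (m + b + Q))"
  proof -
    have "(l + 3 * m) / 2 - Q / 2 = (m + b - Q) / 2" unfolding l by simp
    also have "m + b - Q = (4 * k * (m * b)) / (m + b + Q)"
      unfolding prod[symmetric] using dpos by simp
    finally have e: "(l + 3 * m) / 2 - Q / 2 = 2 * k * (m * b) / (m + b + Q)" using dpos by (simp add: field_simps)
    have lm: "l + m = b - m" unfolding l by simp
    have "1 / k * ((b - m) / P) * (2 * k * P / d) = (b - m) * (2 / d)" if "P > 0" for P d
      using k that by (simp add: divide_simps)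
    then show ?thesis unfolding n1 e lm using m b by simp
  qed
  then have "(1 + 1 / (n - 2))\<^sup>2 * ((l + m) / (m * b))\<^sup>2 * ((l + 3 * m) / 2 - Q / 2)\<^sup>2 = ((b - m) * (2 / (m + b + Q)))\<^sup>2"
    by (simp only: power_mult_distrib[symmetric])
  then show ?thesis
    unfolding b_def[symmetric] sq crit_rho_properties(3)[OF n2 m b] den by (simp only: power_mult_distrib)
qed

lemma crit_rho_plane:
  assumes "m > 0" "l + 2 * m > 0"
  shows "(crit_rho 2 m (l + 2 * m) / m)\<^sup>2 = ((l + m) / (l + 3 * m))\<^sup>2"
proof -
  have "crit_den 2 m (l + 2 * m) = 2 * (l + 3 * m)"
    unfolding crit_den_def crit_disc_def using assms by simp
  then have "crit_rho 2 m (l + 2 * m) / m = - (l + 2 * m - m) * (2 * m / (2 * (l + 3 * m))) / m"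
    unfolding crit_rho_def by simp
  also have "\<dots> = - ((l + m) / d)" if "d = l + 3 * m" for d
    unfolding that[symmetric] using assms that by (simp add: divide_simps) (simp add: algebra_simps)
  finally have "crit_rho 2 m (l + 2 * m) / m = - ((l + m) / (l + 3 * m))" by simp
  then show ?thesis by simp
qed

theorem theorem5p1:
  fixes \<Omega> :: "(real^'n::finite) set" and lam mu :: "real^'n \<Rightarrow> real"
  assumes dim: "CARD('n) \<ge> 2"
    and dom: "bounded_lipschitz_domain \<Omega> \<or> lipschitz_graph_domain \<Omega>"
    and bdd: "bounded (lam ` \<Omega>)" "bounded (mu ` \<Omega>)"
    and lip: "lam \<in> Lip_loc \<Omega>" "mu \<in> Lip_loc \<Omega>"
    and ell: "essinf (lebesgue_on \<Omega>) (\<lambda>x. ereal (min (mu x) (lam x + 2 * mu x))) > 0"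
  shows "\<exists>r \<in> Lip_loc \<Omega>.
      (\<forall>u \<in> W12_loc_vec \<Omega>. \<forall>\<alpha>. \<forall>\<phi> \<in> test_fun \<Omega>.
         lame_op \<Omega> lam mu u \<alpha> \<phi> = system_op \<Omega> (lame_A lam mu r) (lame_B \<Omega> r) u \<alpha> \<phi>)
    \<and> (\<forall>u \<in> W12_loc_vec \<Omega>.
         vanishes_weakly \<Omega> (lame_op \<Omega> lam mu u) \<longleftrightarrow>
         vanishes_weakly \<Omega> (system_op \<Omega> (lame_A lam mu r) (lame_B \<Omega> r) u))
    \<and> (\<exists>K::real. AE x in lebesgue_on \<Omega>.
         coeff_norm (lame_B \<Omega> r x) \<le> K * (norm (wgrad \<Omega> lam x) + norm (wgrad \<Omega> mu x)))
    \<and> (\<exists>C::real.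
         (\<forall>p>1. integral_p_elliptic \<Omega> p (lame_A lam mu r) \<longleftrightarrow> (1 - 2 / p)\<^sup>2 < C)
       \<and> (CARD('n) = 2 \<longrightarrow>
            ereal C = 1 - esssup (lebesgue_on \<Omega>)
              (\<lambda>x. ereal (((lam x + mu x) / (lam x + 3 * mu x))\<^sup>2)))
       \<and> (CARD('n) \<ge> 3 \<longrightarrow>
            ereal C \<le> 1 - esssup (lebesgue_on \<Omega>)
              (\<lambda>x. ereal (((lam x + mu x) / (lam x + 3 * mu x))\<^sup>2))
          \<and> ereal C \<ge> 1 - esssup (lebesgue_on \<Omega>)
              (\<lambda>x. ereal ((1 + 1 / (real CARD('n) - 2))\<^sup>2
                 * ((lam x + mu x) / (mu x * (lam x + 2 * mu x)))\<^sup>2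
                 * ((lam x + 3 * mu x) / 2
                    - sqrt (((lam x + mu x) / 2)\<^sup>2
                        + mu x * (lam x + 2 * mu x) / (real CARD('n) - 1)))\<^sup>2))
          \<and> 1 - esssup (lebesgue_on \<Omega>)
              (\<lambda>x. ereal ((1 + 1 / (real CARD('n) - 2))\<^sup>2
                 * ((lam x + mu x) / (mu x * (lam x + 2 * mu x)))\<^sup>2
                 * ((lam x + 3 * mu x) / 2
                    - sqrt (((lam x + mu x) / 2)\<^sup>2
                        + mu x * (lam x + 2 * mu x) / (real CARD('n) - 1)))\<^sup>2))
            \<ge> 1 - esssup (lebesgue_on \<Omega>)
              (\<lambda>x. ereal (((lam x + mu x) / max (mu x) (lam x + 2 * mu x))\<^sup>2))))"
proof -
  have open\<Omega>: "open \<Omega>" and ne\<Omega>: "\<Omega> \<noteq> {}" using lipschitz_domain_open_nonempty[OF dom] by blast+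
  have S: "\<Omega> \<in> sets lebesgue" using open\<Omega> by (simp add: borel_open)
  let ?n = "real CARD('n)"
  have n2: "?n \<ge> 2" using dim by simp
  have lc: "continuous_on \<Omega> lam" and mc: "continuous_on \<Omega> mu" using lip Lip_loc_continuous_on by blast+
  have gc: "continuous_on \<Omega> (\<lambda>x. min (mu x) (lam x + 2 * mu x))" by (intro continuous_intros lc mc)
  obtain e where e: "e > 0" "\<And>x. x \<in> \<Omega> \<Longrightarrow> e \<le> min (mu x) (lam x + 2 * mu x)"
    using essinf_continuous_pos[OF open\<Omega> gc ell] by blast
  have em: "e \<le> mu x" and eb: "e \<le> lam x + 2 * mu x" if "x \<in> \<Omega>" for x using e(2)[OF that] by auto
  have mp: "0 < mu x" and bp: "0 < lam x + 2 * mu x" if "x \<in> \<Omega>" for x using em[OF that] eb[OF that] e(1) by auto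
  obtain L1 L2 where "\<And>x. x \<in> \<Omega> \<Longrightarrow> \<bar>lam x\<bar> \<le> L1" "\<And>x. x \<in> \<Omega> \<Longrightarrow> \<bar>mu x\<bar> \<le> L2"
    using bdd unfolding bounded_iff by auto
  then obtain L0 where L0: "\<And>x. x \<in> \<Omega> \<Longrightarrow> \<bar>lam x\<bar> \<le> L0" "\<And>x. x \<in> \<Omega> \<Longrightarrow> \<bar>mu x\<bar> \<le> L0"
    using that[of "max L1 L2"] by (metis max.coboundedI1 max.coboundedI2)
  define \<rho> where "\<rho> x = crit_rho ?n (mu x) (lam x + 2 * mu x)" for x
  define r where "r x = aux_coeff ?n (lam x, mu x)" for x
  have r: "r x = mu x + \<rho> x" for x unfolding r_def \<rho>_def aux_coeff_def by simp
  obtain B and \<Phi>1 \<Phi>2 :: "real \<times> real \<Rightarrow> real" where B: "B \<ge> 0"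
    and \<Phi>: "\<And>p. p \<in> elliptic_cone \<Longrightarrow> (aux_coeff ?n has_derivative (\<lambda>(s, t). \<Phi>1 p * s + \<Phi>2 p * t)) (at p)"
    "continuous_on elliptic_cone \<Phi>1" "continuous_on elliptic_cone \<Phi>2"
    and \<Phi>B: "\<And>l m. \<bar>l\<bar> \<le> L0 \<Longrightarrow> \<bar>m\<bar> \<le> L0 \<Longrightarrow> e \<le> m \<Longrightarrow> e \<le> l + 2 * m \<Longrightarrow> \<bar>\<Phi>1 (l, m)\<bar> \<le> B \<and> \<bar>\<Phi>2 (l, m)\<bar> \<le> B"
    and lipB: "\<And>l m l' m'. \<bar>l\<bar> \<le> L0 \<Longrightarrow> \<bar>m\<bar> \<le> L0 \<Longrightarrow> e \<le> m \<Longrightarrow> e \<le> l + 2 * m \<Longrightarrow> \<bar>l'\<bar> \<le> L0 \<Longrightarrow> \<bar>m'\<bar> \<le> L0 \<Longrightarrow> e \<le> m' \<Longrightarrow> e \<le> l' + 2 * m'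
      \<Longrightarrow> \<bar>aux_coeff ?n (l, m) - aux_coeff ?n (l', m')\<bar> \<le> B * (\<bar>l - l'\<bar> + \<bar>m - m'\<bar>)"
    by (rule aux_coeff_lipschitz[OF n2 e(1), of L0]) (rule that; assumption)
  have rLip: "r \<in> Lip_loc \<Omega>"
    unfolding r_def[abs_def] by (rule Lip_loc_chain2[OF lip _ B]) (intro lipB L0 em eb)
  have rc: "continuous_on \<Omega> r" by (rule Lip_loc_continuous_on[OF rLip])
  have \<rho>4: "(\<rho> x / mu x)\<^sup>2 \<le> ((lam x + mu x) / max (mu x) (lam x + 2 * mu x))\<^sup>2" if "x \<in> \<Omega>" for x
    using crit_rho_properties(4)[OF n2 mp[OF that] bp[OF that]] unfolding \<rho>_def by (simp add: add.commute)
  have L0p: "0 < L0" using ne\<Omega> L0(2) mp by fastforce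
  \<comment> \<open>A bound for the quotient that is uniform in \<open>x\<close> and less than \<open>1\<close>: the
    numerator is at most \<open>max (mu x) (lam x + 2 * mu x) - e\<close> and the denominator at most \<open>3 * L0\<close>.\<close>
  define m3 where "m3 = 1 - e / (3 * L0)"
  have m3: "m3 < 1" unfolding m3_def using e(1) L0p by simp
  have f3le: "((lam x + mu x) / max (mu x) (lam x + 2 * mu x))\<^sup>2 \<le> m3" if x: "x \<in> \<Omega>" for x
  proof -
    let ?a = "mu x" let ?b = "lam x + 2 * mu x"
    have mx: "0 < max ?a ?b" "max ?a ?b \<le> 3 * L0" using mp[OF x] L0[OF x] by auto
    have "\<bar>lam x + mu x\<bar> \<le> max ?a ?b - e" using em[OF x] eb[OF x] by (auto simp: max_def)
    then have "\<bar>(lam x + mu x) / max ?a ?b\<bar> \<le> (max ?a ?b - e) / max ?a ?b"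
      unfolding abs_divide using mx(1) by (simp add: divide_right_mono)
    also have "\<dots> = 1 - e / max ?a ?b" using mx(1) by (simp add: diff_divide_distrib)
    also have "\<dots> \<le> m3" unfolding m3_def using mx e(1) by (simp add: frac_le)
    finally have t: "\<bar>(lam x + mu x) / max ?a ?b\<bar> \<le> m3" .
    have "\<bar>(lam x + mu x) / max ?a ?b\<bar>\<^sup>2 \<le> \<bar>(lam x + mu x) / max ?a ?b\<bar> * 1"
      unfolding power2_eq_square using t m3 by (intro mult_left_mono) auto
    then show ?thesis using t unfolding power2_abs by linarith
  qed
  have \<rho>le: "(\<rho> x / mu x)\<^sup>2 \<le> m3" if "x \<in> \<Omega>" for x using order_trans[OF \<rho>4[OF that] f3le[OF that]] .
  have rb: "\<bar>\<rho> x\<bar> \<le> L0" if x: "x \<in> \<Omega>" for x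
  proof -
    have "(\<rho> x / mu x)\<^sup>2 \<le> 1" using \<rho>le[OF x] m3 by linarith
    then have "\<bar>\<rho> x / mu x\<bar> \<le> 1" using abs_square_le_1 by blast
    then have "\<bar>\<rho> x\<bar> \<le> mu x" using mp[OF x] by (simp add: abs_divide)
    then show ?thesis using L0(2)[OF x] by linarith
  qed
  \<comment> \<open>All coefficients are combinations of \<open>lam\<close>, \<open>mu\<close> and \<open>\<rho>\<close>, each bounded by \<open>L0\<close>, with at most three terms.\<close>
  interpret lame_setting \<Omega> lam mu r e "3 * L0"
  proof (unfold_locales)
    fix x assume x: "x \<in> \<Omega>"
    note b = L0[OF x] rb[OF x] mp[OF x]
    show "\<bar>mu x\<bar> \<le> 3 * L0" "\<bar>lam x + r x\<bar> \<le> 3 * L0" "\<bar>mu x - r x\<bar> \<le> 3 * L0" "\<bar>lam x + mu x\<bar> \<le> 3 * L0" "lam x + 2 * mu x \<le> 3 * L0"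
      using b unfolding r by linarith+
  qed (use dim open\<Omega> lc mc rc e(1) em eb in auto)
  obtain F G where FG: "smooth_approx \<Omega> r F G" using Lip_loc_smooth_approx[OF open\<Omega> rLip] by blast
  have op: "lame_op \<Omega> lam mu u \<alpha> \<phi> = system_op \<Omega> (lame_A lam mu r) (lame_B \<Omega> r) u \<alpha> \<phi>"
    if "u \<in> W12_loc_vec \<Omega>" "\<phi> \<in> test_fun \<Omega>" for u \<alpha> \<phi>
    by (rule lame_op_eq_system_op[OF open\<Omega> lc mc rc FG that])
  have van: "vanishes_weakly \<Omega> (lame_op \<Omega> lam mu u) \<longleftrightarrow> vanishes_weakly \<Omega> (system_op \<Omega> (lame_A lam mu r) (lame_B \<Omega> r) u)"
    if "u \<in> W12_loc_vec \<Omega>" for u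
    unfolding vanishes_weakly_def using op[OF that] by simp
  \<comment> \<open>The derivative of \<open>r = aux_coeff n (lam, mu)\<close> by the chain rule bounds \<open>lame_B\<close>.\<close>
  obtain Fl Gl where Fl: "smooth_approx \<Omega> lam Fl Gl" using Lip_loc_smooth_approx[OF open\<Omega> lip(1)] by blast
  obtain Fm Gm where Fm: "smooth_approx \<Omega> mu Fm Gm" using Lip_loc_smooth_approx[OF open\<Omega> lip(2)] by blast
  have inU: "(lam x, mu x) \<in> elliptic_cone" if "x \<in> \<Omega>" for x
    unfolding elliptic_cone_def using mp[OF that] bp[OF that] by simp
  have wr: "has_wderiv \<Omega> i r (\<lambda>x. \<Phi>1 (lam x, mu x) * Gl i x + \<Phi>2 (lam x, mu x) * Gm i x)" for i
    unfolding r_def[abs_def] by (rule has_wderiv_chain2[OF open\<Omega> lc mc Fl Fm open_elliptic_cone inU \<Phi>])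
  define K where "K = sqrt (?n ^ 3 * 4) * (?n * B)"
  have aeB: "AE x in lebesgue_on \<Omega>. coeff_norm (lame_B \<Omega> r x) \<le> K * (norm (wgrad \<Omega> lam x) + norm (wgrad \<Omega> mu x))"
  proof -
    have "AE x in lebesgue. \<forall>i. x \<in> \<Omega> \<longrightarrow> wderiv \<Omega> i r x = \<Phi>1 (lam x, mu x) * Gl i x + \<Phi>2 (lam x, mu x) * Gm i x"
      unfolding AE_all_countable by (intro allI wderiv_AE_eq[OF open\<Omega> wr])
    moreover have "AE x in lebesgue. \<forall>i. x \<in> \<Omega> \<longrightarrow> wderiv \<Omega> i lam x = Gl i x"
      unfolding AE_all_countable by (intro allI wderiv_AE_eq[OF open\<Omega> has_wderiv_smooth_approx[OF open\<Omega> lc Fl]])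
    moreover have "AE x in lebesgue. \<forall>i. x \<in> \<Omega> \<longrightarrow> wderiv \<Omega> i mu x = Gm i x"
      unfolding AE_all_countable by (intro allI wderiv_AE_eq[OF open\<Omega> has_wderiv_smooth_approx[OF open\<Omega> mc Fm]])
    ultimately show ?thesis
      unfolding AE_lebesgue_on_iff[OF S]
    proof eventually_elim
      case (elim x)
      show ?case
      proof
        assume x: "x \<in> \<Omega>"
        let ?g = "norm (wgrad \<Omega> lam x) + norm (wgrad \<Omega> mu x)"
        have b: "\<bar>\<Phi>1 (lam x, mu x)\<bar> \<le> B" "\<bar>\<Phi>2 (lam x, mu x)\<bar> \<le> B" using \<Phi>B[OF L0[OF x] em[OF x] eb[OF x]] by blast+
        have comp: "\<bar>wgrad \<Omega> r x $ i\<bar> \<le> B * ?g" for i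
        proof -
          have "wgrad \<Omega> r x $ i = \<Phi>1 (lam x, mu x) * wgrad \<Omega> lam x $ i + \<Phi>2 (lam x, mu x) * wgrad \<Omega> mu x $ i"
            using elim x by (simp add: wgrad_def)
          then have "\<bar>wgrad \<Omega> r x $ i\<bar> \<le> \<bar>\<Phi>1 (lam x, mu x)\<bar> * \<bar>wgrad \<Omega> lam x $ i\<bar> + \<bar>\<Phi>2 (lam x, mu x)\<bar> * \<bar>wgrad \<Omega> mu x $ i\<bar>"
            unfolding abs_mult[symmetric] using abs_triangle_ineq by metis
          also have "\<dots> \<le> B * norm (wgrad \<Omega> lam x) + B * norm (wgrad \<Omega> mu x)"
            by (intro add_mono mult_mono b component_le_norm_cart B) auto
          finally show ?thesis by (simp add: distrib_left)
        qed
        have "norm (wgrad \<Omega> r x) \<le> (\<Sum>i\<in>UNIV. \<bar>wgrad \<Omega> r x $ i\<bar>)" by (rule norm_le_l1_cart)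
        also have "\<dots> \<le> (\<Sum>i\<in>(UNIV::'n set). B * ?g)" by (intro sum_mono comp)
        finally have g: "norm (wgrad \<Omega> r x) \<le> ?n * B * ?g" by simp
        have "coeff_norm (lame_B \<Omega> r x) \<le> sqrt (?n ^ 3 * 4) * norm (wgrad \<Omega> r x)" by (rule coeff_norm_lame_B_le)
        also have "\<dots> \<le> sqrt (?n ^ 3 * 4) * (?n * B * ?g)" using g by (intro mult_left_mono) auto
        finally show "coeff_norm (lame_B \<Omega> r x) \<le> K * ?g" unfolding K_def by (simp add: mult.assoc)
      qed
    qed
  qed
  define f1 where "f1 x = ((lam x + mu x) / (lam x + 3 * mu x))\<^sup>2" for x
  define f2 where "f2 x = (\<rho> x / mu x)\<^sup>2" for x
  define f3 where "f3 x = ((lam x + mu x) / max (mu x) (lam x + 2 * mu x))\<^sup>2" for x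
  have dp: "0 < lam x + 3 * mu x" if "x \<in> \<Omega>" for x using mp[OF that] bp[OF that] by linarith
  have c1: "continuous_on \<Omega> f1"
    unfolding f1_def using dp by (intro continuous_intros lc mc) (auto simp: less_imp_neq[symmetric])
  have c2: "continuous_on \<Omega> f2"
  proof -
    have eq: "f2 x = ((r x - mu x) / mu x)\<^sup>2" for x unfolding f2_def r by simp
    show ?thesis unfolding eq using mp by (intro continuous_intros rc mc) (auto simp: less_imp_neq[symmetric])
  qed
  have c3: "continuous_on \<Omega> f3"
  proof -
    have "max (mu x) (lam x + 2 * mu x) \<noteq> 0" if "x \<in> \<Omega>" for x using less_le_trans[OF mp[OF that] max.cobounded1] by (rule less_imp_neq[symmetric])
    then show ?thesis unfolding f3_def by (intro continuous_intros lc mc) blast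
  qed
  have b1: "f1 x \<le> 1" if x: "x \<in> \<Omega>" for x
  proof -
    have "\<bar>(lam x + mu x) / (lam x + 3 * mu x)\<bar> \<le> 1"
      unfolding abs_divide using dp[OF x] mp[OF x] bp[OF x] by (simp add: abs_le_iff)
    then show ?thesis unfolding f1_def using abs_square_le_1 by blast
  qed
  have bd: "bdd_above (f1 ` \<Omega>)" "bdd_above (f2 ` \<Omega>)" "bdd_above (f3 ` \<Omega>)"
    using b1 \<rho>le f3le unfolding bdd_above_def f2_def f3_def by blast+
  define m1 where "m1 = (SUP x\<in>\<Omega>. f1 x)"
  define m2 where "m2 = (SUP x\<in>\<Omega>. f2 x)"
  define m4 where "m4 = (SUP x\<in>\<Omega>. f3 x)"
  have up: "f1 x \<le> m1" "f2 x \<le> m2" "f3 x \<le> m4" if "x \<in> \<Omega>" for x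
    unfolding m1_def m2_def m4_def using that bd by (auto intro!: cSUP_upper)
  have ne: "m2 < 1"
  proof -
    have "m2 \<le> m3" unfolding m2_def by (rule cSUP_least[OF ne\<Omega>]) (simp add: f2_def \<rho>le)
    then show ?thesis using m3 by simp
  qed
  have m24: "m2 \<le> m4"
    unfolding m2_def using up(3) \<rho>4 by (intro cSUP_least[OF ne\<Omega>]) (force simp: f2_def f3_def intro: order_trans)
  have m20: "0 \<le> m2"
  proof -
    obtain x where x: "x \<in> \<Omega>" using ne\<Omega> by blast
    have "0 \<le> f2 x" unfolding f2_def by simp
    then show ?thesis using up(2)[OF x] by linarith
  qed
  have E1: "esssup (lebesgue_on \<Omega>) (\<lambda>x. ereal (f1 x)) = ereal m1" unfolding m1_def by (rule esssup_continuous[OF open\<Omega> ne\<Omega> c1 bd(1)])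
  have E2: "esssup (lebesgue_on \<Omega>) (\<lambda>x. ereal (f2 x)) = ereal m2" unfolding m2_def by (rule esssup_continuous[OF open\<Omega> ne\<Omega> c2 bd(2)])
  have E3: "esssup (lebesgue_on \<Omega>) (\<lambda>x. ereal (f3 x)) = ereal m4" unfolding m4_def by (rule esssup_continuous[OF open\<Omega> ne\<Omega> c3 bd(3)])
  have sub: "elliptic_at s" if "0 \<le> s" "s < 1 - m2" for s
    by (rule elliptic_at_subcritical[OF _ _ ne that]) (use r up(2) in \<open>simp_all add: \<rho>_def f2_def\<close>)
  have sup: "s \<le> 1 - m1" if s: "0 \<le> s" "elliptic_at s" for s
  proof (rule ccontr)
    assume "\<not> s \<le> 1 - m1"
    then have "1 - s < (SUP x\<in>\<Omega>. f1 x)" unfolding m1_def by simp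
    then obtain x where x: "x \<in> \<Omega>" "1 - s < f1 x" using less_cSUP_iff[OF ne\<Omega> bd(1)] by blast
    then have "\<not> elliptic_at s" by (intro not_elliptic_at_supercritical[OF x(1) s(1)]) (simp add: f1_def)
    then show False using s(2) by blast
  qed
  define T where "T = {s. 0 \<le> s \<and> elliptic_at s}"
  \<comment> \<open>The admissible parameters form an interval \<open>[0, C)\<close>.\<close>
  define C where "C = Sup T"
  have Tb: "bdd_above T" unfolding T_def bdd_above_def using sup by blast
  have T0: "0 \<in> T" unfolding T_def using sub[of 0] ne by simp
  have iff: "elliptic_at s \<longleftrightarrow> s < C" if s: "0 \<le> s" for s
  proof
    assume "elliptic_at s"
    then obtain s' where s': "s < s'" "elliptic_at s'" using elliptic_at_open[OF _ ne\<Omega>] by blast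
    then have "s' \<in> T" unfolding T_def using s by simp
    then have "s' \<le> C" unfolding C_def using Tb by (rule cSup_upper)
    then show "s < C" using s'(1) by simp
  next
    assume "s < C"
    then obtain s' where s': "s' \<in> T" "s < s'" unfolding C_def using less_cSup_iff[of T s] T0 Tb by blast
    have "elliptic_at s'" using s'(1) unfolding T_def by simp
    then show "elliptic_at s" by (rule elliptic_at_mono) (use s'(2) in simp)
  qed
  have Cup: "C \<le> 1 - m1" unfolding C_def using T0 sup by (intro cSup_least) (auto simp: T_def)
  have Clow: "1 - m2 \<le> C"
  proof (rule ccontr)
    assume "\<not> 1 - m2 \<le> C"
    then have C: "C < 1 - m2" by simp
    have "0 \<le> C" unfolding C_def using T0 Tb by (rule cSup_upper)
    then show False using iff sub C by blast
  qed
  have pC: "\<forall>p>1. integral_p_elliptic \<Omega> p (lame_A lam mu r) \<longleftrightarrow> (1 - 2 / p)\<^sup>2 < C"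
    unfolding integral_p_elliptic_iff using iff by simp
  have two: "ereal C = 1 - ereal m1" if n: "CARD('n) = 2"
  proof -
    have "f2 x = f1 x" if "x \<in> \<Omega>" for x
      unfolding f2_def f1_def \<rho>_def using crit_rho_plane[OF mp[OF that] bp[OF that]] n by simp
    then have "m2 = m1" unfolding m1_def m2_def by (intro SUP_cong refl)
    then have "C = 1 - m1" using Cup Clow by simp
    then show ?thesis by (simp add: one_ereal_def)
  qed
  have three: "esssup (lebesgue_on \<Omega>)
              (\<lambda>x. ereal ((1 + 1 / (?n - 2))\<^sup>2
                 * ((lam x + mu x) / (mu x * (lam x + 2 * mu x)))\<^sup>2
                 * ((lam x + 3 * mu x) / 2
                    - sqrt (((lam x + mu x) / 2)\<^sup>2
                        + mu x * (lam x + 2 * mu x) / (?n - 1)))\<^sup>2)) = ereal m2" (is "esssup _ ?h = _")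
    if n: "CARD('n) \<ge> 3"
  proof -
    have n3: "?n \<ge> 3" using n by simp
    have "?h x = ereal (f2 x)" if "x \<in> space (lebesgue_on \<Omega>)" for x
    proof -
      have x: "x \<in> \<Omega>" using that by simp
      show ?thesis unfolding f2_def \<rho>_def crit_rho_statement_form[OF n3 mp[OF x] bp[OF x]] ..
    qed
    note eq = this
    have m: "(\<lambda>x. ereal (f2 x)) \<in> borel_measurable (lebesgue_on \<Omega>)"
      using continuous_measurable_lebesgue_on[OF open\<Omega> c2] by simp
    have m': "?h \<in> borel_measurable (lebesgue_on \<Omega>)"
      using m measurable_cong[of "lebesgue_on \<Omega>" ?h "\<lambda>x. ereal (f2 x)" borel] eq by blast
    show ?thesis unfolding E2[symmetric] by (rule esssup_AE_cong[OF m' m]) (rule AE_I2, rule eq)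
  qed
  have s1: "ereal C \<le> 1 - ereal m1" and s2: "1 - ereal m2 \<le> ereal C" and s3: "1 - ereal m4 \<le> 1 - ereal m2"
    using Cup Clow m24 by (simp_all add: one_ereal_def)
  have thr: "\<exists>C::real.
         (\<forall>p>1. integral_p_elliptic \<Omega> p (lame_A lam mu r) \<longleftrightarrow> (1 - 2 / p)\<^sup>2 < C)
       \<and> (CARD('n) = 2 \<longrightarrow>
            ereal C = 1 - esssup (lebesgue_on \<Omega>)
              (\<lambda>x. ereal (((lam x + mu x) / (lam x + 3 * mu x))\<^sup>2)))
       \<and> (CARD('n) \<ge> 3 \<longrightarrow>
            ereal C \<le> 1 - esssup (lebesgue_on \<Omega>)
              (\<lambda>x. ereal (((lam x + mu x) / (lam x + 3 * mu x))\<^sup>2))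
          \<and> ereal C \<ge> 1 - esssup (lebesgue_on \<Omega>)
              (\<lambda>x. ereal ((1 + 1 / (real CARD('n) - 2))\<^sup>2
                 * ((lam x + mu x) / (mu x * (lam x + 2 * mu x)))\<^sup>2
                 * ((lam x + 3 * mu x) / 2
                    - sqrt (((lam x + mu x) / 2)\<^sup>2
                        + mu x * (lam x + 2 * mu x) / (real CARD('n) - 1)))\<^sup>2))
          \<and> 1 - esssup (lebesgue_on \<Omega>)
              (\<lambda>x. ereal ((1 + 1 / (real CARD('n) - 2))\<^sup>2
                 * ((lam x + mu x) / (mu x * (lam x + 2 * mu x)))\<^sup>2
                 * ((lam x + 3 * mu x) / 2
                    - sqrt (((lam x + mu x) / 2)\<^sup>2
                        + mu x * (lam x + 2 * mu x) / (real CARD('n) - 1)))\<^sup>2))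
            \<ge> 1 - esssup (lebesgue_on \<Omega>)
              (\<lambda>x. ereal (((lam x + mu x) / max (mu x) (lam x + 2 * mu x))\<^sup>2)))"
    unfolding E1[unfolded f1_def] E3[unfolded f3_def]
    using pC two three s1 s2 s3 by (intro exI[of _ C]) simp
  show ?thesis
    using rLip op van aeB thr by blast
qed

end
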